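(* Let $\alpha,b,\kappa\in\mathbb{R}$ be constants, let $1\le p\le\infty$, and let $\phi$ be an admissible weight function. Let $z_0=(u_0,\rho_0)\in H^s(\mathbb{R})\times H^{s-1}(\mathbb{R})$ with $s>3/2$ be such that $u_0\phi,\ u_{0,x}\phi,\ \rho_0\phi\in L^p(\mathbb{R})$, and let $T$ be the maximal time of the solution $z=(u,\rho)$, with initial data $z_0$, to the system $$\begin{cases} m_t=\alpha u_x-bu_xm-um_x-\kappa\rho\rho_x,\quad m=u-u_{xx},\\ \rho_t=-u\rho_x-(b-1)u_x\rho.\end{cases}$$ Then, for all $t\in[0,T]$, there is a constant $C>0$ depending only on the weight $\phi$ such that $$\|u(t)\phi\|_{L^p}+\|u_x(t)\phi\|_{L^p}+\|\rho(t)\phi\|_{L^p}\le\left(\|u_0\phi\|_{L^p}+\|u_{0,x}\phi\|_{L^p}+\|\rho_0\phi\|_{L^p}\right)\exp\{C(1+M)t\},$$ where $$M=\sup_{t\in[0,T]}\left(\|u(t)\|_{L^\infty}+\|u_x(t)\|_{L^\infty}+\|\rho(t)\|_{L^\infty}\right)<\infty.$$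
   Context: The constants $\alpha,b,\kappa$ of the system are fixed, and $x\in\mathbb{R}$. For data in $H^s\times H^{s-1}$, the solution is $z=(u,\rho)\in\mathcal{C}([0,T),H^s(\mathbb{R}))\times\mathcal{C}([0,T),H^{s-1}(\mathbb{R}))$; with $G(x)=\frac12e^{-|x|}$ the system is understood in the equivalent nonlocal form $u_t+uu_x=-\partial_xG*\left(\frac b2u^2+\frac{3-b}2u_x^2+\frac\kappa2\rho^2-\alpha u\right)$, $\rho_t+u\rho_x=-(b-1)u_x\rho$. A weight function is a non-negative function. A weight function $v:\mathbb{R}\to\mathbb{R}$ is sub-multiplicative if $v(x+y)\le v(x)v(y)$ for all $x,y\in\mathbb{R}$. Given a sub-multiplicative $v$, a positive function $\phi$ is $v$-moderate if there is $C_0>0$ such that $\phi(x+y)\le C_0v(x)\phi(y)$ for all $x,y\in\mathbb{R}$. An admissible weight function is a locally absolutely continuous function $\phi:\mathbb{R}\to\mathbb{R}$ such that, for some $A>0$ and almost all $x\in\mathbb{R}$, $|\phi'(x)|\le A|\phi(x)|$, and that is $v$-moderate for some sub-multiplicative weight function $v$ satisfying $\inf_{\mathbb{R}}v>0$ and $\int_{\mathbb{R}}\frac{v(x)}{e^{|x|}}\,dx<\infty$.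
   Formalization: As u(T) is undefined at the maximal time and M can be infinite (wave breaking), M<∞ and the estimate are proved on every [0,T'] with T'<T, and the estimate on [0,T) whenever M over [0,T) is finite; C may depend on the fixed α, b, κ. *)

theory Defs
  imports "HOL-Analysis.Analysis" "HOL-Probability.Essential_Supremum"
begin

section \<open>Lebesgue spaces\<close>

text \<open>
  Elements of \<open>L\<^sup>p(\<real>)\<close> are represented by arbitrary Borel representatives of their a.e. classes;
  all notions below are insensitive to the choice of representative.
  The exponent ranges over \<open>[1,\<infinity>]\<close> inside \<^typ>\<open>ennreal\<close>.
\<close>

definition Lp_norm :: "ennreal \<Rightarrow> (real \<Rightarrow> 'a::real_normed_vector) \<Rightarrow> ennreal" where
  "Lp_norm p f =
     (if p = \<infinity> then esssup lborel (\<lambda>x. ennreal (norm (f x)))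
      else let I = (\<integral>\<^sup>+x. ennreal (norm (f x) powr enn2real p) \<partial>lborel)
           in if I = \<infinity> then \<infinity> else ennreal (enn2real I powr (1 / enn2real p)))"

definition in_Lp :: "ennreal \<Rightarrow> (real \<Rightarrow> 'a::real_normed_vector) \<Rightarrow> bool" where
  "in_Lp p f \<longleftrightarrow> f \<in> borel_measurable lborel \<and> Lp_norm p f < \<infinity>"

section \<open>Schwartz functions, weak derivative, Fourier transform\<close>

definition schwartz :: "(real \<Rightarrow> complex) \<Rightarrow> bool" where
  "schwartz \<psi> \<longleftrightarrow>
     (\<exists>D :: nat \<Rightarrow> real \<Rightarrow> complex. D 0 = \<psi> \<and>
        (\<forall>n x. (D n has_vector_derivative D (Suc n) x) (at x)) \<and>
        (\<forall>k n. bounded (range (\<lambda>x. x ^ k *\<^sub>R D n x))))"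

abbreviation x_deriv :: "(real \<Rightarrow> complex) \<Rightarrow> real \<Rightarrow> complex" where
  "x_deriv \<psi> x \<equiv> vector_derivative \<psi> (at x)"

definition pairing :: "(real \<Rightarrow> real) \<Rightarrow> (real \<Rightarrow> complex) \<Rightarrow> complex" where
  "pairing f \<psi> = (\<integral>x. complex_of_real (f x) * \<psi> x \<partial>lborel)"

text \<open>
  Distributional derivative, in \<open>L\<^sup>2\<close>, of an \<open>L\<^sup>2\<close> function. For \<open>L\<^sup>2\<close> functions, testing against
  Schwartz functions and testing against compactly supported smooth functions are equivalent.
\<close>

definition has_weak_deriv :: "(real \<Rightarrow> real) \<Rightarrow> (real \<Rightarrow> real) \<Rightarrow> bool" where
  "has_weak_deriv f g \<longleftrightarrow>
     in_Lp 2 g \<and> (\<forall>\<psi>. schwartz \<psi> \<longrightarrow> pairing f (x_deriv \<psi>) = - pairing g \<psi>)"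

definition weak_deriv :: "(real \<Rightarrow> real) \<Rightarrow> real \<Rightarrow> real" where
  "weak_deriv f = (SOME g. has_weak_deriv f g)"

definition schwartz_fourier :: "(real \<Rightarrow> complex) \<Rightarrow> real \<Rightarrow> complex" where
  "schwartz_fourier \<psi> \<xi> = (\<integral>x. cis (- (x * \<xi>)) * \<psi> x \<partial>lborel)"

text \<open>
  Fourier transform of an \<open>L\<^sup>2\<close> function, by duality as for tempered distributions; by Plancherel's
  theorem it exists in \<open>L\<^sup>2\<close>, and it is unique up to a.e. equality.
\<close>

definition has_fourier :: "(real \<Rightarrow> real) \<Rightarrow> (real \<Rightarrow> complex) \<Rightarrow> bool" where
  "has_fourier f g \<longleftrightarrow>
     in_Lp 2 g \<and>
     (\<forall>\<psi>. schwartz \<psi> \<longrightarrow> pairing f (schwartz_fourier \<psi>) = (\<integral>\<xi>. g \<xi> * \<psi> \<xi> \<partial>lborel))"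

definition fourier :: "(real \<Rightarrow> real) \<Rightarrow> real \<Rightarrow> complex" where
  "fourier f = (SOME g. has_fourier f g)"

section \<open>Sobolev spaces of order \<open>s \<ge> 0\<close>\<close>

definition Hs_norm :: "real \<Rightarrow> (real \<Rightarrow> real) \<Rightarrow> ennreal" where
  "Hs_norm s f = Lp_norm 2 (\<lambda>\<xi>. ((1 + \<xi>\<^sup>2) powr (s / 2)) *\<^sub>R fourier f \<xi>)"

text \<open>For \<open>s \<ge> 0\<close>, the only range used, \<open>H\<^sup>s(\<real>)\<close> is contained in \<open>L\<^sup>2(\<real>)\<close>.\<close>

definition in_Hs :: "real \<Rightarrow> (real \<Rightarrow> real) \<Rightarrow> bool" where
  "in_Hs s f \<longleftrightarrow>
     in_Lp 2 f \<and>
     (\<exists>g. has_fourier f g \<and> in_Lp 2 (\<lambda>\<xi>. ((1 + \<xi>\<^sup>2) powr (s / 2)) *\<^sub>R g \<xi>))"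

definition Hs_continuous_on :: "real \<Rightarrow> real set \<Rightarrow> (real \<Rightarrow> real \<Rightarrow> real) \<Rightarrow> bool" where
  "Hs_continuous_on s I f \<longleftrightarrow>
     (\<forall>t\<in>I. in_Hs s (f t) \<and>
            ((\<lambda>\<tau>. Hs_norm s (\<lambda>x. f \<tau> x - f t x)) \<longlongrightarrow> 0) (at t within I))"

section \<open>The system\<close>

definition life_span :: "ereal \<Rightarrow> real set" where
  "life_span T = {t. 0 \<le> t \<and> ereal t < T}"

definition conv :: "(real \<Rightarrow> real) \<Rightarrow> (real \<Rightarrow> real) \<Rightarrow> real \<Rightarrow> real" where
  "conv f g x = (\<integral>y. f (x - y) * g y \<partial>lborel)"

text \<open>The derivative of \<open>G(x) = exp (-\<bar>x\<bar>) / 2\<close> (the value at \<open>0\<close>, where \<open>G\<close> has a corner, is immaterial).\<close>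

definition dG :: "real \<Rightarrow> real" where
  "dG x = - (sgn x * exp (- \<bar>x\<bar>) / 2)"

definition nonlocal_flux ::
  "real \<Rightarrow> real \<Rightarrow> real \<Rightarrow> (real \<Rightarrow> real) \<Rightarrow> (real \<Rightarrow> real) \<Rightarrow> real \<Rightarrow> real" where
  "nonlocal_flux \<alpha> b \<kappa> u \<rho> x =
     b / 2 * (u x)\<^sup>2 + (3 - b) / 2 * (weak_deriv u x)\<^sup>2 + \<kappa> / 2 * (\<rho> x)\<^sup>2 - \<alpha> * u x"

text \<open>
  The tempered distribution \<open>u \<rho>\<^sub>x\<close>, that is \<open>\<psi> \<mapsto> - \<integral> \<rho> (u \<psi>)\<^sub>x\<close>. It is not a function in general,
  since \<open>\<rho>\<close> is only in \<open>H\<^sup>s\<^sup>-\<^sup>1\<close> with \<open>s - 1 > 1/2\<close>.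
\<close>

definition pairing_u_rho_x ::
  "(real \<Rightarrow> real) \<Rightarrow> (real \<Rightarrow> real) \<Rightarrow> (real \<Rightarrow> complex) \<Rightarrow> complex" where
  "pairing_u_rho_x u \<rho> \<psi> =
     - (\<integral>x. complex_of_real (\<rho> x) *
           (complex_of_real (weak_deriv u x) * \<psi> x + complex_of_real (u x) * x_deriv \<psi> x) \<partial>lborel)"

text \<open>
  Solutions in \<open>C([0,T),H\<^sup>s) \<times> C([0,T),H\<^sup>s\<^sup>-\<^sup>1)\<close>. The equations
  \<open>u\<^sub>t = - u u\<^sub>x - \<partial>\<^sub>xG * F\<close> and \<open>\<rho>\<^sub>t = - u \<rho>\<^sub>x - (b - 1) u\<^sub>x \<rho>\<close> hold at every time as identities
  of tempered distributions in \<open>x\<close>.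
\<close>

definition is_solution ::
  "real \<Rightarrow> real \<Rightarrow> real \<Rightarrow> real \<Rightarrow> ereal \<Rightarrow>
     (real \<Rightarrow> real \<Rightarrow> real) \<Rightarrow> (real \<Rightarrow> real \<Rightarrow> real) \<Rightarrow> bool" where
  "is_solution \<alpha> b \<kappa> s T u \<rho> \<longleftrightarrow>
     Hs_continuous_on s (life_span T) u \<and>
     Hs_continuous_on (s - 1) (life_span T) \<rho> \<and>
     (\<forall>t\<in>life_span T. \<forall>\<psi>. schwartz \<psi> \<longrightarrow>
        ((\<lambda>\<tau>. pairing (u \<tau>) \<psi>) has_vector_derivative
           - pairing (\<lambda>x. u t x * weak_deriv (u t) x) \<psi>
           - pairing (conv dG (nonlocal_flux \<alpha> b \<kappa> (u t) (\<rho> t))) \<psi>)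
          (at t within life_span T) \<and>
        ((\<lambda>\<tau>. pairing (\<rho> \<tau>) \<psi>) has_vector_derivative
           - pairing_u_rho_x (u t) (\<rho> t) \<psi>
           - complex_of_real (b - 1) * pairing (\<lambda>x. weak_deriv (u t) x * \<rho> t x) \<psi>)
          (at t within life_span T))"

definition has_initial_data ::
  "(real \<Rightarrow> real \<Rightarrow> real) \<Rightarrow> (real \<Rightarrow> real \<Rightarrow> real) \<Rightarrow>
     (real \<Rightarrow> real) \<Rightarrow> (real \<Rightarrow> real) \<Rightarrow> bool" where
  "has_initial_data u \<rho> u0 \<rho>0 \<longleftrightarrow> (AE x in lborel. u 0 x = u0 x \<and> \<rho> 0 x = \<rho>0 x)"

text \<open>\<open>T\<close> (possibly \<open>\<infinity>\<close>) is the maximal time: the solution cannot be continued beyond \<open>T\<close>.\<close>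

definition is_maximal_solution ::
  "real \<Rightarrow> real \<Rightarrow> real \<Rightarrow> real \<Rightarrow> ereal \<Rightarrow>
     (real \<Rightarrow> real \<Rightarrow> real) \<Rightarrow> (real \<Rightarrow> real \<Rightarrow> real) \<Rightarrow> bool" where
  "is_maximal_solution \<alpha> b \<kappa> s T u \<rho> \<longleftrightarrow>
     0 < T \<and> is_solution \<alpha> b \<kappa> s T u \<rho> \<and>
     \<not> (\<exists>T' u' \<rho>'. T < T' \<and> is_solution \<alpha> b \<kappa> s T' u' \<rho>' \<and>
          (\<forall>t\<in>life_span T. AE x in lborel. u' t x = u t x \<and> \<rho>' t x = \<rho> t x))"

section \<open>Weights\<close>

definition locally_absolutely_continuous :: "(real \<Rightarrow> real) \<Rightarrow> bool" where
  "locally_absolutely_continuous \<phi> \<longleftrightarrow>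
     (\<forall>a b \<epsilon>. \<epsilon> > 0 \<longrightarrow> (\<exists>\<delta>>0. \<forall>(n::nat) (c::nat \<Rightarrow> real) d.
        (\<forall>i<n. a \<le> c i \<and> c i \<le> d i \<and> d i \<le> b) \<and>
        disjoint_family_on (\<lambda>i. {c i<..<d i}) {..<n} \<and>
        (\<Sum>i<n. d i - c i) < \<delta>
        \<longrightarrow> (\<Sum>i<n. \<bar>\<phi> (d i) - \<phi> (c i)\<bar>) < \<epsilon>))"

definition weight_function :: "(real \<Rightarrow> real) \<Rightarrow> bool" where
  "weight_function v \<longleftrightarrow> (\<forall>x. 0 \<le> v x)"

definition sub_multiplicative :: "(real \<Rightarrow> real) \<Rightarrow> bool" where
  "sub_multiplicative v \<longleftrightarrow> (\<forall>x y. v (x + y) \<le> v x * v y)"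

definition moderate :: "(real \<Rightarrow> real) \<Rightarrow> (real \<Rightarrow> real) \<Rightarrow> bool" where
  "moderate v \<phi> \<longleftrightarrow>
     (\<forall>x. 0 < \<phi> x) \<and> (\<exists>C0>0. \<forall>x y. \<phi> (x + y) \<le> C0 * v x * \<phi> y)"

definition admissible_weight :: "(real \<Rightarrow> real) \<Rightarrow> bool" where
  "admissible_weight \<phi> \<longleftrightarrow>
     locally_absolutely_continuous \<phi> \<and>
     (\<exists>A>0. AE x in lebesgue. \<exists>d. (\<phi> has_real_derivative d) (at x) \<and> \<bar>d\<bar> \<le> A * \<bar>\<phi> x\<bar>) \<and>
     (\<exists>v. weight_function v \<and> sub_multiplicative v \<and> moderate v \<phi> \<and>
          (INF x. v x) > 0 \<and> integrable lebesgue (\<lambda>x. v x / exp \<bar>x\<bar>))"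

section \<open>The quantities in the estimate\<close>

definition weighted_norm ::
  "ennreal \<Rightarrow> (real \<Rightarrow> real) \<Rightarrow> (real \<Rightarrow> real) \<Rightarrow> (real \<Rightarrow> real) \<Rightarrow> ennreal" where
  "weighted_norm p \<phi> u \<rho> =
     Lp_norm p (\<lambda>x. u x * \<phi> x) + Lp_norm p (\<lambda>x. weak_deriv u x * \<phi> x) +
     Lp_norm p (\<lambda>x. \<rho> x * \<phi> x)"

definition sup_norm_bound ::
  "real set \<Rightarrow> (real \<Rightarrow> real \<Rightarrow> real) \<Rightarrow> (real \<Rightarrow> real \<Rightarrow> real) \<Rightarrow> ennreal" where
  "sup_norm_bound I u \<rho> =
     (SUP t\<in>I. Lp_norm \<infinity> (u t) + Lp_norm \<infinity> (weak_deriv (u t)) + Lp_norm \<infinity> (\<rho> t))"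

end

theory Submission
  imports Defs "HOL-Probability.Probability" "HOL-Computational_Algebra.Polynomial" "HOL-Real_Asymp.Real_Asymp"
begin

text \<open>
  By Sobolev embedding, \<open>u\<close>, \<open>u\<^sub>x\<close> and \<open>\<rho>\<close> have bounded continuous representatives. Each of them solves a transport
  equation \<open>W\<^sub>t + u W\<^sub>x = S\<close> in the sense of distributions, and on a time interval where they are bounded by \<open>M\<close>,
  the weighted \<open>L\<^sup>p\<close> norm of \<open>S\<close> is at most \<open>c (1 + M)\<close> times the sum of the weighted norms of \<open>u\<close>, \<open>u\<^sub>x\<close>, \<open>\<rho>\<close>.
  For the convolutions with \<open>G\<close> and \<open>\<partial>\<^sub>xG\<close> this is Young's inequality, because the weight satisfies
  \<open>\<phi> (z + y) exp (- \<bar>z\<bar>) \<le> k z \<phi> y\<close> with integrable \<open>k\<close>. Mollifying the transport equation in \<open>x\<close> by a Gaussian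
  turns it into an ordinary differential equation at each point, up to a commutator that vanishes in the limit; an
  Euler step of length \<open>h\<close> along the characteristics then multiplies weighted norms by \<open>1 + O(h M)\<close>, as
  \<open>ln \<phi>\<close> is Lipschitz, and a discrete Gronwall argument gives the exponential bound. Finiteness of the
  norms in the meantime is ensured by truncating the weight; Fatou's lemma removes the truncation.
\<close>

section \<open>Fourier transform and Sobolev embedding\<close>

text \<open>The regularity of \<rho> shapes the argument: it lies in H^(s-1) with s - 1 > 1/2, so it
  is bounded and uniformly continuous but need not be differentiable, and the equations give time
  derivatives only of pairings with Schwartz functions. Hence the mollifier is a Gaussian, itself a
  Schwartz function, and the commutator has to vanish through the modulus of continuity of the
  transported function alone. This works because its kernel has integral zero and an L^1 norm
  bounded independently of the width. Mollification errors are uniform in x, but small in weighted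
  norm only if the weight itself is in L^p: a second reason for truncating it. The final constant is
  A + 2 + 3 c2. Here A is a Lipschitz constant for the logarithms of the truncated weights, 2 pays
  for the Jacobian of an Euler step, 3 is the number of unknowns, and c2 (1 + M) bounds each source;
  the 1 next to M comes from the linear term \<alpha> u of the flux. No factor depends on p, so C
  depends on \<phi> and the fixed \<alpha>, b, \<kappa>, but not on p, s or the solution.\<close>

lemma borel_measurable_cis [measurable]: "cis \<in> borel_measurable borel"
  by (intro borel_measurable_continuous_onI continuous_intros)

section \<open>Gaussians as Schwartz functions and their Fourier transforms\<close>

lemma abs_power_mult_exp_bounded:
  fixes a r x :: real
  assumes "a > 0"
  shows "\<bar>x\<bar> ^ k * exp (- (a * x\<^sup>2) + r * x) \<le> fact k * exp ((1 + \<bar>r\<bar>)\<^sup>2 / (4 * a))"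
proof -
  \<comment> \<open>The quotient is a single term of the nonnegative exponential series.\<close>
  have "\<bar>x\<bar> ^ k / fact k \<le> exp \<bar>x\<bar>"
  proof -
    have "(\<Sum>n\<in>{k}. \<bar>x\<bar> ^ n /\<^sub>R fact n) \<le> (\<Sum>n. \<bar>x\<bar> ^ n /\<^sub>R fact n)"
      by (rule sum_le_suminf[OF summable_exp_generic]) auto
    then show ?thesis by (simp add: exp_def divide_inverse mult.commute)
  qed
  then have 1: "\<bar>x\<bar> ^ k \<le> fact k * exp \<bar>x\<bar>" by (simp add: field_simps)
  have "\<bar>x\<bar> + (- (a * x\<^sup>2) + r * x) \<le> (1 + \<bar>r\<bar>) * \<bar>x\<bar> - a * \<bar>x\<bar>\<^sup>2"
  proof -
    have "r * x \<le> \<bar>r\<bar> * \<bar>x\<bar>" by (metis abs_ge_self abs_mult)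
    then show ?thesis by (simp add: algebra_simps)
  qed
  \<comment> \<open>Completing the square: the bound is the maximum of (1 + |r|) y - a y^2 over
    y.\<close>
  also have "\<dots> \<le> (1 + \<bar>r\<bar>)\<^sup>2 / (4 * a)"
  proof -
    have "(2 * a * \<bar>x\<bar> - (1 + \<bar>r\<bar>))\<^sup>2 \<ge> 0" by simp
    then have "4 * a * ((1 + \<bar>r\<bar>) * \<bar>x\<bar> - a * \<bar>x\<bar>\<^sup>2) \<le> (1 + \<bar>r\<bar>)\<^sup>2"
      by (simp add: power2_eq_square algebra_simps del: abs_mult_self_eq)
    then show ?thesis using assms by (simp add: pos_le_divide_eq mult.commute)
  qed
  finally have 2: "exp (\<bar>x\<bar>) * exp (- (a * x\<^sup>2) + r * x) \<le> exp ((1 + \<bar>r\<bar>)\<^sup>2 / (4 * a))"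
    by (simp add: exp_add[symmetric])
  have "\<bar>x\<bar> ^ k * exp (- (a * x\<^sup>2) + r * x) \<le> (fact k * exp \<bar>x\<bar>) * exp (- (a * x\<^sup>2) + r * x)"
    using 1 by (intro mult_right_mono) auto
  also have "\<dots> \<le> fact k * exp ((1 + \<bar>r\<bar>)\<^sup>2 / (4 * a))"
    using 2 by (simp add: mult.assoc)
  finally show ?thesis .
qed

text \<open>Induction on the coefficients. In \<open>pCons d q\<close> = d + x q the factor x is
  absorbed into the power x^k, so the hypothesis for q is needed for every k at once.\<close>

lemma bounded_poly_mult_gaussian:
  fixes a :: real and c :: complex and q :: "complex poly"
  assumes "a > 0"
  shows "bounded (range (\<lambda>x::real. x ^ k *\<^sub>R (poly q (of_real x) * exp (- of_real (a * x\<^sup>2) + c * of_real x))))"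
proof (induction q arbitrary: k)
  case 0
  then show ?case by (auto simp: bounded_iff intro!: exI[of _ 0])
next
  case (pCons d q)
  have "bounded (range (\<lambda>x::real. x ^ k *\<^sub>R (d * exp (- of_real (a * x\<^sup>2) + c * of_real x))))"
  proof (rule boundedI, clarify)
    fix x :: real
    have "norm (x ^ k *\<^sub>R (d * exp (- of_real (a * x\<^sup>2) + c * of_real x)))
        = norm d * (\<bar>x\<bar> ^ k * exp (- (a * x\<^sup>2) + Re c * x))"
      by (simp add: norm_mult norm_exp_eq_Re power_abs)
    also have "\<dots> \<le> norm d * (fact k * exp ((1 + \<bar>Re c\<bar>)\<^sup>2 / (4 * a)))"
      by (intro mult_left_mono abs_power_mult_exp_bounded assms) auto
    finally show "norm (x ^ k *\<^sub>R (d * exp (- of_real (a * x\<^sup>2) + c * of_real x)))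
        \<le> norm d * (fact k * exp ((1 + \<bar>Re c\<bar>)\<^sup>2 / (4 * a)))" .
  qed
  from bounded_plus_comp[OF this pCons.IH[of "Suc k"]]
  show ?case by (simp add: algebra_simps scaleR_conv_of_real)
qed

lemma schwartz_gaussian:
  fixes a :: real and c k :: complex
  assumes "a > 0"
  shows "schwartz (\<lambda>x. k * exp (- of_real (a * x\<^sup>2) + c * of_real x))"
proof -
  \<comment> \<open>Every derivative is a polynomial times the same exponential; the product rule
    gives the recursion q' + (c - 2 a z) q for that polynomial.\<close>
  define q where "q = rec_nat [:k:] (\<lambda>_ p. pderiv p + [:c, - 2 * of_real a:] * p)"
  define D where "D n x = poly (q n) (of_real x) * exp (- of_real (a * x\<^sup>2) + c * of_real x)" for n and x :: real
  have q0: "q 0 = [:k:]" and qS: "q (Suc n) = pderiv (q n) + [:c, - 2 * of_real a:] * q n" for n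
    by (auto simp: q_def)
  have "(D n has_vector_derivative D (Suc n) x) (at x)" for n x
  proof -
    have "((\<lambda>z. poly (q n) z * exp (- (of_real a * z\<^sup>2) + c * z)) has_field_derivative D (Suc n) x) (at (of_real x))"
      unfolding D_def qS
      by (rule derivative_eq_intros poly_DERIV refl | simp add: algebra_simps)+
    from has_vector_derivative_real_field[OF this] show ?thesis by (simp add: D_def[abs_def])
  qed
  moreover have "bounded (range (\<lambda>x. x ^ j *\<^sub>R D n x))" for j n
    unfolding D_def by (rule bounded_poly_mult_gaussian[OF assms])
  moreover have "D 0 = (\<lambda>x. k * exp (- of_real (a * x\<^sup>2) + c * of_real x))"
    by (simp add: D_def q0 fun_eq_iff)
  ultimately show ?thesis unfolding schwartz_def by blast
qed

lemma schwartz_normal_density: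
  assumes "e > 0"
  shows "schwartz (\<lambda>x. complex_of_real (normal_density m e x))"
proof -
  have "complex_of_real (normal_density m e x)
     = of_real (exp (- (m\<^sup>2 / (2 * e\<^sup>2))) / sqrt (2 * pi * e\<^sup>2)) *
       exp (- of_real (1 / (2 * e\<^sup>2) * x\<^sup>2) + of_real (m / e\<^sup>2) * of_real x)" for x
  proof -
    have "- (x - m)\<^sup>2 / (2 * e\<^sup>2) = - (m\<^sup>2 / (2 * e\<^sup>2)) + (- (1 / (2 * e\<^sup>2) * x\<^sup>2) + m / e\<^sup>2 * x)"
      using assms by (simp add: field_simps power2_eq_square)
    then have "normal_density m e x = exp (- (m\<^sup>2 / (2 * e\<^sup>2))) / sqrt (2 * pi * e\<^sup>2) *
        exp (- (1 / (2 * e\<^sup>2) * x\<^sup>2) + m / e\<^sup>2 * x)"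
      by (simp only: normal_density_def exp_add) simp
    then show ?thesis by (simp add: exp_of_real[symmetric] del: exp_of_real) 
  qed
  then show ?thesis using assms by (simp only:) (intro schwartz_gaussian, simp)
qed

text \<open>These are the separating test functions: pairing f with all of them amounts to the
  Fourier transform of f times a Gaussian.\<close>

lemma schwartz_modulated_gaussian:
  "schwartz (\<lambda>y. cis (r * y) * of_real (exp (- y\<^sup>2 / 2)))"
proof -
  have "cis (r * y) * of_real (exp (- y\<^sup>2 / 2))
      = 1 * exp (- of_real (1 / 2 * y\<^sup>2) + (\<i> * of_real r) * of_real y)" for y :: real
    by (simp add: cis_conv_exp exp_of_real[symmetric] exp_add[symmetric] algebra_simps del: exp_of_real)
  then show ?thesis using schwartz_gaussian[of "1/2" 1 "\<i> * of_real r"] by simp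
qed

text \<open>The characteristic function of the standard normal law, carried over by the substitution
  y = (x - m) / e.\<close>

lemma has_bochner_integral_cis_normal_density:
  assumes "e > 0"
  shows "has_bochner_integral lborel (\<lambda>x. cis (t * x) * of_real (normal_density m e x))
           (cis (t * m) * of_real (exp (- (e * t)\<^sup>2 / 2)))"
proof -
  have s: "integrable lborel (\<lambda>x. cis (s * x) * complex_of_real (normal_density m e x))"
    if "e > 0" for s m e
    by (rule Bochner_Integration.integrable_bound[of _ "normal_density m e"])
      (use that in \<open>auto simp: norm_mult\<close>)
  have "(\<integral>x. cis (s * x) * complex_of_real (std_normal_density x) \<partial>lborel) = of_real (exp (- s\<^sup>2 / 2))" for s
    using fun_cong[OF char_std_normal_distribution, of s]
    unfolding char_def by (subst (asm) integral_density) (auto simp: scaleR_conv_of_real cis_conv_exp mult_ac)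
  then have std: "has_bochner_integral lborel (\<lambda>x. cis (s * x) * complex_of_real (std_normal_density x)) (of_real (exp (- s\<^sup>2 / 2)))" for s
    by (simp add: has_bochner_integral_iff s)
  have "has_bochner_integral lborel (\<lambda>x. cis ((e * t) * (- m / e + (1/e) * x)) * complex_of_real (std_normal_density (- m / e + (1/e) * x)))
       (of_real (exp (- (e * t)\<^sup>2 / 2)) /\<^sub>R \<bar>1 / e\<bar>)"
    by (rule lborel_has_bochner_integral_real_affine_iff[THEN iffD1, OF _ std]) (use assms in auto)
  then have "has_bochner_integral lborel (\<lambda>x. (cis (t * m) / of_real e) * (cis ((e * t) * (- m / e + (1/e) * x)) * complex_of_real (std_normal_density (- m / e + (1/e) * x))))
       ((cis (t * m) / of_real e) * (of_real (exp (- (e * t)\<^sup>2 / 2)) /\<^sub>R \<bar>1 / e\<bar>))"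
    by (rule has_bochner_integral_mult_right)
  moreover have "(cis (t * m) / of_real e) * (of_real (exp (- (e * t)\<^sup>2 / 2)) /\<^sub>R \<bar>1 / e\<bar>)
     = cis (t * m) * of_real (exp (- (e * t)\<^sup>2 / 2))"
    using assms by (simp add: scaleR_conv_of_real field_simps)
  moreover have "(cis (t * m) / of_real e) * (cis ((e * t) * (- m / e + (1/e) * x)) * complex_of_real (std_normal_density (- m / e + (1/e) * x)))
     = cis (t * x) * of_real (normal_density m e x)" for x
  proof -
    have "std_normal_density (- m / e + (1/e) * x) / e = normal_density m e x"
    proof -
      have "(- m / e + (1/e) * x)\<^sup>2 / 2 = (x - m)\<^sup>2 / (2 * e\<^sup>2)"
        using assms by (simp add: field_simps power2_eq_square)
      then show ?thesis using assms by (simp add: normal_density_def real_sqrt_mult field_simps)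
    qed
    moreover have "cis (t * m) * cis ((e * t) * (- m / e + (1/e) * x)) = cis (t * x)"
      using assms by (simp add: cis_mult field_simps)
    moreover have "(cis (t * m) / of_real e) * (c * complex_of_real d) = (cis (t * m) * c) * of_real (d / e)" for c d
      by simp
    ultimately show ?thesis by (simp only:)
  qed
  ultimately show ?thesis by simp
qed

section \<open>Injectivity of the Fourier transform on integrable functions\<close>

lemma integrable_cis_mult:
  fixes g :: "real \<Rightarrow> complex"
  assumes "integrable lborel g"
  shows "integrable lborel (\<lambda>\<xi>. g \<xi> * cis (x * \<xi>))"
  by (rule Bochner_Integration.integrable_bound[OF assms])
    (use borel_measurable_integrable[OF assms] in \<open>auto simp: norm_mult\<close>)

text \<open>The positive and negative parts of a function with vanishing Fourier transform are densities of
  finite measures with equal characteristic functions.\<close>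

lemma real_fourier_eq_0_imp_AE_eq_0:
  fixes f :: "real \<Rightarrow> real"
  assumes f: "integrable lborel f"
    and 0: "\<And>r. (\<integral>y. of_real (f y) * cis (r * y) \<partial>lborel) = (0::complex)"
  shows "AE y in lborel. f y = 0"
proof -
  define P N where "P = (\<lambda>y. max (f y) 0)" and "N = (\<lambda>y. max (- f y) 0)"
  have [measurable]: "f \<in> borel_measurable borel" using f by auto
  have PN: "integrable lborel P" "integrable lborel N" "P y \<ge> 0" "N y \<ge> 0" "f y = P y - N y" for y
    using f by (auto simp: P_def N_def intro!: integrable_max)
  have [measurable]: "P \<in> borel_measurable borel" "N \<in> borel_measurable borel" by (auto simp: P_def N_def)
  have cP: "integrable lborel (\<lambda>y. of_real (P y) * cis (r * y))" "integrable lborel (\<lambda>y. of_real (N y) * cis (r * y))" for r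
    using PN(1,2) by (auto intro!: integrable_cis_mult)
  have eq: "(\<integral>y. of_real (P y) * cis (r * y) \<partial>lborel) = (\<integral>y. of_real (N y) * cis (r * y) \<partial>lborel)" for r
  proof -
    have "(\<integral>y. of_real (f y) * cis (r * y) \<partial>lborel) = (\<integral>y. of_real (P y) * cis (r * y) \<partial>lborel) - (\<integral>y. of_real (N y) * cis (r * y) \<partial>lborel)"
      by (subst Bochner_Integration.integral_diff[symmetric, OF cP]) (simp add: PN(5) left_diff_distrib)
    then show ?thesis using 0[of r] by simp
  qed
  \<comment> \<open>Both parts have the same total mass \<open>m\<close>, by the case r = 0 of
    \<open>eq\<close>. For \<open>m\<close> > 0, dividing by it gives probability densities, to
    which Levy's uniqueness theorem applies; for \<open>m\<close> = 0 both parts vanish almost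
    everywhere.\<close>
  define m where "m = integral\<^sup>L lborel P"
  have "complex_of_real m = of_real (integral\<^sup>L lborel N)"
    using eq[of 0] PN(1,2) by (simp add: m_def del: of_real_eq_iff)
  then have mN: "integral\<^sup>L lborel N = m" by simp
  have "m \<ge> 0" unfolding m_def using PN by (intro integral_nonneg_AE) auto
  show ?thesis
  proof (cases "m = 0")
    case True
    then have "AE y in lborel. P y = 0" "AE y in lborel. N y = 0"
      using PN mN m_def integral_nonneg_eq_0_iff_AE[of lborel P] integral_nonneg_eq_0_iff_AE[of lborel N] by auto
    then show ?thesis by eventually_elim (simp add: PN(5))
  next
    case False
    then have m: "m > 0" using \<open>m \<ge> 0\<close> by simp
    have rd: "real_distribution (density lborel (\<lambda>y. ennreal (Q y / m)))"
      if "integrable lborel Q" "\<And>y. Q y \<ge> 0" "integral\<^sup>L lborel Q = m" for Q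
    proof -
      have [measurable]: "Q \<in> borel_measurable borel" using that by auto
      have "emeasure (density lborel (\<lambda>y. ennreal (Q y / m))) UNIV = (\<integral>\<^sup>+y. ennreal (Q y / m) \<partial>lborel)"
        by (simp add: emeasure_density)
      also have "\<dots> = ennreal (\<integral>y. Q y / m \<partial>lborel)"
        using that(1,2) m by (intro nn_integral_eq_integral) auto
      also have "\<dots> = 1" using m by (simp add: that(3))
      finally have "prob_space (density lborel (\<lambda>y. ennreal (Q y / m)))"
        by (intro prob_spaceI) simp
      then show ?thesis by (simp add: real_distribution_def real_distribution_axioms_def)
    qed
    have ch: "char (density lborel (\<lambda>y. ennreal (Q y / m))) r = (\<integral>y. of_real (Q y) * cis (r * y) \<partial>lborel) / of_real m"
      if "integrable lborel Q" "\<And>y. Q y \<ge> 0" for Q r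
    proof -
      have [measurable]: "Q \<in> borel_measurable borel" using that by auto
      show ?thesis unfolding char_def using that m
        by (subst integral_density) (auto simp: scaleR_conv_of_real cis_conv_exp mult_ac)
    qed
    have "density lborel (\<lambda>y. ennreal (P y / m)) = density lborel (\<lambda>y. ennreal (N y / m))"
      by (rule Levy_uniqueness) (auto intro!: rd simp: PN mN m_def[symmetric] ch eq)
    then have "AE y in lborel. ennreal (P y / m) = ennreal (N y / m)"
      by (subst (asm) sigma_finite_measure.density_unique_iff[OF sigma_finite_lborel]) auto
    then show ?thesis
      by eventually_elim (use m PN in \<open>simp\<close>)
  qed
qed

text \<open>Conjugating a function conjugates its transform and reverses r, so the transform of the
  real part vanishes as well. The imaginary part of f is the real part of -i f.\<close>

lemma fourier_eq_0_imp_AE_eq_0: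
  fixes f :: "real \<Rightarrow> complex"
  assumes f: "integrable lborel f"
    and 0: "\<And>r. (\<integral>y. f y * cis (r * y) \<partial>lborel) = 0"
  shows "AE y in lborel. f y = 0"
proof -
  have Re_0: "AE y in lborel. Re (g y) = 0"
    if g: "integrable lborel g" and g0: "\<And>r. (\<integral>y. g y * cis (r * y) \<partial>lborel) = 0"
    for g :: "real \<Rightarrow> complex"
  proof (rule real_fourier_eq_0_imp_AE_eq_0)
    fix r
    have c: "(\<integral>y. cnj (g y) * cis (r * y) \<partial>lborel) = 0"
    proof -
      have "(\<integral>y. cnj (g y) * cis (r * y) \<partial>lborel) = (\<integral>y. cnj (g y * cis ((-r) * y)) \<partial>lborel)"
        by (intro Bochner_Integration.integral_cong) (auto simp: cis_cnj)
      also have "\<dots> = cnj (\<integral>y. g y * cis ((-r) * y) \<partial>lborel)"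
        by (rule Bochner_Integration.integral_cnj)
      finally show ?thesis using g0[of "-r"] by simp
    qed
    have gc: "integrable lborel (\<lambda>y. cnj (g y))" using g by simp
    have "(\<integral>y. of_real (Re (g y)) * cis (r * y) \<partial>lborel) = (\<integral>y. (g y * cis (r * y) + cnj (g y) * cis (r * y)) / 2 \<partial>lborel)"
      by (intro Bochner_Integration.integral_cong) (auto simp: complex_eq_iff algebra_simps)
    also have "\<dots> = 0"
      using integrable_cis_mult[OF g, of r] integrable_cis_mult[OF gc, of r] g0 c by simp
    finally show "(\<integral>y. of_real (Re (g y)) * cis (r * y) \<partial>lborel) = 0" .
  qed (use g in auto)
  have "AE y in lborel. Re (- \<i> * f y) = 0"
    by (rule Re_0) (use f 0 in \<open>auto simp: mult.assoc\<close>)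
  with Re_0[OF f 0] show ?thesis by eventually_elim (simp add: complex_eq_iff)
qed

section \<open>Square-integrable functions and the Sobolev weight\<close>

lemma Lp_norm_2_eq:
  fixes f :: "real \<Rightarrow> 'a::{real_normed_vector}"
  assumes "I = (\<integral>\<^sup>+x. ennreal ((norm (f x))\<^sup>2) \<partial>lborel)"
  shows "Lp_norm 2 f = (if I = \<infinity> then \<infinity> else ennreal (sqrt (enn2real I)))"
proof -
  have "norm (f x) powr 2 = (norm (f x))\<^sup>2" for x
    by (cases "f x = 0") (auto simp: powr_numeral)
  then show ?thesis unfolding Lp_norm_def assms
    by (auto simp: Let_def powr_half_sqrt)
qed

lemma in_Lp_2_iff:
  fixes f :: "real \<Rightarrow> 'a::{real_normed_vector}"
  shows "in_Lp 2 f \<longleftrightarrow> f \<in> borel_measurable borel \<and> (\<integral>\<^sup>+x. ennreal ((norm (f x))\<^sup>2) \<partial>lborel) < \<infinity>"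
  unfolding in_Lp_def by (subst Lp_norm_2_eq[OF refl]) (auto simp: less_top)

lemma in_Lp_2_integrable:
  fixes f :: "real \<Rightarrow> 'a::{second_countable_topology, banach}"
  assumes "in_Lp 2 f"
  shows "f \<in> borel_measurable borel" "integrable lborel (\<lambda>x. (norm (f x))\<^sup>2)"
proof -
  show m[measurable]: "f \<in> borel_measurable borel" using assms by (simp add: in_Lp_2_iff)
  show "integrable lborel (\<lambda>x. (norm (f x))\<^sup>2)"
    using assms by (intro integrableI_nonneg) (auto simp: in_Lp_2_iff)
qed

lemma in_Lp_2_I:
  fixes f :: "real \<Rightarrow> 'a::{second_countable_topology, banach}"
  assumes "f \<in> borel_measurable borel" "integrable lborel (\<lambda>x. (norm (f x))\<^sup>2)"
  shows "in_Lp 2 f"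
  unfolding in_Lp_2_iff
  using assms(1) nn_integral_eq_integral[OF assms(2)] by (auto simp: less_top)

lemma integrable_mult_L2:
  fixes f :: "real \<Rightarrow> 'a::{real_normed_field, second_countable_topology, banach}" and g :: "real \<Rightarrow> 'a"
  assumes "in_Lp 2 f" "in_Lp 2 g"
  shows "integrable lborel (\<lambda>x. f x * g x)"
proof (rule Bochner_Integration.integrable_bound)
  show "integrable lborel (\<lambda>x. (norm (f x))\<^sup>2 + (norm (g x))\<^sup>2)"
    using assms in_Lp_2_integrable by (intro Bochner_Integration.integrable_add) auto
  have [measurable]: "f \<in> borel_measurable borel" "g \<in> borel_measurable borel"
    using assms by (auto simp: in_Lp_2_iff)
  show "(\<lambda>x. f x * g x) \<in> borel_measurable lborel" by measurable
  have "norm (f x * g x) \<le> norm ((norm (f x))\<^sup>2 + (norm (g x))\<^sup>2)" for x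
  proof -
    have "2 * norm (f x) * norm (g x) \<le> (norm (f x))\<^sup>2 + (norm (g x))\<^sup>2"
      by (rule sum_squares_bound)
    moreover have "0 \<le> norm (f x) * norm (g x)" by simp
    ultimately have "norm (f x) * norm (g x) \<le> (norm (f x))\<^sup>2 + (norm (g x))\<^sup>2"
      by linarith
    then show ?thesis by (simp add: norm_mult)
  qed
  then show "AE x in lborel. norm (f x * g x) \<le> norm ((norm (f x))\<^sup>2 + (norm (g x))\<^sup>2)" by simp
qed

lemma in_Lp_2_diff:
  fixes f :: "real \<Rightarrow> 'a::{second_countable_topology, banach}"
  assumes "in_Lp 2 f" "in_Lp 2 g"
  shows "in_Lp 2 (\<lambda>x. f x - g x)"
proof (rule in_Lp_2_I)
  have [measurable]: "f \<in> borel_measurable borel" "g \<in> borel_measurable borel"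
    using assms by (auto simp: in_Lp_2_iff)
  show "(\<lambda>x. f x - g x) \<in> borel_measurable borel" by measurable
  show "integrable lborel (\<lambda>x. (norm (f x - g x))\<^sup>2)"
  proof (rule Bochner_Integration.integrable_bound)
    show "integrable lborel (\<lambda>x. 2 * ((norm (f x))\<^sup>2 + (norm (g x))\<^sup>2))"
      using assms in_Lp_2_integrable by (intro Bochner_Integration.integrable_add integrable_mult_right) auto
    show "(\<lambda>x. (norm (f x - g x))\<^sup>2) \<in> borel_measurable lborel" by measurable
    have "(norm (f x - g x))\<^sup>2 \<le> 2 * ((norm (f x))\<^sup>2 + (norm (g x))\<^sup>2)" for x
    proof -
      have "(norm (f x - g x))\<^sup>2 \<le> (norm (f x) + norm (g x))\<^sup>2"
        by (intro power_mono norm_triangle_ineq4) auto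
      also have "\<dots> \<le> 2 * ((norm (f x))\<^sup>2 + (norm (g x))\<^sup>2)"
        using sum_squares_bound[of "norm (f x)" "norm (g x)"] by (simp add: power2_eq_square algebra_simps)
      finally show ?thesis .
    qed
    then show "AE x in lborel. norm ((norm (f x - g x))\<^sup>2) \<le> norm (2 * ((norm (f x))\<^sup>2 + (norm (g x))\<^sup>2))" by simp
  qed
qed

text \<open>Comparison with 1 on [-1,1] and with |xi|^(-2 s) outside, which is integrable at
  infinity because 2 s > 1.\<close>

lemma integrable_Sobolev_weight:
  assumes "s > 1 / 2"
  shows "integrable lborel (\<lambda>\<xi>::real. (1 + \<xi>\<^sup>2) powr (- s))"
proof -
  have 1: "set_integrable lborel {1..} (\<lambda>\<xi>::real. \<xi> powr (- 2 * s))"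
  proof -
    have "((\<lambda>\<xi>. \<xi> powr (- 2 * s)) has_integral - (1 powr (- 2 * s + 1)) / (- 2 * s + 1)) {1::real..}"
      by (rule has_integral_powr_to_inf) (use assms in auto)
    then have "(\<lambda>\<xi>. \<xi> powr (- 2 * s)) absolutely_integrable_on {1::real..}"
      by (intro nonnegative_absolutely_integrable_1) (auto simp: integrable_on_def)
    then show ?thesis
      unfolding set_integrable_def by (subst (asm) integrable_completion) auto
  qed
  have 2: "set_integrable lborel {..-1} (\<lambda>\<xi>::real. (-\<xi>) powr (- 2 * s))"
  proof -
    have "integrable lborel (\<lambda>\<xi>::real. indicator {1..} (0 + (-1) * \<xi>) *\<^sub>R (0 + (-1) * \<xi>) powr (- 2 * s))"
      using 1 unfolding set_integrable_def by (subst lborel_integrable_real_affine_iff) auto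
    then show ?thesis unfolding set_integrable_def
      by (rule Bochner_Integration.integrable_cong[THEN iffD1, rotated 2]) (auto simp: indicator_def)
  qed
  have 3: "integrable lborel (indicat_real {-1..1::real})"
    by (rule integrable_real_indicator) auto
  have "integrable lborel (\<lambda>\<xi>. (indicator {1..} \<xi> *\<^sub>R \<xi> powr (- 2 * s) + indicator {..-1} \<xi> *\<^sub>R (-\<xi>) powr (- 2 * s)) + indicat_real {-1..1::real} \<xi>)"
    using 1 2 3 unfolding set_integrable_def by (intro Bochner_Integration.integrable_add)
  then show ?thesis
  proof (rule Bochner_Integration.integrable_bound)
    have "(1 + \<xi>\<^sup>2) powr (- s) \<le> (indicator {1..} \<xi> *\<^sub>R \<xi> powr (- 2 * s) + indicator {..-1} \<xi> *\<^sub>R (-\<xi>) powr (- 2 * s)) + indicat_real {-1..1::real} \<xi>" for \<xi> :: real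
    proof (cases "\<bar>\<xi>\<bar> \<le> 1")
      case True
      have "(1 + \<xi>\<^sup>2) powr (- s) \<le> 1 powr (-s)" using assms
        by (intro powr_mono2') auto
      then show ?thesis using True by (auto simp: indicator_def abs_le_iff)
    next
      case False
      have "(1 + \<xi>\<^sup>2) powr (- s) \<le> (\<bar>\<xi>\<bar>\<^sup>2) powr (- s)" using False assms
        by (intro powr_mono2') (auto simp: abs_if split: if_splits)
      also have "\<dots> = \<bar>\<xi>\<bar> powr (- 2 * s)"
      proof -
        have "\<bar>\<xi>\<bar>\<^sup>2 = \<bar>\<xi>\<bar> powr 2" using False by (subst powr_numeral) auto
        then show ?thesis by (simp only: powr_powr) simp
      qed
      finally show ?thesis using False by (auto simp: indicator_def abs_if split: if_splits)
    qed
    moreover have "(0::real) \<le> (1 + \<xi>\<^sup>2) powr (- s)" for \<xi> :: real by simp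
    ultimately show "AE \<xi> in lborel. norm ((1 + \<xi>\<^sup>2) powr (- s)) \<le> norm ((indicator {1..} \<xi> *\<^sub>R \<xi> powr (- 2 * s) + indicator {..-1} \<xi> *\<^sub>R (-\<xi>) powr (- 2 * s)) + indicat_real {-1..1::real} \<xi>)"
      by (intro AE_I2) (simp add: order_trans[OF _ abs_ge_self])
  qed simp
qed

text \<open>The analytic core of the Sobolev embedding: Cauchy-Schwarz for the product of (1 +
  xi^2)^(-s/2), square integrable as s > 1/2, with the weighted g. The constant depends on s
  alone.\<close>

lemma L1_bound_Sobolev:
  assumes s: "s > 1 / 2"
  obtains C where "C > 0" and
    "\<And>g :: real \<Rightarrow> complex. \<lbrakk>g \<in> borel_measurable borel; Lp_norm 2 (\<lambda>\<xi>. ((1 + \<xi>\<^sup>2) powr (s / 2)) *\<^sub>R g \<xi>) < \<infinity>\<rbrakk>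
      \<Longrightarrow> integrable lborel g \<and> (\<integral>\<xi>. norm (g \<xi>) \<partial>lborel) \<le> C * enn2real (Lp_norm 2 (\<lambda>\<xi>. ((1 + \<xi>\<^sup>2) powr (s / 2)) *\<^sub>R g \<xi>))"
proof -
  define W where "W = (\<integral>\<xi>. (1 + (\<xi>::real)\<^sup>2) powr (- s) \<partial>lborel)"
  have W0: "W \<ge> 0" unfolding W_def by simp
  show ?thesis
  \<comment> \<open>Adding 1 makes the constant strictly positive without a lower bound for
    \<open>W\<close>.\<close>
  proof (rule that[of "sqrt W + 1"])
    fix g :: "real \<Rightarrow> complex"
    assume g[measurable]: "g \<in> borel_measurable borel"
      and fin: "Lp_norm 2 (\<lambda>\<xi>. ((1 + \<xi>\<^sup>2) powr (s / 2)) *\<^sub>R g \<xi>) < \<infinity>"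
    define I where "I = (\<integral>\<^sup>+\<xi>. ennreal ((norm (((1 + \<xi>\<^sup>2) powr (s / 2)) *\<^sub>R g \<xi>))\<^sup>2) \<partial>lborel)"
    have I: "I \<noteq> \<infinity>" "Lp_norm 2 (\<lambda>\<xi>. ((1 + \<xi>\<^sup>2) powr (s / 2)) *\<^sub>R g \<xi>) = ennreal (sqrt (enn2real I))"
      using fin Lp_norm_2_eq[OF I_def] by (auto split: if_splits)
    have "(\<integral>\<^sup>+\<xi>. ennreal (norm (g \<xi>)) \<partial>lborel)\<^sup>2
       = (\<integral>\<^sup>+\<xi>. ennreal ((1 + \<xi>\<^sup>2) powr (- s / 2)) * ennreal (norm (((1 + \<xi>\<^sup>2) powr (s / 2)) *\<^sub>R g \<xi>)) \<partial>lborel)\<^sup>2"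
    proof -
      have "norm (g \<xi>) = (1 + \<xi>\<^sup>2) powr (- s / 2) * norm (((1 + \<xi>\<^sup>2) powr (s / 2)) *\<^sub>R g \<xi>)" for \<xi>
      proof -
        have "(1 + \<xi>\<^sup>2) powr (- s / 2) * (1 + \<xi>\<^sup>2) powr (s / 2) = 1"
          by (simp add: powr_add[symmetric] add_nonneg_eq_0_iff)
        then show ?thesis by (simp add: mult.assoc[symmetric])
      qed
      then have "ennreal (norm (g \<xi>)) = ennreal ((1 + \<xi>\<^sup>2) powr (- s / 2)) * ennreal (norm (((1 + \<xi>\<^sup>2) powr (s / 2)) *\<^sub>R g \<xi>))" for \<xi>
        by (subst ennreal_mult[symmetric]) (auto simp del: norm_scaleR)
      then show ?thesis by presburger
    qed
    also have "\<dots> \<le> (\<integral>\<^sup>+\<xi>. (ennreal ((1 + \<xi>\<^sup>2) powr (- s / 2)))\<^sup>2 \<partial>lborel) * (\<integral>\<^sup>+\<xi>. (ennreal (norm (((1 + \<xi>\<^sup>2) powr (s / 2)) *\<^sub>R g \<xi>)))\<^sup>2 \<partial>lborel)"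
      by (rule Cauchy_Schwarz_nn_integral) measurable
    also have "(\<integral>\<^sup>+\<xi>. (ennreal ((1 + \<xi>\<^sup>2) powr (- s / 2)))\<^sup>2 \<partial>lborel) = ennreal W"
    proof -
      have "(ennreal ((1 + \<xi>\<^sup>2) powr (- s / 2)))\<^sup>2 = ennreal ((1 + \<xi>\<^sup>2) powr (- s))" for \<xi> :: real
        by (simp add: ennreal_power power2_eq_square[of "_ powr _"] powr_add[symmetric])
      then show ?thesis unfolding W_def
        using nn_integral_eq_integral[OF integrable_Sobolev_weight[OF s]] by simp
    qed
    also have "(\<integral>\<^sup>+\<xi>. (ennreal (norm (((1 + \<xi>\<^sup>2) powr (s / 2)) *\<^sub>R g \<xi>)))\<^sup>2 \<partial>lborel) = I"
      unfolding I_def by (simp add: ennreal_power)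
    also have "ennreal W * I = ennreal (W * enn2real I)"
      using I W0 by (simp add: ennreal_mult ennreal_enn2real_if)
    finally have le: "(\<integral>\<^sup>+\<xi>. ennreal (norm (g \<xi>)) \<partial>lborel)\<^sup>2 \<le> ennreal (W * enn2real I)" .
    then have fin2: "(\<integral>\<^sup>+\<xi>. ennreal (norm (g \<xi>)) \<partial>lborel) < \<infinity>"
      by (auto simp: less_top[symmetric] power2_eq_square ennreal_top_mult top_unique)
    then have gi: "integrable lborel g" by (intro integrableI_bounded) auto
    then have "(\<integral>\<^sup>+\<xi>. ennreal (norm (g \<xi>)) \<partial>lborel) = ennreal (\<integral>\<xi>. norm (g \<xi>) \<partial>lborel)"
      by (intro nn_integral_eq_integral) auto
    with le have "(\<integral>\<xi>. norm (g \<xi>) \<partial>lborel)\<^sup>2 \<le> W * enn2real I"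
      using W0 by (simp add: ennreal_power)
    then have "(\<integral>\<xi>. norm (g \<xi>) \<partial>lborel) \<le> sqrt (W * enn2real I)"
      by (rule real_le_rsqrt)
    also have "\<dots> \<le> (sqrt W + 1) * sqrt (enn2real I)"
      by (simp add: real_sqrt_mult algebra_simps)
    finally show "integrable lborel g \<and> (\<integral>\<xi>. norm (g \<xi>) \<partial>lborel) \<le> (sqrt W + 1) * enn2real (Lp_norm 2 (\<lambda>\<xi>. ((1 + \<xi>\<^sup>2) powr (s / 2)) *\<^sub>R g \<xi>))"
      using gi by (simp add: I(2))
  qed (use W0 in \<open>simp add: add_nonneg_pos\<close>)
qed

section \<open>The inverse Fourier integral and Plancherel's inequality\<close>

definition inv_fourier :: "(real \<Rightarrow> complex) \<Rightarrow> real \<Rightarrow> complex" where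
  "inv_fourier g x = (\<integral>\<xi>. g \<xi> * cis (x * \<xi>) \<partial>lborel)"

lemma norm_inv_fourier_le:
  assumes "integrable lborel g"
  shows "norm (inv_fourier g x) \<le> (\<integral>\<xi>. norm (g \<xi>) \<partial>lborel)"
proof -
  have "norm (inv_fourier g x) \<le> (\<integral>\<xi>. norm (g \<xi> * cis (x * \<xi>)) \<partial>lborel)"
    unfolding inv_fourier_def by (rule integral_norm_bound)
  then show ?thesis by (simp add: norm_mult)
qed

lemma norm_cis_minus_1_le: "norm (cis x - 1) \<le> \<bar>x\<bar>" "norm (cis x - 1) \<le> 2"
  using iexp_approx1[of x 0] norm_triangle_ineq4[of "cis x" 1] by (auto simp: cis_conv_exp)

text \<open>Two bounds for differentiating under the integral sign: the quadratic one makes the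
  remainder of the difference quotient tend to 0, the linear one dominates it by a multiple of |xi
  g(xi)|.\<close>

lemma norm_cis_minus_linear_le:
  "norm (cis x - 1 - \<i> * x) \<le> x\<^sup>2 / 2" "norm (cis x - 1 - \<i> * x) \<le> 2 * \<bar>x\<bar>"
  using iexp_approx1[of x 1] iexp_approx2[of x 1]
  by (auto simp: cis_conv_exp power2_eq_square algebra_simps)

text \<open>The increment between x and y is bounded by \<open>m\<close> (y - x), which depends on
  the difference only and tends to 0 by dominated convergence with majorant 2 |g|.\<close>

lemma uniformly_continuous_inv_fourier:
  assumes g: "integrable lborel g"
  shows "uniformly_continuous_on UNIV (inv_fourier g)"
proof -
  have [measurable]: "g \<in> borel_measurable borel" using g by auto
  define m where "m z = (\<integral>\<xi>. norm (g \<xi> * (cis (z * \<xi>) - 1)) \<partial>lborel)" for z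
  have i: "integrable lborel (\<lambda>\<xi>. g \<xi> * (cis (z * \<xi>) - 1))" for z
    using integrable_cis_mult[OF g, of z] g by (simp add: right_diff_distrib)
  have le: "dist (inv_fourier g y) (inv_fourier g x) \<le> m (y - x)" for x y
  proof -
    have "inv_fourier g y - inv_fourier g x = (\<integral>\<xi>. g \<xi> * cis (y * \<xi>) - g \<xi> * cis (x * \<xi>) \<partial>lborel)"
      unfolding inv_fourier_def using integrable_cis_mult[OF g] by simp
    also have "norm \<dots> \<le> (\<integral>\<xi>. norm (g \<xi> * cis (y * \<xi>) - g \<xi> * cis (x * \<xi>)) \<partial>lborel)"
      by (rule integral_norm_bound)
    also have "\<dots> = m (y - x)" unfolding m_def
    proof (rule Bochner_Integration.integral_cong[OF refl])
      fix \<xi>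
      have "g \<xi> * cis (y * \<xi>) - g \<xi> * cis (x * \<xi>) = g \<xi> * (cis ((y - x) * \<xi>) - 1) * cis (x * \<xi>)"
        by (simp add: algebra_simps cis_mult)
      then show "norm (g \<xi> * cis (y * \<xi>) - g \<xi> * cis (x * \<xi>)) = norm (g \<xi> * (cis ((y - x) * \<xi>) - 1))"
        by (simp add: norm_mult)
    qed
    finally show ?thesis by (simp add: dist_norm)
  qed
  have "(m \<longlongrightarrow> 0) (at 0)"
    unfolding tendsto_at_iff_sequentially
  proof (safe, unfold o_def)
    fix X :: "nat \<Rightarrow> real" assume X: "X \<longlonglongrightarrow> 0"
    have "(\<lambda>n. m (X n)) \<longlonglongrightarrow> integral\<^sup>L lborel (\<lambda>\<xi>::real. 0::real)"
      unfolding m_def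
    proof (rule integral_dominated_convergence)
      show "integrable lborel (\<lambda>\<xi>. 2 * norm (g \<xi>))" using g by simp
      show "AE \<xi> in lborel. (\<lambda>n. norm (g \<xi> * (cis (X n * \<xi>) - 1))) \<longlonglongrightarrow> 0"
      proof (rule AE_I2)
        fix \<xi>
        have "(\<lambda>n. norm (g \<xi> * (cis (X n * \<xi>) - 1))) \<longlonglongrightarrow> norm (g \<xi> * (cis (0 * \<xi>) - 1))"
          by (intro tendsto_intros X isCont_tendsto_compose[where g = cis])
        then show "(\<lambda>n. norm (g \<xi> * (cis (X n * \<xi>) - 1))) \<longlonglongrightarrow> 0" by simp
      qed
      show "AE \<xi> in lborel. norm (norm (g \<xi> * (cis (X n * \<xi>) - 1))) \<le> 2 * norm (g \<xi>)" for n
      proof (rule AE_I2)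
        fix \<xi>
        have "norm (g \<xi>) * norm (cis (X n * \<xi>) - 1) \<le> norm (g \<xi>) * 2"
          by (intro mult_left_mono norm_cis_minus_1_le(2)) simp
        then show "norm (norm (g \<xi> * (cis (X n * \<xi>) - 1))) \<le> 2 * norm (g \<xi>)"
          by (simp add: norm_mult mult.commute)
      qed
    qed auto
    then show "(\<lambda>n. m (X n)) \<longlonglongrightarrow> 0" by simp
  qed
  show ?thesis unfolding uniformly_continuous_on_def
  proof (intro allI impI)
    fix e :: real assume "e > 0"
    then obtain d where d: "d > 0" "\<And>z. z \<noteq> 0 \<Longrightarrow> \<bar>z\<bar> < d \<Longrightarrow> \<bar>m z\<bar> < e"
      using \<open>(m \<longlongrightarrow> 0) (at 0)\<close> unfolding tendsto_iff eventually_at by (auto simp: dist_real_def)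
    have "m 0 = 0" by (simp add: m_def)
    then have "\<bar>z\<bar> < d \<Longrightarrow> m z < e" for z using d(2)[of z] \<open>e > 0\<close> by (cases "z = 0") auto
    then show "\<exists>d>0. \<forall>x\<in>UNIV. \<forall>x'\<in>UNIV. dist x' x < d \<longrightarrow> dist (inv_fourier g x') (inv_fourier g x) < e"
      using d(1) by (intro exI[of _ d]) (auto simp: dist_real_def intro!: le_less_trans[OF le])
  qed
qed

lemma has_vector_derivative_inv_fourier:
  assumes g: "integrable lborel g" and g': "integrable lborel (\<lambda>\<xi>. \<xi> *\<^sub>R g \<xi>)"
  shows "(inv_fourier g has_vector_derivative inv_fourier (\<lambda>\<xi>. \<i> * of_real \<xi> * g \<xi>) x) (at x)"
proof -
  have [measurable]: "g \<in> borel_measurable borel" using g by auto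
  have g'': "integrable lborel (\<lambda>\<xi>. \<i> * of_real \<xi> * g \<xi>)"
    using integrable_mult_right[OF g', of \<i>] by (simp add: scaleR_conv_of_real mult_ac)
  \<comment> \<open>Modulus of the remainder of the difference quotient under the integral sign.
    \<open>R1\<close> gives an integrable majorant, \<open>R2\<close> the pointwise limit 0; for h =
    0 the value is 0, as division by zero returns 0.\<close>
  define R where "R h \<xi> = norm (g \<xi> * (cis (h * \<xi>) - 1 - \<i> * (h * \<xi>))) / \<bar>h\<bar>" for h \<xi>
  have [measurable]: "R h \<in> borel_measurable borel" for h unfolding R_def by measurable
  have R1: "R h \<xi> \<le> 2 * norm (\<xi> *\<^sub>R g \<xi>)" and R2: "R h \<xi> \<le> \<bar>h\<bar> * (\<xi>\<^sup>2 * norm (g \<xi>) / 2)" for h \<xi>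
  proof -
    show "R h \<xi> \<le> 2 * norm (\<xi> *\<^sub>R g \<xi>)"
    proof (cases "h = 0")
      case False
      have "norm (g \<xi>) * norm (cis (h * \<xi>) - 1 - \<i> * (h * \<xi>)) \<le> norm (g \<xi>) * (2 * \<bar>h * \<xi>\<bar>)"
        using norm_cis_minus_linear_le(2)[of "h * \<xi>"] by (intro mult_left_mono) auto
      also have "norm (g \<xi>) * (2 * \<bar>h * \<xi>\<bar>) = (2 * norm (\<xi> *\<^sub>R g \<xi>)) * \<bar>h\<bar>"
        by (simp only: abs_mult norm_scaleR mult_ac)
      finally show ?thesis using False unfolding R_def norm_mult
        by (intro mult_imp_div_pos_le) simp_all
    qed (simp add: R_def)
    show "R h \<xi> \<le> \<bar>h\<bar> * (\<xi>\<^sup>2 * norm (g \<xi>) / 2)"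
    proof (cases "h = 0")
      case False
      have "norm (g \<xi>) * norm (cis (h * \<xi>) - 1 - \<i> * (h * \<xi>)) \<le> norm (g \<xi>) * ((h * \<xi>)\<^sup>2 / 2)"
        using norm_cis_minus_linear_le(1)[of "h * \<xi>"] by (intro mult_left_mono) auto
      also have "norm (g \<xi>) * ((h * \<xi>)\<^sup>2 / 2) = (\<bar>h\<bar> * (\<xi>\<^sup>2 * norm (g \<xi>) / 2)) * \<bar>h\<bar>"
      proof -
        have "(h * \<xi>)\<^sup>2 = \<bar>h\<bar> * \<bar>h\<bar> * \<xi>\<^sup>2" by (simp add: power2_eq_square)
        then show ?thesis by simp
      qed
      finally show ?thesis using False unfolding R_def norm_mult
        by (intro mult_imp_div_pos_le) simp_all
    qed (simp add: R_def)
  qed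
  have R0: "R h \<xi> \<ge> 0" for h \<xi> by (simp add: R_def)
  have i: "integrable lborel (\<lambda>\<xi>. g \<xi> * (cis (h * \<xi>) - 1 - \<i> * (h * \<xi>)))" for h
  proof -
    have "integrable lborel (\<lambda>\<xi>. g \<xi> * cis (h * \<xi>) - g \<xi> - of_real h * (\<i> * of_real \<xi> * g \<xi>))"
      using integrable_cis_mult[OF g, of h] g g'' by (intro Bochner_Integration.integrable_diff integrable_mult_right)
    moreover have "g \<xi> * cis (h * \<xi>) - g \<xi> - of_real h * (\<i> * of_real \<xi> * g \<xi>) = g \<xi> * (cis (h * \<xi>) - 1 - \<i> * (h * \<xi>))" for \<xi>
      by (simp add: algebra_simps)
    ultimately show ?thesis by (simp only:)
  qed
  have le: "norm (inv_fourier g (x + h) - inv_fourier g x - h *\<^sub>R inv_fourier (\<lambda>\<xi>. \<i> * of_real \<xi> * g \<xi>) x) / norm h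
        \<le> (\<integral>\<xi>. R h \<xi> \<partial>lborel)" for h
  proof -
    note A = integrable_cis_mult[OF g, of "x+h"] and B = integrable_cis_mult[OF g, of x]
      and C = integrable_mult_right[OF integrable_cis_mult[OF g'', of x], of "of_real h"]
    have eq: "inv_fourier g (x + h) - inv_fourier g x - h *\<^sub>R inv_fourier (\<lambda>\<xi>. \<i> * of_real \<xi> * g \<xi>) x
       = (\<integral>\<xi>. g \<xi> * cis ((x + h) * \<xi>) - g \<xi> * cis (x * \<xi>) - of_real h * (\<i> * of_real \<xi> * g \<xi> * cis (x * \<xi>)) \<partial>lborel)"
      unfolding inv_fourier_def scaleR_conv_of_real
      by (simp only: Bochner_Integration.integral_diff[OF Bochner_Integration.integrable_diff[OF A B] C]
          Bochner_Integration.integral_diff[OF A B] integral_mult_right_zero)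
    have "norm (inv_fourier g (x + h) - inv_fourier g x - h *\<^sub>R inv_fourier (\<lambda>\<xi>. \<i> * of_real \<xi> * g \<xi>) x) \<le> (\<integral>\<xi>. norm (g \<xi> * cis ((x + h) * \<xi>) - g \<xi> * cis (x * \<xi>) - of_real h * (\<i> * of_real \<xi> * g \<xi> * cis (x * \<xi>))) \<partial>lborel)"
      unfolding eq by (rule integral_norm_bound)
    also have "\<dots> = (\<integral>\<xi>. norm (g \<xi> * (cis (h * \<xi>) - 1 - \<i> * (h * \<xi>))) \<partial>lborel)"
    proof (rule Bochner_Integration.integral_cong[OF refl])
      fix \<xi>
      have "g \<xi> * cis ((x + h) * \<xi>) - g \<xi> * cis (x * \<xi>) - of_real h * (\<i> * of_real \<xi> * g \<xi> * cis (x * \<xi>))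
          = g \<xi> * (cis (h * \<xi>) - 1 - \<i> * (h * \<xi>)) * cis (x * \<xi>)"
      proof -
        have "cis ((x + h) * \<xi>) = cis (h * \<xi>) * cis (x * \<xi>)" by (simp add: cis_mult algebra_simps)
        moreover have "a * (c * e) - a * e - of_real h * (\<i> * of_real \<xi> * a * e) = a * (c - 1 - \<i> * (h * \<xi>)) * e"
          for a c e :: complex
          by (simp add: algebra_simps)
        ultimately show ?thesis by (simp only:)
      qed
      then show "norm (g \<xi> * cis ((x + h) * \<xi>) - g \<xi> * cis (x * \<xi>) - of_real h * (\<i> * of_real \<xi> * g \<xi> * cis (x * \<xi>)))
        = norm (g \<xi> * (cis (h * \<xi>) - 1 - \<i> * (h * \<xi>)))"
        by (simp only: norm_mult norm_cis mult_1_right)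
    qed
    finally have "norm (inv_fourier g (x + h) - inv_fourier g x - h *\<^sub>R inv_fourier (\<lambda>\<xi>. \<i> * of_real \<xi> * g \<xi>) x)
      \<le> (\<integral>\<xi>. norm (g \<xi> * (cis (h * \<xi>) - 1 - \<i> * (h * \<xi>))) \<partial>lborel)" .
    then show ?thesis unfolding R_def
      by (subst integral_divide_zero) (simp add: divide_right_mono)
  qed
  have "((\<lambda>h. \<integral>\<xi>. R h \<xi> \<partial>lborel) \<longlongrightarrow> 0) (at 0)"
    unfolding tendsto_at_iff_sequentially
  proof (safe, unfold o_def)
    fix X :: "nat \<Rightarrow> real" assume X: "X \<longlonglongrightarrow> 0"
    have "(\<lambda>n. \<integral>\<xi>. R (X n) \<xi> \<partial>lborel) \<longlonglongrightarrow> integral\<^sup>L lborel (\<lambda>\<xi>::real. 0::real)"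
    proof (rule integral_dominated_convergence)
      show "integrable lborel (\<lambda>\<xi>. 2 * norm (\<xi> *\<^sub>R g \<xi>))" using g' by (intro integrable_mult_right integrable_norm)
      show "AE \<xi> in lborel. (\<lambda>n. R (X n) \<xi>) \<longlonglongrightarrow> 0"
      proof (rule AE_I2)
        fix \<xi>
        have "(\<lambda>n. \<bar>X n\<bar> * (\<xi>\<^sup>2 * norm (g \<xi>) / 2)) \<longlonglongrightarrow> \<bar>0\<bar> * (\<xi>\<^sup>2 * norm (g \<xi>) / 2)"
          by (intro tendsto_intros X)
        then have "(\<lambda>n. \<bar>X n\<bar> * (\<xi>\<^sup>2 * norm (g \<xi>) / 2)) \<longlonglongrightarrow> 0" by simp
        then show "(\<lambda>n. R (X n) \<xi>) \<longlonglongrightarrow> 0"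
          by (rule Lim_null_comparison[rotated]) (simp add: R0 R2 del: times_divide_eq_right)
      qed
      show "AE \<xi> in lborel. norm (R (X n) \<xi>) \<le> 2 * norm (\<xi> *\<^sub>R g \<xi>)" for n
        using R1 R0 by (intro AE_I2) auto
    qed auto
    then show "(\<lambda>n. \<integral>\<xi>. R (X n) \<xi> \<partial>lborel) \<longlonglongrightarrow> 0" by simp
  qed
  then have "((\<lambda>h. norm (inv_fourier g (x + h) - inv_fourier g x - h *\<^sub>R inv_fourier (\<lambda>\<xi>. \<i> * of_real \<xi> * g \<xi>) x) / norm h) \<longlongrightarrow> 0) (at 0)"
    by (rule Lim_null_comparison[rotated]) (use le in \<open>auto intro!: always_eventually\<close>)
  then show ?thesis
    unfolding has_vector_derivative_def has_derivative_at using bounded_linear_scaleR_left by blast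
qed

text \<open>Fubini: the kernel cis (x xi) is symmetric in its two variables, so the transform passes
  from one factor to the other.\<close>

lemma inv_fourier_multiplication:
  fixes k g :: "real \<Rightarrow> complex"
  assumes k: "integrable lborel k" and g: "integrable lborel g"
  shows "(\<integral>x. k x * inv_fourier g x \<partial>lborel) = (\<integral>\<xi>. g \<xi> * inv_fourier k \<xi> \<partial>lborel)"
proof -
  have [measurable]: "k \<in> borel_measurable borel" "g \<in> borel_measurable borel" using k g by auto
  have "integrable (lborel \<Otimes>\<^sub>M lborel) (\<lambda>(\<xi>, x). g \<xi> * k x * cis (x * \<xi>))"
  proof (rule lborel_pair.Fubini_integrable)
    show "integrable lborel (\<lambda>\<xi>. \<integral>x. norm (case (\<xi>, x) of (\<xi>, x) \<Rightarrow> g \<xi> * k x * cis (x * \<xi>)) \<partial>lborel)"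
      using g by (simp add: norm_mult)
    show "AE \<xi> in lborel. integrable lborel (\<lambda>x. case (\<xi>, x) of (\<xi>, x) \<Rightarrow> g \<xi> * k x * cis (x * \<xi>))"
    proof (rule AE_I2)
      fix \<xi>
      have "integrable lborel (\<lambda>x. g \<xi> * (k x * cis (\<xi> * x)))"
        by (intro integrable_mult_right integrable_cis_mult k)
      then show "integrable lborel (\<lambda>x. case (\<xi>, x) of (\<xi>, x) \<Rightarrow> g \<xi> * k x * cis (x * \<xi>))"
        by (simp add: mult_ac)
    qed
  qed measurable
  from lborel_pair.Fubini_integral[OF this]
  have "(\<integral>x. (\<integral>\<xi>. g \<xi> * k x * cis (x * \<xi>) \<partial>lborel) \<partial>lborel) = (\<integral>\<xi>. (\<integral>x. g \<xi> * k x * cis (x * \<xi>) \<partial>lborel) \<partial>lborel)" .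
  moreover have "(\<integral>\<xi>. g \<xi> * k x * cis (x * \<xi>) \<partial>lborel) = k x * inv_fourier g x" for x
  proof -
    have "(\<integral>\<xi>. g \<xi> * k x * cis (x * \<xi>) \<partial>lborel) = (\<integral>\<xi>. k x * (g \<xi> * cis (x * \<xi>)) \<partial>lborel)"
      by (intro Bochner_Integration.integral_cong) (auto simp: mult_ac)
    then show ?thesis by (simp add: inv_fourier_def)
  qed
  moreover have "(\<integral>x. g \<xi> * k x * cis (x * \<xi>) \<partial>lborel) = g \<xi> * inv_fourier k \<xi>" for \<xi>
  proof -
    have "(\<integral>x. g \<xi> * k x * cis (x * \<xi>) \<partial>lborel) = (\<integral>x. g \<xi> * (k x * cis (\<xi> * x)) \<partial>lborel)"
      by (intro Bochner_Integration.integral_cong) (auto simp: mult_ac)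
    then show ?thesis by (simp add: inv_fourier_def)
  qed
  ultimately show ?thesis by simp
qed

lemma inv_fourier_normal_density:
  assumes "e > 0"
  shows "integrable lborel (\<lambda>x. complex_of_real (normal_density 0 e x))"
    "inv_fourier (\<lambda>x. complex_of_real (normal_density 0 e x)) t = of_real (exp (- (e * t)\<^sup>2 / 2))"
  using assms integrable_of_real[OF integrable_normal_density[OF assms, of 0]]
    has_bochner_integral_cis_normal_density[OF assms, of t 0]
  by (auto simp: inv_fourier_def has_bochner_integral_iff mult.commute)

lemma inv_fourier_measurable [measurable]:
  assumes "integrable lborel g"
  shows "inv_fourier g \<in> borel_measurable borel"
  using uniformly_continuous_inv_fourier[OF assms]
  by (intro borel_measurable_continuous_onI uniformly_continuous_imp_continuous)

lemma exp_eq_normal_density: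
  assumes "e > 0"
  shows "exp (- ((1 / e) * t)\<^sup>2 / 2) = sqrt (2 * pi) * e * normal_density 0 e t"
  using assms by (simp add: normal_density_def real_sqrt_mult power_divide)

text \<open>The upper half of Plancherel's identity, obtained by inserting the convergence factor
  \<open>exp (- e\<^sup>2 x\<^sup>2 / 2)\<close> and letting \<open>e\<close> tend to \<open>0\<close>.\<close>

lemma nn_integral_inv_fourier_gaussian_le:
  assumes g: "integrable lborel g" and e: "e > 0"
  shows "(\<integral>\<^sup>+x. ennreal ((norm (inv_fourier g x))\<^sup>2 * exp (- (e * x)\<^sup>2 / 2)) \<partial>lborel)
       \<le> ennreal (2 * pi) * (\<integral>\<^sup>+\<xi>. ennreal ((norm (g \<xi>))\<^sup>2) \<partial>lborel)"
proof -
  have [measurable]: "g \<in> borel_measurable borel" using g by auto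
  \<comment> \<open>The convergence factor, up to a constant, as a probability density of width 1 /
    e.\<close>
  define K where "K = normal_density 0 (1 / e)"
  have e': "1 / e > 0" using e by simp
  have Kexp: "exp (- (e * x)\<^sup>2 / 2) = sqrt (2 * pi) / e * K x" for x
    using exp_eq_normal_density[OF e', of x] by (simp add: K_def)
  have K0: "K x \<ge> 0" for x by (simp add: K_def)
  have [measurable]: "K \<in> borel_measurable borel" unfolding K_def by measurable
  have Ki: "integrable lborel K" unfolding K_def using e by simp
  define h where "h = inv_fourier g"
  have [measurable]: "h \<in> borel_measurable borel" unfolding h_def by (rule inv_fourier_measurable[OF g])
  define B where "B = (\<integral>\<xi>. norm (g \<xi>) \<partial>lborel)"
  have hB: "norm (h x) \<le> B" for x unfolding h_def B_def by (rule norm_inv_fourier_le[OF g])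
  have int_bd: "integrable lborel (\<lambda>x. f x * complex_of_real (K x))"
    if "f \<in> borel_measurable borel" "\<And>x. norm (f x) \<le> C" for f C
  proof (rule Bochner_Integration.integrable_bound)
    show "integrable lborel (\<lambda>x. C * K x)" using Ki by simp
    have "norm (f x * complex_of_real (K x)) \<le> norm (C * K x)" for x
      using mult_right_mono[OF that(2) K0, of x x] K0[of x] by (simp add: norm_mult)
    then show "AE x in lborel. norm (f x * complex_of_real (K x)) \<le> norm (C * K x)" by simp
  qed (use that(1) in measurable)
  define k where "k = (\<lambda>x. cnj (h x) * complex_of_real (K x))"
  have [measurable]: "cnj \<in> borel_measurable borel"
    by (intro borel_measurable_continuous_onI continuous_intros)
  have k: "integrable lborel k" unfolding k_def by (rule int_bd[where C = B]) (auto simp: hB)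
  \<comment> \<open>The transform of \<open>K\<close> is again a Gaussian, now of width e, so the
    transform of \<open>k\<close> is the conjugate of g smeared out by that Gaussian.\<close>
  have ik: "cnj (inv_fourier k \<xi>) = (\<integral>\<eta>. g \<eta> * of_real (exp (- ((1 / e) * (\<eta> - \<xi>))\<^sup>2 / 2)) \<partial>lborel)" for \<xi>
  proof -
    define c where "c = (\<lambda>x. cis ((- \<xi>) * x) * complex_of_real (K x))"
    have c: "integrable lborel c" unfolding c_def by (rule int_bd[where C = 1]) auto
    have "cnj (inv_fourier k \<xi>) = (\<integral>x. cnj (k x * cis (\<xi> * x)) \<partial>lborel)"
      unfolding inv_fourier_def by (rule Bochner_Integration.integral_cnj[symmetric])
    also have "\<dots> = (\<integral>x. c x * inv_fourier g x \<partial>lborel)"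
      by (intro Bochner_Integration.integral_cong) (auto simp: k_def c_def h_def cis_cnj mult_ac)
    also have "\<dots> = (\<integral>\<eta>. g \<eta> * inv_fourier c \<eta> \<partial>lborel)"
      by (rule inv_fourier_multiplication[OF c g])
    also have "\<dots> = (\<integral>\<eta>. g \<eta> * of_real (exp (- ((1 / e) * (\<eta> - \<xi>))\<^sup>2 / 2)) \<partial>lborel)"
    proof (rule Bochner_Integration.integral_cong[OF refl])
      fix \<eta>
      have "inv_fourier c \<eta> = inv_fourier (\<lambda>x. complex_of_real (normal_density 0 (1 / e) x)) (\<eta> - \<xi>)"
        unfolding inv_fourier_def c_def K_def
        by (intro Bochner_Integration.integral_cong) (auto simp: cis_mult algebra_simps)
      then show "g \<eta> * inv_fourier c \<eta> = g \<eta> * of_real (exp (- ((1 / e) * (\<eta> - \<xi>))\<^sup>2 / 2))"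
        by (simp only: inv_fourier_normal_density(2)[OF e'])
    qed
    finally show ?thesis .
  qed
  define N where "N = (\<lambda>\<xi> \<eta>. normal_density 0 e (\<eta> - \<xi>))"
  have N0: "N \<xi> \<eta> \<ge> 0" for \<xi> \<eta> by (simp add: N_def)
  have N_sym: "N \<xi> \<eta> = N \<eta> \<xi>" for \<xi> \<eta>
    by (simp add: N_def normal_density_def power2_commute)
  have [measurable]: "case_prod N \<in> borel_measurable (borel \<Otimes>\<^sub>M borel)" unfolding N_def by measurable
  have N1: "(\<integral>\<^sup>+\<eta>. ennreal (N \<xi> \<eta>) \<partial>lborel) = 1" for \<xi>
  proof -
    have "(\<integral>\<^sup>+\<eta>. ennreal (normal_density 0 e (-\<xi> + 1 * \<eta>)) \<partial>lborel) = (\<integral>\<^sup>+\<eta>. ennreal (normal_density 0 e \<eta>) \<partial>lborel)"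
      using nn_integral_real_affine[of "\<lambda>\<eta>. ennreal (normal_density 0 e \<eta>)" 1 "-\<xi>"] by simp
    also have "\<dots> = ennreal 1"
      using e by (subst nn_integral_eq_integral) auto
    finally show ?thesis by (simp add: N_def)
  qed
  have bound: "ennreal (norm (inv_fourier k \<xi>)) \<le> ennreal (sqrt (2 * pi) * e) * (\<integral>\<^sup>+\<eta>. ennreal (norm (g \<eta>) * N \<xi> \<eta>) \<partial>lborel)" for \<xi>
  proof -
    have "norm (inv_fourier k \<xi>) = norm (\<integral>\<eta>. g \<eta> * of_real (exp (- ((1 / e) * (\<eta> - \<xi>))\<^sup>2 / 2)) \<partial>lborel)"
      by (metis ik complex_mod_cnj)
    moreover have "ennreal (norm (\<integral>\<eta>. g \<eta> * of_real (exp (- ((1 / e) * (\<eta> - \<xi>))\<^sup>2 / 2)) \<partial>lborel))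
       \<le> (\<integral>\<^sup>+\<eta>. ennreal (norm (g \<eta> * of_real (exp (- ((1 / e) * (\<eta> - \<xi>))\<^sup>2 / 2)))) \<partial>lborel)"
      by (rule integral_norm_bound_ennreal) (auto intro!: Bochner_Integration.integrable_bound[OF g] simp: norm_mult mult_left_le)
    moreover have "(\<integral>\<^sup>+\<eta>. ennreal (norm (g \<eta> * of_real (exp (- ((1 / e) * (\<eta> - \<xi>))\<^sup>2 / 2)))) \<partial>lborel)
       = (\<integral>\<^sup>+\<eta>. ennreal (sqrt (2 * pi) * e) * ennreal (norm (g \<eta>) * N \<xi> \<eta>) \<partial>lborel)"
    proof (rule nn_integral_cong)
      fix \<eta>
      have "norm (g \<eta> * of_real (exp (- ((1 / e) * (\<eta> - \<xi>))\<^sup>2 / 2))) = (sqrt (2 * pi) * e) * (norm (g \<eta>) * N \<xi> \<eta>)"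
        unfolding norm_mult norm_of_real exp_eq_normal_density[OF e] N_def using e by (simp add: abs_mult)
      then show "ennreal (norm (g \<eta> * of_real (exp (- ((1 / e) * (\<eta> - \<xi>))\<^sup>2 / 2)))) = ennreal (sqrt (2 * pi) * e) * ennreal (norm (g \<eta>) * N \<xi> \<eta>)"
        using e N0 by (simp only:) (subst ennreal_mult[symmetric]; simp)
    qed
    ultimately show ?thesis by (simp add: nn_integral_cmult)
  qed
  have "(\<integral>\<^sup>+x. ennreal ((norm (h x))\<^sup>2 * K x) \<partial>lborel) = ennreal (norm (\<integral>x. k x * h x \<partial>lborel))"
  proof -
    have i: "integrable lborel (\<lambda>x. (norm (h x))\<^sup>2 * K x)"
    proof -
      have "norm ((h x)\<^sup>2) \<le> B\<^sup>2" for x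
        using hB by (simp add: norm_power power_mono)
      then have "integrable lborel (\<lambda>x. (h x)\<^sup>2 * complex_of_real (K x))"
        by (intro int_bd[where C = "B\<^sup>2"]) auto
      from integrable_norm[OF this] show ?thesis by (simp add: norm_mult norm_power K0)
    qed
    have "(\<integral>x. k x * h x \<partial>lborel) = (\<integral>x. of_real ((norm (h x))\<^sup>2 * K x) \<partial>lborel)"
      by (intro Bochner_Integration.integral_cong)
        (auto simp: k_def complex_norm_square[symmetric] mult_ac simp flip: of_real_power)
    also have "\<dots> = of_real (\<integral>x. (norm (h x))\<^sup>2 * K x \<partial>lborel)"
      by (rule integral_complex_of_real)
    finally have "norm (\<integral>x. k x * h x \<partial>lborel) = (\<integral>x. (norm (h x))\<^sup>2 * K x \<partial>lborel)"
      using K0 by simp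
    then show ?thesis using i K0 by (simp add: nn_integral_eq_integral)
  qed
  \<comment> \<open>The multiplication formula moves the transform from g onto \<open>k\<close>,
    where its explicit form is known.\<close>
  also have "(\<integral>x. k x * h x \<partial>lborel) = (\<integral>\<xi>. g \<xi> * inv_fourier k \<xi> \<partial>lborel)"
    unfolding h_def by (rule inv_fourier_multiplication[OF k g])
  also have "ennreal (norm (\<integral>\<xi>. g \<xi> * inv_fourier k \<xi> \<partial>lborel)) \<le> (\<integral>\<^sup>+\<xi>. ennreal (norm (g \<xi> * inv_fourier k \<xi>)) \<partial>lborel)"
  proof (rule integral_norm_bound_ennreal)
    have [measurable]: "inv_fourier k \<in> borel_measurable borel" by (rule inv_fourier_measurable[OF k])
    show "integrable lborel (\<lambda>\<xi>. g \<xi> * inv_fourier k \<xi>)"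
    proof (rule Bochner_Integration.integrable_bound)
      show "integrable lborel (\<lambda>\<xi>. norm (g \<xi>) * (\<integral>x. norm (k x) \<partial>lborel))" using g by simp
      show "AE \<xi> in lborel. norm (g \<xi> * inv_fourier k \<xi>) \<le> norm (norm (g \<xi>) * (\<integral>x. norm (k x) \<partial>lborel))"
        by (intro AE_I2) (simp add: norm_mult mult_left_mono norm_inv_fourier_le[OF k])
    qed measurable
  qed
  also have "\<dots> \<le> (\<integral>\<^sup>+\<xi>. ennreal (norm (g \<xi>)) * (ennreal (sqrt (2 * pi) * e) * (\<integral>\<^sup>+\<eta>. ennreal (norm (g \<eta>) * N \<xi> \<eta>) \<partial>lborel)) \<partial>lborel)"
    by (intro nn_integral_mono) (auto simp: norm_mult ennreal_mult intro!: mult_left_mono bound)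
  also have "\<dots> = (\<integral>\<^sup>+\<xi>. (ennreal (sqrt (2 * pi) * e) * (\<integral>\<^sup>+\<eta>. ennreal (norm (g \<xi>)) * ennreal (norm (g \<eta>) * N \<xi> \<eta>) \<partial>lborel)) \<partial>lborel)"
    by (intro nn_integral_cong) (simp add: nn_integral_cmult mult_ac)
  \<comment> \<open>2 |g(xi)| |g(eta)| is at most the sum of the squares; in each of the two
    resulting terms the normal density integrates to 1 over the other variable.\<close>
  also have "\<dots> \<le> (\<integral>\<^sup>+\<xi>. (ennreal (sqrt (2 * pi) * e) * (\<integral>\<^sup>+\<eta>. (ennreal ((norm (g \<xi>))\<^sup>2 / 2) * ennreal (N \<xi> \<eta>) + ennreal ((norm (g \<eta>))\<^sup>2 / 2) * ennreal (N \<xi> \<eta>)) \<partial>lborel)) \<partial>lborel)"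
  proof (intro nn_integral_mono mult_left_mono)
    fix \<xi> \<eta>
    have "norm (g \<xi>) * (norm (g \<eta>) * N \<xi> \<eta>) \<le> ((norm (g \<xi>))\<^sup>2 / 2 + (norm (g \<eta>))\<^sup>2 / 2) * N \<xi> \<eta>"
      using mult_right_mono[OF sum_squares_bound[of "norm (g \<xi>)" "norm (g \<eta>)"] N0[of \<xi> \<eta>]]
      by (simp add: algebra_simps)
    then show "ennreal (norm (g \<xi>)) * ennreal (norm (g \<eta>) * N \<xi> \<eta>) \<le> ennreal ((norm (g \<xi>))\<^sup>2 / 2) * ennreal (N \<xi> \<eta>) + ennreal ((norm (g \<eta>))\<^sup>2 / 2) * ennreal (N \<xi> \<eta>)"
      using N0[of \<xi> \<eta>]
      by (simp add: ennreal_mult[symmetric] ennreal_plus[symmetric] distrib_right ennreal_leI del: ennreal_plus)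
  qed auto
  also have "\<dots> = ennreal (sqrt (2 * pi) * e) * (\<integral>\<^sup>+\<xi>. ennreal ((norm (g \<xi>))\<^sup>2) \<partial>lborel)"
  proof -
    have 1: "(\<integral>\<^sup>+\<xi>. (\<integral>\<^sup>+\<eta>. ennreal ((norm (g \<xi>))\<^sup>2 / 2) * ennreal (N \<xi> \<eta>) \<partial>lborel) \<partial>lborel) = (\<integral>\<^sup>+\<xi>. ennreal ((norm (g \<xi>))\<^sup>2 / 2) \<partial>lborel)"
      by (intro nn_integral_cong) (simp add: nn_integral_cmult N1)
    have "(\<integral>\<^sup>+\<xi>. (\<integral>\<^sup>+\<eta>. ennreal ((norm (g \<eta>))\<^sup>2 / 2) * ennreal (N \<xi> \<eta>) \<partial>lborel) \<partial>lborel)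
        = (\<integral>\<^sup>+\<eta>. (\<integral>\<^sup>+\<xi>. ennreal ((norm (g \<eta>))\<^sup>2 / 2) * ennreal (N \<xi> \<eta>) \<partial>lborel) \<partial>lborel)"
      by (rule lborel_pair.Fubini'[symmetric]) measurable
    also have "\<dots> = (\<integral>\<^sup>+\<eta>. ennreal ((norm (g \<eta>))\<^sup>2 / 2) \<partial>lborel)"
      by (intro nn_integral_cong) (simp add: nn_integral_cmult N_sym[of _ "_::real"] N1)
    finally have 2: "(\<integral>\<^sup>+\<xi>. (\<integral>\<^sup>+\<eta>. ennreal ((norm (g \<eta>))\<^sup>2 / 2) * ennreal (N \<xi> \<eta>) \<partial>lborel) \<partial>lborel) = (\<integral>\<^sup>+\<eta>. ennreal ((norm (g \<eta>))\<^sup>2 / 2) \<partial>lborel)" .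
    have "(\<integral>\<^sup>+\<xi>. ennreal ((norm (g \<xi>))\<^sup>2 / 2) \<partial>lborel) + (\<integral>\<^sup>+\<eta>. ennreal ((norm (g \<eta>))\<^sup>2 / 2) \<partial>lborel) = (\<integral>\<^sup>+\<xi>. ennreal ((norm (g \<xi>))\<^sup>2) \<partial>lborel)"
      by (subst nn_integral_add[symmetric]) (auto simp: ennreal_plus[symmetric] simp del: ennreal_plus)
    moreover have "(\<integral>\<^sup>+\<xi>. (ennreal (sqrt (2 * pi) * e) * (\<integral>\<^sup>+\<eta>. (ennreal ((norm (g \<xi>))\<^sup>2 / 2) * ennreal (N \<xi> \<eta>) + ennreal ((norm (g \<eta>))\<^sup>2 / 2) * ennreal (N \<xi> \<eta>)) \<partial>lborel)) \<partial>lborel)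
        = (\<integral>\<^sup>+\<xi>. (ennreal (sqrt (2 * pi) * e) * ((\<integral>\<^sup>+\<eta>. ennreal ((norm (g \<xi>))\<^sup>2 / 2) * ennreal (N \<xi> \<eta>) \<partial>lborel) + (\<integral>\<^sup>+\<eta>. ennreal ((norm (g \<eta>))\<^sup>2 / 2) * ennreal (N \<xi> \<eta>) \<partial>lborel))) \<partial>lborel)"
      by (intro nn_integral_cong) (subst nn_integral_add; measurable)
    moreover have "\<dots> = ennreal (sqrt (2 * pi) * e) * ((\<integral>\<^sup>+\<xi>. (\<integral>\<^sup>+\<eta>. ennreal ((norm (g \<xi>))\<^sup>2 / 2) * ennreal (N \<xi> \<eta>) \<partial>lborel) \<partial>lborel) + (\<integral>\<^sup>+\<xi>. (\<integral>\<^sup>+\<eta>. ennreal ((norm (g \<eta>))\<^sup>2 / 2) * ennreal (N \<xi> \<eta>) \<partial>lborel) \<partial>lborel))"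
      by (subst nn_integral_cmult; (subst nn_integral_add)?; measurable)
    ultimately show ?thesis
      by (simp only: 1 2)
  qed
  finally have main: "(\<integral>\<^sup>+x. ennreal ((norm (h x))\<^sup>2 * K x) \<partial>lborel) \<le> ennreal (sqrt (2 * pi) * e) * (\<integral>\<^sup>+\<xi>. ennreal ((norm (g \<xi>))\<^sup>2) \<partial>lborel)" .
  have "(\<integral>\<^sup>+x. ennreal ((norm (h x))\<^sup>2 * exp (- (e * x)\<^sup>2 / 2)) \<partial>lborel) = (\<integral>\<^sup>+x. ennreal (sqrt (2 * pi) / e) * ennreal ((norm (h x))\<^sup>2 * K x) \<partial>lborel)"
    unfolding Kexp using e K0 by (intro nn_integral_cong) (subst ennreal_mult[symmetric], auto simp: mult_ac)
  also have "\<dots> = ennreal (sqrt (2 * pi) / e) * (\<integral>\<^sup>+x. ennreal ((norm (h x))\<^sup>2 * K x) \<partial>lborel)"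
    by (rule nn_integral_cmult) measurable
  also have "\<dots> \<le> ennreal (sqrt (2 * pi) / e) * (ennreal (sqrt (2 * pi) * e) * (\<integral>\<^sup>+\<xi>. ennreal ((norm (g \<xi>))\<^sup>2) \<partial>lborel))"
    by (intro mult_left_mono main) simp
  also have "ennreal (sqrt (2 * pi) / e) * (ennreal (sqrt (2 * pi) * e) * (\<integral>\<^sup>+\<xi>. ennreal ((norm (g \<xi>))\<^sup>2) \<partial>lborel))
      = ennreal (2 * pi) * (\<integral>\<^sup>+\<xi>. ennreal ((norm (g \<xi>))\<^sup>2) \<partial>lborel)"
  proof -
    have "ennreal (sqrt (2 * pi) / e) * ennreal (sqrt (2 * pi) * e) = ennreal (2 * pi)"
      using e by (subst ennreal_mult[symmetric]) auto
    then show ?thesis by (simp only: mult.assoc[symmetric])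
  qed
  finally show ?thesis unfolding h_def .
qed

text \<open>Fatou's lemma along e = 1 / (n + 1): the Gaussian factor tends to 1 while the bound does
  not depend on e.\<close>

lemma in_Lp_2_inv_fourier:
  assumes g: "integrable lborel g" and g2: "in_Lp 2 g"
  shows "in_Lp 2 (inv_fourier g)"
proof -
  have [measurable]: "inv_fourier g \<in> borel_measurable borel" by (rule inv_fourier_measurable[OF g])
  have "(\<integral>\<^sup>+x. ennreal ((norm (inv_fourier g x))\<^sup>2) \<partial>lborel)
      = (\<integral>\<^sup>+x. liminf (\<lambda>n. ennreal ((norm (inv_fourier g x))\<^sup>2 * exp (- (1 / real (Suc n) * x)\<^sup>2 / 2))) \<partial>lborel)"
  proof (rule nn_integral_cong)
    fix x
    have "(\<lambda>n. ennreal ((norm (inv_fourier g x))\<^sup>2 * exp (- (1 / real (Suc n) * x)\<^sup>2 / 2))) \<longlonglongrightarrow> ennreal ((norm (inv_fourier g x))\<^sup>2 * exp (- (0 * x)\<^sup>2 / 2))"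
      by (intro tendsto_intros LIMSEQ_Suc[OF lim_1_over_n]) auto
    then show "ennreal ((norm (inv_fourier g x))\<^sup>2) = liminf (\<lambda>n. ennreal ((norm (inv_fourier g x))\<^sup>2 * exp (- (1 / real (Suc n) * x)\<^sup>2 / 2)))"
      by (subst lim_imp_Liminf) auto
  qed
  also have "\<dots> \<le> liminf (\<lambda>n. \<integral>\<^sup>+x. ennreal ((norm (inv_fourier g x))\<^sup>2 * exp (- (1 / real (Suc n) * x)\<^sup>2 / 2)) \<partial>lborel)"
    by (rule nn_integral_liminf) measurable
  also have "\<dots> \<le> liminf (\<lambda>n. ennreal (2 * pi) * (\<integral>\<^sup>+\<xi>. ennreal ((norm (g \<xi>))\<^sup>2) \<partial>lborel))"
    by (intro Liminf_mono always_eventually allI nn_integral_inv_fourier_gaussian_le g) simp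
  also have "\<dots> = ennreal (2 * pi) * (\<integral>\<^sup>+\<xi>. ennreal ((norm (g \<xi>))\<^sup>2) \<partial>lborel)"
    by (simp add: Liminf_const)
  also have "\<dots> < \<infinity>"
    using g2 by (auto simp: in_Lp_2_iff ennreal_mult_less_top)
  finally show ?thesis by (simp add: in_Lp_2_iff)
qed

section \<open>Schwartz test functions, pairings and weak derivatives\<close>

lemma integrable_inverse_1_plus_square: "integrable lborel (\<lambda>x::real. C / (1 + x\<^sup>2))"
proof -
  have "integrable lborel (\<lambda>x::real. C * (1 + x\<^sup>2) powr (- 1))"
    by (intro integrable_mult_right integrable_Sobolev_weight) auto
  moreover have "(1 + x\<^sup>2) powr (- 1) = 1 / (1 + x\<^sup>2)" for x :: real
    using powr_minus_divide[of "1 + x\<^sup>2" 1] by (simp add: add_nonneg_eq_0_iff)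
  ultimately show ?thesis by simp
qed

lemma schwartz_bound:
  assumes "schwartz \<psi>"
  obtains C where "C > 0" "\<And>x. norm (\<psi> x) \<le> C / (1 + x\<^sup>2)"
proof -
  from assms obtain D where D0: "D 0 = \<psi>" and "\<forall>n x. (D n has_vector_derivative D (Suc n) x) (at x)"
    and D: "\<forall>k n. bounded (range (\<lambda>x. x ^ k *\<^sub>R D n x))"
    unfolding schwartz_def by (elim exE conjE)
  have "bounded (range (\<lambda>x. x ^ 0 *\<^sub>R \<psi> x))" "bounded (range (\<lambda>x. x ^ 2 *\<^sub>R \<psi> x))"
    using D[rule_format, of 0 0] D[rule_format, of 2 0] unfolding D0 by simp_all
  from bounded_plus_comp[OF this] have "bounded (range (\<lambda>x. x ^ 0 *\<^sub>R \<psi> x + x ^ 2 *\<^sub>R \<psi> x))" .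
  then obtain C where C: "norm (x ^ 0 *\<^sub>R \<psi> x + x ^ 2 *\<^sub>R \<psi> x) \<le> C" for x
    unfolding bounded_iff by blast
  have "norm (\<psi> x) \<le> (\<bar>C\<bar> + 1) / (1 + x\<^sup>2)" for x
  proof -
    have "x ^ 0 *\<^sub>R \<psi> x + x ^ 2 *\<^sub>R \<psi> x = (1 + x\<^sup>2) *\<^sub>R \<psi> x" by (simp add: algebra_simps)
    then have "(1 + x\<^sup>2) * norm (\<psi> x) \<le> C"
      using C[of x] by (simp only: norm_scaleR) (simp add: abs_of_nonneg)
    moreover have "0 < 1 + x\<^sup>2" by (simp add: add_pos_nonneg)
    ultimately show ?thesis by (simp add: pos_le_divide_eq mult.commute)
  qed
  then show ?thesis by (intro that[of "\<bar>C\<bar> + 1"]) auto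
qed

lemma schwartz_deriv:
  assumes "schwartz \<psi>"
  shows "(\<psi> has_vector_derivative x_deriv \<psi> x) (at x)" "schwartz (x_deriv \<psi>)"
proof -
  from assms obtain D where D0: "D 0 = \<psi>" and D1': "\<forall>n x. (D n has_vector_derivative D (Suc n) x) (at x)"
    and D2': "\<forall>k n. bounded (range (\<lambda>x. x ^ k *\<^sub>R D n x))"
    unfolding schwartz_def by (elim exE conjE)
  note D1 = D1'[rule_format] and D2 = D2'[rule_format]
  have eq: "x_deriv \<psi> x = D 1 x" for x
    using D1[of 0 x] D0 by (simp add: vector_derivative_at)
  show "(\<psi> has_vector_derivative x_deriv \<psi> x) (at x)" using D1[of 0 x] D0 by (simp add: eq)
  show "schwartz (x_deriv \<psi>)" unfolding schwartz_def
  proof (intro exI[of _ "\<lambda>n. D (Suc n)"] conjI allI)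
    show "D (Suc 0) = x_deriv \<psi>" by (simp add: eq fun_eq_iff)
  qed (rule D1 D2)+
qed

lemma schwartz_continuous:
  assumes "schwartz \<psi>"
  shows "continuous_on A \<psi>"
  using schwartz_deriv(1)[OF assms]
  by (intro continuous_at_imp_continuous_on ballI has_vector_derivative_continuous)

lemma schwartz_measurable [measurable]:
  assumes "schwartz \<psi>"
  shows "\<psi> \<in> borel_measurable borel"
  by (intro borel_measurable_continuous_onI schwartz_continuous assms)

lemma integrable_bounded_mult_schwartz:
  fixes f :: "real \<Rightarrow> complex"
  assumes \<psi>: "schwartz \<psi>" and f[measurable]: "f \<in> borel_measurable borel" and B: "\<And>x. norm (f x) \<le> B"
  shows "integrable lborel (\<lambda>x. f x * \<psi> x)"
proof -
  obtain C where C: "C > 0" "\<And>x. norm (\<psi> x) \<le> C / (1 + x\<^sup>2)" using schwartz_bound[OF \<psi>] by metis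
  have [measurable]: "\<psi> \<in> borel_measurable borel" by (rule schwartz_measurable[OF \<psi>])
  have B0: "0 \<le> B" using order_trans[OF norm_ge_zero B] .
  show ?thesis
  proof (rule Bochner_Integration.integrable_bound)
    show "integrable lborel (\<lambda>x. B * (C / (1 + x\<^sup>2)))"
      by (intro integrable_mult_right integrable_inverse_1_plus_square)
    have "norm (f x * \<psi> x) \<le> norm (B * (C / (1 + x\<^sup>2)))" for x
    proof -
      have "norm (f x) * norm (\<psi> x) \<le> B * (C / (1 + x\<^sup>2))"
        by (intro mult_mono B C B0) auto
      then show ?thesis
        unfolding norm_mult[of "f x"] real_norm_def by (rule order_trans[OF _ abs_ge_self])
    qed
    then show "AE x in lborel. norm (f x * \<psi> x) \<le> norm (B * (C / (1 + x\<^sup>2)))" by simp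
  qed measurable
qed

lemma integrable_schwartz:
  assumes "schwartz \<psi>"
  shows "integrable lborel \<psi>"
  using integrable_bounded_mult_schwartz[OF assms, of "\<lambda>_. 1" 1] by simp

lemma in_Lp_2_schwartz:
  assumes \<psi>: "schwartz \<psi>"
  shows "in_Lp 2 \<psi>"
proof (rule in_Lp_2_I)
  obtain C where C: "C > 0" "\<And>x. norm (\<psi> x) \<le> C / (1 + x\<^sup>2)" using schwartz_bound[OF \<psi>] by metis
  show "\<psi> \<in> borel_measurable borel" by (rule schwartz_measurable[OF \<psi>])
  have "norm (\<psi> x) \<le> C" for x
  proof -
    have "C / (1 + x\<^sup>2) \<le> C / 1" using C(1) by (intro divide_left_mono) (auto simp: add_pos_nonneg)
    then show ?thesis using C(2)[of x] by simp
  qed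
  then have "integrable lborel (\<lambda>x. norm (\<psi> x * \<psi> x))"
    by (intro integrable_norm integrable_bounded_mult_schwartz[OF \<psi>] schwartz_measurable[OF \<psi>])
  then show "integrable lborel (\<lambda>x. (norm (\<psi> x))\<^sup>2)" by (simp add: norm_mult power2_eq_square)
qed

lemma in_Lp_2_of_real:
  "in_Lp 2 f \<Longrightarrow> in_Lp 2 (\<lambda>x. complex_of_real (f x))"
  unfolding in_Lp_2_iff by (auto intro: measurable_compose[OF _ borel_measurable_of_real])

lemma integrable_pairing:
  assumes "in_Lp 2 f" "schwartz \<psi>"
  shows "integrable lborel (\<lambda>x. complex_of_real (f x) * \<psi> x)"
  by (intro integrable_mult_L2 in_Lp_2_of_real in_Lp_2_schwartz assms)

lemma pairing_diff:
  assumes "in_Lp 2 f" "in_Lp 2 g" "schwartz \<psi>"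
  shows "pairing (\<lambda>x. f x - g x) \<psi> = pairing f \<psi> - pairing g \<psi>"
  using integrable_pairing[OF assms(1,3)] integrable_pairing[OF assms(2,3)]
  by (simp add: pairing_def left_diff_distrib)

lemma pairing_cong_AE:
  assumes "f \<in> borel_measurable borel" "g \<in> borel_measurable borel" "\<psi> \<in> borel_measurable borel"
    "AE x in lborel. f x = g x"
  shows "pairing f \<psi> = pairing g \<psi>"
  unfolding pairing_def
proof (rule integral_cong_AE)
  show "AE x in lborel. complex_of_real (f x) * \<psi> x = complex_of_real (g x) * \<psi> x"
    using assms(4) by eventually_elim simp
qed (use assms in measurable)

text \<open>By hypothesis the product of f with a nowhere vanishing Gaussian has zero Fourier
  transform. The three alternatives are different ways to guarantee that this product is
  integrable.\<close>

lemma L2_eq_0_if_modulated_gaussian: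
  fixes f :: "real \<Rightarrow> complex"
  assumes f: "in_Lp 2 f \<or> (f \<in> borel_measurable borel \<and> (\<exists>B. \<forall>x. norm (f x) \<le> B)) \<or> integrable lborel (\<lambda>x. f x * of_real (exp (- x\<^sup>2 / 2)))"
    and 0: "\<And>r. (\<integral>y. f y * (cis (r * y) * of_real (exp (- y\<^sup>2 / 2))) \<partial>lborel) = 0"
  shows "AE x in lborel. f x = 0"
proof -
  have s: "schwartz (\<lambda>y. of_real (exp (- y\<^sup>2 / 2)))"
    using schwartz_modulated_gaussian[of 0] by simp
  have "integrable lborel (\<lambda>y. f y * of_real (exp (- y\<^sup>2 / 2)))"
    using f integrable_mult_L2[OF _ in_Lp_2_schwartz[OF s], of f] integrable_bounded_mult_schwartz[OF s, of f]
    by blast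
  then have "AE y in lborel. f y * of_real (exp (- y\<^sup>2 / 2)) = 0"
    by (rule fourier_eq_0_imp_AE_eq_0) (use 0 in \<open>simp add: mult_ac\<close>)
  then show ?thesis by eventually_elim simp
qed

text \<open>Makes the choice operator in \<open>weak_deriv\<close> harmless, the chosen function
  being determined up to a null set.\<close>

lemma has_weak_deriv_unique:
  assumes "has_weak_deriv f g" "has_weak_deriv f h"
  shows "AE x in lborel. g x = h x"
proof -
  have g: "in_Lp 2 g" and h: "in_Lp 2 h" using assms by (auto simp: has_weak_deriv_def)
  have "AE x in lborel. complex_of_real (g x) - complex_of_real (h x) = 0"
  proof (rule L2_eq_0_if_modulated_gaussian)
    show "in_Lp 2 (\<lambda>x. complex_of_real (g x) - complex_of_real (h x)) \<or> ((\<lambda>x. complex_of_real (g x) - complex_of_real (h x)) \<in> borel_measurable borel \<and> (\<exists>B. \<forall>x. norm (complex_of_real (g x) - complex_of_real (h x)) \<le> B))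
      \<or> integrable lborel (\<lambda>x. (complex_of_real (g x) - complex_of_real (h x)) * of_real (exp (- x\<^sup>2 / 2)))"
      using in_Lp_2_diff[OF in_Lp_2_of_real[OF g] in_Lp_2_of_real[OF h]] by blast
    fix r
    define \<psi> where "\<psi> = (\<lambda>y. cis (r * y) * complex_of_real (exp (- y\<^sup>2 / 2)))"
    have s: "schwartz \<psi>" unfolding \<psi>_def by (rule schwartz_modulated_gaussian)
    have "pairing g \<psi> = pairing h \<psi>"
      using assms s unfolding has_weak_deriv_def by (metis neg_equal_iff_equal)
    then have "pairing (\<lambda>x. g x - h x) \<psi> = 0" using pairing_diff[OF g h s] by simp
    then show "(\<integral>y. (complex_of_real (g y) - complex_of_real (h y)) * (cis (r * y) * of_real (exp (- y\<^sup>2 / 2))) \<partial>lborel) = 0"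
      by (simp add: pairing_def \<psi>_def)
  qed
  then show ?thesis by eventually_elim simp
qed

lemma has_weak_deriv_diff:
  assumes "has_weak_deriv f g" "has_weak_deriv f' g'" "in_Lp 2 f" "in_Lp 2 f'"
  shows "has_weak_deriv (\<lambda>x. f x - f' x) (\<lambda>x. g x - g' x)"
  using assms schwartz_deriv(2) unfolding has_weak_deriv_def
  by (auto simp: in_Lp_2_diff pairing_diff)

lemma has_weak_deriv_weak_deriv: "has_weak_deriv f g \<Longrightarrow> has_weak_deriv f (weak_deriv f)"
  unfolding weak_deriv_def by (rule someI[of "has_weak_deriv f"])

lemma has_fourier_fourier: "has_fourier f g \<Longrightarrow> has_fourier f (fourier f)"
  unfolding fourier_def by (rule someI[of "has_fourier f"])

section \<open>Fourier inversion\<close>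

lemma schwartz_fourier_normal_density:
  "schwartz_fourier (\<lambda>x. complex_of_real (normal_density r 1 x)) y = cis ((- r) * y) * of_real (exp (- y\<^sup>2 / 2))"
  using has_bochner_integral_cis_normal_density[of 1 "-y" r]
  by (simp add: schwartz_fourier_def has_bochner_integral_iff mult.commute)

lemma schwartz_fourier_gaussian_decay:
  assumes "in_Lp 2 f"
  shows "integrable lborel (\<lambda>y. complex_of_real (f y) * (cis (r * y) * of_real (exp (- y\<^sup>2 / 2))))"
  by (rule integrable_pairing[OF assms schwartz_modulated_gaussian])

text \<open>Both sides are tested against the modulated Gaussians \<open>k\<close>, each of which is
  the Fourier transform of a normal density \<psi>. For f this is the definition of
  \<open>has_fourier\<close>; for the inverse integral it is the multiplication formula together
  with \<open>inv_fourier k\<close> = 2 pi \<psi>. This is where the factor 1 / (2 pi), omitted from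
  \<open>inv_fourier\<close>, reappears.\<close>

lemma has_fourier_inversion:
  assumes f: "in_Lp 2 f" and h: "has_fourier f g" and g: "integrable lborel g"
  shows "AE x in lborel. complex_of_real (f x) = inv_fourier g x / (2 * pi)"
proof -
  have fm [measurable]: "f \<in> borel_measurable borel" using f by (simp add: in_Lp_2_iff)
  have im [measurable]: "inv_fourier g \<in> borel_measurable borel" by (rule inv_fourier_measurable[OF g])
  have ii: "integrable lborel (\<lambda>y. (inv_fourier g y / (2 * pi)) * (cis (r * y) * complex_of_real (exp (- y\<^sup>2 / 2))))" for r
    by (rule integrable_bounded_mult_schwartz[OF schwartz_modulated_gaussian, where B = "(\<integral>\<xi>. norm (g \<xi>) \<partial>lborel) / (2 * pi)"])
      (use norm_inv_fourier_le[OF g] in \<open>auto simp: norm_divide divide_right_mono\<close>)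
  have "AE x in lborel. complex_of_real (f x) - inv_fourier g x / (2 * pi) = 0"
  proof (rule L2_eq_0_if_modulated_gaussian)
    have "integrable lborel (\<lambda>x. (complex_of_real (f x) - inv_fourier g x / (2 * pi)) * complex_of_real (exp (- x\<^sup>2 / 2)))"
      using Bochner_Integration.integrable_diff[OF schwartz_fourier_gaussian_decay[OF f, of 0] ii[of 0]] by (simp add: left_diff_distrib)
    then show "in_Lp 2 (\<lambda>x. complex_of_real (f x) - inv_fourier g x / (2 * pi)) \<or> ((\<lambda>x. complex_of_real (f x) - inv_fourier g x / (2 * pi)) \<in> borel_measurable borel \<and> (\<exists>B. \<forall>x. norm (complex_of_real (f x) - inv_fourier g x / (2 * pi)) \<le> B))
      \<or> integrable lborel (\<lambda>x. (complex_of_real (f x) - inv_fourier g x / (2 * pi)) * of_real (exp (- x\<^sup>2 / 2)))"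
      by blast
    fix r
    define \<psi> where "\<psi> = (\<lambda>x. complex_of_real (normal_density (- r) 1 x))"
    define k where "k = (\<lambda>y. cis (r * y) * complex_of_real (exp (- y\<^sup>2 / 2)))"
    have s: "schwartz \<psi>" unfolding \<psi>_def by (rule schwartz_normal_density) simp
    have k: "integrable lborel k" unfolding k_def by (intro integrable_schwartz schwartz_modulated_gaussian)
    have "schwartz_fourier \<psi> = k"
      unfolding \<psi>_def k_def by (simp add: fun_eq_iff schwartz_fourier_normal_density)
    then have 1: "(\<integral>y. complex_of_real (f y) * k y \<partial>lborel) = (\<integral>\<xi>. g \<xi> * \<psi> \<xi> \<partial>lborel)"
      using h s unfolding has_fourier_def pairing_def by metis
    have ik: "inv_fourier k \<xi> = of_real (2 * pi) * \<psi> \<xi>" for \<xi>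
    proof -
      have "exp (- y\<^sup>2 / 2) = sqrt (2 * pi) * normal_density 0 1 y" for y
        using exp_eq_normal_density[of 1 y] by simp
      then have "inv_fourier k \<xi> = (\<integral>y. of_real (sqrt (2 * pi)) * (complex_of_real (normal_density 0 1 y) * (cis (r * y) * cis (\<xi> * y))) \<partial>lborel)"
        unfolding inv_fourier_def k_def
        by (intro Bochner_Integration.integral_cong) (simp_all add: mult_ac)
      also have "\<dots> = of_real (sqrt (2 * pi)) * inv_fourier (\<lambda>y. complex_of_real (normal_density 0 1 y)) (\<xi> + r)"
        by (simp add: inv_fourier_def cis_mult distrib_right add.commute)
      also have "\<dots> = of_real (sqrt (2 * pi) * exp (- (\<xi> + r)\<^sup>2 / 2))"
        by (simp add: inv_fourier_normal_density(2))
      also have "sqrt (2 * pi) * exp (- (\<xi> + r)\<^sup>2 / 2) = 2 * pi * normal_density (- r) 1 \<xi>"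
        by (simp add: normal_density_def real_sqrt_mult field_simps flip: power2_eq_square)
      finally show ?thesis by (simp add: \<psi>_def)
    qed
    have 2: "(\<integral>y. (inv_fourier g y / (2 * pi)) * k y \<partial>lborel) = (\<integral>\<xi>. g \<xi> * \<psi> \<xi> \<partial>lborel)"
    proof -
      have "(\<integral>y. (inv_fourier g y / (2 * pi)) * k y \<partial>lborel) = (\<integral>y. (k y * inv_fourier g y) / of_real (2 * pi) \<partial>lborel)"
        by (intro Bochner_Integration.integral_cong) (simp_all add: mult_ac)
      also have "\<dots> = (\<integral>y. k y * inv_fourier g y \<partial>lborel) / of_real (2 * pi)"
        by (rule integral_divide_zero)
      also have "(\<integral>y. k y * inv_fourier g y \<partial>lborel) = (\<integral>\<xi>. g \<xi> * inv_fourier k \<xi> \<partial>lborel)"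
        by (rule inv_fourier_multiplication[OF k g])
      also have "\<dots> = (\<integral>\<xi>. of_real (2 * pi) * (g \<xi> * \<psi> \<xi>) \<partial>lborel)"
        by (intro Bochner_Integration.integral_cong) (simp_all add: ik mult_ac)
      finally show ?thesis by simp
    qed
    have "(\<integral>y. (complex_of_real (f y) - inv_fourier g y / (2 * pi)) * k y \<partial>lborel) = (\<integral>y. complex_of_real (f y) * k y \<partial>lborel) - (\<integral>y. (inv_fourier g y / (2 * pi)) * k y \<partial>lborel)"
      using schwartz_fourier_gaussian_decay[OF f, of r] ii[of r] unfolding left_diff_distrib k_def
      by (rule Bochner_Integration.integral_diff)
    then have "(\<integral>y. (complex_of_real (f y) - inv_fourier g y / (2 * pi)) * k y \<partial>lborel) = 0"
      by (simp only: 1 2 diff_self)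
    then show "(\<integral>y. (complex_of_real (f y) - inv_fourier g y / (2 * pi)) * (cis (r * y) * of_real (exp (- y\<^sup>2 / 2))) \<partial>lborel) = 0"
      by (simp only: k_def)
  qed
  then show ?thesis by eventually_elim simp
qed

section \<open>Integration by parts and the Sobolev embeddings\<close>

lemma integral_deriv_eq_0:
  fixes F :: "real \<Rightarrow> complex"
  assumes F: "\<And>x. (F has_vector_derivative f x) (at x)"
    and f: "continuous_on UNIV f" "integrable lborel f"
    and lim: "(F \<longlongrightarrow> 0) at_top" "(F \<longlongrightarrow> 0) at_bot"
  shows "(\<integral>x. f x \<partial>lborel) = 0"
proof -
  have "(LBINT x=-\<infinity>..\<infinity>. f x) = 0 - 0"
  proof (rule interval_integral_FTC_integrable)
    show "set_integrable lborel (einterval (- \<infinity>) \<infinity>) f"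
      using f(2) by (simp add: set_integrable_def)
    show "((F \<circ> real_of_ereal) \<longlongrightarrow> 0) (at_right (- \<infinity>))" "((F \<circ> real_of_ereal) \<longlongrightarrow> 0) (at_left \<infinity>)"
      using lim by (simp_all add: ereal_tendsto_simps)
    show "isCont f x" for x using f(1) by (simp add: continuous_on_eq_continuous_at)
  qed (use F in auto)
  then show ?thesis
    by (simp add: interval_lebesgue_integral_def set_lebesgue_integral_def)
qed

text \<open>The boundary terms vanish because f is bounded and \<psi> decays like 1 / (1 +
  x^2).\<close>

lemma integral_by_parts_schwartz:
  fixes f f' :: "real \<Rightarrow> real"
  assumes f: "\<And>x. (f has_real_derivative f' x) (at x)" and f': "continuous_on UNIV f'"
    and B: "\<And>x. \<bar>f x\<bar> \<le> B" "\<And>x. \<bar>f' x\<bar> \<le> B'" and \<psi>: "schwartz \<psi>"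
  shows "pairing f (x_deriv \<psi>) = - pairing f' \<psi>"
proof -
  have fc: "continuous_on UNIV f"
    using f by (intro continuous_at_imp_continuous_on ballI) (auto intro: DERIV_isCont)
  have [measurable]: "f \<in> borel_measurable borel" "f' \<in> borel_measurable borel"
    using fc f' by (auto intro: borel_measurable_continuous_onI)
  note \<psi>' = schwartz_deriv[OF \<psi>]
  have i1: "integrable lborel (\<lambda>x. complex_of_real (f x) * x_deriv \<psi> x)"
    by (rule integrable_bounded_mult_schwartz[OF \<psi>'(2), where B = B]) (use B in auto)
  have i2: "integrable lborel (\<lambda>x. complex_of_real (f' x) * \<psi> x)"
    by (rule integrable_bounded_mult_schwartz[OF \<psi>, where B = B']) (use B in auto)
  obtain C where C: "C > 0" "\<And>x. norm (\<psi> x) \<le> C / (1 + x\<^sup>2)" using schwartz_bound[OF \<psi>] by metis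
  have bd: "norm (complex_of_real (f x) * \<psi> x) \<le> B * (C / (1 + x\<^sup>2))" for x
    unfolding norm_mult using B(1)[of x] C by (intro mult_mono) (auto intro: order_trans[OF abs_ge_zero])
  have "((\<lambda>x::real. 1 / (1 + x\<^sup>2)) \<longlongrightarrow> 0) at_top" by real_asymp
  from tendsto_mult_left[OF this, of "B * C"]
  have l1: "((\<lambda>x. B * (C / (1 + x\<^sup>2))) \<longlongrightarrow> 0) at_top" by simp
  have "((\<lambda>x::real. 1 / (1 + x\<^sup>2)) \<longlongrightarrow> 0) at_bot" by real_asymp
  from tendsto_mult_left[OF this, of "B * C"]
  have l2: "((\<lambda>x. B * (C / (1 + x\<^sup>2))) \<longlongrightarrow> 0) at_bot" by simp
  have "(\<integral>x. complex_of_real (f x) * x_deriv \<psi> x + complex_of_real (f' x) * \<psi> x \<partial>lborel) = 0"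
  proof (rule integral_deriv_eq_0)
    show "((\<lambda>x. complex_of_real (f x) * \<psi> x) has_vector_derivative complex_of_real (f x) * x_deriv \<psi> x + complex_of_real (f' x) * \<psi> x) (at x)" for x
      by (intro has_vector_derivative_mult has_vector_derivative_of_real f \<psi>'(1))
    show "continuous_on UNIV (\<lambda>x. complex_of_real (f x) * x_deriv \<psi> x + complex_of_real (f' x) * \<psi> x)"
      by (intro continuous_intros fc f' schwartz_continuous \<psi> \<psi>'(2))
    show "integrable lborel (\<lambda>x. complex_of_real (f x) * x_deriv \<psi> x + complex_of_real (f' x) * \<psi> x)"
      using i1 i2 by simp
    show "((\<lambda>x. complex_of_real (f x) * \<psi> x) \<longlongrightarrow> 0) at_top"
      by (rule Lim_null_comparison[OF _ l1]) (use bd in auto)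
    show "((\<lambda>x. complex_of_real (f x) * \<psi> x) \<longlongrightarrow> 0) at_bot"
      by (rule Lim_null_comparison[OF _ l2]) (use bd in auto)
  qed
  then show ?thesis using i1 i2 by (simp add: pairing_def add_eq_0_iff2)
qed

text \<open>A continuous function exceeding c at one point does so on a whole ball, which is not a
  null set.\<close>

lemma AE_eq_continuous_imp_le:
  fixes f h :: "real \<Rightarrow> real"
  assumes "continuous_on UNIV h" "AE x in lborel. f x = h x" "AE x in lborel. \<bar>f x\<bar> \<le> c"
  shows "\<bar>h x\<bar> \<le> c"
proof (rule ccontr)
  assume "\<not> \<bar>h x\<bar> \<le> c"
  have "open {y. c < \<bar>h y\<bar>}"
    by (intro open_Collect_less continuous_intros assms)
  moreover have "x \<in> {y. c < \<bar>h y\<bar>}" using \<open>\<not> \<bar>h x\<bar> \<le> c\<close> by simp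
  ultimately obtain e where e: "e > 0" "ball x e \<subseteq> {y. c < \<bar>h y\<bar>}"
    unfolding open_contains_ball by blast
  have "AE y in lborel. \<bar>h y\<bar> \<le> c" using assms(2,3) by eventually_elim simp
  then have "AE y in lborel. y \<notin> ball x e"
    by eventually_elim (use e in auto)
  then have "emeasure lborel (ball x e) = 0"
    by (subst (asm) AE_iff_null_sets[symmetric]) auto
  moreover have "emeasure lborel (ball x e) = ennreal (2 * e)"
    using e(1) by (simp add: ball_eq_greaterThanLessThan)
  ultimately show False using e(1) by simp
qed

lemma has_fourier_diff:
  assumes "has_fourier f g" "has_fourier f' g'" "in_Lp 2 f" "in_Lp 2 f'"
    "\<And>\<psi>. schwartz \<psi> \<Longrightarrow> in_Lp 2 (schwartz_fourier \<psi>)"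
  shows "has_fourier (\<lambda>x. f x - f' x) (\<lambda>x. g x - g' x)"
  unfolding has_fourier_def
proof (intro conjI allI impI)
  have g: "in_Lp 2 g" "in_Lp 2 g'" using assms by (auto simp: has_fourier_def)
  show "in_Lp 2 (\<lambda>x. g x - g' x)" by (intro in_Lp_2_diff g)
  fix \<psi> :: "real \<Rightarrow> complex" assume s: "schwartz \<psi>"
  have "pairing (\<lambda>x. f x - f' x) (schwartz_fourier \<psi>) = pairing f (schwartz_fourier \<psi>) - pairing f' (schwartz_fourier \<psi>)"
    using integrable_mult_L2[OF in_Lp_2_of_real[OF assms(3)] assms(5)[OF s]] integrable_mult_L2[OF in_Lp_2_of_real[OF assms(4)] assms(5)[OF s]]
    by (simp add: pairing_def left_diff_distrib)
  also have "\<dots> = (\<integral>\<xi>. g \<xi> * \<psi> \<xi> \<partial>lborel) - (\<integral>\<xi>. g' \<xi> * \<psi> \<xi> \<partial>lborel)"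
    using assms(1,2) s by (auto simp: has_fourier_def)
  also have "\<dots> = (\<integral>\<xi>. (g \<xi> - g' \<xi>) * \<psi> \<xi> \<partial>lborel)"
    using integrable_mult_L2[OF g(1) in_Lp_2_schwartz[OF s]] integrable_mult_L2[OF g(2) in_Lp_2_schwartz[OF s]]
    by (simp add: left_diff_distrib)
  finally show "pairing (\<lambda>x. f x - f' x) (schwartz_fourier \<psi>) = (\<integral>\<xi>. (g \<xi> - g' \<xi>) * \<psi> \<xi> \<partial>lborel)" .
qed

text \<open>Square integrability of the transformed test function is what
  \<open>has_fourier_diff\<close> needs to split pairings; it is the Plancherel bound for the
  reflected inverse integral.\<close>

lemma in_Lp_2_schwartz_fourier:
  assumes \<psi>: "schwartz \<psi>"
  shows "in_Lp 2 (schwartz_fourier \<psi>)"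
proof -
  obtain C where C: "C > 0" "\<And>x. norm (\<psi> x) \<le> C / (1 + x\<^sup>2)" using schwartz_bound[OF \<psi>] by metis
  have "schwartz_fourier \<psi> \<xi> = inv_fourier \<psi> (- \<xi>)" for \<xi>
    by (simp add: schwartz_fourier_def inv_fourier_def mult.commute)
  then have eq: "schwartz_fourier \<psi> = (\<lambda>\<xi>. inv_fourier \<psi> (- \<xi>))" by (simp add: fun_eq_iff)
  have i: "in_Lp 2 (inv_fourier \<psi>)"
    by (intro in_Lp_2_inv_fourier integrable_schwartz in_Lp_2_schwartz \<psi>)
  then have m[measurable]: "inv_fourier \<psi> \<in> borel_measurable borel" by (simp add: in_Lp_2_iff)
  show ?thesis unfolding eq
  proof (rule in_Lp_2_I)
    show "(\<lambda>\<xi>. inv_fourier \<psi> (- \<xi>)) \<in> borel_measurable borel" by measurable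
    have "integrable lborel (\<lambda>\<xi>. (norm (inv_fourier \<psi> (0 + (- 1) * \<xi>)))\<^sup>2)"
      using in_Lp_2_integrable(2)[OF i]
      by (rule lborel_integrable_real_affine) simp
    then show "integrable lborel (\<lambda>\<xi>. (norm (inv_fourier \<psi> (- \<xi>)))\<^sup>2)" by simp
  qed
qed

lemma Sobolev_embedding:
  assumes s: "s > 1 / 2"
  obtains C where "C > 0" and
    "\<And>f g. \<lbrakk>in_Lp 2 f; has_fourier f g; Lp_norm 2 (\<lambda>\<xi>. ((1 + \<xi>\<^sup>2) powr (s / 2)) *\<^sub>R g \<xi>) < \<infinity>\<rbrakk>
      \<Longrightarrow> \<exists>h. uniformly_continuous_on UNIV h \<and> (AE x in lborel. f x = h x) \<and>
            (\<forall>x. \<bar>h x\<bar> \<le> C * enn2real (Lp_norm 2 (\<lambda>\<xi>. ((1 + \<xi>\<^sup>2) powr (s / 2)) *\<^sub>R g \<xi>)))"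
proof -
  obtain C where C: "C > 0" and
    CB0: "\<forall>g :: real \<Rightarrow> complex. g \<in> borel_measurable borel \<longrightarrow> Lp_norm 2 (\<lambda>\<xi>. ((1 + \<xi>\<^sup>2) powr (s / 2)) *\<^sub>R g \<xi>) < \<infinity>
      \<longrightarrow> integrable lborel g \<and> (\<integral>\<xi>. norm (g \<xi>) \<partial>lborel) \<le> C * enn2real (Lp_norm 2 (\<lambda>\<xi>. ((1 + \<xi>\<^sup>2) powr (s / 2)) *\<^sub>R g \<xi>))"
    by (rule L1_bound_Sobolev[OF s], rule that, assumption, blast)
  note CB = CB0[rule_format]
  show ?thesis
  proof (rule that[OF C])
    fix f g
    assume f: "in_Lp 2 f" and fg: "has_fourier f g" and fin: "Lp_norm 2 (\<lambda>\<xi>. ((1 + \<xi>\<^sup>2) powr (s / 2)) *\<^sub>R g \<xi>) < \<infinity>"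
    let ?N = "enn2real (Lp_norm 2 (\<lambda>\<xi>. ((1 + \<xi>\<^sup>2) powr (s / 2)) *\<^sub>R g \<xi>))"
    have "g \<in> borel_measurable borel" using fg by (simp add: has_fourier_def in_Lp_2_iff)
    from CB[OF this fin] have g: "integrable lborel g" and gN: "(\<integral>\<xi>. norm (g \<xi>) \<partial>lborel) \<le> C * ?N" by auto
    define h where "h = (\<lambda>x. Re (inv_fourier g x / (2 * pi)))"
    have "uniformly_continuous_on UNIV (\<lambda>x. Re (inv_fourier g x / (2 * pi)))"
      unfolding divide_inverse
      by (intro bounded_linear.uniformly_continuous_on[OF bounded_linear_Re] bounded_linear.uniformly_continuous_on[OF bounded_linear_mult_left]
          uniformly_continuous_inv_fourier g)
    moreover have "AE x in lborel. f x = h x"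
      using has_fourier_inversion[OF f fg g] by eventually_elim (drule arg_cong[where f = Re], simp add: h_def)
    moreover have "\<bar>h x\<bar> \<le> C * ?N" for x
    proof -
      have "\<bar>h x\<bar> \<le> norm (inv_fourier g x / (2 * pi))" unfolding h_def by (rule abs_Re_le_cmod)
      also have "\<dots> = norm (inv_fourier g x) / (2 * pi)" by (simp add: norm_divide)
      also have "\<dots> \<le> norm (inv_fourier g x) / 1"
        using pi_gt3 by (intro divide_left_mono) auto
      also have "\<dots> \<le> C * ?N" using norm_inv_fourier_le[OF g, of x] gN by simp
      finally show ?thesis .
    qed
    ultimately show "\<exists>h. uniformly_continuous_on UNIV h \<and> (AE x in lborel. f x = h x) \<and> (\<forall>x. \<bar>h x\<bar> \<le> C * ?N)"
      unfolding h_def[symmetric] by (intro exI[of _ h] conjI allI)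
  qed
qed

lemma Lp_norm_2_mono:
  fixes f :: "real \<Rightarrow> 'a::real_normed_vector" and g :: "real \<Rightarrow> 'b::real_normed_vector"
  assumes "\<And>x. norm (f x) \<le> norm (g x)"
  shows "Lp_norm 2 f \<le> Lp_norm 2 g"
proof -
  define I J where "I = (\<integral>\<^sup>+x. ennreal ((norm (f x))\<^sup>2) \<partial>lborel)" and "J = (\<integral>\<^sup>+x. ennreal ((norm (g x))\<^sup>2) \<partial>lborel)"
  have "I \<le> J" unfolding I_def J_def
    by (intro nn_integral_mono ennreal_leI power_mono assms) auto
  then show ?thesis
    unfolding Lp_norm_2_eq[OF I_def] Lp_norm_2_eq[OF J_def]
    by (auto simp: top_unique less_top intro!: ennreal_leI enn2real_mono)
qed

text \<open>Both g and i xi g are bounded by (1 + xi^2)^(1/2) |g|, so the L^1 bound of order s - 1 >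
  1/2 applies to both: the inverse integral is C^1 with uniformly continuous derivative. By
  integration by parts against test functions this derivative is also the weak one.\<close>

lemma Sobolev_embedding_C1:
  assumes s: "s > 3 / 2"
  obtains C where "C > 0" and
    "\<And>f g. \<lbrakk>in_Lp 2 f; has_fourier f g; Lp_norm 2 (\<lambda>\<xi>. ((1 + \<xi>\<^sup>2) powr (s / 2)) *\<^sub>R g \<xi>) < \<infinity>\<rbrakk>
      \<Longrightarrow> \<exists>h h'. uniformly_continuous_on UNIV h \<and> uniformly_continuous_on UNIV h' \<and>
            (AE x in lborel. f x = h x) \<and> has_weak_deriv f (weak_deriv f) \<and> (AE x in lborel. weak_deriv f x = h' x) \<and>
            (\<forall>x. (h has_real_derivative h' x) (at x)) \<and>
            (\<forall>x. \<bar>h x\<bar> \<le> C * enn2real (Lp_norm 2 (\<lambda>\<xi>. ((1 + \<xi>\<^sup>2) powr (s / 2)) *\<^sub>R g \<xi>))) \<and>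
            (\<forall>x. \<bar>h' x\<bar> \<le> C * enn2real (Lp_norm 2 (\<lambda>\<xi>. ((1 + \<xi>\<^sup>2) powr (s / 2)) *\<^sub>R g \<xi>)))"
proof -
  have s1: "s - 1 > 1 / 2" using s by simp
  obtain C where C: "C > 0" and
    CB0: "\<forall>g :: real \<Rightarrow> complex. g \<in> borel_measurable borel \<longrightarrow> Lp_norm 2 (\<lambda>\<xi>. ((1 + \<xi>\<^sup>2) powr ((s - 1) / 2)) *\<^sub>R g \<xi>) < \<infinity>
      \<longrightarrow> integrable lborel g \<and> (\<integral>\<xi>. norm (g \<xi>) \<partial>lborel) \<le> C * enn2real (Lp_norm 2 (\<lambda>\<xi>. ((1 + \<xi>\<^sup>2) powr ((s - 1) / 2)) *\<^sub>R g \<xi>))"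
    by (rule L1_bound_Sobolev[OF s1], rule that, assumption, blast)
  note CB = CB0[rule_format]
  show ?thesis
  proof (rule that[OF C])
    fix f g
    assume f: "in_Lp 2 f" and fg: "has_fourier f g" and fin: "Lp_norm 2 (\<lambda>\<xi>. ((1 + \<xi>\<^sup>2) powr (s / 2)) *\<^sub>R g \<xi>) < \<infinity>"
    let ?N = "enn2real (Lp_norm 2 (\<lambda>\<xi>. ((1 + \<xi>\<^sup>2) powr (s / 2)) *\<^sub>R g \<xi>))"
    have gm [measurable]: "g \<in> borel_measurable borel" using fg by (simp add: has_fourier_def in_Lp_2_iff)
    have g2: "in_Lp 2 g" using fg by (simp add: has_fourier_def)
    define k where "k = (\<lambda>\<xi>. \<i> * of_real \<xi> * g \<xi>)"
    have [measurable]: "k \<in> borel_measurable borel" unfolding k_def by measurable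
    \<comment> \<open>The common estimate for g and \<open>k\<close>: a factor (1 + xi^2)^(1/2) is
      traded for one order of the Sobolev weight.\<close>
    have bound: "integrable lborel q \<and> (\<integral>\<xi>. norm (q \<xi>) \<partial>lborel) \<le> C * ?N"
      if q: "q \<in> borel_measurable borel" and le: "\<And>\<xi>. norm (q \<xi>) \<le> (1 + \<xi>\<^sup>2) powr (1 / 2) * norm (g \<xi>)" for q :: "real \<Rightarrow> complex"
    proof -
      have mono: "Lp_norm 2 (\<lambda>\<xi>. ((1 + \<xi>\<^sup>2) powr ((s - 1) / 2)) *\<^sub>R q \<xi>) \<le> Lp_norm 2 (\<lambda>\<xi>. ((1 + \<xi>\<^sup>2) powr (s / 2)) *\<^sub>R g \<xi>)"
      proof (rule Lp_norm_2_mono)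
        fix \<xi> :: real
        have "(1 + \<xi>\<^sup>2) powr ((s - 1) / 2) * norm (q \<xi>) \<le> (1 + \<xi>\<^sup>2) powr ((s - 1) / 2) * ((1 + \<xi>\<^sup>2) powr (1 / 2) * norm (g \<xi>))"
          by (intro mult_left_mono le) simp
        also have "\<dots> = (1 + \<xi>\<^sup>2) powr (s / 2) * norm (g \<xi>)"
          by (simp add: mult.assoc[symmetric] powr_add[symmetric] diff_divide_distrib)
        finally show "norm (((1 + \<xi>\<^sup>2) powr ((s - 1) / 2)) *\<^sub>R q \<xi>) \<le> norm (((1 + \<xi>\<^sup>2) powr (s / 2)) *\<^sub>R g \<xi>)"
          by simp
      qed
      have fin': "Lp_norm 2 (\<lambda>\<xi>. ((1 + \<xi>\<^sup>2) powr ((s - 1) / 2)) *\<^sub>R q \<xi>) < \<infinity>"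
        using mono fin by (rule le_less_trans)
      have "enn2real (Lp_norm 2 (\<lambda>\<xi>. ((1 + \<xi>\<^sup>2) powr ((s - 1) / 2)) *\<^sub>R q \<xi>)) \<le> ?N"
        using mono fin by (intro enn2real_mono) auto
      then show ?thesis using CB[OF q fin'] C by (meson mult_left_mono less_imp_le order_trans)
    qed
    have sq1: "1 \<le> (1 + \<xi>\<^sup>2) powr (1 / 2)" and sq2: "\<bar>\<xi>\<bar> \<le> (1 + \<xi>\<^sup>2) powr (1 / 2)" for \<xi> :: real
    proof -
      have "(1 + \<xi>\<^sup>2) powr (1 / 2) = sqrt (1 + \<xi>\<^sup>2)" by (simp add: powr_half_sqrt)
      then show "1 \<le> (1 + \<xi>\<^sup>2) powr (1 / 2)" "\<bar>\<xi>\<bar> \<le> (1 + \<xi>\<^sup>2) powr (1 / 2)" by (auto intro: real_le_rsqrt)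
    qed
    have g: "integrable lborel g" and gN: "(\<integral>\<xi>. norm (g \<xi>) \<partial>lborel) \<le> C * ?N"
      using bound[OF gm] mult_right_mono[OF sq1 norm_ge_zero] by auto
    have k: "integrable lborel k" and kN: "(\<integral>\<xi>. norm (k \<xi>) \<partial>lborel) \<le> C * ?N"
      using bound[of k] mult_right_mono[OF sq2 norm_ge_zero] by (auto simp: k_def norm_mult)
    \<comment> \<open>A weak derivative has to lie in L^2; Plancherel's bound passes this property
      from \<open>k\<close> to its inverse integral.\<close>
    have k2: "in_Lp 2 k"
      unfolding in_Lp_def
    proof
      have "Lp_norm 2 k \<le> Lp_norm 2 (\<lambda>\<xi>. ((1 + \<xi>\<^sup>2) powr (s / 2)) *\<^sub>R g \<xi>)"
      proof (rule Lp_norm_2_mono)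
        fix \<xi>
        have "(1 + \<xi>\<^sup>2) powr (1 / 2) \<le> (1 + \<xi>\<^sup>2) powr (s / 2)" using s by (intro powr_mono) auto
        then have "\<bar>\<xi>\<bar> \<le> (1 + \<xi>\<^sup>2) powr (s / 2)" using sq2 order_trans by blast
        then show "norm (k \<xi>) \<le> norm (((1 + \<xi>\<^sup>2) powr (s / 2)) *\<^sub>R g \<xi>)"
          by (simp add: k_def norm_mult mult_right_mono)
      qed
      then show "Lp_norm 2 k < \<infinity>" using fin by (rule le_less_trans)
    qed simp
    define h where "h = (\<lambda>x. Re (inv_fourier g x / (2 * pi)))"
    define h' where "h' = (\<lambda>x. Re (inv_fourier k x / (2 * pi)))"
    have uc: "uniformly_continuous_on UNIV h" "uniformly_continuous_on UNIV h'"
      unfolding h_def h'_def divide_inverse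
      by (intro bounded_linear.uniformly_continuous_on[OF bounded_linear_Re] bounded_linear.uniformly_continuous_on[OF bounded_linear_mult_left]
          uniformly_continuous_inv_fourier g k)+
    have fh: "AE x in lborel. f x = h x"
      using has_fourier_inversion[OF f fg g] by eventually_elim (drule arg_cong[where f = Re], simp add: h_def)
    have Re_bound: "\<bar>Re (inv_fourier q x / (2 * pi))\<bar> \<le> norm (inv_fourier q x)" for q x
    proof -
      have "\<bar>Re (inv_fourier q x / (2 * pi))\<bar> \<le> norm (inv_fourier q x / (2 * pi))" by (rule abs_Re_le_cmod)
      also have "\<dots> = norm (inv_fourier q x) / (2 * pi)" by (simp add: norm_divide)
      also have "\<dots> \<le> norm (inv_fourier q x) / 1"
        using pi_gt3 by (intro divide_left_mono) auto
      finally show ?thesis by simp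
    qed
    have hN: "\<bar>h x\<bar> \<le> C * ?N" "\<bar>h' x\<bar> \<le> C * ?N" for x
      using Re_bound[of g x] norm_inv_fourier_le[OF g, of x] gN Re_bound[of k x] norm_inv_fourier_le[OF k, of x] kN
      unfolding h_def h'_def by linarith+
    have dh: "(h has_real_derivative h' x) (at x)" for x
    proof -
      have "integrable lborel (\<lambda>\<xi>. \<xi> *\<^sub>R g \<xi>)"
        using integrable_mult_right[OF k, of "- \<i>"] by (simp add: k_def scaleR_conv_of_real mult.assoc[symmetric])
      from has_vector_derivative_inv_fourier[OF g this]
      have "(inv_fourier g has_vector_derivative inv_fourier k x) (at x)" unfolding k_def .
      from bounded_linear.has_vector_derivative[OF bounded_linear_Re has_vector_derivative_divide[OF this]]
      show ?thesis unfolding h_def h'_def has_real_derivative_iff_has_vector_derivative .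
    qed
    have h'2: "in_Lp 2 h'"
    proof (rule in_Lp_2_I)
      have hm: "h' \<in> borel_measurable borel"
        using uc(2) by (intro borel_measurable_continuous_onI uniformly_continuous_imp_continuous)
      then show "h' \<in> borel_measurable borel" .
      show "integrable lborel (\<lambda>x. (norm (h' x))\<^sup>2)"
      proof (rule Bochner_Integration.integrable_bound)
        show "integrable lborel (\<lambda>x. (norm (inv_fourier k x))\<^sup>2)"
          by (intro in_Lp_2_integrable in_Lp_2_inv_fourier k k2)
        show "(\<lambda>x. (norm (h' x))\<^sup>2) \<in> borel_measurable lborel" using hm by measurable
        show "AE x in lborel. norm ((norm (h' x))\<^sup>2) \<le> norm ((norm (inv_fourier k x))\<^sup>2)"
          unfolding h'_def using Re_bound by (intro AE_I2) (auto intro!: power_mono)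
      qed
    qed
    have wd: "has_weak_deriv f h'"
      unfolding has_weak_deriv_def
    proof (intro conjI allI impI h'2)
      fix \<psi> :: "real \<Rightarrow> complex" assume \<psi>: "schwartz \<psi>"
      have "pairing f (x_deriv \<psi>) = pairing h (x_deriv \<psi>)"
        using f uc(1) schwartz_measurable[OF schwartz_deriv(2)[OF \<psi>]] fh
        by (intro pairing_cong_AE) (auto simp: in_Lp_2_iff intro: borel_measurable_continuous_onI uniformly_continuous_imp_continuous)
      also have "\<dots> = - pairing h' \<psi>"
        by (rule integral_by_parts_schwartz[OF dh _ hN \<psi>]) (rule uniformly_continuous_imp_continuous[OF uc(2)])
      finally show "pairing f (x_deriv \<psi>) = - pairing h' \<psi>" .
    qed
    have wd': "has_weak_deriv f (weak_deriv f)" using wd by (rule has_weak_deriv_weak_deriv)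
    show "\<exists>h h'. uniformly_continuous_on UNIV h \<and> uniformly_continuous_on UNIV h' \<and>
            (AE x in lborel. f x = h x) \<and> has_weak_deriv f (weak_deriv f) \<and> (AE x in lborel. weak_deriv f x = h' x) \<and>
            (\<forall>x. (h has_real_derivative h' x) (at x)) \<and> (\<forall>x. \<bar>h x\<bar> \<le> C * ?N) \<and> (\<forall>x. \<bar>h' x\<bar> \<le> C * ?N)"
      by (intro exI[of _ h] exI[of _ h'] conjI allI uc fh wd' has_weak_deriv_unique[OF wd' wd] dh hN)
  qed
qed

section \<open>Lebesgue norms\<close>

text \<open>Young's inequality. It is the tangent line inequality of the convex function z^p at m,
  solved for z; being affine in z^p, it can be integrated against a kernel.\<close>

lemma le_tangent_powr:
  fixes z m p :: real
  assumes "z \<ge> 0" "m > 0" "p \<ge> 1"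
  shows "z \<le> z powr p * m powr (1 - p) / p + (1 - 1 / p) * m"
proof (cases "z = 0")
  case False
  then have z: "z > 0" using assms by simp
  have "(z powr p * m powr (1 - p)) powr (1 / p) * m powr (1 - 1 / p) \<le> 1 / p * (z powr p * m powr (1 - p)) + (1 - 1 / p) * m"
    by (rule Youngs_inequality_0) (use assms z in auto)
  moreover have "(z powr p * m powr (1 - p)) powr (1 / p) * m powr (1 - 1 / p) = z"
  proof -
    have "(z powr p * m powr (1 - p)) powr (1 / p) = z * m powr ((1 - p) / p)"
      using assms z by (simp add: powr_mult powr_powr)
    moreover have "m powr ((1 - p) / p) * m powr (1 - 1 / p) = 1"
      using assms by (simp add: powr_add[symmetric] field_simps)
    ultimately show ?thesis by simp
  qed
  ultimately show ?thesis by simp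
qed (use assms in simp)

text \<open>The way back from an integrated tangent inequality: with K the mass of the kernel and J
  the integral of the p-th power, the tangent point S / K makes the terms combine to Jensen's
  inequality.\<close>

lemma powr_le_of_tangent:
  fixes S J K p :: real
  assumes "S > 0" "K > 0" "p \<ge> 1"
    and le: "S \<le> J * (S / K) powr (1 - p) / p + (1 - 1 / p) * (S / K) * K"
  shows "S powr p \<le> K powr (p - 1) * J"
proof -
  have "S / p \<le> J * (S / K) powr (1 - p) / p"
    using le assms by (simp add: field_simps)
  then have "S \<le> J * (S / K) powr (1 - p)"
    using assms by (simp add: divide_le_cancel)
  then have "S * (S / K) powr (p - 1) \<le> J * (S / K) powr (1 - p) * (S / K) powr (p - 1)"
    by (rule mult_right_mono) simp
  also have "\<dots> = J"
    using assms by (simp add: mult.assoc powr_add[symmetric])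
  also have "S * (S / K) powr (p - 1) = S powr p / K powr (p - 1)"
  proof -
    have "S * S powr (p - 1) = S powr p" using assms by (simp add: powr_diff)
    then show ?thesis using assms by (simp add: powr_divide)
  qed
  finally show ?thesis using assms by (simp add: pos_divide_le_eq mult.commute)
qed

text \<open>Convexity of the p-th power for the mean of x / a and y / b with weights proportional to
  a and b. In Minkowski's inequality a and b are bounds for the two norms.\<close>

lemma powr_add_le_convex:
  fixes x y a b p :: real
  assumes "x \<ge> 0" "y \<ge> 0" "a > 0" "b > 0" "p \<ge> 1"
  shows "(x + y) powr p \<le> (a + b) powr (p - 1) * (a * (x / a) powr p + b * (y / b) powr p)"
proof (cases "x + y = 0")
  case False
  define m where "m = (x + y) / (a + b)"
  have m: "m > 0" unfolding m_def using assms False by simp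
  show ?thesis
  proof (rule powr_le_of_tangent)
    have "a * (x / a) \<le> a * ((x / a) powr p * m powr (1 - p) / p + (1 - 1 / p) * m)"
      using assms m by (intro mult_left_mono le_tangent_powr) auto
    moreover have "b * (y / b) \<le> b * ((y / b) powr p * m powr (1 - p) / p + (1 - 1 / p) * m)"
      using assms m by (intro mult_left_mono le_tangent_powr) auto
    ultimately have "x + y \<le> a * ((x / a) powr p * m powr (1 - p) / p + (1 - 1 / p) * m) + b * ((y / b) powr p * m powr (1 - p) / p + (1 - 1 / p) * m)"
      using assms by simp
    also have "\<dots> = (a * (x / a) powr p + b * (y / b) powr p) * m powr (1 - p) / p + (1 - 1 / p) * m * (a + b)"
      using assms by (simp add: algebra_simps add_divide_distrib)
    finally show "x + y \<le> (a * (x / a) powr p + b * (y / b) powr p) * ((x + y) / (a + b)) powr (1 - p) / p + (1 - 1 / p) * ((x + y) / (a + b)) * (a + b)"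
      unfolding m_def .
  qed (use assms False in auto)
qed (use assms in auto)

section \<open>Elementary properties of the norms, Minkowski's and Young's inequalities\<close>

lemma Lp_norm_le_iff:
  fixes f :: "real \<Rightarrow> 'a::real_normed_vector"
  assumes "1 \<le> p" "p \<noteq> \<infinity>" "c \<ge> 0"
  shows "Lp_norm p f \<le> ennreal c \<longleftrightarrow> (\<integral>\<^sup>+x. ennreal (norm (f x) powr enn2real p) \<partial>lborel) \<le> ennreal (c powr enn2real p)"
proof -
  define I where "I = (\<integral>\<^sup>+x. ennreal (norm (f x) powr enn2real p) \<partial>lborel)"
  define q where "q = enn2real p"
  have q: "q > 0"
    using assms by (cases p) (auto simp: q_def enn2real_positive_iff less_top)
  show ?thesis
  proof (cases "I = \<infinity>")
    case True
    then show ?thesis unfolding Lp_norm_def I_def[symmetric] using assms by (simp add: Let_def top_unique)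
  next
    case False
    then obtain r where r: "I = ennreal r" "r \<ge> 0" by (cases I) auto
    have "r powr (1 / q) \<le> c \<longleftrightarrow> r \<le> c powr q"
    proof
      assume "r powr (1 / q) \<le> c"
      then have "(r powr (1 / q)) powr q \<le> c powr q" using q by (intro powr_mono2) auto
      then show "r \<le> c powr q" using q r by (simp add: powr_powr)
    next
      assume "r \<le> c powr q"
      then have "r powr (1 / q) \<le> (c powr q) powr (1 / q)" using q r by (intro powr_mono2) auto
      then show "r powr (1 / q) \<le> c" using q assms by (simp add: powr_powr)
    qed
    moreover have "(\<integral>\<^sup>+x. ennreal (norm (f x) powr q) \<partial>lborel) = ennreal r"
      using r by (simp add: I_def q_def)
    ultimately show ?thesis
      unfolding Lp_norm_def q_def[symmetric] using assms r by (simp add: Let_def)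
  qed
qed

lemma Lp_norm_infinity_le_iff:
  fixes f :: "real \<Rightarrow> 'a::real_normed_vector"
  assumes [measurable]: "f \<in> borel_measurable borel" and "c \<ge> 0"
  shows "Lp_norm \<infinity> f \<le> ennreal c \<longleftrightarrow> (AE x in lborel. norm (f x) \<le> c)"
proof
  assume "Lp_norm \<infinity> f \<le> ennreal c"
  then have "esssup lborel (\<lambda>x. ennreal (norm (f x))) \<le> ennreal c" by (simp add: Lp_norm_def)
  moreover have "AE x in lborel. ennreal (norm (f x)) \<le> esssup lborel (\<lambda>x. ennreal (norm (f x)))"
    by (rule esssup_AE)
  ultimately have "AE x in lborel. ennreal (norm (f x)) \<le> ennreal c"
    by (auto elim!: eventually_mono)
  then show "AE x in lborel. norm (f x) \<le> c"
    by (simp add: assms(2))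
next
  assume "AE x in lborel. norm (f x) \<le> c"
  then have "esssup lborel (\<lambda>x. ennreal (norm (f x))) \<le> ennreal c"
    by (intro esssup_I) (auto elim!: eventually_mono simp: assms(2) ennreal_leI)
  then show "Lp_norm \<infinity> f \<le> ennreal c" by (simp add: Lp_norm_def)
qed

lemma one_le_enn2real:
  "1 \<le> p \<Longrightarrow> p \<noteq> \<infinity> \<Longrightarrow> 1 \<le> enn2real p"
  by (cases p) auto

lemma Lp_norm_mono_AE:
  fixes f :: "real \<Rightarrow> 'a::real_normed_vector" and g :: "real \<Rightarrow> 'b::real_normed_vector"
  assumes [measurable]: "f \<in> borel_measurable borel" "g \<in> borel_measurable borel"
    and p: "1 \<le> p" and le: "AE x in lborel. norm (f x) \<le> norm (g x)"
  shows "Lp_norm p f \<le> Lp_norm p g"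
proof (cases "Lp_norm p g")
  case (real c)
  show ?thesis
  proof (cases "p = \<infinity>")
    case True
    have "AE x in lborel. norm (g x) \<le> c"
      using real True Lp_norm_infinity_le_iff[of g c] by simp
    with le have "AE x in lborel. norm (f x) \<le> c" by eventually_elim simp
    then show ?thesis using real True Lp_norm_infinity_le_iff[of f c] by simp
  next
    case False
    have "(\<integral>\<^sup>+x. ennreal (norm (f x) powr enn2real p) \<partial>lborel) \<le> (\<integral>\<^sup>+x. ennreal (norm (g x) powr enn2real p) \<partial>lborel)"
    proof (rule nn_integral_mono_AE)
      show "AE x in lborel. ennreal (norm (f x) powr enn2real p) \<le> ennreal (norm (g x) powr enn2real p)"
        using le by eventually_elim (auto intro!: ennreal_leI powr_mono2)
    qed
    then show ?thesis
      using Lp_norm_le_iff[OF p False real(1), of g] Lp_norm_le_iff[OF p False real(1), of f] real(2) by auto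
  qed
qed simp

lemma Lp_norm_cong_AE:
  fixes f g :: "real \<Rightarrow> 'a::real_normed_vector"
  assumes "f \<in> borel_measurable borel" "g \<in> borel_measurable borel" "1 \<le> p"
    and "AE x in lborel. f x = g x"
  shows "Lp_norm p f = Lp_norm p g"
  using assms by (intro antisym Lp_norm_mono_AE) (auto elim: eventually_mono)

lemma Lp_norm_cmult_le:
  fixes f :: "real \<Rightarrow> real"
  assumes [measurable]: "f \<in> borel_measurable borel" and p: "1 \<le> p" and a: "a \<ge> 0"
  shows "Lp_norm p (\<lambda>x. a * f x) \<le> ennreal a * Lp_norm p f"
proof (cases "a = 0")
  case True
  have "Lp_norm p (\<lambda>x. 0::real) \<le> ennreal 0"
  proof (cases "p = \<infinity>")
    case True
    then show ?thesis using Lp_norm_infinity_le_iff[of "\<lambda>_. 0::real" 0] by simp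
  next
    case False
    then show ?thesis using p by (subst Lp_norm_le_iff) auto
  qed
  then show ?thesis using True by simp
next
  case False
  then have a: "a > 0" using a by simp
  show ?thesis
  proof (cases "Lp_norm p f")
    case (real c)
    have "Lp_norm p (\<lambda>x. a * f x) \<le> ennreal (a * c)"
    proof (cases "p = \<infinity>")
      case True
      have "AE x in lborel. norm (f x) \<le> c"
        using real True Lp_norm_infinity_le_iff[of f c] by simp
      then have "AE x in lborel. norm (a * f x) \<le> a * c"
        by eventually_elim (use a in \<open>simp add: abs_mult\<close>)
      then show ?thesis using real True a Lp_norm_infinity_le_iff[of "\<lambda>x. a * f x" "a * c"] by simp
    next
      case False
      have "(\<integral>\<^sup>+x. ennreal (norm (a * f x) powr enn2real p) \<partial>lborel) = ennreal (a powr enn2real p) * (\<integral>\<^sup>+x. ennreal (norm (f x) powr enn2real p) \<partial>lborel)"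
        using a by (subst nn_integral_cmult[symmetric]) (auto simp: abs_mult powr_mult ennreal_mult)
      also have "\<dots> \<le> ennreal (a powr enn2real p) * ennreal (c powr enn2real p)"
        using Lp_norm_le_iff[OF p False real(1), of f] real(2) by (intro mult_left_mono) auto
      also have "\<dots> = ennreal ((a * c) powr enn2real p)"
        using a real(1) by (simp add: powr_mult ennreal_mult)
      finally show ?thesis using a real(1) by (subst Lp_norm_le_iff[OF p False]) auto
    qed
    then show ?thesis using real a by (simp add: ennreal_mult)
  next
    case top
    then show ?thesis using a by (simp add: ennreal_mult_top)
  qed
qed

lemma Lp_norm_triangle:
  fixes f g :: "real \<Rightarrow> real"
  assumes [measurable]: "f \<in> borel_measurable borel" "g \<in> borel_measurable borel" and p: "1 \<le> p"
  shows "Lp_norm p (\<lambda>x. f x + g x) \<le> Lp_norm p f + Lp_norm p g"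
proof (rule ennreal_le_epsilon)
  fix e :: real
  assume fin: "Lp_norm p f + Lp_norm p g < top" and e: "0 < e"
  obtain a0 where a0: "Lp_norm p f = ennreal a0" "a0 \<ge> 0" using fin by (cases "Lp_norm p f") auto
  obtain b0 where b0: "Lp_norm p g = ennreal b0" "b0 \<ge> 0" using fin by (cases "Lp_norm p g") auto
  \<comment> \<open>The norms are enlarged so that a and b are positive and can be divided by; the
    total surplus e is removed by \<open>ennreal_le_epsilon\<close>.\<close>
  define a b where "a = a0 + e / 2" and "b = b0 + e / 2"
  have ab: "a > 0" "b > 0" "Lp_norm p f \<le> ennreal a" "Lp_norm p g \<le> ennreal b"
    using e a0 b0 by (auto simp: a_def b_def ennreal_leI)
  have "Lp_norm p (\<lambda>x. f x + g x) \<le> ennreal (a + b)"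
  proof (cases "p = \<infinity>")
    case True
    have "AE x in lborel. norm (f x) \<le> a" "AE x in lborel. norm (g x) \<le> b"
      using ab True Lp_norm_infinity_le_iff[of f a] Lp_norm_infinity_le_iff[of g b] by auto
    then have "AE x in lborel. norm (f x + g x) \<le> a + b"
      by eventually_elim (metis add_mono norm_triangle_le)
    then show ?thesis using True ab Lp_norm_infinity_le_iff[of "\<lambda>x. f x + g x" "a + b"] by simp
  next
    case False
    define q where "q = enn2real p"
    have q: "q \<ge> 1" unfolding q_def by (rule one_le_enn2real[OF p False])
    have If: "(\<integral>\<^sup>+x. ennreal (norm (f x) powr q) \<partial>lborel) \<le> ennreal (a powr q)"
      and Ig: "(\<integral>\<^sup>+x. ennreal (norm (g x) powr q) \<partial>lborel) \<le> ennreal (b powr q)"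
      using Lp_norm_le_iff[OF p False, of a f] Lp_norm_le_iff[OF p False, of b g] ab by (auto simp: q_def)
    \<comment> \<open>Coefficients read off from \<open>powr_add_le_convex\<close>; they satisfy A
      a^q + B b^q = (a + b)^q.\<close>
    define A B where "A = (a + b) powr (q - 1) * a / a powr q" and "B = (a + b) powr (q - 1) * b / b powr q"
    have AB: "A \<ge> 0" "B \<ge> 0" using ab by (auto simp: A_def B_def)
    have pw: "norm (f x + g x) powr q \<le> A * norm (f x) powr q + B * norm (g x) powr q" for x
    proof -
      have "norm (f x + g x) powr q \<le> (norm (f x) + norm (g x)) powr q"
        using q by (intro powr_mono2 norm_triangle_ineq) auto
      also have "\<dots> \<le> (a + b) powr (q - 1) * (a * (norm (f x) / a) powr q + b * (norm (g x) / b) powr q)"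
        using ab q by (intro powr_add_le_convex) auto
      also have "\<dots> = A * norm (f x) powr q + B * norm (g x) powr q"
        using ab by (simp add: A_def B_def powr_divide distrib_left)
      finally show ?thesis .
    qed
    have "(\<integral>\<^sup>+x. ennreal (norm (f x + g x) powr q) \<partial>lborel) \<le> (\<integral>\<^sup>+x. ennreal A * ennreal (norm (f x) powr q) + ennreal B * ennreal (norm (g x) powr q) \<partial>lborel)"
    proof (rule nn_integral_mono)
      fix x
      have "ennreal (norm (f x + g x) powr q) \<le> ennreal (A * norm (f x) powr q + B * norm (g x) powr q)"
        by (intro ennreal_leI pw)
      then show "ennreal (norm (f x + g x) powr q) \<le> ennreal A * ennreal (norm (f x) powr q) + ennreal B * ennreal (norm (g x) powr q)"
        using AB by (simp add: ennreal_mult)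
    qed
    also have "\<dots> = ennreal A * (\<integral>\<^sup>+x. ennreal (norm (f x) powr q) \<partial>lborel) + ennreal B * (\<integral>\<^sup>+x. ennreal (norm (g x) powr q) \<partial>lborel)"
      by (simp add: nn_integral_add nn_integral_cmult)
    also have "\<dots> \<le> ennreal A * ennreal (a powr q) + ennreal B * ennreal (b powr q)"
      by (intro add_mono mult_left_mono If Ig) auto
    also have "\<dots> = ennreal (A * a powr q + B * b powr q)"
      using AB by (simp add: ennreal_mult)
    also have "A * a powr q + B * b powr q = (a + b) powr q"
    proof -
      have "A * a powr q + B * b powr q = (a + b) powr (q - 1) * (a + b)"
        using ab by (simp add: A_def B_def distrib_left)
      also have "\<dots> = (a + b) powr q" using ab by (simp add: powr_diff)
      finally show ?thesis .
    qed
    finally show ?thesis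
      using ab by (subst Lp_norm_le_iff[OF p False]) (auto simp: q_def)
  qed
  also have "ennreal (a + b) = Lp_norm p f + Lp_norm p g + ennreal e"
    using a0 b0 e by (simp add: a_def b_def ennreal_plus[symmetric] del: ennreal_plus)
  finally show "Lp_norm p (\<lambda>x. f x + g x) \<le> Lp_norm p f + Lp_norm p g + ennreal e" .
qed

text \<open>Young's convolution inequality in \<open>L\<^sup>1 * L\<^sup>p\<close>: Jensen's inequality for the kernel is replaced by integrating
  the tangent inequality at the point \<open>\<bar>H x\<bar> / K\<close>.\<close>

lemma Lp_norm_convolution_le:
  fixes k F H :: "real \<Rightarrow> real"
  assumes [measurable]: "k \<in> borel_measurable borel" "F \<in> borel_measurable borel" "H \<in> borel_measurable borel"
    and k0: "\<And>x. k x \<ge> 0" and F0: "\<And>x. F x \<ge> 0" and K: "(\<integral>\<^sup>+x. ennreal (k x) \<partial>lborel) \<le> ennreal K" "K > 0"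
    and le: "\<And>x. ennreal \<bar>H x\<bar> \<le> (\<integral>\<^sup>+y. ennreal (k (x - y)) * ennreal (F y) \<partial>lborel)"
    and p: "1 \<le> p"
  shows "Lp_norm p H \<le> ennreal K * Lp_norm p F"
proof (cases "Lp_norm p F")
  case top
  then show ?thesis using K(2) by (simp add: ennreal_mult_top)
next
  case (real c)
  have K1: "(\<integral>\<^sup>+y. ennreal (k (x - y)) \<partial>lborel) \<le> ennreal K" for x
  proof -
    have "(\<integral>\<^sup>+y. ennreal (k (x + (- 1) * y)) \<partial>lborel) = (\<integral>\<^sup>+y. ennreal (k y) \<partial>lborel)"
      using nn_integral_real_affine[of "\<lambda>y. ennreal (k y)" "-1" x] by simp
    then show ?thesis using K by simp
  qed
  have K2: "(\<integral>\<^sup>+x. ennreal (k (x - y)) \<partial>lborel) \<le> ennreal K" for y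
  proof -
    have "(\<integral>\<^sup>+x. ennreal (k (- y + 1 * x)) \<partial>lborel) = (\<integral>\<^sup>+x. ennreal (k x) \<partial>lborel)"
      using nn_integral_real_affine[of "\<lambda>y. ennreal (k y)" "1" "-y"] by simp
    then show ?thesis using K by simp
  qed
  have "Lp_norm p H \<le> ennreal (K * c)"
  proof (cases "p = \<infinity>")
    case True
    have Fc: "AE x in lborel. F x \<le> c"
      using real True Lp_norm_infinity_le_iff[of F c] F0 by simp
    have "\<bar>H x\<bar> \<le> K * c" for x
    proof -
      note le[of x]
      also have "(\<integral>\<^sup>+y. ennreal (k (x - y)) * ennreal (F y) \<partial>lborel) \<le> (\<integral>\<^sup>+y. ennreal (k (x - y)) * ennreal c \<partial>lborel)"
        using Fc by (intro nn_integral_mono_AE) (auto elim!: eventually_mono intro!: mult_left_mono ennreal_leI)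
      also have "\<dots> = (\<integral>\<^sup>+y. ennreal (k (x - y)) \<partial>lborel) * ennreal c"
        by (rule nn_integral_multc) measurable
      also have "\<dots> \<le> ennreal K * ennreal c" by (intro mult_right_mono K1) auto
      also have "\<dots> = ennreal (K * c)" using K(2) real(1) by (simp add: ennreal_mult)
      finally show ?thesis using K(2) real(1) by simp
    qed
    then show ?thesis using True K(2) real(1) Lp_norm_infinity_le_iff[of H "K * c"] by simp
  next
    case False
    define q where "q = enn2real p"
    have q: "q \<ge> 1" unfolding q_def by (rule one_le_enn2real[OF p False])
    have IF: "(\<integral>\<^sup>+x. ennreal (F x powr q) \<partial>lborel) \<le> ennreal (c powr q)"
      using Lp_norm_le_iff[OF p False real(1), of F] real(2) F0 by (auto simp: q_def)
    define J where "J x = (\<integral>\<^sup>+y. ennreal (k (x - y)) * ennreal (F y powr q) \<partial>lborel)" for x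
    have [measurable]: "J \<in> borel_measurable borel" unfolding J_def by measurable
    \<comment> \<open>Jensen's inequality at the point x. It is trivial if H x = 0 or J x is
      infinite; otherwise |H x| / K is a positive tangent point.\<close>
    have pw: "ennreal (\<bar>H x\<bar> powr q) \<le> ennreal (K powr (q - 1)) * J x" for x
    proof (cases "H x = 0 \<or> J x = \<top>")
      case True
      then show ?thesis using K(2) by (auto simp: ennreal_mult_top)
    next
      case F: False
      then obtain j where j: "J x = ennreal j" "j \<ge> 0" by (cases "J x") auto
      define S where "S = \<bar>H x\<bar>"
      have S: "S > 0" using F by (simp add: S_def)
      define m where "m = S / K"
      have m: "m > 0" using S K(2) by (simp add: m_def)
      have "ennreal S \<le> (\<integral>\<^sup>+y. ennreal (k (x - y)) * ennreal (F y) \<partial>lborel)" unfolding S_def by (rule le)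
      also have "\<dots> \<le> (\<integral>\<^sup>+y. ennreal (m powr (1 - q) / q) * (ennreal (k (x - y)) * ennreal (F y powr q)) + ennreal ((1 - 1 / q) * m) * ennreal (k (x - y)) \<partial>lborel)"
      proof (rule nn_integral_mono)
        fix y
        have "k (x - y) * F y \<le> k (x - y) * (F y powr q * m powr (1 - q) / q + (1 - 1 / q) * m)"
          by (intro mult_left_mono le_tangent_powr k0 F0 m q)
        also have "\<dots> = m powr (1 - q) / q * (k (x - y) * F y powr q) + (1 - 1 / q) * m * k (x - y)"
          by (simp add: algebra_simps)
        finally have "ennreal (k (x - y) * F y) \<le> ennreal (m powr (1 - q) / q * (k (x - y) * F y powr q) + (1 - 1 / q) * m * k (x - y))"
          by (rule ennreal_leI)
        also have "\<dots> = ennreal (m powr (1 - q) / q * (k (x - y) * F y powr q)) + ennreal ((1 - 1 / q) * m * k (x - y))"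
          using q m k0 by (intro ennreal_plus) auto
        also have "ennreal (m powr (1 - q) / q * (k (x - y) * F y powr q)) = ennreal (m powr (1 - q) / q) * (ennreal (k (x - y)) * ennreal (F y powr q))"
          using q k0 by (subst ennreal_mult; simp add: ennreal_mult)
        also have "ennreal ((1 - 1 / q) * m * k (x - y)) = ennreal ((1 - 1 / q) * m) * ennreal (k (x - y))"
          using q k0 m by (intro ennreal_mult) auto
        finally show "ennreal (k (x - y)) * ennreal (F y) \<le> ennreal (m powr (1 - q) / q) * (ennreal (k (x - y)) * ennreal (F y powr q)) + ennreal ((1 - 1 / q) * m) * ennreal (k (x - y))"
          using k0 F0 by (simp add: ennreal_mult)
      qed
      also have "\<dots> = ennreal (m powr (1 - q) / q) * J x + ennreal ((1 - 1 / q) * m) * (\<integral>\<^sup>+y. ennreal (k (x - y)) \<partial>lborel)"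
        unfolding J_def by (simp add: nn_integral_add nn_integral_cmult)
      also have "\<dots> \<le> ennreal (m powr (1 - q) / q) * J x + ennreal ((1 - 1 / q) * m) * ennreal K"
        by (intro add_left_mono mult_left_mono K1) simp
      also have "\<dots> = ennreal (m powr (1 - q) / q * j + (1 - 1 / q) * m * K)"
        using q m K(2) j by (simp add: j(1) ennreal_plus[symmetric] ennreal_mult[symmetric] del: ennreal_plus)
      finally have "S \<le> m powr (1 - q) / q * j + (1 - 1 / q) * m * K"
        using q m K(2) j by (subst (asm) ennreal_le_iff) auto
      then have "S \<le> j * (S / K) powr (1 - q) / q + (1 - 1 / q) * (S / K) * K"
        by (simp add: m_def mult.commute)
      from powr_le_of_tangent[OF S K(2) q this]
      have "ennreal (S powr q) \<le> ennreal (K powr (q - 1) * j)" by (rule ennreal_leI)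
      then show ?thesis using j by (simp add: S_def ennreal_mult)
    qed
    have "(\<integral>\<^sup>+x. ennreal (norm (H x) powr q) \<partial>lborel) \<le> (\<integral>\<^sup>+x. ennreal (K powr (q - 1)) * J x \<partial>lborel)"
      by (intro nn_integral_mono) (use pw in auto)
    also have "\<dots> = ennreal (K powr (q - 1)) * (\<integral>\<^sup>+x. J x \<partial>lborel)"
      by (rule nn_integral_cmult) measurable
    also have "(\<integral>\<^sup>+x. J x \<partial>lborel) = (\<integral>\<^sup>+y. (\<integral>\<^sup>+x. ennreal (k (x - y)) * ennreal (F y powr q) \<partial>lborel) \<partial>lborel)"
      unfolding J_def by (rule lborel_pair.Fubini'[symmetric]) measurable
    also have "\<dots> = (\<integral>\<^sup>+y. (\<integral>\<^sup>+x. ennreal (k (x - y)) \<partial>lborel) * ennreal (F y powr q) \<partial>lborel)"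
      by (intro nn_integral_cong nn_integral_multc) measurable
    also have "ennreal (K powr (q - 1)) * (\<integral>\<^sup>+y. (\<integral>\<^sup>+x. ennreal (k (x - y)) \<partial>lborel) * ennreal (F y powr q) \<partial>lborel)
        \<le> ennreal (K powr (q - 1)) * (\<integral>\<^sup>+y. ennreal K * ennreal (F y powr q) \<partial>lborel)"
      by (intro mult_left_mono nn_integral_mono mult_right_mono K2) auto
    also have "(\<integral>\<^sup>+y. ennreal K * ennreal (F y powr q) \<partial>lborel) = ennreal K * (\<integral>\<^sup>+y. ennreal (F y powr q) \<partial>lborel)"
      by (rule nn_integral_cmult) measurable
    also have "ennreal (K powr (q - 1)) * (ennreal K * (\<integral>\<^sup>+y. ennreal (F y powr q) \<partial>lborel)) \<le> ennreal (K powr (q - 1)) * (ennreal K * ennreal (c powr q))"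
      by (intro mult_left_mono IF) auto
    also have "\<dots> = ennreal ((K * c) powr q)"
    proof -
      have "K powr (q - 1) * K = K powr q" using K(2) by (simp add: powr_diff)
      then have "K powr (q - 1) * (K * c powr q) = (K * c) powr q"
        using K(2) real(1) by (simp add: powr_mult mult.assoc[symmetric])
      then show ?thesis using K(2) by (simp add: ennreal_mult[symmetric])
    qed
    finally show ?thesis
      using K(2) real(1) by (subst Lp_norm_le_iff[OF p False]) (auto simp: q_def)
  qed
  then show ?thesis using real K(2) by (simp add: ennreal_mult)
qed

text \<open>Change of variables on [-n, n] after inserting the factor g' / \<theta>, which is at
  least 1, followed by monotone convergence in n.\<close>

lemma nn_integral_composition_le:
  fixes F g g' :: "real \<Rightarrow> real"
  assumes F: "F \<in> borel_measurable borel" and F0: "\<And>x. F x \<ge> 0"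
    and g: "\<And>x. (g has_real_derivative g' x) (at x)" and g': "continuous_on UNIV g'"
    and \<theta>: "\<theta> > 0" "\<And>x. g' x \<ge> \<theta>"
  shows "(\<integral>\<^sup>+x. ennreal (F (g x)) \<partial>lborel) \<le> ennreal (1 / \<theta>) * (\<integral>\<^sup>+x. ennreal (F x) \<partial>lborel)"
proof -
  note [measurable] = F
  have gc: "continuous_on UNIV g"
    using g by (intro continuous_at_imp_continuous_on ballI) (auto intro: DERIV_isCont)
  have [measurable]: "g \<in> borel_measurable borel" "g' \<in> borel_measurable borel"
    using gc g' by (auto intro: borel_measurable_continuous_onI)
  have part: "(\<integral>\<^sup>+x. ennreal (F (g x)) * indicator {- real n..real n} x \<partial>lborel) \<le> ennreal (1 / \<theta>) * (\<integral>\<^sup>+x. ennreal (F x) \<partial>lborel)" for n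
  proof -
    have "(\<integral>\<^sup>+x. ennreal (F (g x)) * indicator {- real n..real n} x \<partial>lborel)
        \<le> (\<integral>\<^sup>+x. ennreal (1 / \<theta>) * (ennreal (F (g x) * g' x * indicator {- real n..real n} x)) \<partial>lborel)"
    proof (rule nn_integral_mono)
      fix x
      have "F (g x) * \<theta> \<le> F (g x) * g' x" by (intro mult_left_mono \<theta> F0)
      then have "F (g x) \<le> 1 / \<theta> * (F (g x) * g' x)" using \<theta>(1) by (simp add: field_simps)
      then have "ennreal (F (g x)) \<le> ennreal (1 / \<theta>) * ennreal (F (g x) * g' x)"
        using \<theta>(1) by (subst ennreal_mult'[symmetric]) (auto intro!: ennreal_leI)
      then show "ennreal (F (g x)) * indicator {- real n..real n} x \<le> ennreal (1 / \<theta>) * (ennreal (F (g x) * g' x * indicator {- real n..real n} x))"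
        by (auto simp: indicator_def)
    qed
    also have "\<dots> = ennreal (1 / \<theta>) * (\<integral>\<^sup>+x. ennreal (F (g x) * g' x * indicator {- real n..real n} x) \<partial>lborel)"
      by (rule nn_integral_cmult) measurable
    also have "(\<integral>\<^sup>+x. ennreal (F (g x) * g' x * indicator {- real n..real n} x) \<partial>lborel)
       = (\<integral>\<^sup>+x. ennreal (F x * indicator {g (- real n)..g (real n)} x) \<partial>lborel)"
      by (rule nn_integral_substitution[symmetric])
        (use g g' \<theta> in \<open>auto intro: continuous_on_subset order_trans[OF less_imp_le[OF \<theta>(1)]] simp: set_borel_measurable_def\<close>)
    also have "\<dots> \<le> (\<integral>\<^sup>+x. ennreal (F x) \<partial>lborel)"
      using F0 by (intro nn_integral_mono ennreal_leI) (auto simp: indicator_def)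
    finally show ?thesis by (simp add: mult_left_mono)
  qed
  have "(\<integral>\<^sup>+x. ennreal (F (g x)) \<partial>lborel) = (\<integral>\<^sup>+x. (SUP n. ennreal (F (g x)) * indicator {- real n..real n} x) \<partial>lborel)"
  proof (rule nn_integral_cong, rule antisym)
    fix x
    obtain n where "\<bar>x\<bar> \<le> real n" using real_arch_simple by blast
    then have "ennreal (F (g x)) = ennreal (F (g x)) * indicator {- real n..real n} x" by (auto simp: indicator_def)
    also have "\<dots> \<le> (SUP n. ennreal (F (g x)) * indicator {- real n..real n} x)" by (rule SUP_upper) simp
    finally show "ennreal (F (g x)) \<le> (SUP n. ennreal (F (g x)) * indicator {- real n..real n} x)" .
    show "(SUP n. ennreal (F (g x)) * indicator {- real n..real n} x) \<le> ennreal (F (g x))"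
      by (rule SUP_least) (auto simp: indicator_def)
  qed
  also have "\<dots> = (SUP n. (\<integral>\<^sup>+x. ennreal (F (g x)) * indicator {- real n..real n} x \<partial>lborel))"
    by (rule nn_integral_monotone_convergence_SUP)
      (auto simp: incseq_def le_fun_def indicator_def)
  also have "\<dots> \<le> ennreal (1 / \<theta>) * (\<integral>\<^sup>+x. ennreal (F x) \<partial>lborel)"
    by (rule SUP_least) (rule part)
  finally show ?thesis .
qed

text \<open>The natural factor is \<theta>^(-1/p); as \<theta> \<le> 1 it is at most 1 / \<theta>, a
  bound uniform in p. For p = \<infinity>, continuity of F turns the almost everywhere bound into a
  pointwise one, which survives the composition.\<close>

lemma Lp_norm_composition_le:
  fixes F g g' :: "real \<Rightarrow> real"
  assumes F: "continuous_on UNIV F"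
    and g: "\<And>x. (g has_real_derivative g' x) (at x)" and g': "continuous_on UNIV g'"
    and \<theta>: "\<theta> > 0" "\<theta> \<le> 1" "\<And>x. g' x \<ge> \<theta>" and p: "1 \<le> p"
  shows "Lp_norm p (\<lambda>x. F (g x)) \<le> ennreal (1 / \<theta>) * Lp_norm p F"
proof (cases "Lp_norm p F")
  case top
  then show ?thesis using \<theta> by (simp add: ennreal_mult_top)
next
  case (real c)
  have Fm [measurable]: "F \<in> borel_measurable borel" using F by (rule borel_measurable_continuous_onI)
  have gc: "continuous_on UNIV g"
    using g by (intro continuous_at_imp_continuous_on ballI) (auto intro: DERIV_isCont)
  then have [measurable]: "g \<in> borel_measurable borel" by (rule borel_measurable_continuous_onI)
  have c\<theta>: "c \<le> 1 / \<theta> * c" using \<theta> real(1) by (simp add: field_simps mult_left_le_one_le)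
  have "Lp_norm p (\<lambda>x. F (g x)) \<le> ennreal (1 / \<theta> * c)"
  proof (cases "p = \<infinity>")
    case True
    have "AE x in lborel. \<bar>F x\<bar> \<le> c"
      using real True Lp_norm_infinity_le_iff[OF Fm, of c] by simp
    then have "\<bar>F x\<bar> \<le> c" for x by (rule AE_eq_continuous_imp_le[OF F AE_I2[OF refl]])
    then have "\<bar>F (g x)\<bar> \<le> 1 / \<theta> * c" for x using c\<theta> order_trans by blast
    then show ?thesis using True \<theta> real(1) Lp_norm_infinity_le_iff[of "\<lambda>x. F (g x)" "1 / \<theta> * c"] by simp
  next
    case False
    define q where "q = enn2real p"
    have q: "q \<ge> 1" unfolding q_def by (rule one_le_enn2real[OF p False])
    have IF: "(\<integral>\<^sup>+x. ennreal (\<bar>F x\<bar> powr q) \<partial>lborel) \<le> ennreal (c powr q)"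
      using Lp_norm_le_iff[OF p False real(1), of F] real(2) by (auto simp: q_def)
    have "(\<integral>\<^sup>+x. ennreal (\<bar>F (g x)\<bar> powr q) \<partial>lborel) \<le> ennreal (1 / \<theta>) * (\<integral>\<^sup>+x. ennreal (\<bar>F x\<bar> powr q) \<partial>lborel)"
      by (rule nn_integral_composition_le[OF _ _ g g' \<theta>(1,3)]) auto
    also have "\<dots> \<le> ennreal (1 / \<theta>) * ennreal (c powr q)" by (intro mult_left_mono IF) simp
    also have "\<dots> = ennreal (1 / \<theta> * c powr q)" using \<theta> by (simp add: ennreal_mult[symmetric])
    also have "\<dots> \<le> ennreal ((1 / \<theta>) powr q * c powr q)"
    proof (intro ennreal_leI mult_right_mono)
      show "1 / \<theta> \<le> (1 / \<theta>) powr q" using \<theta> q powr_mono[of 1 q "1 / \<theta>"] by simp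
    qed simp
    also have "(1 / \<theta>) powr q * c powr q = (1 / \<theta> * c) powr q"
      using \<theta> real(1) by (simp add: powr_mult powr_divide)
    finally show ?thesis
      using \<theta> real(1) by (subst Lp_norm_le_iff[OF p False]) (auto simp: q_def)
  qed
  then show ?thesis using real \<theta> by (simp add: ennreal_mult[symmetric])
qed

text \<open>Fatou's lemma for finite p; for p = \<infinity> countably many exceptional null sets are
  united. Truncated weights provide the eventual equality at each point.\<close>

lemma Lp_norm_le_liminf:
  fixes f :: "real \<Rightarrow> real" and fn :: "nat \<Rightarrow> real \<Rightarrow> real"
  assumes [measurable]: "f \<in> borel_measurable borel" "\<And>n. fn n \<in> borel_measurable borel"
    and ev: "\<And>x. \<forall>\<^sub>F n in sequentially. fn n x = f x"
    and p: "1 \<le> p" and le: "\<And>n. Lp_norm p (fn n) \<le> c"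
  shows "Lp_norm p f \<le> c"
proof (cases c)
  case (real r)
  have "Lp_norm p f \<le> ennreal r"
  proof (cases "p = \<infinity>")
    case True
    have "AE x in lborel. norm (fn n x) \<le> r" for n
      using le[of n] real True Lp_norm_infinity_le_iff[of "fn n" r] by simp
    then have "AE x in lborel. \<forall>n. norm (fn n x) \<le> r" by (subst AE_all_countable) auto
    then have "AE x in lborel. norm (f x) \<le> r"
    proof eventually_elim
      case (elim x)
      obtain n where "fn n x = f x" using eventually_happens[OF ev[of x]] by auto
      then show ?case using elim by metis
    qed
    then show ?thesis using True real Lp_norm_infinity_le_iff[of f r] by simp
  next
    case False
    have "(\<integral>\<^sup>+x. ennreal (norm (f x) powr enn2real p) \<partial>lborel) = (\<integral>\<^sup>+x. liminf (\<lambda>n. ennreal (norm (fn n x) powr enn2real p)) \<partial>lborel)"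
    proof (rule nn_integral_cong)
      fix x
      have "(\<lambda>n. ennreal (norm (fn n x) powr enn2real p)) \<longlonglongrightarrow> ennreal (norm (f x) powr enn2real p)"
        by (rule tendsto_eventually) (use ev[of x] in \<open>auto elim: eventually_mono\<close>)
      then show "ennreal (norm (f x) powr enn2real p) = liminf (\<lambda>n. ennreal (norm (fn n x) powr enn2real p))"
        by (subst lim_imp_Liminf) auto
    qed
    also have "\<dots> \<le> liminf (\<lambda>n. \<integral>\<^sup>+x. ennreal (norm (fn n x) powr enn2real p) \<partial>lborel)"
      by (rule nn_integral_liminf) measurable
    also have "\<dots> \<le> liminf (\<lambda>n. ennreal (r powr enn2real p))"
    proof (intro Liminf_mono always_eventually allI)
      fix n
      show "(\<integral>\<^sup>+x. ennreal (norm (fn n x) powr enn2real p) \<partial>lborel) \<le> ennreal (r powr enn2real p)"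
        using Lp_norm_le_iff[OF p False real(1), of "fn n"] le[of n] real(2) by (simp only:)
    qed
    also have "\<dots> = ennreal (r powr enn2real p)" by (simp add: Liminf_const)
    finally show ?thesis using Lp_norm_le_iff[OF p False real(1), of f] by simp
  qed
  then show ?thesis using real by simp
qed simp

section \<open>Admissible weights\<close>

lemma local_Lipschitz_of_derivative:
  fixes f :: "real \<Rightarrow> real"
  assumes "(f has_real_derivative d) (at x)" "\<bar>d\<bar> < B"
  obtains r where "r > 0" "\<And>y. \<bar>y - x\<bar> < r \<Longrightarrow> \<bar>f y - f x\<bar> \<le> B * \<bar>y - x\<bar>"
proof -
  have "((\<lambda>y. (f y - f x) / (y - x)) \<longlongrightarrow> d) (at x)"
    using assms(1) by (simp add: has_field_derivative_iff)
  then have "\<forall>\<^sub>F y in at x. dist ((f y - f x) / (y - x)) d < B - \<bar>d\<bar>"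
    using assms(2) by (auto simp: tendsto_iff)
  then obtain r where r: "r > 0" "\<And>y. y \<noteq> x \<Longrightarrow> dist y x < r \<Longrightarrow> dist ((f y - f x) / (y - x)) d < B - \<bar>d\<bar>"
    unfolding eventually_at by blast
  have "\<bar>f y - f x\<bar> \<le> B * \<bar>y - x\<bar>" if "\<bar>y - x\<bar> < r" for y
  proof (cases "y = x")
    case False
    have "\<bar>(f y - f x) / (y - x)\<bar> < B"
      using r(2)[OF False] that unfolding dist_real_def by linarith
    then show ?thesis using False by (simp add: abs_divide pos_divide_less_eq less_imp_le)
  qed simp
  with r(1) show ?thesis by (rule that)
qed

lemma locally_absolutely_continuousE:
  assumes "locally_absolutely_continuous f" "e > 0"
  obtains \<delta> where "\<delta> > 0" "\<And>(n::nat) c d. (\<forall>i<n. a \<le> c i \<and> c i \<le> d i \<and> d i \<le> b) \<Longrightarrow>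
        disjoint_family_on (\<lambda>i. {c i<..<d i}) {..<n} \<Longrightarrow> (\<Sum>i<n. d i - c i) < \<delta> \<Longrightarrow> (\<Sum>i<n. \<bar>f (d i) - f (c i)\<bar>) < e"
proof -
  have "\<exists>\<delta>>0. \<forall>(n::nat) (c::nat \<Rightarrow> real) d.
        (\<forall>i<n. a \<le> c i \<and> c i \<le> d i \<and> d i \<le> b) \<and> disjoint_family_on (\<lambda>i. {c i<..<d i}) {..<n} \<and> (\<Sum>i<n. d i - c i) < \<delta>
        \<longrightarrow> (\<Sum>i<n. \<bar>f (d i) - f (c i)\<bar>) < e"
    by (rule assms(1)[unfolded locally_absolutely_continuous_def, rule_format, OF assms(2)])
  then show ?thesis using that by (elim exE conjE) (rule that, assumption, simp)
qed

text \<open>A Cousin-type covering argument: tags in the exceptional null set only contribute intervals inside an open set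
  of small measure, which absolute continuity controls.\<close>

lemma absolutely_continuous_imp_Lipschitz:
  fixes f :: "real \<Rightarrow> real"
  assumes ac: "locally_absolutely_continuous f"
    and d: "AE x in lebesgue. \<exists>d. (f has_real_derivative d) (at x) \<and> \<bar>d\<bar> \<le> A"
    and ab: "a \<le> b"
  shows "\<bar>f b - f a\<bar> \<le> A * (b - a)"
proof (rule field_le_epsilon)
  fix e0 :: real assume e0: "e0 > 0"
  \<comment> \<open>The intervals tagged outside \<open>N\<close> lose e (b - a), the others lose e;
    together this is e0.\<close>
  define e where "e = e0 / (b - a + 1)"
  have e: "e > 0" using e0 ab by (simp add: e_def)
  obtain \<delta> where \<delta>: "\<delta> > 0" and ac\<delta>: "\<And>(n::nat) c d. (\<forall>i<n. a \<le> c i \<and> c i \<le> d i \<and> d i \<le> b) \<Longrightarrow>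
        disjoint_family_on (\<lambda>i. {c i<..<d i}) {..<n} \<Longrightarrow> (\<Sum>i<n. d i - c i) < \<delta> \<Longrightarrow> (\<Sum>i<n. \<bar>f (d i) - f (c i)\<bar>) < e"
    using locally_absolutely_continuousE[OF ac e, of a b] by blast
  define N where "N = {x. \<not> (\<exists>d. (f has_real_derivative d) (at x) \<and> \<bar>d\<bar> \<le> A)}"
  have N: "N \<in> null_sets lebesgue"
  proof -
    obtain N' where "\<And>x. x \<in> space lebesgue - N' \<Longrightarrow> \<exists>d. (f has_real_derivative d) (at x) \<and> \<bar>d\<bar> \<le> A"
      and N': "N' \<in> null_sets lebesgue"
      using AE_E3[OF d] by blast
    then have "N \<subseteq> N'" unfolding N_def by auto
    then show ?thesis using N' by (rule null_sets_completion_subset)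
  qed
  obtain O' where O': "open O'" "N \<subseteq> O'" and mO: "emeasure lebesgue (O' - N) < ennreal \<delta>"
    by (rule sets_lebesgue_outer_open[of N \<delta>]) (use N \<delta> in auto)
  have O\<delta>: "emeasure lborel O' < ennreal \<delta>"
  proof -
    have "emeasure lborel O' = emeasure lebesgue O'" using O' by simp
    also have "\<dots> = emeasure lebesgue (O' - N)"
      by (rule emeasure_Diff_null_set[symmetric]) (use N O' in auto)
    finally show ?thesis using mO by simp
  qed
  have "\<forall>x. \<exists>r>0. if x \<in> N then ball x r \<subseteq> O' else (\<forall>y. \<bar>y - x\<bar> < r \<longrightarrow> \<bar>f y - f x\<bar> \<le> (A + e) * \<bar>y - x\<bar>)"
  proof
    fix x
    show "\<exists>r>0. if x \<in> N then ball x r \<subseteq> O' else (\<forall>y. \<bar>y - x\<bar> < r \<longrightarrow> \<bar>f y - f x\<bar> \<le> (A + e) * \<bar>y - x\<bar>)"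
    proof (cases "x \<in> N")
      case True
      then have "x \<in> O'" using O'(2) by blast
      then show ?thesis using True O'(1) unfolding open_contains_ball by simp
    next
      case False
      then obtain d where "(f has_real_derivative d) (at x)" "\<bar>d\<bar> \<le> A" by (auto simp: N_def)
      moreover from this have "\<bar>d\<bar> < A + e" using e by simp
      ultimately obtain r where "r > 0" "\<And>y. \<bar>y - x\<bar> < r \<Longrightarrow> \<bar>f y - f x\<bar> \<le> (A + e) * \<bar>y - x\<bar>"
        using local_Lipschitz_of_derivative by metis
      then show ?thesis using False by auto
    qed
  qed
  \<comment> \<open>At a tag in \<open>N\<close> the radius keeps the interval inside the small open
    set; elsewhere it enforces the local Lipschitz bound A + e.\<close>
  then obtain r where r: "\<And>x. r x > 0" "\<And>x. x \<in> N \<Longrightarrow> ball x (r x) \<subseteq> O'"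
    "\<And>x y. x \<notin> N \<Longrightarrow> \<bar>y - x\<bar> < r x \<Longrightarrow> \<bar>f y - f x\<bar> \<le> (A + e) * \<bar>y - x\<bar>"
    by metis
  have "gauge (\<lambda>x. ball x (r x))" using r(1) by (simp add: gauge_def)
  then obtain P where P: "P tagged_division_of {a..b}" "(\<lambda>x. ball x (r x)) fine P"
    by (rule fine_division_exists_real)
  note PD = tagged_division_ofD[OF P(1)]
  have K: "K = {Inf K..Sup K} \<and> Inf K \<le> x \<and> x \<le> Sup K \<and> a \<le> Inf K \<and> Sup K \<le> b \<and> K \<subseteq> ball x (r x)" if xK: "(x, K) \<in> P" for x K
  proof -
    obtain u v where uv: "K = {u..v}" using PD(4)[OF xK] by auto
    have "x \<in> K" using PD(2)[OF xK] .
    then have "u \<le> v" using uv by auto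
    moreover have "K \<subseteq> {a..b}" using PD(3)[OF xK] .
    moreover have "K \<subseteq> ball x (r x)" using P(2) xK by (auto simp: fine_def)
    ultimately show ?thesis using uv \<open>x \<in> K\<close> by auto
  qed
  define F where "F = (\<lambda>(x::real, K). \<bar>f (Sup K) - f (Inf K)\<bar>)"
  define L where "L = (\<lambda>(x::real, K::real set). Sup K - Inf K)"
  have fin: "finite P" using PD(1) .
  have L0: "L p \<ge> 0" if "p \<in> P" for p using K[of "fst p" "snd p"] that by (auto simp: L_def split: prod.splits)
  have sumL: "sum L P = b - a"
    using additive_tagged_division_1[OF ab P(1), of "\<lambda>x. x"] by (simp add: L_def)
  have good: "sum F {p \<in> P. fst p \<notin> N} \<le> (A + e) * (b - a)"
  proof -
    have "sum F {p \<in> P. fst p \<notin> N} \<le> (\<Sum>p\<in>{p \<in> P. fst p \<notin> N}. (A + e) * L p)"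
    proof (rule sum_mono)
      fix p assume "p \<in> {p \<in> P. fst p \<notin> N}"
      then obtain x K' where p: "p = (x, K')" "(x, K') \<in> P" "x \<notin> N" by (cases p) auto
      note k = K[OF p(2)]
      have "Sup K' \<in> K'" "Inf K' \<in> K'" using k by (metis atLeastAtMost_iff order_refl order_trans)+
      then have "\<bar>Sup K' - x\<bar> < r x" "\<bar>Inf K' - x\<bar> < r x"
        using k by (auto simp: subset_iff dist_real_def abs_minus_commute)
      from r(3)[OF p(3) this(1)] r(3)[OF p(3) this(2)]
      have "\<bar>f (Sup K') - f x\<bar> \<le> (A + e) * (Sup K' - x)" "\<bar>f (Inf K') - f x\<bar> \<le> (A + e) * (x - Inf K')"
        using k by auto
      then have "\<bar>f (Sup K') - f (Inf K')\<bar> \<le> (A + e) * (Sup K' - Inf K')"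
        by (simp add: algebra_simps)
      then show "F p \<le> (A + e) * L p" by (simp add: F_def L_def p)
    qed
    also have "\<dots> = (A + e) * sum L {p \<in> P. fst p \<notin> N}" by (simp add: sum_distrib_left)
    also have "\<dots> \<le> (A + e) * (b - a)"
    proof (cases "{p \<in> P. fst p \<notin> N} = {}")
      case True
      \<comment> \<open>Without good tags the sum is empty, and the right-hand side still has to be
        nonnegative: a negative A would put every point into the null set \<open>N\<close>.\<close>
      have "0 \<le> A + e \<or> b = a"
      proof (rule ccontr)
        assume "\<not> (0 \<le> A + e \<or> b = a)"
        then have "A < 0" using e by auto
        then have "N = UNIV" by (auto simp: N_def)
        then show False using N by (simp add: null_sets_def)
      qed
      then have "0 \<le> (A + e) * (b - a)" using ab by auto
      then show ?thesis unfolding True by simp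
    next
      case False
      then obtain x where "x \<notin> N" by auto
      then have "A \<ge> 0" by (auto simp: N_def)
      moreover have "sum L {p \<in> P. fst p \<notin> N} \<le> sum L P"
        using fin L0 by (intro sum_mono2) auto
      ultimately show ?thesis using e sumL by (intro mult_left_mono) auto
    qed
    finally show ?thesis .
  qed
  have bad: "sum F {p \<in> P. fst p \<in> N} < e"
  proof -
    define Q where "Q = {p \<in> P. fst p \<in> N}"
    have finQ: "finite Q" using fin by (simp add: Q_def)
    \<comment> \<open>The bad intervals are numbered, since absolute continuity is formulated for
      finite sequences of intervals.\<close>
    obtain h where h: "bij_betw h {..<card Q} Q"
      using ex_bij_betw_nat_finite[OF finQ] by (auto simp: atLeast0LessThan)
    define c d where "c = (\<lambda>i. Inf (snd (h i)))" and "d = (\<lambda>i. Sup (snd (h i)))"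
    have hQ: "h i \<in> Q" if "i < card Q" for i using h that by (auto simp: bij_betw_def)
    have kh: "snd (h i) = {c i..d i} \<and> c i \<le> d i \<and> a \<le> c i \<and> d i \<le> b \<and> {c i..d i} \<subseteq> O'" if "i < card Q" for i
    proof -
      have "(fst (h i), snd (h i)) \<in> P" "fst (h i) \<in> N" using hQ[OF that] by (auto simp: Q_def)
      from K[OF this(1)] r(2)[OF this(2)] show ?thesis unfolding c_def d_def by auto
    qed
    have disj: "disjoint_family_on (\<lambda>i. {c i<..<d i}) {..<card Q}"
      unfolding disjoint_family_on_def
    proof (intro ballI impI)
      fix i j assume ij: "i \<in> {..<card Q}" "j \<in> {..<card Q}" "i \<noteq> j"
      then have "h i \<noteq> h j" using h by (auto simp: bij_betw_def inj_on_def)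
      moreover have "h i \<in> P" "h j \<in> P" using hQ ij by (auto simp: Q_def)
      ultimately have "interior (snd (h i)) \<inter> interior (snd (h j)) = {}"
        using PD(5)[of "fst (h i)" "snd (h i)" "fst (h j)" "snd (h j)"] by simp
      then show "{c i<..<d i} \<inter> {c j<..<d j} = {}"
        using kh[of i] kh[of j] ij by simp
    qed
    have "ennreal (\<Sum>i<card Q. d i - c i) = (\<Sum>i<card Q. emeasure lborel {c i<..<d i})"
      using kh by (subst sum_ennreal[symmetric]) auto
    also have "\<dots> = emeasure lborel (\<Union>i<card Q. {c i<..<d i})"
      by (rule sum_emeasure) (use disj in auto)
    also have "\<dots> \<le> emeasure lborel O'"
      using kh O'(1) by (intro emeasure_mono) (auto simp: subset_iff)
    also note O\<delta>
    finally have "(\<Sum>i<card Q. d i - c i) < \<delta>"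
      by (subst (asm) ennreal_less_iff) (use kh in \<open>auto intro!: sum_nonneg\<close>)
    from ac\<delta>[OF _ disj this] kh have "(\<Sum>i<card Q. \<bar>f (d i) - f (c i)\<bar>) < e" by blast
    also have "(\<Sum>i<card Q. \<bar>f (d i) - f (c i)\<bar>) = sum F Q"
      using sum.reindex_bij_betw[OF h, of F] by (simp add: F_def c_def d_def case_prod_unfold)
    finally show ?thesis by (simp add: Q_def)
  qed
  have "f b - f a = (\<Sum>(x, K)\<in>P. f (Sup K) - f (Inf K))"
    by (rule additive_tagged_division_1[OF ab P(1), symmetric])
  then have "\<bar>f b - f a\<bar> \<le> sum F P"
    unfolding F_def by (simp add: case_prod_unfold)
  also have "P = {p \<in> P. fst p \<notin> N} \<union> {p \<in> P. fst p \<in> N}" by auto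
  also have "sum F \<dots> = sum F {p \<in> P. fst p \<notin> N} + sum F {p \<in> P. fst p \<in> N}"
    using fin by (intro sum.union_disjoint) auto
  also have "\<dots> \<le> (A + e) * (b - a) + e" using good bad by simp
  also have "\<dots> = A * (b - a) + e0"
  proof -
    have "e * (b - a + 1) = e0" using ab by (simp add: e_def)
    then show ?thesis by (simp add: algebra_simps)
  qed
  finally show "\<bar>f b - f a\<bar> \<le> A * (b - a) + e0" .
qed

text \<open>The case of a single interval inside [x - 1, x + 1].\<close>

lemma locally_absolutely_continuous_imp_continuous:
  assumes "locally_absolutely_continuous f"
  shows "continuous_on UNIV f"
  unfolding continuous_on_eq_continuous_at[OF open_UNIV]
proof
  fix x
  show "isCont f x"
    unfolding continuous_at_eps_delta
  proof (intro allI impI)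
    fix e :: real assume "e > 0"
    then obtain \<delta> where \<delta>: "\<delta> > 0" and ac\<delta>: "\<And>(n::nat) c d. (\<forall>i<n. x - 1 \<le> c i \<and> c i \<le> d i \<and> d i \<le> x + 1) \<Longrightarrow>
        disjoint_family_on (\<lambda>i. {c i<..<d i}) {..<n} \<Longrightarrow> (\<Sum>i<n. d i - c i) < \<delta> \<Longrightarrow> (\<Sum>i<n. \<bar>f (d i) - f (c i)\<bar>) < e"
      using locally_absolutely_continuousE[OF assms, of e "x - 1" "x + 1"] by blast
    have "dist (f y) (f x) < e" if "dist y x < min \<delta> 1" for y
    proof -
      have "(\<Sum>i<Suc 0. \<bar>f (max x y) - f (min x y)\<bar>) < e"
      proof (rule ac\<delta>)
        show "\<forall>i<Suc 0. x - 1 \<le> min x y \<and> min x y \<le> max x y \<and> max x y \<le> x + 1"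
          using that by (auto simp: dist_real_def)
        show "disjoint_family_on (\<lambda>i. {min x y<..<max x y}) {..<Suc 0}"
          by (simp add: disjoint_family_on_def)
        show "(\<Sum>i<Suc 0. max x y - min x y) < \<delta>"
        proof -
          have "max x y - min x y = \<bar>y - x\<bar>" by (cases "x \<le> y") auto
          then show ?thesis using that by (simp add: dist_real_def)
        qed
      qed
      then show ?thesis by (cases "x \<le> y") (simp_all add: dist_real_def abs_minus_commute)
    qed
    then show "\<exists>d>0. \<forall>y. dist y x < d \<longrightarrow> dist (f y) (f x) < e"
      using \<delta> by (intro exI[of _ "min \<delta> 1"]) auto
  qed
qed

lemma abs_ln_diff_le:
  fixes x y m :: real
  assumes "0 < m" "m \<le> x" "m \<le> y"
  shows "\<bar>ln x - ln y\<bar> \<le> \<bar>x - y\<bar> / m"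
proof -
  have *: "ln x - ln y \<le> (x - y) / m" if "m \<le> y" "y \<le> x" for x y
  proof -
    have "ln x - ln y = ln (x / y)" using that assms by (simp add: ln_div)
    also have "\<dots> \<le> x / y - 1" using that assms by (intro ln_le_minus_one) auto
    also have "\<dots> = (x - y) / y" using that assms by (simp add: field_simps)
    also have "\<dots> \<le> (x - y) / m" using that assms by (intro divide_left_mono) auto
    finally show ?thesis .
  qed
  show ?thesis
  proof (cases "y \<le> x")
    case True
    then show ?thesis using *[of y x] assms by (simp add: abs_if)
  next
    case False
    then show ?thesis using *[of x y] assms ln_less_cancel_iff[of x y] by (auto simp: abs_if)
  qed
qed

text \<open>On [a, b] the continuous positive \<phi> has a positive minimum m, and ln is Lipschitz
  with constant 1 / m on values above m.\<close>

lemma locally_absolutely_continuous_ln: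
  assumes ac: "locally_absolutely_continuous \<phi>" and pos: "\<And>x. 0 < \<phi> x"
  shows "locally_absolutely_continuous (\<lambda>x. ln (\<phi> x))"
  unfolding locally_absolutely_continuous_def
proof (intro allI impI)
  fix a b e :: real assume e: "e > 0"
  show "\<exists>\<delta>>0. \<forall>(n::nat) (c::nat \<Rightarrow> real) d.
        (\<forall>i<n. a \<le> c i \<and> c i \<le> d i \<and> d i \<le> b) \<and> disjoint_family_on (\<lambda>i. {c i<..<d i}) {..<n} \<and> (\<Sum>i<n. d i - c i) < \<delta>
        \<longrightarrow> (\<Sum>i<n. \<bar>ln (\<phi> (d i)) - ln (\<phi> (c i))\<bar>) < e"
  proof (cases "a \<le> b")
    case True
    have "\<exists>x0\<in>{a..b}. \<forall>y\<in>{a..b}. \<phi> x0 \<le> \<phi> y"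
      using True by (intro continuous_attains_inf continuous_on_subset[OF locally_absolutely_continuous_imp_continuous[OF ac]]) auto
    then obtain x0 where x0: "\<And>y. y \<in> {a..b} \<Longrightarrow> \<phi> x0 \<le> \<phi> y" by blast
    define m where "m = \<phi> x0"
    have m: "m > 0" unfolding m_def by (rule pos)
    have "e * m > 0" using e m by simp
    then obtain \<delta> where \<delta>: "\<delta> > 0" and ac\<delta>: "\<And>(n::nat) c d. (\<forall>i<n. a \<le> c i \<and> c i \<le> d i \<and> d i \<le> b) \<Longrightarrow>
        disjoint_family_on (\<lambda>i. {c i<..<d i}) {..<n} \<Longrightarrow> (\<Sum>i<n. d i - c i) < \<delta> \<Longrightarrow> (\<Sum>i<n. \<bar>\<phi> (d i) - \<phi> (c i)\<bar>) < e * m"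
      using locally_absolutely_continuousE[OF ac, of "e * m" a b] by blast
    show ?thesis
    proof (intro exI[of _ \<delta>] conjI \<delta> allI impI, elim conjE)
      fix n :: nat and c d :: "nat \<Rightarrow> real"
      assume A: "\<forall>i<n. a \<le> c i \<and> c i \<le> d i \<and> d i \<le> b" "disjoint_family_on (\<lambda>i. {c i<..<d i}) {..<n}" "(\<Sum>i<n. d i - c i) < \<delta>"
      have "(\<Sum>i<n. \<bar>ln (\<phi> (d i)) - ln (\<phi> (c i))\<bar>) \<le> (\<Sum>i<n. \<bar>\<phi> (d i) - \<phi> (c i)\<bar> / m)"
      proof (rule sum_mono)
        fix i assume "i \<in> {..<n}"
        then have "m \<le> \<phi> (d i)" "m \<le> \<phi> (c i)" using A(1) unfolding m_def by (auto intro!: x0 intro: order_trans)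
        then show "\<bar>ln (\<phi> (d i)) - ln (\<phi> (c i))\<bar> \<le> \<bar>\<phi> (d i) - \<phi> (c i)\<bar> / m" using m by (intro abs_ln_diff_le)
      qed
      also have "\<dots> = (\<Sum>i<n. \<bar>\<phi> (d i) - \<phi> (c i)\<bar>) / m" by (simp add: sum_divide_distrib)
      also have "\<dots> < e" using ac\<delta>[OF A] m by (simp add: pos_divide_less_eq)
      finally show "(\<Sum>i<n. \<bar>ln (\<phi> (d i)) - ln (\<phi> (c i))\<bar>) < e" .
    qed
  next
    case False
    then have n0: "n = 0" if "\<forall>i<n. a \<le> c i \<and> c i \<le> d i \<and> d i \<le> b" for n :: nat and c d :: "nat \<Rightarrow> real"
      using that by (metis gr0I order_trans)
    then show ?thesis using e by (intro exI[of _ 1]) (auto dest!: n0)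
  qed
qed

text \<open>The logarithm has derivative \<phi>' / \<phi>, bounded by A almost everywhere; absolute
  continuity upgrades this to a global Lipschitz bound.\<close>

lemma log_Lipschitz_of_admissible:
  assumes ac: "locally_absolutely_continuous \<phi>" and pos: "\<And>x. 0 < \<phi> x"
    and d: "AE x in lebesgue. \<exists>d. (\<phi> has_real_derivative d) (at x) \<and> \<bar>d\<bar> \<le> A * \<bar>\<phi> x\<bar>"
  shows "\<phi> x \<le> \<phi> y * exp (A * \<bar>x - y\<bar>)"
proof -
  have d': "AE x in lebesgue. \<exists>d. ((\<lambda>x. ln (\<phi> x)) has_real_derivative d) (at x) \<and> \<bar>d\<bar> \<le> A"
    using d
  proof eventually_elim
    case (elim x)
    then obtain d where d: "(\<phi> has_real_derivative d) (at x)" "\<bar>d\<bar> \<le> A * \<bar>\<phi> x\<bar>" by blast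
    have "((\<lambda>x. ln (\<phi> x)) has_real_derivative (1 / \<phi> x * d)) (at x)"
      using d(1) pos[of x] by (auto intro!: derivative_eq_intros)
    moreover have "\<bar>1 / \<phi> x * d\<bar> \<le> A"
      using d(2) pos[of x] by (simp add: abs_mult field_simps)
    ultimately show ?case by blast
  qed
  note L = absolutely_continuous_imp_Lipschitz[OF locally_absolutely_continuous_ln[OF ac pos] d']
  have "ln (\<phi> x) - ln (\<phi> y) \<le> A * \<bar>x - y\<bar>"
    using L[of x y] L[of y x] by (cases "x \<le> y") auto
  then have "ln (\<phi> x) \<le> ln (\<phi> y * exp (A * \<bar>x - y\<bar>))"
    using pos[of y] by (simp add: ln_mult)
  then show ?thesis using pos[of x] pos[of y] by (subst (asm) ln_le_cancel_iff) auto
qed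

section \<open>The convolution kernel and the truncated weights\<close>

lemma exp_half_abs_le: "exp (- \<bar>x\<bar> / 2) \<le> 8 / (1 + x\<^sup>2)" for x :: real
proof -
  have "1 + (\<bar>x\<bar> / 2) + (\<bar>x\<bar> / 2)\<^sup>2 / 2 \<le> exp (\<bar>x\<bar> / 2)"
    by (rule exp_lower_Taylor_quadratic) simp
  then have "1 + x\<^sup>2 / 8 \<le> exp (\<bar>x\<bar> / 2)" by (simp add: power_divide)
  then have "1 + x\<^sup>2 \<le> 8 * exp (\<bar>x\<bar> / 2)" by simp
  moreover have "0 < 1 + x\<^sup>2" by (simp add: add_pos_nonneg)
  ultimately show ?thesis
    by (simp add: exp_minus field_simps)
qed

lemma integrable_exp_half_abs: "integrable lborel (\<lambda>x::real. exp (- \<bar>x\<bar> / 2))"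
  by (rule Bochner_Integration.integrable_bound[OF integrable_inverse_1_plus_square[of 8]])
    (use exp_half_abs_le in \<open>auto simp: order_trans[OF _ abs_ge_self]\<close>)

lemma integrable_exp_abs: "integrable lborel (\<lambda>x::real. exp (- \<bar>x\<bar>))"
  by (rule Bochner_Integration.integrable_bound[OF integrable_exp_half_abs]) auto

text \<open>As exp (-|x| / 2) \<le> 1, its powers with exponent at least 1 lie below the function
  itself, so one integrable majorant serves all finite p.\<close>

lemma Lp_norm_exp_half_finite:
  assumes "1 \<le> p" "c \<ge> 0" and [measurable]: "w \<in> borel_measurable borel" and le: "\<And>x. \<bar>w x\<bar> \<le> c * exp (- \<bar>x\<bar> / 2)"
  shows "Lp_norm p w < \<infinity>"
proof -
  define h where "h = (\<lambda>x::real. exp (- \<bar>x\<bar> / 2))"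
  have [measurable]: "h \<in> borel_measurable borel" unfolding h_def by measurable
  have "Lp_norm p h < \<infinity>"
  proof (cases "p = \<infinity>")
    case True
    have "Lp_norm p h \<le> ennreal 1"
      unfolding True by (subst Lp_norm_infinity_le_iff) (auto simp: h_def)
    then show ?thesis by (rule le_less_trans) simp
  next
    case False
    define q where "q = enn2real p"
    have q: "q \<ge> 1" unfolding q_def by (rule one_le_enn2real[OF assms(1) False])
    define I where "I = (\<integral>x. h x \<partial>lborel)"
    have I0: "I \<ge> 0" by (simp add: I_def h_def)
    have "(\<integral>\<^sup>+x. ennreal (norm (h x) powr q) \<partial>lborel) \<le> (\<integral>\<^sup>+x. ennreal (h x) \<partial>lborel)"
    proof (intro nn_integral_mono ennreal_leI)
      fix x
      have "h x powr q \<le> h x powr 1" using q by (intro powr_mono') (auto simp: h_def)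
      then show "norm (h x) powr q \<le> h x" by (simp add: h_def)
    qed
    also have "\<dots> = ennreal I" unfolding I_def h_def
      by (rule nn_integral_eq_integral[OF integrable_exp_half_abs]) simp
    also have "I = (I powr (1 / q)) powr q" using q I0 by (simp add: powr_powr)
    finally have "Lp_norm p h \<le> ennreal (I powr (1 / q))"
      by (subst Lp_norm_le_iff[OF assms(1) False]) (auto simp: q_def)
    then show ?thesis by (rule le_less_trans) simp
  qed
  moreover have "Lp_norm p w \<le> Lp_norm p (\<lambda>x. c * h x)"
    by (rule Lp_norm_mono_AE) (use assms in \<open>auto simp: h_def abs_mult\<close>)
  moreover have "Lp_norm p (\<lambda>x. c * h x) \<le> ennreal c * Lp_norm p h"
    by (rule Lp_norm_cmult_le) (use assms in auto)
  ultimately show ?thesis by (auto simp: ennreal_mult_less_top le_less_trans)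
qed

text \<open>Moderateness bounds \<phi>(z + y) by C0 v(z) \<phi>(y), so the kernel is C0 v(z) exp
  (-|z|). Integrability is in the Lebesgue sense, so v(z) exp (-|z|) is replaced by a Borel version
  g; this is why the inequality is stated for almost every z only.\<close>

lemma admissible_kernel:
  assumes "admissible_weight \<phi>"
  obtains A k where "A > 0" "\<And>x. 0 < \<phi> x" "\<And>x y. \<phi> x \<le> \<phi> y * exp (A * \<bar>x - y\<bar>)"
    "k \<in> borel_measurable borel" "\<And>z. 0 \<le> k z" "(\<integral>\<^sup>+z. ennreal (k z) \<partial>lborel) < \<infinity>"
    "AE z in lborel. \<forall>y. \<phi> (z + y) * exp (- \<bar>z\<bar>) \<le> k z * \<phi> y"
proof -
  obtain A where A: "A > 0" "AE x in lebesgue. \<exists>d. (\<phi> has_real_derivative d) (at x) \<and> \<bar>d\<bar> \<le> A * \<bar>\<phi> x\<bar>"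
    using assms unfolding admissible_weight_def by blast
  obtain v where v: "weight_function v" "moderate v \<phi>" "integrable lebesgue (\<lambda>x. v x / exp \<bar>x\<bar>)"
    using assms unfolding admissible_weight_def by blast
  have pos: "0 < \<phi> x" for x using v(2) by (simp add: moderate_def)
  obtain C0 where C0: "C0 > 0" "\<And>x y. \<phi> (x + y) \<le> C0 * v x * \<phi> y" using v(2) unfolding moderate_def by blast
  obtain g where g: "g \<in> borel_measurable lborel" "AE x in lborel. v x / exp \<bar>x\<bar> = g x"
    using completion_ex_borel_measurable_real[OF borel_measurable_integrable[OF v(3)]] by blast
  have [measurable]: "g \<in> borel_measurable borel" using g(1) by simp
  define k where "k = (\<lambda>z. C0 * \<bar>g z\<bar>)"
  have "(\<integral>\<^sup>+z. ennreal (k z) \<partial>lborel) = (\<integral>\<^sup>+z. ennreal C0 * ennreal \<bar>g z\<bar> \<partial>lborel)"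
    using C0 by (simp add: k_def ennreal_mult)
  also have "\<dots> = ennreal C0 * (\<integral>\<^sup>+z. ennreal \<bar>g z\<bar> \<partial>lborel)" by (rule nn_integral_cmult) measurable
  also have "(\<integral>\<^sup>+z. ennreal \<bar>g z\<bar> \<partial>lborel) = (\<integral>\<^sup>+z. ennreal (norm (v z / exp \<bar>z\<bar>)) \<partial>lborel)"
  proof (rule nn_integral_cong_AE)
    show "AE z in lborel. ennreal \<bar>g z\<bar> = ennreal (norm (v z / exp \<bar>z\<bar>))"
      using g(2) by eventually_elim simp
  qed
  also have "ennreal C0 * \<dots> < \<infinity>"
    using v(3) by (simp add: integrable_iff_bounded nn_integral_completion ennreal_mult_less_top)
  finally have fin: "(\<integral>\<^sup>+z. ennreal (k z) \<partial>lborel) < \<infinity>" .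
  have "AE z in lborel. \<forall>y. \<phi> (z + y) * exp (- \<bar>z\<bar>) \<le> k z * \<phi> y"
    using g(2)
  proof eventually_elim
    case (elim z)
    show ?case
    proof
      fix y
      have "\<phi> (z + y) * exp (- \<bar>z\<bar>) \<le> C0 * v z * \<phi> y * exp (- \<bar>z\<bar>)"
        by (intro mult_right_mono C0) simp
      also have "\<dots> = C0 * g z * \<phi> y" using elim by (simp add: exp_minus divide_inverse mult_ac flip: elim)
      also have "\<dots> \<le> k z * \<phi> y" unfolding k_def using C0 pos[of y]
        by (intro mult_right_mono mult_left_mono) auto
      finally show "\<phi> (z + y) * exp (- \<bar>z\<bar>) \<le> k z * \<phi> y" .
    qed
  qed
  moreover have "locally_absolutely_continuous \<phi>" using assms by (simp add: admissible_weight_def)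
  ultimately show ?thesis
    using fin C0 by (intro that[of A k] A pos log_Lipschitz_of_admissible[OF _ pos A(2)]) (auto simp: k_def)
qed

text \<open>Truncated weights \<open>min \<phi> (n exp (-\<bar>x\<bar>/2))\<close> make all weighted norms finite a priori,
  with constants independent of \<open>n\<close>.\<close>

lemma admissible_truncation:
  assumes "admissible_weight \<phi>"
  obtains A K k w where "A > 0" "K > 0" "k \<in> borel_measurable borel" "\<And>z. 0 \<le> k z" "(\<integral>\<^sup>+z. ennreal (k z) \<partial>lborel) \<le> ennreal K"
    "\<phi> \<in> borel_measurable borel" "\<And>x. 0 < \<phi> x"
    "\<And>n::nat. w n \<in> borel_measurable borel" "\<And>n x. 0 < w n x" "\<And>n x. w n x \<le> \<phi> x" "\<And>n x. w n x \<le> w (Suc n) x"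
    "\<And>n x y. w n x \<le> w n y * exp (A * \<bar>x - y\<bar>)"
    "\<And>n p. 1 \<le> p \<Longrightarrow> Lp_norm p (w n) < \<infinity>"
    "\<And>n. AE z in lborel. \<forall>y. w n (z + y) * exp (- \<bar>z\<bar>) \<le> k z * w n y"
    "\<And>x. \<forall>\<^sub>F n in sequentially. w n x = \<phi> x"
proof (rule admissible_kernel[OF assms])
  fix A0 k0
  assume A0: "A0 > 0" and pos: "\<And>x. 0 < \<phi> x" and lip: "\<And>x y. \<phi> x \<le> \<phi> y * exp (A0 * \<bar>x - y\<bar>)"
    and k0m[measurable]: "k0 \<in> borel_measurable borel" and k0: "\<And>z. 0 \<le> k0 z" "(\<integral>\<^sup>+z. ennreal (k0 z) \<partial>lborel) < \<infinity>"
    and ker: "AE z in lborel. \<forall>y. \<phi> (z + y) * exp (- \<bar>z\<bar>) \<le> k0 z * \<phi> y"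
  \<comment> \<open>The rate 1/2 is below that of exp (-|z|): by the triangle inequality h(z + y)
    exp (-|z|) \<le> h(z) h(y), so h satisfies the kernel inequality with h as its own
    kernel.\<close>
  define h where "h = (\<lambda>x::real. exp (- \<bar>x\<bar> / 2))"
  \<comment> \<open>\<open>A\<close> covers the Lipschitz constants of ln \<phi> and of ln h, and
    \<open>k\<close> dominates the kernels of both. In \<open>w\<close>, the factor
    \<open>Suc n\<close> keeps the weight positive for n = 0.\<close>
  define A where "A = max A0 (1 / 2)"
  define k where "k = (\<lambda>z. k0 z + h z)"
  define w where "w = (\<lambda>(n::nat) x. min (\<phi> x) (real (Suc n) * h x))"
  have [measurable]: "h \<in> borel_measurable borel" unfolding h_def by measurable
  have "locally_absolutely_continuous \<phi>" using assms by (simp add: admissible_weight_def)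
  from borel_measurable_continuous_onI[OF locally_absolutely_continuous_imp_continuous[OF this]]
  have \<phi>m[measurable]: "\<phi> \<in> borel_measurable borel" .
  define K where "K = enn2real (\<integral>\<^sup>+z. ennreal (k z) \<partial>lborel) + 1"
  have hpos: "h x > 0" for x by (simp add: h_def)
  have "(\<integral>\<^sup>+z. ennreal (k z) \<partial>lborel) = (\<integral>\<^sup>+z. ennreal (k0 z) + ennreal (h z) \<partial>lborel)"
    unfolding k_def using k0(1) hpos by (intro nn_integral_cong ennreal_plus) (auto intro: less_imp_le)
  also have "\<dots> = (\<integral>\<^sup>+z. ennreal (k0 z) \<partial>lborel) + (\<integral>\<^sup>+z. ennreal (h z) \<partial>lborel)"
    by (rule nn_integral_add) measurable
  also have "\<dots> < \<infinity>"
    using k0(2) nn_integral_eq_integral[OF integrable_exp_half_abs] by (simp add: h_def)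
  finally have kfin: "(\<integral>\<^sup>+z. ennreal (k z) \<partial>lborel) < \<infinity>" .
  have hlip: "h x \<le> h y * exp (1 / 2 * \<bar>x - y\<bar>)" for x y
  proof -
    have "- \<bar>x\<bar> / 2 \<le> - \<bar>y\<bar> / 2 + 1 / 2 * \<bar>x - y\<bar>"
      using abs_triangle_ineq2[of y x] abs_minus_commute[of x y] by (simp add: field_simps)
    then show ?thesis by (simp only: h_def exp_add[symmetric] exp_le_cancel_iff)
  qed
  have up: "\<phi> y * exp (A0 * \<bar>x - y\<bar>) \<le> \<phi> y * exp (A * \<bar>x - y\<bar>)" "h y * exp (1 / 2 * \<bar>x - y\<bar>) \<le> h y * exp (A * \<bar>x - y\<bar>)" for x y
  proof -
    have "A0 * \<bar>x - y\<bar> \<le> A * \<bar>x - y\<bar>" "1 / 2 * \<bar>x - y\<bar> \<le> A * \<bar>x - y\<bar>"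
      by (intro mult_right_mono; simp add: A_def)+
    then have "exp (A0 * \<bar>x - y\<bar>) \<le> exp (A * \<bar>x - y\<bar>)" "exp (1 / 2 * \<bar>x - y\<bar>) \<le> exp (A * \<bar>x - y\<bar>)"
      by simp_all
    then show "\<phi> y * exp (A0 * \<bar>x - y\<bar>) \<le> \<phi> y * exp (A * \<bar>x - y\<bar>)" "h y * exp (1 / 2 * \<bar>x - y\<bar>) \<le> h y * exp (A * \<bar>x - y\<bar>)"
      using pos[of y] hpos[of y] by (auto intro!: mult_left_mono)
  qed
  show ?thesis
  proof (rule that[of A K k w])
    show "A > 0" by (simp add: A_def)
    show "K > 0" by (simp add: K_def add_nonneg_pos)
    show "k \<in> borel_measurable borel" unfolding k_def by measurable
    show "0 \<le> k z" for z using k0(1)[of z] hpos[of z] by (simp add: k_def)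
    show "(\<integral>\<^sup>+z. ennreal (k z) \<partial>lborel) \<le> ennreal K"
    proof -
      have "(\<integral>\<^sup>+z. ennreal (k z) \<partial>lborel) = ennreal (enn2real (\<integral>\<^sup>+z. ennreal (k z) \<partial>lborel))"
        using kfin by simp
      also have "\<dots> \<le> ennreal K" unfolding K_def by (intro ennreal_leI) simp
      finally show ?thesis .
    qed
    show "\<phi> \<in> borel_measurable borel" by measurable
    show "0 < \<phi> x" for x by (rule pos)
    show wm: "w n \<in> borel_measurable borel" for n unfolding w_def by measurable
    show w0: "0 < w n x" for n x using pos hpos by (simp add: w_def)
    show "w n x \<le> \<phi> x" for n x by (simp add: w_def)
    show "w n x \<le> w (Suc n) x" for n x
      unfolding w_def using hpos[of x] by (intro min.mono mult_right_mono) auto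
    show "w n x \<le> w n y * exp (A * \<bar>x - y\<bar>)" for n x y
    proof -
      have "\<phi> x \<le> \<phi> y * exp (A * \<bar>x - y\<bar>)" using lip[of x y] up(1)[of y x] by linarith
      moreover have "real (Suc n) * h x \<le> real (Suc n) * h y * exp (A * \<bar>x - y\<bar>)"
      proof -
        have "h x \<le> h y * exp (A * \<bar>x - y\<bar>)" using hlip[of x y] up(2)[of y x] by linarith
        then show ?thesis unfolding mult.assoc by (intro mult_left_mono) auto
      qed
      ultimately have "w n x \<le> \<phi> y * exp (A * \<bar>x - y\<bar>)" "w n x \<le> real (Suc n) * h y * exp (A * \<bar>x - y\<bar>)"
        unfolding w_def by (meson min.cobounded1 min.cobounded2 order_trans)+
      then show ?thesis
        by (cases "\<phi> y \<le> real (Suc n) * h y") (simp_all only: w_def min_def if_True if_False)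
    qed
    show "Lp_norm p (w n) < \<infinity>" if "1 \<le> p" for n p
      by (rule Lp_norm_exp_half_finite[OF that, where c = "real (Suc n)"])
        (use w0[of n] wm in \<open>auto simp: abs_of_pos simp del: of_nat_Suc\<close>, simp add: w_def h_def)
    show "AE z in lborel. \<forall>y. w n (z + y) * exp (- \<bar>z\<bar>) \<le> k z * w n y" for n
      using ker
    proof eventually_elim
      case (elim z)
      show ?case
      proof
        fix y
        have "w n (z + y) * exp (- \<bar>z\<bar>) \<le> \<phi> (z + y) * exp (- \<bar>z\<bar>)" by (intro mult_right_mono) (auto simp: w_def)
        also have "\<dots> \<le> k0 z * \<phi> y" using elim by blast
        also have "\<dots> \<le> k z * \<phi> y" using pos[of y] hpos[of z] by (intro mult_right_mono) (auto simp: k_def)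
        finally have 1: "w n (z + y) * exp (- \<bar>z\<bar>) \<le> k z * \<phi> y" .
        have "w n (z + y) * exp (- \<bar>z\<bar>) \<le> real (Suc n) * h (z + y) * exp (- \<bar>z\<bar>)"
          by (intro mult_right_mono) (auto simp: w_def)
        also have "\<dots> = real (Suc n) * (h (z + y) * exp (- \<bar>z\<bar>))" by simp
        also have "\<dots> \<le> real (Suc n) * (h z * h y)"
        proof (intro mult_left_mono)
          have "- \<bar>z + y\<bar> / 2 + - \<bar>z\<bar> \<le> - \<bar>z\<bar> / 2 + - \<bar>y\<bar> / 2"
            using abs_triangle_ineq4[of "z + y" z] by simp
          then show "h (z + y) * exp (- \<bar>z\<bar>) \<le> h z * h y"
            unfolding h_def exp_add[symmetric] by simp
        qed simp
        also have "\<dots> \<le> k z * (real (Suc n) * h y)"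
        proof -
          have "h z * (real (Suc n) * h y) \<le> k z * (real (Suc n) * h y)"
            using k0(1)[of z] hpos[of y] by (intro mult_right_mono) (auto simp: k_def)
          then show ?thesis by (simp add: mult_ac)
        qed
        finally have 2: "w n (z + y) * exp (- \<bar>z\<bar>) \<le> k z * (real (Suc n) * h y)" .
        show "w n (z + y) * exp (- \<bar>z\<bar>) \<le> k z * w n y"
          using 1 2 by (cases "\<phi> y \<le> real (Suc n) * h y") (simp_all only: w_def min_def if_True if_False)
      qed
    qed
    show "\<forall>\<^sub>F n in sequentially. w n x = \<phi> x" for x
    proof -
      obtain N :: nat where N: "\<phi> x / h x \<le> real N" using real_arch_simple by blast
      show ?thesis
        unfolding eventually_sequentially
      proof (intro exI[of _ N] allI impI)
        fix n assume "N \<le> n"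
        then have "\<phi> x / h x \<le> real (Suc n)" using N by simp
        then have "\<phi> x \<le> real (Suc n) * h x" using hpos[of x] by (simp add: pos_divide_le_eq)
        then show "w n x = \<phi> x" by (simp add: w_def)
      qed
    qed
  qed
qed

section \<open>Bounded uniformly continuous functions and Gaussian mollification\<close>

text \<open>Boundedness and uniform continuity jointly in time and space. The line is not compact,
  so uniformity in x has to be part of the notion; it is what makes the error of an Euler step
  uniform in x.\<close>

definition BUC :: "real set \<Rightarrow> (real \<Rightarrow> real \<Rightarrow> real) \<Rightarrow> bool" where
  "BUC I f \<longleftrightarrow> (\<exists>B. \<forall>t\<in>I. \<forall>x. \<bar>f t x\<bar> \<le> B) \<and>
     (\<forall>e>0. \<exists>d>0. \<forall>t\<in>I. \<forall>t'\<in>I. \<forall>x x'. \<bar>t' - t\<bar> < d \<longrightarrow> \<bar>x' - x\<bar> < d \<longrightarrow> \<bar>f t' x' - f t x\<bar> < e)"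

lemma BUC_bounded:
  assumes "BUC I f"
  obtains B where "B > 0" "\<And>t x. t \<in> I \<Longrightarrow> \<bar>f t x\<bar> \<le> B"
proof -
  obtain B where "\<forall>t\<in>I. \<forall>x. \<bar>f t x\<bar> \<le> B" using assms unfolding BUC_def by blast
  then have "\<bar>f t x\<bar> \<le> \<bar>B\<bar> + 1" if "t \<in> I" for t x
    using that by (metis abs_ge_self add_increasing2 order_trans zero_le_one)
  then show ?thesis by (intro that[of "\<bar>B\<bar> + 1"]) auto
qed

lemma BUC_uniform:
  assumes "BUC I f" "e > 0"
  obtains d where "d > 0" "\<And>t t' x x'. t \<in> I \<Longrightarrow> t' \<in> I \<Longrightarrow> \<bar>t' - t\<bar> < d \<Longrightarrow> \<bar>x' - x\<bar> < d \<Longrightarrow> \<bar>f t' x' - f t x\<bar> < e"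
proof -
  obtain d where "d > 0" "\<forall>t\<in>I. \<forall>t'\<in>I. \<forall>x x'. \<bar>t' - t\<bar> < d \<longrightarrow> \<bar>x' - x\<bar> < d \<longrightarrow> \<bar>f t' x' - f t x\<bar> < e"
    using assms unfolding BUC_def by meson
  then show ?thesis by (intro that[of d]) simp_all
qed

lemma BUC_I:
  assumes "\<And>t x. t \<in> I \<Longrightarrow> \<bar>f t x\<bar> \<le> B"
    and "\<And>e. e > 0 \<Longrightarrow> \<exists>d>0. \<forall>t\<in>I. \<forall>t'\<in>I. \<forall>x x'. \<bar>t' - t\<bar> < d \<longrightarrow> \<bar>x' - x\<bar> < d \<longrightarrow> \<bar>f t' x' - f t x\<bar> < e"
  shows "BUC I f"
  using assms unfolding BUC_def by blast

lemma BUC_continuous: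
  assumes "BUC I f" "t \<in> I"
  shows "continuous_on UNIV (f t)"
  unfolding continuous_on_iff
proof (intro ballI allI impI)
  fix x e :: real assume "e > 0"
  from BUC_uniform[OF assms(1) this] obtain d where d: "d > 0"
    "\<And>t t' x x'. t \<in> I \<Longrightarrow> t' \<in> I \<Longrightarrow> \<bar>t' - t\<bar> < d \<Longrightarrow> \<bar>x' - x\<bar> < d \<Longrightarrow> \<bar>f t' x' - f t x\<bar> < e" by metis
  show "\<exists>d>0. \<forall>x'\<in>UNIV. dist x' x < d \<longrightarrow> dist (f t x') (f t x) < e"
    by (rule exI[of _ d]) (auto simp: d(1) dist_real_def intro!: d(2) assms(2))
qed

lemma BUC_measurable:
  assumes "BUC I f" "t \<in> I"
  shows "f t \<in> borel_measurable borel"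
  by (intro borel_measurable_continuous_onI BUC_continuous[OF assms])

lemma BUC_cmult:
  assumes "BUC I f"
  shows "BUC I (\<lambda>t x. c * f t x)"
proof -
  obtain B where B: "B > 0" "\<And>t x. t \<in> I \<Longrightarrow> \<bar>f t x\<bar> \<le> B" using BUC_bounded[OF assms] by metis
  show ?thesis
  proof (rule BUC_I[where B = "\<bar>c\<bar> * B"])
    show "\<bar>c * f t x\<bar> \<le> \<bar>c\<bar> * B" if "t \<in> I" for t x
      using B(2)[OF that] by (simp add: abs_mult mult_left_mono)
    fix e :: real assume e: "e > 0"
    then have "e / (\<bar>c\<bar> + 1) > 0" by (simp add: add_nonneg_pos)
    from BUC_uniform[OF assms this] obtain d where d: "d > 0"
      "\<And>t t' x x'. t \<in> I \<Longrightarrow> t' \<in> I \<Longrightarrow> \<bar>t' - t\<bar> < d \<Longrightarrow> \<bar>x' - x\<bar> < d \<Longrightarrow> \<bar>f t' x' - f t x\<bar> < e / (\<bar>c\<bar> + 1)" by metis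
    have "\<bar>c * f t' x' - c * f t x\<bar> < e" if "t \<in> I" "t' \<in> I" "\<bar>t' - t\<bar> < d" "\<bar>x' - x\<bar> < d" for t t' x x'
    proof -
      have "\<bar>c * f t' x' - c * f t x\<bar> = \<bar>c\<bar> * \<bar>f t' x' - f t x\<bar>" by (simp add: abs_mult right_diff_distrib[symmetric])
      also have "\<dots> \<le> (\<bar>c\<bar> + 1) * \<bar>f t' x' - f t x\<bar>" by (intro mult_right_mono) auto
      also have "\<dots> < e" using d(2)[OF that] by (simp add: pos_less_divide_eq mult.commute add_nonneg_pos)
      finally show ?thesis .
    qed
    then show "\<exists>d>0. \<forall>t\<in>I. \<forall>t'\<in>I. \<forall>x x'. \<bar>t' - t\<bar> < d \<longrightarrow> \<bar>x' - x\<bar> < d \<longrightarrow> \<bar>c * f t' x' - c * f t x\<bar> < e"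
      using d(1) by (intro exI[of _ d]) simp
  qed
qed

lemma BUC_add:
  assumes f: "BUC I f" and g: "BUC I g"
  shows "BUC I (\<lambda>t x. f t x + g t x)"
proof -
  obtain B where B: "B > 0" "\<And>t x. t \<in> I \<Longrightarrow> \<bar>f t x\<bar> \<le> B" using BUC_bounded[OF f] by metis
  obtain C where C: "C > 0" "\<And>t x. t \<in> I \<Longrightarrow> \<bar>g t x\<bar> \<le> C" using BUC_bounded[OF g] by metis
  show ?thesis
  proof (rule BUC_I[where B = "B + C"])
    show "\<bar>f t x + g t x\<bar> \<le> B + C" if "t \<in> I" for t x
      using B(2)[OF that, of x] C(2)[OF that, of x] by linarith
    fix e :: real assume e: "e > 0"
    then have e2: "e / 2 > 0" by simp
    from BUC_uniform[OF f e2] obtain d where d: "d > 0"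
      "\<And>t t' x x'. t \<in> I \<Longrightarrow> t' \<in> I \<Longrightarrow> \<bar>t' - t\<bar> < d \<Longrightarrow> \<bar>x' - x\<bar> < d \<Longrightarrow> \<bar>f t' x' - f t x\<bar> < e / 2" by metis
    from BUC_uniform[OF g e2] obtain d' where d': "d' > 0"
      "\<And>t t' x x'. t \<in> I \<Longrightarrow> t' \<in> I \<Longrightarrow> \<bar>t' - t\<bar> < d' \<Longrightarrow> \<bar>x' - x\<bar> < d' \<Longrightarrow> \<bar>g t' x' - g t x\<bar> < e / 2" by metis
    have "\<bar>f t' x' + g t' x' - (f t x + g t x)\<bar> < e" if "t \<in> I" "t' \<in> I" "\<bar>t' - t\<bar> < min d d'" "\<bar>x' - x\<bar> < min d d'" for t t' x x'
    proof -
      have "\<bar>f t' x' - f t x\<bar> < e / 2" "\<bar>g t' x' - g t x\<bar> < e / 2" using d(2) d'(2) that by simp_all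
      then show ?thesis by linarith
    qed
    then show "\<exists>d>0. \<forall>t\<in>I. \<forall>t'\<in>I. \<forall>x x'. \<bar>t' - t\<bar> < d \<longrightarrow> \<bar>x' - x\<bar> < d \<longrightarrow> \<bar>f t' x' + g t' x' - (f t x + g t x)\<bar> < e"
      using d(1) d'(1) by (intro exI[of _ "min d d'"]) simp
  qed
qed

lemma BUC_mult:
  assumes f: "BUC I f" and g: "BUC I g"
  shows "BUC I (\<lambda>t x. f t x * g t x)"
proof -
  obtain B where B: "B > 0" "\<And>t x. t \<in> I \<Longrightarrow> \<bar>f t x\<bar> \<le> B" using BUC_bounded[OF f] by metis
  obtain C where C: "C > 0" "\<And>t x. t \<in> I \<Longrightarrow> \<bar>g t x\<bar> \<le> C" using BUC_bounded[OF g] by metis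
  show ?thesis
  proof (rule BUC_I[where B = "B * C"])
    show "\<bar>f t x * g t x\<bar> \<le> B * C" if "t \<in> I" for t x
      using B(2)[OF that, of x] C(2)[OF that, of x] B(1) unfolding abs_mult by (intro mult_mono) auto
    fix e :: real assume e: "e > 0"
    then have e2: "e / (2 * C) > 0" "e / (2 * B) > 0" using B(1) C(1) by simp_all
    from BUC_uniform[OF f e2(1)] obtain d where d: "d > 0"
      "\<And>t t' x x'. t \<in> I \<Longrightarrow> t' \<in> I \<Longrightarrow> \<bar>t' - t\<bar> < d \<Longrightarrow> \<bar>x' - x\<bar> < d \<Longrightarrow> \<bar>f t' x' - f t x\<bar> < e / (2 * C)" by metis
    from BUC_uniform[OF g e2(2)] obtain d' where d': "d' > 0"
      "\<And>t t' x x'. t \<in> I \<Longrightarrow> t' \<in> I \<Longrightarrow> \<bar>t' - t\<bar> < d' \<Longrightarrow> \<bar>x' - x\<bar> < d' \<Longrightarrow> \<bar>g t' x' - g t x\<bar> < e / (2 * B)" by metis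
    have "\<bar>f t' x' * g t' x' - f t x * g t x\<bar> < e" if t: "t \<in> I" "t' \<in> I" "\<bar>t' - t\<bar> < min d d'" "\<bar>x' - x\<bar> < min d d'" for t t' x x'
    proof -
      have "f t' x' * g t' x' - f t x * g t x = (f t' x' - f t x) * g t' x' + f t x * (g t' x' - g t x)"
        by (simp add: algebra_simps)
      then have "\<bar>f t' x' * g t' x' - f t x * g t x\<bar> \<le> \<bar>f t' x' - f t x\<bar> * \<bar>g t' x'\<bar> + \<bar>f t x\<bar> * \<bar>g t' x' - g t x\<bar>"
        by (metis abs_mult abs_triangle_ineq)
      also have "\<dots> \<le> \<bar>f t' x' - f t x\<bar> * C + B * \<bar>g t' x' - g t x\<bar>"
        using t by (intro add_mono mult_left_mono mult_right_mono B C) auto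
      also have "\<dots> < e / (2 * C) * C + B * (e / (2 * B))"
        using t B(1) C(1) by (intro add_strict_mono mult_strict_right_mono mult_strict_left_mono d(2) d'(2)) auto
      also have "\<dots> = e" using B(1) C(1) by (simp add: field_simps)
      finally show ?thesis .
    qed
    then show "\<exists>d>0. \<forall>t\<in>I. \<forall>t'\<in>I. \<forall>x x'. \<bar>t' - t\<bar> < d \<longrightarrow> \<bar>x' - x\<bar> < d \<longrightarrow> \<bar>f t' x' * g t' x' - f t x * g t x\<bar> < e"
      using d(1) d'(1) by (intro exI[of _ "min d d'"]) simp
  qed
qed

lemma BUC_diff: "BUC I f \<Longrightarrow> BUC I g \<Longrightarrow> BUC I (\<lambda>t x. f t x - g t x)"
  using BUC_add[of I f "\<lambda>t x. (- 1) * g t x"] BUC_cmult[of I g "- 1"] by simp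

lemma conv_eq:
  "conv k f x = (\<integral>z. k z * f (x - z) \<partial>lborel)"
  unfolding conv_def
  using lborel_integral_real_affine[of "-1" "\<lambda>y. k (x - y) * f y" x] by simp

lemma integrable_conv:
  fixes k f :: "real \<Rightarrow> real"
  assumes k: "integrable lborel k" and f[measurable]: "f \<in> borel_measurable borel" and B: "\<And>x. \<bar>f x\<bar> \<le> B"
  shows "integrable lborel (\<lambda>z. k z * f (x - z))"
proof (rule Bochner_Integration.integrable_bound)
  have [measurable]: "k \<in> borel_measurable borel" using k by auto
  show "integrable lborel (\<lambda>z. B * \<bar>k z\<bar>)" using k by simp
  have "\<bar>k z * f (x - z)\<bar> \<le> \<bar>B * \<bar>k z\<bar>\<bar>" for z
  proof -
    have "\<bar>k z * f (x - z)\<bar> \<le> B * \<bar>k z\<bar>"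
      unfolding abs_mult mult.commute[of "\<bar>k z\<bar>"] by (intro mult_right_mono B) simp
    then show ?thesis by simp
  qed
  then show "AE z in lborel. norm (k z * f (x - z)) \<le> norm (B * \<bar>k z\<bar>)" by simp
  show "(\<lambda>z. k z * f (x - z)) \<in> borel_measurable lborel" by measurable
qed

lemma abs_integral_kernel_le:
  fixes k h :: "real \<Rightarrow> real"
  assumes k: "integrable lborel k" and h: "integrable lborel (\<lambda>z. k z * h z)" and B: "\<And>z. \<bar>h z\<bar> \<le> B"
  shows "\<bar>\<integral>z. k z * h z \<partial>lborel\<bar> \<le> B * (\<integral>z. \<bar>k z\<bar> \<partial>lborel)"
proof -
  have "\<bar>\<integral>z. k z * h z \<partial>lborel\<bar> \<le> (\<integral>z. \<bar>k z * h z\<bar> \<partial>lborel)"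
    using integral_norm_bound[of lborel "\<lambda>z. k z * h z"] by simp
  also have "\<dots> \<le> (\<integral>z. B * \<bar>k z\<bar> \<partial>lborel)"
  proof (rule integral_mono)
    show "integrable lborel (\<lambda>z. \<bar>k z * h z\<bar>)" using h by simp
    show "integrable lborel (\<lambda>z. B * \<bar>k z\<bar>)" using k by simp
    show "\<bar>k z * h z\<bar> \<le> B * \<bar>k z\<bar>" for z
      unfolding abs_mult mult.commute[of "\<bar>k z\<bar>"] by (intro mult_right_mono B) simp
  qed
  also have "\<dots> = B * (\<integral>z. \<bar>k z\<bar> \<partial>lborel)" by simp
  finally show ?thesis .
qed

lemma BUC_conv:
  assumes f: "BUC I f" and k: "integrable lborel k"
  shows "BUC I (\<lambda>t. conv k (f t))"
proof -
  obtain B where B: "B > 0" "\<And>t x. t \<in> I \<Longrightarrow> \<bar>f t x\<bar> \<le> B" using BUC_bounded[OF f] by metis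
  define N where "N = (\<integral>z. \<bar>k z\<bar> \<partial>lborel)"
  have N: "N \<ge> 0" by (simp add: N_def)
  have ii: "integrable lborel (\<lambda>z. k z * f t (x - z))" if "t \<in> I" for t x
    using that B(2) by (intro integrable_conv k BUC_measurable[OF f]) auto
  show ?thesis
  proof (rule BUC_I[where B = "B * N"])
    show "\<bar>conv k (f t) x\<bar> \<le> B * N" if "t \<in> I" for t x
      unfolding conv_eq N_def by (rule abs_integral_kernel_le[OF k ii[OF that]]) (rule B(2)[OF that])
    fix e :: real assume e: "e > 0"
    then have "e / (N + 1) > 0" using N by simp
    from BUC_uniform[OF f this] obtain d where d: "d > 0"
      "\<And>t t' x x'. t \<in> I \<Longrightarrow> t' \<in> I \<Longrightarrow> \<bar>t' - t\<bar> < d \<Longrightarrow> \<bar>x' - x\<bar> < d \<Longrightarrow> \<bar>f t' x' - f t x\<bar> < e / (N + 1)" by metis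
    have "\<bar>conv k (f t') x' - conv k (f t) x\<bar> < e" if t: "t \<in> I" "t' \<in> I" "\<bar>t' - t\<bar> < d" "\<bar>x' - x\<bar> < d" for t t' x x'
    proof -
      have "conv k (f t') x' - conv k (f t) x = (\<integral>z. k z * (f t' (x' - z) - f t (x - z)) \<partial>lborel)"
        unfolding conv_eq right_diff_distrib by (rule Bochner_Integration.integral_diff[OF ii ii, symmetric]) (use t in auto)
      also have "\<bar>\<integral>z. k z * (f t' (x' - z) - f t (x - z)) \<partial>lborel\<bar> \<le> e / (N + 1) * N"
        unfolding N_def
      proof (rule abs_integral_kernel_le[OF k])
        show "integrable lborel (\<lambda>z. k z * (f t' (x' - z) - f t (x - z)))"
          unfolding right_diff_distrib using t by (intro Bochner_Integration.integrable_diff ii)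
        show "\<bar>f t' (x' - z) - f t (x - z)\<bar> \<le> e / ((\<integral>z. \<bar>k z\<bar> \<partial>lborel) + 1)" for z
          using d(2)[OF t(1,2,3), of "x' - z" "x - z"] t(4) unfolding N_def by simp
      qed
      finally have le: "\<bar>conv k (f t') x' - conv k (f t) x\<bar> \<le> e / (N + 1) * N" .
      have "e / (N + 1) * N < e"
        using e N by (simp add: pos_divide_less_eq)
      then show ?thesis using le by linarith
    qed
    then show "\<exists>d>0. \<forall>t\<in>I. \<forall>t'\<in>I. \<forall>x x'. \<bar>t' - t\<bar> < d \<longrightarrow> \<bar>x' - x\<bar> < d \<longrightarrow> \<bar>conv k (f t') x' - conv k (f t) x\<bar> < e"
      using d(1) by (intro exI[of _ d]) simp
  qed
qed

lemma compact_real_cover: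
  fixes I :: "real set"
  assumes I: "compact I" and r: "\<And>t. t \<in> I \<Longrightarrow> r t > 0"
  obtains J where "J \<subseteq> I" "finite J" "\<And>t. t \<in> I \<Longrightarrow> \<exists>s\<in>J. \<bar>t - s\<bar> < r s"
proof -
  have o: "open (ball s (r s))" for s by simp
  have c: "I \<subseteq> (\<Union>s\<in>I. ball s (r s))" using r by (auto intro: bexI)
  from I have "compact I" .
  then obtain J where J: "J \<subseteq> I" "finite J" "I \<subseteq> (\<Union>s\<in>J. ball s (r s))"
    by (rule compactE_image[OF _ o c])
  have "\<exists>s\<in>J. \<bar>t - s\<bar> < r s" if "t \<in> I" for t
  proof -
    from that J(3) have "t \<in> (\<Union>s\<in>J. ball s (r s))" by (rule rev_subsetD)
    then obtain s where "s \<in> J" "t \<in> ball s (r s)" by (rule UN_E)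
    then show ?thesis by (intro bexI[of _ s]) (simp_all add: dist_real_def abs_minus_commute)
  qed
  with J(1,2) show ?thesis by (rule that)
qed

text \<open>A finite subcover of the times reduces both properties to finitely many time slices,
  each bounded and uniformly continuous; the passage to neighbouring times is uniform in x by
  \<open>tc\<close>.\<close>

lemma BUC_compact_I:
  assumes I: "compact I"
    and uc: "\<And>t. t \<in> I \<Longrightarrow> uniformly_continuous_on UNIV (f t)"
    and bd: "\<And>t. t \<in> I \<Longrightarrow> \<exists>B. \<forall>x. \<bar>f t x\<bar> \<le> B"
    and tc: "\<And>t e. t \<in> I \<Longrightarrow> e > 0 \<Longrightarrow> \<exists>d>0. \<forall>t'\<in>I. \<bar>t' - t\<bar> < d \<longrightarrow> (\<forall>x. \<bar>f t' x - f t x\<bar> \<le> e)"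
  shows "BUC I f"
proof -
  have "\<exists>B. \<forall>t\<in>I. \<forall>x. \<bar>f t x\<bar> \<le> B"
  proof -
    have "\<forall>t\<in>I. \<exists>r. r > 0 \<and> (\<forall>t'\<in>I. \<bar>t' - t\<bar> < r \<longrightarrow> (\<forall>x. \<bar>f t' x - f t x\<bar> \<le> 1))"
      by (intro ballI tc zero_less_one)
    from bchoice[OF this] obtain r where r0: "\<forall>t\<in>I. r t > 0 \<and> (\<forall>t'\<in>I. \<bar>t' - t\<bar> < r t \<longrightarrow> (\<forall>x. \<bar>f t' x - f t x\<bar> \<le> 1))" ..
    have r: "t \<in> I \<Longrightarrow> r t > 0" "t \<in> I \<Longrightarrow> t' \<in> I \<Longrightarrow> \<bar>t' - t\<bar> < r t \<Longrightarrow> \<bar>f t' x - f t x\<bar> \<le> 1" for t t' x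
      using bspec[OF r0, of t] by simp_all
    obtain J where J: "J \<subseteq> I" "finite J" "\<And>t. t \<in> I \<Longrightarrow> \<exists>s\<in>J. \<bar>t - s\<bar> < r s"
      using compact_real_cover[OF I, of r] r(1) by metis
    have "\<forall>t\<in>I. \<exists>B. \<forall>x. \<bar>f t x\<bar> \<le> B" using bd by blast
    from bchoice[OF this] obtain B where B0: "\<forall>t\<in>I. \<forall>x. \<bar>f t x\<bar> \<le> B t" ..
    have B: "t \<in> I \<Longrightarrow> \<bar>f t x\<bar> \<le> B t" for t x using B0 by blast
    have "\<bar>f t x\<bar> \<le> (\<Sum>s\<in>J. \<bar>B s\<bar>) + 1" if t: "t \<in> I" for t x
    proof -
      obtain s where s: "s \<in> J" "\<bar>t - s\<bar> < r s" using J(3)[OF t] by (rule bexE)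
      then have sI: "s \<in> I" using J(1) by blast
      have "\<bar>f t x - f s x\<bar> \<le> 1" by (rule r(2)[OF sI t s(2)])
      moreover have "\<bar>f s x\<bar> \<le> \<bar>B s\<bar>" using B[OF sI, of x] by linarith
      moreover have "\<bar>B s\<bar> \<le> (\<Sum>s\<in>J. \<bar>B s\<bar>)" using J(2) s(1) by (intro member_le_sum) auto
      ultimately show ?thesis by linarith
    qed
    then show ?thesis by (intro exI[of _ "(\<Sum>s\<in>J. \<bar>B s\<bar>) + 1"] ballI allI)
  qed
  then obtain B where "\<forall>t\<in>I. \<forall>x. \<bar>f t x\<bar> \<le> B" ..
  then have B: "t \<in> I \<Longrightarrow> \<bar>f t x\<bar> \<le> B" for t x by simp
  show ?thesis
  proof (rule BUC_I[OF B])
    fix e :: real assume e: "e > 0"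
    then have e4: "e / 4 > 0" by simp
    \<comment> \<open>The time condition has radius 2 r because t lies within r of a centre s and t'
      within another r of t. The three differences through the slice at s cost e / 4 each.\<close>
    have "\<exists>r. r > 0 \<and> (\<forall>t'\<in>I. \<bar>t' - t\<bar> < 2 * r \<longrightarrow> (\<forall>x. \<bar>f t' x - f t x\<bar> \<le> e / 4)) \<and> (\<forall>x x'. \<bar>x' - x\<bar> < r \<longrightarrow> \<bar>f t x' - f t x\<bar> < e / 4)"
      if t: "t \<in> I" for t
    proof -
      obtain d where d: "d > 0" "\<forall>t'\<in>I. \<bar>t' - t\<bar> < d \<longrightarrow> (\<forall>x. \<bar>f t' x - f t x\<bar> \<le> e / 4)" using tc[OF t e4] by blast
      obtain d' where d': "d' > 0" "\<And>x x'. \<bar>x' - x\<bar> < d' \<Longrightarrow> \<bar>f t x' - f t x\<bar> < e / 4"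
        using uc[OF t, unfolded uniformly_continuous_on_def dist_real_def, rule_format, OF e4] by auto
      show ?thesis
      proof (intro exI[of _ "min (d / 2) d'"] conjI ballI allI impI)
        show "0 < min (d / 2) d'" using d(1) d'(1) by simp
        show "\<bar>f t' x - f t x\<bar> \<le> e / 4" if "t' \<in> I" "\<bar>t' - t\<bar> < 2 * min (d / 2) d'" for t' x
        proof -
          have "\<bar>t' - t\<bar> < d" using that(2) by linarith
          then show ?thesis using d(2) that(1) by blast
        qed
        show "\<bar>f t x' - f t x\<bar> < e / 4" if "\<bar>x' - x\<bar> < min (d / 2) d'" for x x'
          by (rule d'(2)) (use that in linarith)
      qed
    qed
    then have "\<forall>t\<in>I. \<exists>r. r > 0 \<and> (\<forall>t'\<in>I. \<bar>t' - t\<bar> < 2 * r \<longrightarrow> (\<forall>x. \<bar>f t' x - f t x\<bar> \<le> e / 4)) \<and> (\<forall>x x'. \<bar>x' - x\<bar> < r \<longrightarrow> \<bar>f t x' - f t x\<bar> < e / 4)"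
      by (rule ballI)
    from bchoice[OF this] obtain r where r0: "\<forall>t\<in>I. r t > 0 \<and> (\<forall>t'\<in>I. \<bar>t' - t\<bar> < 2 * r t \<longrightarrow> (\<forall>x. \<bar>f t' x - f t x\<bar> \<le> e / 4)) \<and> (\<forall>x x'. \<bar>x' - x\<bar> < r t \<longrightarrow> \<bar>f t x' - f t x\<bar> < e / 4)" ..
    have r: "t \<in> I \<Longrightarrow> r t > 0"
      "t \<in> I \<Longrightarrow> t' \<in> I \<Longrightarrow> \<bar>t' - t\<bar> < 2 * r t \<Longrightarrow> \<bar>f t' x - f t x\<bar> \<le> e / 4"
      "t \<in> I \<Longrightarrow> \<bar>x' - x\<bar> < r t \<Longrightarrow> \<bar>f t x' - f t x\<bar> < e / 4" for t t' x x'
      using bspec[OF r0, of t] by simp_all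
    obtain J where J: "J \<subseteq> I" "finite J" "\<And>t. t \<in> I \<Longrightarrow> \<exists>s\<in>J. \<bar>t - s\<bar> < r s"
      using compact_real_cover[OF I, of r] r(1) by metis
    define d where "d = Min (insert 1 (r ` J))"
    have "d > 0" unfolding d_def using J r(1) by (subst Min_gr_iff) auto
    have dr: "d \<le> r s" if "s \<in> J" for s unfolding d_def using J(2) that by (intro Min_le) auto
    have "\<bar>f t' x' - f t x\<bar> < e" if tt: "t \<in> I" "t' \<in> I" "\<bar>t' - t\<bar> < d" "\<bar>x' - x\<bar> < d" for t t' x x'
    proof -
      obtain s where s: "s \<in> J" "\<bar>t - s\<bar> < r s" using J(3)[OF tt(1)] by (rule bexE)
      have sI: "s \<in> I" using s J by blast
      have "\<bar>t - s\<bar> < 2 * r s" "\<bar>t' - s\<bar> < 2 * r s" "\<bar>x' - x\<bar> < r s" using s dr[OF s(1)] tt r(1)[OF sI] by linarith+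
      then have "\<bar>f t x - f s x\<bar> \<le> e / 4" "\<bar>f t' x' - f s x'\<bar> \<le> e / 4" "\<bar>f s x' - f s x\<bar> < e / 4"
        using r(2)[OF sI tt(1)] r(2)[OF sI tt(2)] r(3)[OF sI] by simp_all
      then show ?thesis by linarith
    qed
    then show "\<exists>d>0. \<forall>t\<in>I. \<forall>t'\<in>I. \<forall>x x'. \<bar>t' - t\<bar> < d \<longrightarrow> \<bar>x' - x\<bar> < d \<longrightarrow> \<bar>f t' x' - f t x\<bar> < e"
      using \<open>d > 0\<close> by (intro exI[of _ d]) simp
  qed
qed

section \<open>Derivatives and Taylor expansion of the Gaussian kernel\<close>

definition normal_deriv :: "real \<Rightarrow> real \<Rightarrow> real" where
  "normal_deriv e z = - (z / e\<^sup>2) * normal_density 0 e z"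

lemma has_real_derivative_normal_density:
  assumes "e > 0"
  shows "(normal_density 0 e has_real_derivative normal_deriv e z) (at z)"
  unfolding normal_density_def[abs_def] normal_deriv_def normal_density_def using assms
  by (auto intro!: derivative_eq_intros simp: field_simps power2_eq_square)

lemma has_real_derivative_normal_deriv:
  assumes "e > 0"
  shows "(normal_deriv e has_real_derivative (z\<^sup>2 / (e\<^sup>2)\<^sup>2 - 1 / e\<^sup>2) * normal_density 0 e z) (at z)"
proof -
  have "((\<lambda>z. - (z / e\<^sup>2) * normal_density 0 e z) has_real_derivative
      - (1 / e\<^sup>2) * normal_density 0 e z + normal_deriv e z * - (z / e\<^sup>2)) (at z)"
    by (rule DERIV_mult[OF DERIV_minus[OF DERIV_cdivide[OF DERIV_ident]] has_real_derivative_normal_density[OF assms]])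
  moreover have "- (1 / E) * g + (- (z / E) * g) * - (z / E) = (z\<^sup>2 / E\<^sup>2 - 1 / E) * g" for E g :: real
    by (simp add: power2_eq_square algebra_simps)
  ultimately have "((\<lambda>z. - (z / e\<^sup>2) * normal_density 0 e z) has_real_derivative (z\<^sup>2 / (e\<^sup>2)\<^sup>2 - 1 / e\<^sup>2) * normal_density 0 e z) (at z)"
    unfolding normal_deriv_def by metis
  then show ?thesis unfolding normal_deriv_def[abs_def] .
qed

lemma integrable_normal_deriv:
  assumes "e > 0"
  shows "integrable lborel (normal_deriv e)"
  using integrable_mult_right[OF integrable_normal_moment[OF assms, of 0 1], of "- (1 / e\<^sup>2)"]
  by (simp add: normal_deriv_def[abs_def] mult_ac)

text \<open>An integrable majorant of the second derivative: after multiplication by 1 + z^2 only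
  products of 1, z^2 and z^4 with a Gaussian occur, all of them bounded.\<close>

lemma normal_second_deriv_bound:
  assumes "e > 0"
  obtains C where "C > 0" "\<And>z. \<bar>(z\<^sup>2 / (e\<^sup>2)\<^sup>2 - 1 / e\<^sup>2) * normal_density 0 e z\<bar> \<le> C / (1 + z\<^sup>2)"
proof -
  define G where "G = (\<lambda>z. exp (- (1 / (2 * e\<^sup>2) * z\<^sup>2) + 0 * z))"
  define c where "c = 1 / sqrt (2 * pi * e\<^sup>2)"
  have c: "c > 0" using assms by (simp add: c_def)
  have nG: "normal_density 0 e z = c * G z" for z by (simp add: normal_density_def c_def G_def)
  have a: "1 / (2 * e\<^sup>2) > 0" using assms by simp
  define b where "b k = fact k * exp ((1 + \<bar>0\<bar>)\<^sup>2 / (4 * (1 / (2 * e\<^sup>2))))" for k :: nat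
  have bb: "\<bar>z\<bar> ^ k * G z \<le> b k" for z k
    unfolding G_def b_def by (rule abs_power_mult_exp_bounded[OF a])
  have b0: "b k > 0" for k by (simp add: b_def)
  define C where "C = c * ((b 2 + b 4) / (e\<^sup>2)\<^sup>2 + (b 0 + b 2) / e\<^sup>2)"
  show ?thesis
  proof (rule that[of C])
    show "C > 0" unfolding C_def using c b0[of 2] b0[of 4] b0[of 0] assms by (intro mult_pos_pos add_pos_pos divide_pos_pos) auto
    fix z :: real
    have G0: "G z > 0" by (simp add: G_def)
    have "(1 + z\<^sup>2) * \<bar>(z\<^sup>2 / (e\<^sup>2)\<^sup>2 - 1 / e\<^sup>2) * normal_density 0 e z\<bar> = (1 + z\<^sup>2) * (\<bar>z\<^sup>2 / (e\<^sup>2)\<^sup>2 - 1 / e\<^sup>2\<bar> * (c * G z))"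
      using c G0 by (simp add: nG abs_mult)
    also have "\<dots> \<le> (1 + z\<^sup>2) * ((z\<^sup>2 / (e\<^sup>2)\<^sup>2 + 1 / e\<^sup>2) * (c * G z))"
    proof (intro mult_left_mono mult_right_mono)
      show "\<bar>z\<^sup>2 / (e\<^sup>2)\<^sup>2 - 1 / e\<^sup>2\<bar> \<le> z\<^sup>2 / (e\<^sup>2)\<^sup>2 + 1 / e\<^sup>2"
        using assms abs_triangle_ineq4[of "z\<^sup>2 / (e\<^sup>2)\<^sup>2" "1 / e\<^sup>2"] by simp
    qed (use c G0 in auto)
    also have "\<dots> = c * ((\<bar>z\<bar> ^ 2 * G z + \<bar>z\<bar> ^ 4 * G z) / (e\<^sup>2)\<^sup>2 + (\<bar>z\<bar> ^ 0 * G z + \<bar>z\<bar> ^ 2 * G z) / e\<^sup>2)"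
    proof -
      have "\<bar>z\<bar> ^ 4 = z\<^sup>2 * z\<^sup>2" by (simp add: power4_eq_xxxx power2_eq_square)
      then show ?thesis by (simp add: add_divide_distrib distrib_left distrib_right mult_ac)
    qed
    also have "\<dots> \<le> C"
      unfolding C_def using c assms by (intro mult_left_mono add_mono divide_right_mono bb) auto
    finally have "(1 + z\<^sup>2) * \<bar>(z\<^sup>2 / (e\<^sup>2)\<^sup>2 - 1 / e\<^sup>2) * normal_density 0 e z\<bar> \<le> C" .
    moreover have "0 < 1 + z\<^sup>2" by (simp add: add_pos_nonneg)
    ultimately show "\<bar>(z\<^sup>2 / (e\<^sup>2)\<^sup>2 - 1 / e\<^sup>2) * normal_density 0 e z\<bar> \<le> C / (1 + z\<^sup>2)"
      by (simp add: pos_le_divide_eq mult.commute)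
  qed
qed

text \<open>The mean value inequality is applied twice, to the first derivative and then to the
  density. The majorant has to hold on the whole segment, whence a factor 4: 1 + z^2 \<le> 4 (1 + (z
  + r)^2) for |r| \<le> 1.\<close>

lemma normal_density_Taylor:
  assumes e: "e > 0"
  obtains C where "C > 0" "\<And>z s. \<bar>s\<bar> \<le> 1 \<Longrightarrow> \<bar>normal_density 0 e (z + s) - normal_density 0 e z - s * normal_deriv e z\<bar> \<le> s\<^sup>2 * (C / (1 + z\<^sup>2))"
proof -
  obtain C where C: "C > 0" "\<And>z. \<bar>(z\<^sup>2 / (e\<^sup>2)\<^sup>2 - 1 / e\<^sup>2) * normal_density 0 e z\<bar> \<le> C / (1 + z\<^sup>2)"
    using normal_second_deriv_bound[OF e] by metis
  show ?thesis
  proof (rule that[of "4 * C"])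
    fix z s :: real assume s: "\<bar>s\<bar> \<le> 1"
    define S where "S = {- \<bar>s\<bar>..\<bar>s\<bar>}"
    have S: "convex S" "0 \<in> S" "s \<in> S" by (auto simp: S_def)
    define D where "D = 4 * C / (1 + z\<^sup>2)"
    have D0: "D \<ge> 0" using C(1) by (simp add: D_def)
    have near: "\<bar>((z + r)\<^sup>2 / (e\<^sup>2)\<^sup>2 - 1 / e\<^sup>2) * normal_density 0 e (z + r)\<bar> \<le> D" if "r \<in> S" for r
    proof -
      have r: "\<bar>r\<bar> \<le> 1" using that s by (auto simp: S_def)
      have "z\<^sup>2 \<le> 2 * (z + r)\<^sup>2 + 2 * r\<^sup>2"
      proof -
        have "2 * (z + r)\<^sup>2 + 2 * r\<^sup>2 - z\<^sup>2 = (z + 2 * r)\<^sup>2" by (simp add: power2_eq_square algebra_simps)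
        then show ?thesis by (smt (verit) zero_le_power2)
      qed
      moreover have "r\<^sup>2 \<le> 1" using r by (simp add: abs_square_le_1)
      moreover have lin: "1 + Z \<le> 4 + 4 * Q" if "Z \<le> 2 * Q + 2 * R" "R \<le> 1" "0 \<le> Q" for Z Q R :: real
        using that by linarith
      ultimately have "1 + z\<^sup>2 \<le> 4 + 4 * (z + r)\<^sup>2" by (intro lin[OF _ _ zero_le_power2])
      then have "1 + z\<^sup>2 \<le> 4 * (1 + (z + r)\<^sup>2)" by (simp only: distrib_left mult_1_right)
      moreover have "0 < 1 + z\<^sup>2" "0 < 1 + (z + r)\<^sup>2" by (simp_all add: add_pos_nonneg)
      ultimately have "C / (1 + (z + r)\<^sup>2) \<le> 4 * C / (1 + z\<^sup>2)"
        using C(1) mult_left_mono[of "1 + z\<^sup>2" "4 * (1 + (z + r)\<^sup>2)" C] by (simp add: divide_simps mult_ac)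
      then show ?thesis using C(2)[of "z + r"] unfolding D_def by linarith
    qed
    have first: "\<bar>normal_deriv e (z + r) - normal_deriv e z\<bar> \<le> D * \<bar>s\<bar>" if "r \<in> S" for r
    proof -
      have "norm (normal_deriv e (z + r) - normal_deriv e (z + 0)) \<le> D * norm (r - 0)"
      proof (rule field_differentiable_bound[OF S(1)])
        show "((\<lambda>r. normal_deriv e (z + r)) has_field_derivative ((z + r)\<^sup>2 / (e\<^sup>2)\<^sup>2 - 1 / e\<^sup>2) * normal_density 0 e (z + r)) (at r within S)" for r
          using DERIV_chain2[OF has_real_derivative_normal_deriv[OF e] DERIV_add[OF DERIV_const DERIV_ident], of z r S]
          by simp
      qed (use near S that in auto)
      moreover have "\<bar>r\<bar> \<le> \<bar>s\<bar>" using that by (auto simp: S_def)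
      ultimately show ?thesis using D0 mult_left_mono[of "\<bar>r\<bar>" "\<bar>s\<bar>" D] by simp
    qed
    have "norm ((normal_density 0 e (z + s) - s * normal_deriv e z) - (normal_density 0 e (z + 0) - 0 * normal_deriv e z)) \<le> (D * \<bar>s\<bar>) * norm (s - 0)"
    proof (rule field_differentiable_bound[OF S(1)])
      show "((\<lambda>r. normal_density 0 e (z + r) - r * normal_deriv e z) has_field_derivative normal_deriv e (z + r) - normal_deriv e z) (at r within S)" for r
      proof (rule DERIV_diff)
        show "((\<lambda>r. normal_density 0 e (z + r)) has_field_derivative normal_deriv e (z + r)) (at r within S)"
          using DERIV_chain2[OF has_real_derivative_normal_density[OF e] DERIV_add[OF DERIV_const DERIV_ident], of z r S] by simp
        show "((\<lambda>r. r * normal_deriv e z) has_field_derivative normal_deriv e z) (at r within S)"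
          by (auto intro!: derivative_eq_intros)
      qed
    qed (use first S in auto)
    then show "\<bar>normal_density 0 e (z + s) - normal_density 0 e z - s * normal_deriv e z\<bar> \<le> s\<^sup>2 * (4 * C / (1 + z\<^sup>2))"
      by (simp add: D_def power2_eq_square mult_ac)
  qed (use C in simp)
qed

section \<open>Transport along characteristics\<close>

lemma gaussian_moments:
  assumes "e > 0"
  shows "has_bochner_integral lborel (\<lambda>z. normal_density 0 e z * z\<^sup>2) (e\<^sup>2)"
    "has_bochner_integral lborel (\<lambda>z. normal_density 0 e z * z ^ 4) (3 * (e\<^sup>2)\<^sup>2)"
proof -
  have "fact 2 / ((2 / e\<^sup>2) ^ 1 * fact 1) = e\<^sup>2" by (simp add: fact_numeral)
  then show "has_bochner_integral lborel (\<lambda>z. normal_density 0 e z * z\<^sup>2) (e\<^sup>2)"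
    using normal_moment_even[OF assms, of 0 1] by simp
  have "fact (2 * 2) / ((2 / e\<^sup>2)\<^sup>2 * fact 2) = 3 * (e\<^sup>2)\<^sup>2" by (simp add: fact_numeral power_divide)
  then show "has_bochner_integral lborel (\<lambda>z. normal_density 0 e z * z ^ 4) (3 * (e\<^sup>2)\<^sup>2)"
    using normal_moment_even[OF assms, of 0 2] by simp
qed

text \<open>Combines the modulus of continuity with the trivial bound 2 B: where |z| \<ge> \<delta>,
  the factor z^2 / \<delta>^2 is at least 1. The Gaussian has no compact support, and this form lets
  its moments control the tails.\<close>

lemma oscillation_le:
  fixes f :: "real \<Rightarrow> real"
  assumes B: "\<And>x. \<bar>f x\<bar> \<le> B" and \<delta>: "\<delta> > 0" and \<eta>: "\<eta> \<ge> 0"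
    and mod: "\<And>x'. \<bar>x' - x\<bar> < \<delta> \<Longrightarrow> \<bar>f x' - f x\<bar> \<le> \<eta>"
  shows "\<bar>f (x - z) - f x\<bar> \<le> \<eta> + 2 * B / \<delta>\<^sup>2 * z\<^sup>2"
proof (cases "\<bar>z\<bar> < \<delta>")
  case True
  have "B \<ge> 0" using B[of x] by linarith
  then have "0 \<le> 2 * B / \<delta>\<^sup>2 * z\<^sup>2" by simp
  moreover have "\<bar>f (x - z) - f x\<bar> \<le> \<eta>" using True by (intro mod) simp
  ultimately show ?thesis by linarith
next
  case False
  have B0: "B \<ge> 0" using B[of x] by linarith
  have "\<delta>\<^sup>2 \<le> \<bar>z\<bar>\<^sup>2" using False \<delta> by (intro power_mono) auto
  then have "1 \<le> z\<^sup>2 / \<delta>\<^sup>2" using \<delta> by (simp add: pos_le_divide_eq)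
  then have "2 * B * 1 \<le> 2 * B * (z\<^sup>2 / \<delta>\<^sup>2)" using B0 by (intro mult_left_mono) auto
  moreover have "\<bar>f (x - z) - f x\<bar> \<le> 2 * B" using B[of "x - z"] B[of x] by linarith
  ultimately show ?thesis using \<eta> by simp
qed

text \<open>\<open>oscillation_le\<close> integrated against the density, whose mass is 1 and whose
  second moment is e^2.\<close>

lemma mollify_close:
  fixes f :: "real \<Rightarrow> real"
  assumes e: "e > 0" and f: "f \<in> borel_measurable borel"
    and B: "\<And>x. \<bar>f x\<bar> \<le> B" and \<delta>: "\<delta> > 0" and \<eta>: "\<eta> \<ge> 0"
    and mod: "\<And>x'. \<bar>x' - x\<bar> < \<delta> \<Longrightarrow> \<bar>f x' - f x\<bar> \<le> \<eta>"
  shows "\<bar>conv (normal_density 0 e) f x - f x\<bar> \<le> \<eta> + 2 * B / \<delta>\<^sup>2 * e\<^sup>2"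
proof -
  define n where "n = normal_density 0 e"
  have n0: "n z \<ge> 0" for z by (simp add: n_def)
  have ni: "integrable lborel n" unfolding n_def using e by simp
  have n1: "(\<integral>z. n z \<partial>lborel) = 1" unfolding n_def using e by simp
  note m2 = gaussian_moments(1)[OF e, folded n_def]
  have fi: "integrable lborel (\<lambda>z. n z * f (x - z))" by (rule integrable_conv[OF ni f B])
  have "conv n f x - f x = (\<integral>z. n z * f (x - z) \<partial>lborel) - (\<integral>z. n z * f x \<partial>lborel)"
    unfolding conv_eq using n1 by simp
  also have "\<dots> = (\<integral>z. n z * f (x - z) - n z * f x \<partial>lborel)"
    using fi ni by (intro Bochner_Integration.integral_diff[symmetric]) auto
  finally have eq: "conv n f x - f x = (\<integral>z. n z * f (x - z) - n z * f x \<partial>lborel)" .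
  have "norm (\<integral>z. n z * f (x - z) - n z * f x \<partial>lborel) \<le> (\<integral>z. \<eta> * n z + 2 * B / \<delta>\<^sup>2 * (n z * z\<^sup>2) \<partial>lborel)"
  proof (rule Bochner_Integration.integral_norm_bound_integral)
    show "integrable lborel (\<lambda>z. n z * f (x - z) - n z * f x)" using fi ni by simp
    show "integrable lborel (\<lambda>z. \<eta> * n z + 2 * B / \<delta>\<^sup>2 * (n z * z\<^sup>2))"
      using ni m2 by (intro Bochner_Integration.integrable_add integrable_mult_right) (auto simp: has_bochner_integral_iff)
    fix z
    have "norm (n z * f (x - z) - n z * f x) = n z * \<bar>f (x - z) - f x\<bar>"
      unfolding right_diff_distrib[symmetric] using n0[of z] by (simp add: abs_mult)
    also have "\<dots> \<le> n z * (\<eta> + 2 * B / \<delta>\<^sup>2 * z\<^sup>2)"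
      by (intro mult_left_mono oscillation_le[where f = f, OF B \<delta> \<eta> mod] n0)
    also have "\<dots> = \<eta> * n z + 2 * B / \<delta>\<^sup>2 * (n z * z\<^sup>2)" by (simp add: algebra_simps)
    finally show "norm (n z * f (x - z) - n z * f x) \<le> \<eta> * n z + 2 * B / \<delta>\<^sup>2 * (n z * z\<^sup>2)" .
  qed
  also have "(\<integral>z. \<eta> * n z + 2 * B / \<delta>\<^sup>2 * (n z * z\<^sup>2) \<partial>lborel) = \<eta> * (\<integral>z. n z \<partial>lborel) + 2 * B / \<delta>\<^sup>2 * (\<integral>z. n z * z\<^sup>2 \<partial>lborel)"
    using ni m2 by (subst Bochner_Integration.integral_add) (auto simp: has_bochner_integral_iff)
  also have "\<dots> = \<eta> + 2 * B / \<delta>\<^sup>2 * e\<^sup>2" using n1 m2 by (simp add: has_bochner_integral_iff)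
  finally show ?thesis using eq by (simp add: n_def)
qed

lemma integral_by_parts_gaussian:
  fixes f f' :: "real \<Rightarrow> real"
  assumes e: "e > 0" and f: "\<And>x. (f has_real_derivative f' x) (at x)" and f': "continuous_on UNIV f'"
    and B: "\<And>x. \<bar>f x\<bar> \<le> B" "\<And>x. \<bar>f' x\<bar> \<le> B'"
  shows "(\<integral>z. f z * normal_deriv e z \<partial>lborel) = - (\<integral>z. f' z * normal_density 0 e z \<partial>lborel)"
proof -
  define \<psi> where "\<psi> = (\<lambda>z. complex_of_real (normal_density 0 e z))"
  have s: "schwartz \<psi>" unfolding \<psi>_def by (rule schwartz_normal_density[OF e])
  have d: "x_deriv \<psi> z = complex_of_real (normal_deriv e z)" for z
    unfolding \<psi>_def by (intro vector_derivative_at has_vector_derivative_of_real has_real_derivative_normal_density e)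
  have "complex_of_real (\<integral>z. f z * normal_deriv e z \<partial>lborel) = pairing f (x_deriv \<psi>)"
    unfolding pairing_def d of_real_mult[symmetric] by (rule integral_complex_of_real[symmetric])
  also have "\<dots> = - pairing f' \<psi>" by (rule integral_by_parts_schwartz[OF f f' B s])
  also have "\<dots> = complex_of_real (- (\<integral>z. f' z * normal_density 0 e z \<partial>lborel))"
    unfolding pairing_def \<psi>_def of_real_mult[symmetric] of_real_minus by (subst integral_complex_of_real) (rule refl)
  finally show ?thesis unfolding of_real_eq_iff .
qed

text \<open>A Friedrichs commutator. Its kernel H(z) = (U(x) - U(x - z)) n'(z) + Ux(x - z) n(z) has
  integral 0, so w(x) can be subtracted from w(x - z); and |H| is at most M n(z) (1 + z^2 / e^2),
  whose integral 2 M does not depend on e. Thus the oscillation of w is all that matters, and no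
  derivative of w occurs.\<close>

lemma commutator_bound:
  fixes U Ux w :: "real \<Rightarrow> real"
  assumes e: "e > 0" and U: "\<And>x. (U has_real_derivative Ux x) (at x)" and Uc: "continuous_on UNIV Ux"
    and M: "\<And>x. \<bar>U x\<bar> \<le> M" "\<And>x. \<bar>Ux x\<bar> \<le> M" and w[measurable]: "w \<in> borel_measurable borel"
    and B: "\<And>x. \<bar>w x\<bar> \<le> B" and \<delta>: "\<delta> > 0" and \<eta>: "\<eta> \<ge> 0"
    and mod: "\<And>x'. \<bar>x' - x\<bar> < \<delta> \<Longrightarrow> \<bar>w x' - w x\<bar> \<le> \<eta>"
  shows "\<bar>U x * conv (normal_deriv e) w x - conv (normal_deriv e) (\<lambda>y. U y * w y) x + conv (normal_density 0 e) (\<lambda>y. Ux y * w y) x\<bar>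
    \<le> M * (2 * \<eta> + 8 * B / \<delta>\<^sup>2 * e\<^sup>2)"
proof -
  have M0: "M \<ge> 0" using M(1)[of 0] by linarith
  have B0: "B \<ge> 0" using B[of 0] by linarith
  define n where "n = normal_density 0 e"
  define n' where "n' = normal_deriv e"
  have n0: "n z \<ge> 0" for z by (simp add: n_def)
  have ni: "integrable lborel n" unfolding n_def using e by simp
  have n'i: "integrable lborel n'" unfolding n'_def by (rule integrable_normal_deriv[OF e])
  have n1: "(\<integral>z. n z \<partial>lborel) = 1" unfolding n_def using e by simp
  note m2 = gaussian_moments(1)[OF e, folded n_def] and m4 = gaussian_moments(2)[OF e, folded n_def]
  have Ucont: "continuous_on UNIV U"
    using U by (intro continuous_at_imp_continuous_on ballI) (auto intro: DERIV_isCont)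
  have [measurable]: "U \<in> borel_measurable borel" "Ux \<in> borel_measurable borel"
    using Ucont Uc by (auto intro: borel_measurable_continuous_onI)
  define H where "H = (\<lambda>z. (U x - U (x - z)) * n' z + Ux (x - z) * n z)"
  have i1: "integrable lborel (\<lambda>z. n' z * (U (x - z) * w (x - z)))"
    by (rule integrable_conv[OF n'i, where B = "M * B" and f = "\<lambda>y. U y * w y"]) (auto simp: abs_mult intro!: mult_mono M B M0)
  have i2: "integrable lborel (\<lambda>z. n z * (Ux (x - z) * w (x - z)))"
    by (rule integrable_conv[OF ni, where B = "M * B" and f = "\<lambda>y. Ux y * w y"]) (auto simp: abs_mult intro!: mult_mono M B M0)
  have i3: "integrable lborel (\<lambda>z. n' z * w (x - z))" by (rule integrable_conv[OF n'i w B])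
  have i4: "integrable lborel (\<lambda>z. n' z * U (x - z))" by (rule integrable_conv[OF n'i _ M(1)]) measurable
  have i5: "integrable lborel (\<lambda>z. n z * Ux (x - z))" by (rule integrable_conv[OF ni _ M(2)]) measurable
  have Hi: "integrable lborel H"
  proof -
    have "integrable lborel (\<lambda>z. U x * n' z - n' z * U (x - z) + n z * Ux (x - z))"
      using n'i i4 i5 by simp
    moreover have "U x * n' z - n' z * U (x - z) + n z * Ux (x - z) = H z" for z
      by (simp add: H_def algebra_simps)
    ultimately show ?thesis by simp
  qed
  have Hw: "integrable lborel (\<lambda>z. H z * w (x - z))"
    and Hwi: "U x * conv n' w x - conv n' (\<lambda>y. U y * w y) x + conv n (\<lambda>y. Ux y * w y) x = (\<integral>z. H z * w (x - z) \<partial>lborel)"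
  proof -
    have eq: "H z * w (x - z) = U x * (n' z * w (x - z)) - n' z * (U (x - z) * w (x - z)) + n z * (Ux (x - z) * w (x - z))" for z
      by (simp add: H_def algebra_simps)
    show "integrable lborel (\<lambda>z. H z * w (x - z))" unfolding eq using i1 i2 i3 by simp
    show "U x * conv n' w x - conv n' (\<lambda>y. U y * w y) x + conv n (\<lambda>y. Ux y * w y) x = (\<integral>z. H z * w (x - z) \<partial>lborel)"
      unfolding eq conv_eq using i1 i2 i3 by simp
  qed
  \<comment> \<open>Integration by parts moves the derivative of the Gaussian onto U(x) - U(x - z),
    whose derivative in z is Ux(x - z).\<close>
  have H0: "(\<integral>z. H z \<partial>lborel) = 0"
  proof -
    have d: "((\<lambda>z. U x - U (x - z)) has_real_derivative Ux (x - z)) (at z)" for z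
    proof -
      have "((\<lambda>z. x - z) has_real_derivative - 1) (at z)" by (auto intro!: derivative_eq_intros)
      from DERIV_diff[OF DERIV_const DERIV_chain2[OF U this]] show ?thesis by simp
    qed
    have c: "continuous_on UNIV (\<lambda>z. Ux (x - z))"
      by (intro continuous_on_compose2[OF Uc] continuous_intros) auto
    have "(\<integral>z. (U x - U (x - z)) * n' z \<partial>lborel) = - (\<integral>z. Ux (x - z) * n z \<partial>lborel)"
      unfolding n_def n'_def
    proof (rule integral_by_parts_gaussian[OF e d c])
      show "\<bar>U x - U (x - z)\<bar> \<le> 2 * M" for z using M(1)[of x] M(1)[of "x - z"] by linarith
    qed (rule M(2))
    moreover have "integrable lborel (\<lambda>z. (U x - U (x - z)) * n' z)"
    proof -
      have "integrable lborel (\<lambda>z. U x * n' z - n' z * U (x - z))" using n'i i4 by simp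
      then show ?thesis by (simp add: algebra_simps)
    qed
    moreover have "integrable lborel (\<lambda>z. Ux (x - z) * n z)" using i5 by (simp add: mult.commute)
    ultimately show ?thesis unfolding H_def by simp
  qed
  \<comment> \<open>The bound M |z| for the increment of U meets |n'| = |z| n / e^2; their product
    carries z^2 / e^2, which has mean 1 under the Gaussian.\<close>
  have H_bound: "\<bar>H z\<bar> \<le> M * (n z * (1 + z\<^sup>2 / e\<^sup>2))" for z
  proof -
    have "norm (U x - U (x - z)) \<le> M * norm (x - (x - z))"
    proof (rule field_differentiable_bound[of UNIV])
      show "(U has_field_derivative Ux y) (at y within UNIV)" for y using U by simp
    qed (use M in auto)
    then have f1: "\<bar>U x - U (x - z)\<bar> * (\<bar>z\<bar> / e\<^sup>2 * n z) \<le> (M * \<bar>z\<bar>) * (\<bar>z\<bar> / e\<^sup>2 * n z)"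
      using n0[of z] by (intro mult_right_mono) auto
    have f2: "\<bar>n' z\<bar> = \<bar>z\<bar> / e\<^sup>2 * n z" using n0[of z] by (simp add: n'_def normal_deriv_def n_def abs_mult)
    have f3: "\<bar>Ux (x - z) * n z\<bar> \<le> M * n z" using n0[of z] M(2) by (simp add: abs_mult mult_right_mono)
    have f4: "(M * \<bar>z\<bar>) * (\<bar>z\<bar> / e\<^sup>2 * n z) + M * n z = M * (n z * (1 + z\<^sup>2 / e\<^sup>2))"
    proof -
      have "(M * a) * (a / E * N) + M * N = M * (N * (1 + a * a / E))" for a E N :: real
        by (simp add: algebra_simps)
      moreover have "z\<^sup>2 = \<bar>z\<bar> * \<bar>z\<bar>" by (simp add: power2_eq_square)
      ultimately show ?thesis by (simp only:)
    qed
    have "\<bar>H z\<bar> \<le> \<bar>U x - U (x - z)\<bar> * \<bar>n' z\<bar> + \<bar>Ux (x - z) * n z\<bar>"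
      unfolding H_def abs_mult[symmetric] by (rule abs_triangle_ineq)
    also have "\<dots> \<le> (M * \<bar>z\<bar>) * (\<bar>z\<bar> / e\<^sup>2 * n z) + M * n z"
      unfolding f2 by (rule add_mono[OF f1 f3])
    finally show ?thesis unfolding f4 .
  qed
  have Heq: "(\<integral>z. H z * w (x - z) \<partial>lborel) = (\<integral>z. H z * w (x - z) - H z * w x \<partial>lborel)"
    using Hw Hi H0 by simp
  have "norm (\<integral>z. H z * w (x - z) - H z * w x \<partial>lborel)
     \<le> (\<integral>z. M * (\<eta> * n z + (\<eta> / e\<^sup>2 + 2 * B / \<delta>\<^sup>2) * (n z * z\<^sup>2) + 2 * B / \<delta>\<^sup>2 / e\<^sup>2 * (n z * z ^ 4)) \<partial>lborel)"
  proof (rule Bochner_Integration.integral_norm_bound_integral)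
    show "integrable lborel (\<lambda>z. H z * w (x - z) - H z * w x)" using Hw Hi by simp
    show "integrable lborel (\<lambda>z. M * (\<eta> * n z + (\<eta> / e\<^sup>2 + 2 * B / \<delta>\<^sup>2) * (n z * z\<^sup>2) + 2 * B / \<delta>\<^sup>2 / e\<^sup>2 * (n z * z ^ 4)))"
      using ni m2 m4 by (intro Bochner_Integration.integrable_add integrable_mult_right) (auto simp: has_bochner_integral_iff)
    fix z
    have "norm (H z * w (x - z) - H z * w x) = \<bar>H z\<bar> * \<bar>w (x - z) - w x\<bar>"
      unfolding right_diff_distrib[symmetric] by (simp add: abs_mult)
    also have "\<dots> \<le> M * (n z * (1 + z\<^sup>2 / e\<^sup>2)) * (\<eta> + 2 * B / \<delta>\<^sup>2 * z\<^sup>2)"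
      using M0 n0[of z] by (intro mult_mono H_bound oscillation_le[where f = w, OF B \<delta> \<eta> mod]) auto
    also have "\<dots> = M * (\<eta> * n z + (\<eta> / e\<^sup>2 + 2 * B / \<delta>\<^sup>2) * (n z * z\<^sup>2) + 2 * B / \<delta>\<^sup>2 / e\<^sup>2 * (n z * z ^ 4))"
    proof -
      have "M * (N * (1 + Z / E)) * (\<eta> + b * Z) = M * (\<eta> * N + (\<eta> / E + b) * (N * Z) + b / E * (N * (Z * Z)))"
        for N Z E b :: real
      proof -
        have "N * (1 + Z / E) * (\<eta> + b * Z) = \<eta> * N + (\<eta> / E + b) * (N * Z) + b / E * (N * (Z * Z))"
          by (simp add: distrib_left distrib_right add_divide_distrib mult_ac)
        then show ?thesis by (simp only: mult.assoc)
      qed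
      moreover have "z ^ 4 = z\<^sup>2 * z\<^sup>2" by (simp add: power4_eq_xxxx power2_eq_square)
      ultimately show ?thesis by (simp only:)
    qed
    finally show "norm (H z * w (x - z) - H z * w x) \<le> M * (\<eta> * n z + (\<eta> / e\<^sup>2 + 2 * B / \<delta>\<^sup>2) * (n z * z\<^sup>2) + 2 * B / \<delta>\<^sup>2 / e\<^sup>2 * (n z * z ^ 4))" .
  qed
  also have "(\<integral>z. M * (\<eta> * n z + (\<eta> / e\<^sup>2 + 2 * B / \<delta>\<^sup>2) * (n z * z\<^sup>2) + 2 * B / \<delta>\<^sup>2 / e\<^sup>2 * (n z * z ^ 4)) \<partial>lborel)
     = M * (\<eta> * 1 + (\<eta> / e\<^sup>2 + 2 * B / \<delta>\<^sup>2) * e\<^sup>2 + 2 * B / \<delta>\<^sup>2 / e\<^sup>2 * (3 * (e\<^sup>2)\<^sup>2))"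
  proof (rule has_bochner_integral_integral_eq)
    have m0: "has_bochner_integral lborel n 1" using ni n1 by (simp add: has_bochner_integral_iff)
    show "has_bochner_integral lborel (\<lambda>z. M * (\<eta> * n z + (\<eta> / e\<^sup>2 + 2 * B / \<delta>\<^sup>2) * (n z * z\<^sup>2) + 2 * B / \<delta>\<^sup>2 / e\<^sup>2 * (n z * z ^ 4)))
      (M * (\<eta> * 1 + (\<eta> / e\<^sup>2 + 2 * B / \<delta>\<^sup>2) * e\<^sup>2 + 2 * B / \<delta>\<^sup>2 / e\<^sup>2 * (3 * (e\<^sup>2)\<^sup>2)))"
      by (rule has_bochner_integral_mult_right, rule has_bochner_integral_add, rule has_bochner_integral_add)
        (rule has_bochner_integral_mult_right m0 m2 m4)+
  qed
  also have "\<dots> = M * (2 * \<eta> + 8 * B / \<delta>\<^sup>2 * e\<^sup>2)"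
  proof -
    have "\<eta> * 1 + (\<eta> / E + b) * E + b / E * (3 * E\<^sup>2) = 2 * \<eta> + 4 * b * E" if "E > 0" for E b :: real
      using that by (simp add: field_simps power2_eq_square)
    from this[of "e\<^sup>2" "2 * B / \<delta>\<^sup>2"] show ?thesis using e by simp
  qed
  finally show ?thesis unfolding n_def[symmetric] n'_def[symmetric] Hwi Heq real_norm_def .
qed

text \<open>One constant D serves all functions bounded by B and all points x, so the linearisation
  along a characteristic is uniform in time and space. It is the integral of the Taylor majorant,
  increased by 1.\<close>

lemma conv_gaussian_Taylor:
  assumes e: "e > 0"
  shows "\<exists>D>0. \<forall>f B x s. f \<in> borel_measurable borel \<longrightarrow> (\<forall>x. \<bar>f x\<bar> \<le> B) \<longrightarrow> \<bar>s\<bar> \<le> 1 \<longrightarrow>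
    \<bar>conv (normal_density 0 e) f (x + s) - conv (normal_density 0 e) f x - s * conv (normal_deriv e) f x\<bar> \<le> D * B * s\<^sup>2"
proof -
  obtain C where C: "C > 0" "\<And>z s. \<bar>s\<bar> \<le> 1 \<Longrightarrow> \<bar>normal_density 0 e (z + s) - normal_density 0 e z - s * normal_deriv e z\<bar> \<le> s\<^sup>2 * (C / (1 + z\<^sup>2))"
    using normal_density_Taylor[OF e] by metis
  define D where "D = (\<integral>z. C / (1 + (z::real)\<^sup>2) \<partial>lborel) + 1"
  have D: "D > 0" unfolding D_def using C(1) by (intro add_nonneg_pos integral_nonneg_AE) (auto simp: add_nonneg_pos)
  have "\<bar>conv (normal_density 0 e) f (x + s) - conv (normal_density 0 e) f x - s * conv (normal_deriv e) f x\<bar> \<le> D * B * s\<^sup>2"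
    if f: "f \<in> borel_measurable borel" and B: "\<And>x. \<bar>f x\<bar> \<le> B" and s: "\<bar>s\<bar> \<le> 1" for f B x s
  proof -
    have B0: "B \<ge> 0" using B[of 0] by linarith
    define n where "n = normal_density 0 e"
    define n' where "n' = normal_deriv e"
    have ni: "integrable lborel n" unfolding n_def using e by simp
    have n'i: "integrable lborel n'" unfolding n'_def by (rule integrable_normal_deriv[OF e])
    have shift: "integrable lborel (\<lambda>z. n (z + s))"
      using lborel_integrable_real_affine[OF ni, of 1 s] by (simp add: add.commute)
    have a: "conv n f (x + s) = (\<integral>z. n (z + s) * f (x - z) \<partial>lborel)"
      unfolding conv_eq
      using lborel_integral_real_affine[of 1 "\<lambda>z. n z * f (x + s - z)" s] by (simp add: add.commute)
    have ia: "integrable lborel (\<lambda>z. n (z + s) * f (x - z))" by (rule integrable_conv[OF shift f B])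
    have ib: "integrable lborel (\<lambda>z. n z * f (x - z))" by (rule integrable_conv[OF ni f B])
    have ic: "integrable lborel (\<lambda>z. s * (n' z * f (x - z)))" by (intro integrable_mult_right integrable_conv[OF n'i f B])
    have eq: "conv n f (x + s) - conv n f x - s * conv n' f x = (\<integral>z. n (z + s) * f (x - z) - n z * f (x - z) - s * (n' z * f (x - z)) \<partial>lborel)"
      unfolding a conv_eq[of n f x] conv_eq[of n' f x] using ia ib ic by simp
    have "norm (\<integral>z. n (z + s) * f (x - z) - n z * f (x - z) - s * (n' z * f (x - z)) \<partial>lborel) \<le> (\<integral>z. s\<^sup>2 * B * (C / (1 + z\<^sup>2)) \<partial>lborel)"
    proof (rule Bochner_Integration.integral_norm_bound_integral)
      show "integrable lborel (\<lambda>z. n (z + s) * f (x - z) - n z * f (x - z) - s * (n' z * f (x - z)))"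
        using ia ib ic by (intro Bochner_Integration.integrable_diff)
      show "integrable lborel (\<lambda>z. s\<^sup>2 * B * (C / (1 + z\<^sup>2)))"
        by (intro integrable_mult_right integrable_inverse_1_plus_square)
      fix z
      have "n (z + s) * f (x - z) - n z * f (x - z) - s * (n' z * f (x - z)) = (n (z + s) - n z - s * n' z) * f (x - z)"
        by (simp add: algebra_simps)
      then have "norm (n (z + s) * f (x - z) - n z * f (x - z) - s * (n' z * f (x - z))) = \<bar>n (z + s) - n z - s * n' z\<bar> * \<bar>f (x - z)\<bar>"
        by (simp only: real_norm_def abs_mult)
      also have "\<dots> \<le> (s\<^sup>2 * (C / (1 + z\<^sup>2))) * B"
        unfolding n_def n'_def using C(1) by (intro mult_mono C(2) s B) (auto simp: add_nonneg_pos)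
      also have "\<dots> = s\<^sup>2 * B * (C / (1 + z\<^sup>2))" by simp
      finally show "norm (n (z + s) * f (x - z) - n z * f (x - z) - s * (n' z * f (x - z))) \<le> s\<^sup>2 * B * (C / (1 + z\<^sup>2))" .
    qed
    also have "(\<integral>z. s\<^sup>2 * B * (C / (1 + z\<^sup>2)) \<partial>lborel) = s\<^sup>2 * B * (D - 1)"
      unfolding D_def integral_mult_right_zero by simp
    also have "\<dots> \<le> D * B * s\<^sup>2"
    proof -
      have "s\<^sup>2 * B * (D - 1) \<le> s\<^sup>2 * B * D" using B0 by (intro mult_left_mono) auto
      then show ?thesis by (simp add: mult_ac)
    qed
    finally show ?thesis unfolding n_def[symmetric] n'_def[symmetric] eq by simp
  qed
  then show ?thesis using D by (intro exI[of _ D]) simp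
qed

text \<open>\<open>v\<close> is \<open>w\<close> convolved with a narrow Gaussian: it solves the transport equation up to the commutator,
  and one Euler step backwards along the characteristic costs \<open>o(h)\<close> uniformly in \<open>x\<close>.\<close>

lemma transport_approximation:
  fixes U Ux w S :: "real \<Rightarrow> real \<Rightarrow> real"
  assumes I: "convex I"
    and U: "BUC I U" and Ux: "BUC I Ux" and w: "BUC I w" and S: "BUC I S"
    and dU: "\<And>t x. t \<in> I \<Longrightarrow> (U t has_real_derivative Ux t x) (at x)"
    and M: "\<And>t x. t \<in> I \<Longrightarrow> \<bar>U t x\<bar> \<le> M" "\<And>t x. t \<in> I \<Longrightarrow> \<bar>Ux t x\<bar> \<le> M" "M \<ge> 0"
    and eqn: "\<And>e t x. e > 0 \<Longrightarrow> t \<in> I \<Longrightarrow> ((\<lambda>\<tau>. conv (normal_density 0 e) (w \<tau>) x) has_real_derivative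
        conv (normal_density 0 e) (\<lambda>y. Ux t y * w t y) x - conv (normal_deriv e) (\<lambda>y. U t y * w t y) x
        + conv (normal_density 0 e) (S t) x) (at t within I)"
    and \<eta>: "\<eta> > 0"
  shows "\<exists>v d. BUC I v \<and> (\<forall>t\<in>I. \<forall>x. \<bar>v t x - w t x\<bar> \<le> \<eta>) \<and> d > 0 \<and>
    (\<forall>t\<in>I. \<forall>h. 0 < h \<longrightarrow> h < d \<longrightarrow> t + h \<in> I \<longrightarrow> (\<forall>x. \<bar>v (t + h) x\<bar> \<le> \<bar>v t (x - h * U t x)\<bar> + h * \<bar>S t x\<bar> + h * \<eta>))"
proof -
  obtain Bw where Bw: "Bw > 0" "\<And>t x. t \<in> I \<Longrightarrow> \<bar>w t x\<bar> \<le> Bw" using BUC_bounded[OF w] by metis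
  obtain BS where BS: "BS > 0" "\<And>t x. t \<in> I \<Longrightarrow> \<bar>S t x\<bar> \<le> BS" using BUC_bounded[OF S] by metis
  define B where "B = Bw + BS"
  have B: "B > 0" "\<And>t x. t \<in> I \<Longrightarrow> \<bar>w t x\<bar> \<le> B" "\<And>t x. t \<in> I \<Longrightarrow> \<bar>S t x\<bar> \<le> B"
  proof -
    show "B > 0" using Bw(1) BS(1) by (simp add: B_def)
    show "\<bar>w t x\<bar> \<le> B" if "t \<in> I" for t x using Bw(2)[OF that, of x] BS(1) by (simp add: B_def)
    show "\<bar>S t x\<bar> \<le> B" if "t \<in> I" for t x using BS(2)[OF that, of x] Bw(1) by (simp add: B_def)
  qed
  \<comment> \<open>Small enough that the commutator, at most 3 M \<eta>0, and the mollification
    errors of w and S, at most 2 \<eta>0 each, stay below \<eta> / 4.\<close>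
  define \<eta>0 where "\<eta>0 = \<eta> / (16 * (M + 1))"
  have \<eta>0: "\<eta>0 > 0" using \<eta> M(3) by (simp add: \<eta>0_def)
  have M\<eta>0: "(M + 1) * \<eta>0 = \<eta> / 16" using M(3) by (simp add: \<eta>0_def field_simps)
  obtain d1 where d1: "d1 > 0" "\<And>t t' x x'. t \<in> I \<Longrightarrow> t' \<in> I \<Longrightarrow> \<bar>t' - t\<bar> < d1 \<Longrightarrow> \<bar>x' - x\<bar> < d1 \<Longrightarrow> \<bar>w t' x' - w t x\<bar> < \<eta>0"
    using BUC_uniform[OF w \<eta>0] by metis
  obtain d2 where d2: "d2 > 0" "\<And>t t' x x'. t \<in> I \<Longrightarrow> t' \<in> I \<Longrightarrow> \<bar>t' - t\<bar> < d2 \<Longrightarrow> \<bar>x' - x\<bar> < d2 \<Longrightarrow> \<bar>S t' x' - S t x\<bar> < \<eta>0"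
    using BUC_uniform[OF S \<eta>0] by metis
  define \<delta> where "\<delta> = min d1 d2"
  have \<delta>: "\<delta> > 0" using d1(1) d2(1) by (simp add: \<delta>_def)
  have modw: "\<bar>w t x' - w t x\<bar> \<le> \<eta>0" if "t \<in> I" "\<bar>x' - x\<bar> < \<delta>" for t x x'
    by (rule less_imp_le, rule d1(2)) (use that d1 in \<open>auto simp: \<delta>_def\<close>)
  have modS: "\<bar>S t x' - S t x\<bar> \<le> \<eta>0" if "t \<in> I" "\<bar>x' - x\<bar> < \<delta>" for t x x'
    by (rule less_imp_le, rule d2(2)) (use that d2 in \<open>auto simp: \<delta>_def\<close>)
  \<comment> \<open>This width makes the tail term 8 B e^2 / \<delta>^2 equal to \<eta>0.\<close>
  define e where "e = sqrt (\<delta>\<^sup>2 * \<eta>0 / (8 * B))"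
  have e: "e > 0" using \<delta> \<eta>0 B(1) by (simp add: e_def)
  have e2: "8 * B / \<delta>\<^sup>2 * e\<^sup>2 = \<eta>0" using \<delta> \<eta>0 B(1) by (simp add: e_def)
  have e2': "2 * B / \<delta>\<^sup>2 * e\<^sup>2 \<le> \<eta>0"
  proof -
    have "2 * B / \<delta>\<^sup>2 * e\<^sup>2 = \<eta>0 / 4" using e2 by simp
    then show ?thesis using \<eta>0 by simp
  qed
  define n where "n = normal_density 0 e"
  define n' where "n' = normal_deriv e"
  have ni: "integrable lborel n" unfolding n_def using e by simp
  have n'i: "integrable lborel n'" unfolding n'_def by (rule integrable_normal_deriv[OF e])
  define v where "v = (\<lambda>t. conv n (w t))"
  \<comment> \<open>The time derivative of v according to \<open>eqn\<close>. It is jointly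
    uniformly continuous, hence nearly constant over a short step.\<close>
  define g where "g = (\<lambda>t x. conv n (\<lambda>y. Ux t y * w t y) x - conv n' (\<lambda>y. U t y * w t y) x + conv n (S t) x)"
  have vB: "BUC I v" unfolding v_def by (rule BUC_conv[OF w ni])
  have gB: "BUC I g" unfolding g_def
    by (intro BUC_add BUC_diff BUC_conv ni n'i BUC_mult U Ux w S)
  have close: "\<bar>v t x - w t x\<bar> \<le> 2 * \<eta>0" if "t \<in> I" for t x
    using mollify_close[OF e BUC_measurable[OF w that] B(2)[OF that] \<delta> less_imp_le[OF \<eta>0] modw[OF that, of _ x]] e2'
    unfolding v_def n_def by linarith
  have closeS: "\<bar>conv n (S t) x - S t x\<bar> \<le> 2 * \<eta>0" if "t \<in> I" for t x
    using mollify_close[OF e BUC_measurable[OF S that] B(3)[OF that] \<delta> less_imp_le[OF \<eta>0] modS[OF that, of _ x]] e2'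
    unfolding n_def by linarith
  define r where "r = (\<lambda>t x. U t x * conv n' (w t) x - conv n' (\<lambda>y. U t y * w t y) x + conv n (\<lambda>y. Ux t y * w t y) x)"
  have rb: "\<bar>r t x\<bar> \<le> 3 * (M * \<eta>0)" if t: "t \<in> I" for t x
    using commutator_bound[OF e dU[OF t] BUC_continuous[OF Ux t] M(1)[OF t] M(2)[OF t] BUC_measurable[OF w t] B(2)[OF t] \<delta> less_imp_le[OF \<eta>0] modw[OF t, of _ x]]
    unfolding e2 r_def n_def n'_def by (simp add: algebra_simps)
  obtain D where D: "D > 0" "\<forall>f B x s. f \<in> borel_measurable borel \<longrightarrow> (\<forall>x. \<bar>f x\<bar> \<le> B) \<longrightarrow> \<bar>s\<bar> \<le> 1 \<longrightarrow>
    \<bar>conv n f (x + s) - conv n f x - s * conv n' f x\<bar> \<le> D * B * s\<^sup>2"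
    using conv_gaussian_Taylor[OF e] unfolding n_def n'_def by blast
  have \<eta>4: "\<eta> / 4 > 0" using \<eta> by simp
  obtain d3 where d3: "d3 > 0" "\<And>t t' x x'. t \<in> I \<Longrightarrow> t' \<in> I \<Longrightarrow> \<bar>t' - t\<bar> < d3 \<Longrightarrow> \<bar>x' - x\<bar> < d3 \<Longrightarrow> \<bar>g t' x' - g t x\<bar> < \<eta> / 4"
    using BUC_uniform[OF gB \<eta>4] by metis
  \<comment> \<open>Four errors of at most h \<eta> / 4 make up h \<eta>. Two of them limit the
    step: the variation of \<open>g\<close> through \<open>d3\<close>, and the Taylor remainder D B
    (h M)^2 through \<eta> / K. The bound 1 / (M + 1) keeps the displacement below 1, where the
    Taylor estimate holds.\<close>
  define K where "K = 4 * (D * B * M\<^sup>2 + 1)"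
  have K: "K > 0" unfolding K_def using D(1) B(1) by (intro mult_pos_pos add_nonneg_pos) auto
  define d where "d = min d3 (min (1 / (M + 1)) (\<eta> / K))"
  have d: "d > 0" using d3(1) M(3) \<eta> K by (simp add: d_def)
  have step: "\<bar>v (t + h) x\<bar> \<le> \<bar>v t (x - h * U t x)\<bar> + h * \<bar>S t x\<bar> + h * \<eta>"
    if t: "t \<in> I" and h: "0 < h" "h < d" and th: "t + h \<in> I" for t h x
  proof -
    have sub: "{t..t + h} \<subseteq> I"
    proof
      fix y assume "y \<in> {t..t + h}"
      then have "y \<in> closed_segment t (t + h)" using h(1) by (simp add: closed_segment_eq_real_ivl)
      then show "y \<in> I" using I t th closed_segment_subset by blast
    qed
    have "norm ((v (t + h) x - (t + h) * g t x) - (v t x - t * g t x)) \<le> \<eta> / 4 * norm ((t + h) - t)"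
    proof (rule field_differentiable_bound[of "{t..t + h}"])
      fix y assume y: "y \<in> {t..t + h}"
      have yI: "y \<in> I" using y sub by blast
      have "((\<lambda>\<tau>. v \<tau> x) has_real_derivative g y x) (at y within {t..t + h})"
        using DERIV_subset[OF eqn[OF e yI, of x] sub] unfolding v_def g_def n_def n'_def .
      moreover have "((\<lambda>\<tau>. \<tau> * g t x) has_real_derivative g t x) (at y within {t..t + h})"
        by (auto intro!: derivative_eq_intros)
      ultimately show "((\<lambda>\<tau>. v \<tau> x - \<tau> * g t x) has_field_derivative g y x - g t x) (at y within {t..t + h})"
        by (rule DERIV_diff)
      have "\<bar>y - t\<bar> < d3" using y h by (auto simp: d_def)
      then have "\<bar>g y x - g t x\<bar> < \<eta> / 4" using d3(1) by (intro d3(2) t yI) auto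
      then show "norm (g y x - g t x) \<le> \<eta> / 4" by simp
    qed (use h in auto)
    then have 1: "\<bar>v (t + h) x - v t x - h * g t x\<bar> \<le> \<eta> / 4 * h"
      using h by (simp add: algebra_simps)
    define s where "s = - (h * U t x)"
    have hM: "h * M \<le> 1"
    proof -
      have "h < 1 / (M + 1)" using h(2) by (simp add: d_def)
      then have "h * (M + 1) < 1" using M(3) by (simp add: pos_less_divide_eq)
      then show ?thesis using h(1) by (simp add: algebra_simps)
    qed
    have sM: "\<bar>s\<bar> \<le> h * M" unfolding s_def using M(1)[OF t] h(1) by (simp add: abs_mult mult_left_mono)
    then have s1: "\<bar>s\<bar> \<le> 1" using hM by linarith
    have "\<bar>v t (x + s) - v t x - s * conv n' (w t) x\<bar> \<le> D * B * s\<^sup>2"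
      unfolding v_def by (rule D(2)[rule_format, OF BUC_measurable[OF w t] B(2)[OF t] s1])
    also have "\<dots> \<le> D * B * (h * M)\<^sup>2"
    proof (intro mult_left_mono)
      have "\<bar>s\<bar>\<^sup>2 \<le> (h * M)\<^sup>2" using sM by (intro power_mono) auto
      then show "s\<^sup>2 \<le> (h * M)\<^sup>2" by simp
    qed (use D B in auto)
    also have "\<dots> \<le> h * (\<eta> / 4)"
    proof -
      have "h < \<eta> / K" using h(2) by (simp add: d_def)
      then have "h * K < \<eta>" using K by (simp add: pos_less_divide_eq)
      then have "h * (D * B * M\<^sup>2) \<le> \<eta> / 4" using h(1) by (simp add: K_def algebra_simps)
      then have "h * (h * (D * B * M\<^sup>2)) \<le> h * (\<eta> / 4)" using h(1) by (intro mult_left_mono) auto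
      then show ?thesis by (simp add: power2_eq_square mult_ac)
    qed
    finally have 2: "\<bar>v t (x + s) - v t x - s * conv n' (w t) x\<bar> \<le> h * (\<eta> / 4)" .
    \<comment> \<open>Splitting off the commutator \<open>r\<close> leaves s times the spatial
      derivative of v, which is the linear part of the shift from x to x + s.\<close>
    have g: "h * g t x = h * r t x + s * conv n' (w t) x + h * conv n (S t) x"
      by (simp add: g_def r_def s_def algebra_simps)
    have 3: "\<bar>h * r t x\<bar> \<le> h * (\<eta> / 4)"
    proof -
      have "3 * (M * \<eta>0) \<le> \<eta> / 4" using M\<eta>0 \<eta>0 \<eta> by (simp add: algebra_simps)
      then have "\<bar>r t x\<bar> \<le> \<eta> / 4" using rb[OF t, of x] by linarith
      then have "h * \<bar>r t x\<bar> \<le> h * (\<eta> / 4)" using h(1) by (intro mult_left_mono) auto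
      then show ?thesis using h(1) by (simp add: abs_mult)
    qed
    have 4: "\<bar>h * conv n (S t) x\<bar> \<le> h * \<bar>S t x\<bar> + h * (\<eta> / 4)"
    proof -
      have "0 \<le> M * \<eta>0" using M(3) \<eta>0 by simp
      then have "2 * \<eta>0 \<le> \<eta> / 4" using M\<eta>0 \<eta> by (simp add: algebra_simps)
      then have "\<bar>conv n (S t) x\<bar> \<le> \<bar>S t x\<bar> + \<eta> / 4" using closeS[OF t, of x] by linarith
      then have "h * \<bar>conv n (S t) x\<bar> \<le> h * (\<bar>S t x\<bar> + \<eta> / 4)" using h(1) by (intro mult_left_mono) auto
      then show ?thesis using h(1) by (simp add: abs_mult distrib_left)
    qed
    have "\<bar>v (t + h) x\<bar> \<le> \<bar>v t (x + s)\<bar> + h * \<bar>S t x\<bar> + (\<eta> / 4 * h + h * (\<eta> / 4) + h * (\<eta> / 4) + h * (\<eta> / 4))"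
      using 1 2 3 4 g by linarith
    moreover have "\<eta> / 4 * h + h * (\<eta> / 4) + h * (\<eta> / 4) + h * (\<eta> / 4) = h * \<eta>" by simp
    moreover have "x + s = x - h * U t x" by (simp add: s_def)
    ultimately show ?thesis by (simp only:)
  qed
  have "2 * \<eta>0 \<le> \<eta>"
  proof -
    have "0 \<le> M * \<eta>0" using M(3) \<eta>0 by simp
    then show ?thesis using M\<eta>0 \<eta> by (simp add: algebra_simps)
  qed
  then have close': "\<bar>v t x - w t x\<bar> \<le> \<eta>" if "t \<in> I" for t x using close[OF that, of x] by linarith
  show ?thesis
    by (intro exI[of _ v] exI[of _ d] conjI ballI allI impI vB close' d step)
qed

section \<open>Convolution with the Green function\<close>

definition Green :: "real \<Rightarrow> real" where
  "Green x = exp (- \<bar>x\<bar>) / 2"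

lemma integrable_Green: "integrable lborel Green"
  unfolding Green_def[abs_def] using integrable_exp_abs by simp

lemma dG_measurable [measurable]: "dG \<in> borel_measurable borel"
  unfolding dG_def[abs_def] sgn_real_def by measurable

lemma Green_measurable [measurable]: "Green \<in> borel_measurable borel"
  unfolding Green_def[abs_def] by measurable

lemma abs_dG_le: "\<bar>dG x\<bar> \<le> Green x"
  by (simp add: dG_def Green_def abs_mult sgn_if)

lemma integrable_dG: "integrable lborel dG"
  by (rule Bochner_Integration.integrable_bound[OF integrable_Green])
    (use abs_dG_le in \<open>auto intro: order_trans[OF _ abs_ge_self]\<close>)

text \<open>Up to the factor exp (-x) / 2, the part of the convolution of the Green function with F
  that comes from y < x. Cutting at the corner y = x leaves two smooth kernels, so the fundamental
  theorem of calculus applies to each part.\<close>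

definition exp_primitive :: "(real \<Rightarrow> real) \<Rightarrow> real \<Rightarrow> real" where
  "exp_primitive F x = (\<integral>y. indicator {..<x} y * (exp y * F y) \<partial>lborel)"

lemma integrable_exp_primitive:
  fixes F :: "real \<Rightarrow> real"
  assumes F[measurable]: "F \<in> borel_measurable borel" and B: "\<And>x. \<bar>F x\<bar> \<le> B"
  shows "integrable lborel (\<lambda>y. indicator {..<x} y * (exp y * F y))"
proof (rule Bochner_Integration.integrable_bound)
  have B0: "B \<ge> 0" using B[of 0] by linarith
  have "integrable lborel (\<lambda>y. exp (- \<bar>- x + 1 * y\<bar>))"
    by (rule lborel_integrable_real_affine[OF integrable_exp_abs]) simp
  then show "integrable lborel (\<lambda>y. B * exp x * exp (- \<bar>- x + 1 * y\<bar>))" by (rule integrable_mult_right)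
  show "(\<lambda>y. indicator {..<x} y * (exp y * F y)) \<in> borel_measurable lborel" by measurable
  have "norm (indicator {..<x} y * (exp y * F y)) \<le> norm (B * exp x * exp (- \<bar>- x + 1 * y\<bar>))" for y
  proof (cases "y < x")
    case True
    have "exp y * \<bar>F y\<bar> \<le> exp y * B" by (intro mult_left_mono B) simp
    also have "\<dots> = B * exp x * exp (- \<bar>- x + 1 * y\<bar>)"
      using True by (simp add: mult.assoc exp_add[symmetric])
    finally show ?thesis using True B0 by (simp add: abs_mult)
  next
    case False
    then show ?thesis by simp
  qed
  then show "AE y in lborel. norm (indicator {..<x} y * (exp y * F y)) \<le> norm (B * exp x * exp (- \<bar>- x + 1 * y\<bar>))"
    by simp
qed

lemma has_real_derivative_exp_primitive:
  fixes F :: "real \<Rightarrow> real"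
  assumes F: "continuous_on UNIV F" and B: "\<And>x. \<bar>F x\<bar> \<le> B"
  shows "(exp_primitive F has_real_derivative exp x * F x) (at x)"
proof -
  have Fm [measurable]: "F \<in> borel_measurable borel" using F by (rule borel_measurable_continuous_onI)
  define f where "f = (\<lambda>y. exp y * F y)"
  have fc: "continuous_on UNIV f" unfolding f_def by (intro continuous_intros F)
  have int: "set_integrable lborel {..<z} f" for z
    using integrable_exp_primitive[OF Fm B, of z] by (simp add: set_integrable_def f_def)
  have Peq: "exp_primitive F z = (LBINT y=-\<infinity>..z. f y)" for z
    by (simp add: exp_primitive_def f_def interval_lebesgue_integral_def set_lebesgue_integral_def einterval_def lessThan_def)
  \<comment> \<open>The fundamental theorem is applied with a finite lower limit, so the integral is
    cut at x - 1.\<close>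
  have split: "exp_primitive F z = exp_primitive F (x - 1) + (LBINT y=x - 1..z. f y)" if "x - 1 \<le> z" for z
    unfolding Peq
  proof (rule interval_integral_sum[symmetric])
    have mm: "min (- \<infinity>) (min (ereal (x - 1)) (ereal z)) = - \<infinity>" "max (- \<infinity>) (max (ereal (x - 1)) (ereal z)) = ereal z"
      using that by (auto simp: max_def min_def)
    show "interval_lebesgue_integrable lborel (min (- \<infinity>) (min (ereal (x - 1)) (ereal z))) (max (- \<infinity>) (max (ereal (x - 1)) (ereal z))) f"
      unfolding mm using int[of z] by (simp add: interval_lebesgue_integrable_def einterval_def lessThan_def)
  qed
  have "((\<lambda>u. LBINT y=x - 1..u. f y) has_vector_derivative f x) (at x within {x - 1..x + 1})"
    by (rule interval_integral_FTC2) (auto intro: continuous_on_subset[OF fc])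
  then have "((\<lambda>u. LBINT y=x - 1..u. f y) has_real_derivative f x) (at x)"
    by (simp add: has_real_derivative_iff_has_vector_derivative at_within_Icc_at)
  then have "((\<lambda>u. exp_primitive F (x - 1) + (LBINT y=x - 1..u. f y)) has_real_derivative f x) (at x)"
    using DERIV_add[OF DERIV_const] by fastforce
  then have "(exp_primitive F has_real_derivative f x) (at x)"
  proof (rule has_field_derivative_transform_within_open[of _ _ _ "{x - 1<..}"])
    show "exp_primitive F (x - 1) + (LBINT y=x - 1..z. f y) = exp_primitive F z" if "z \<in> {x - 1<..}" for z
      using split[of z] that by simp
  qed auto
  then show ?thesis by (simp add: f_def)
qed

text \<open>Reflection turns the contribution of y > x into an \<open>exp_primitive\<close> at -x,
  so only one kind of primitive has to be differentiated.\<close>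

lemma integral_reflect_exp:
  fixes F :: "real \<Rightarrow> real"
  shows "(\<integral>y. indicator {x<..} y * (exp (- y) * F y) \<partial>lborel) = exp_primitive (\<lambda>y. F (- y)) (- x)"
proof -
  have "(\<integral>y. indicator {x<..} y * (exp (- y) * F y) \<partial>lborel) = \<bar>- 1\<bar> *\<^sub>R (\<integral>y. indicator {x<..} (0 + (- 1) * y) * (exp (- (0 + (- 1) * y)) * F (0 + (- 1) * y)) \<partial>lborel)"
    by (rule lborel_integral_real_affine) simp
  also have "\<dots> = exp_primitive (\<lambda>y. F (- y)) (- x)"
    unfolding exp_primitive_def by (auto intro!: Bochner_Integration.integral_cong simp: indicator_def)
  finally show ?thesis .
qed

lemma conv_dG_Green_eq:
  fixes F :: "real \<Rightarrow> real"
  assumes F: "continuous_on UNIV F" and B: "\<And>x. \<bar>F x\<bar> \<le> B"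
  shows "conv dG F x = - (1 / 2 * exp (- x)) * exp_primitive F x + 1 / 2 * exp x * exp_primitive (\<lambda>y. F (- y)) (- x)"
    "conv Green F x = 1 / 2 * exp (- x) * exp_primitive F x + 1 / 2 * exp x * exp_primitive (\<lambda>y. F (- y)) (- x)"
proof -
  have Fm [measurable]: "F \<in> borel_measurable borel" using F by (rule borel_measurable_continuous_onI)
  define p where "p = (\<lambda>y. indicator {..<x} y * (exp y * F y))"
  define q where "q = (\<lambda>y. indicator {x<..} y * (exp (- y) * F y))"
  have pi: "integrable lborel p" unfolding p_def by (rule integrable_exp_primitive[OF Fm B])
  have qi: "integrable lborel q"
  proof -
    have "integrable lborel (\<lambda>y. indicator {..<- x} y * (exp y * F (- y)))"
      by (rule integrable_exp_primitive[of "\<lambda>y. F (- y)"]) (use B in auto)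
    from lborel_integrable_real_affine[OF this, of "- 1" 0]
    have "integrable lborel (\<lambda>y. indicator {..<- x} (- y) * (exp (- y) * F y))" by simp
    moreover have "indicator {..<- x} (- y) = (indicator {x<..} y :: real)" for y by (simp add: indicator_def)
    ultimately show ?thesis unfolding q_def by simp
  qed
  have P: "(\<integral>y. p y \<partial>lborel) = exp_primitive F x" by (simp add: p_def exp_primitive_def)
  have Q: "(\<integral>y. q y \<partial>lborel) = exp_primitive (\<lambda>y. F (- y)) (- x)" unfolding q_def by (rule integral_reflect_exp)
  have "dG (x - y) * F y = - (1 / 2 * exp (- x)) * p y + 1 / 2 * exp x * q y" for y
    by (cases y x rule: linorder_cases) (simp_all add: dG_def p_def q_def exp_diff exp_minus field_simps)
  then have "conv dG F x = (\<integral>y. - (1 / 2 * exp (- x)) * p y + 1 / 2 * exp x * q y \<partial>lborel)"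
    unfolding conv_def by (simp only:)
  also have "\<dots> = (\<integral>y. - (1 / 2 * exp (- x)) * p y \<partial>lborel) + (\<integral>y. 1 / 2 * exp x * q y \<partial>lborel)"
    by (rule Bochner_Integration.integral_add) (intro integrable_mult_right pi qi)+
  finally show "conv dG F x = - (1 / 2 * exp (- x)) * exp_primitive F x + 1 / 2 * exp x * exp_primitive (\<lambda>y. F (- y)) (- x)"
    by (simp only: integral_mult_right_zero P Q)
  \<comment> \<open>At y = x both p and q vanish while \<open>Green\<close> does not; a single point
    leaves the integral unchanged. The function \<open>dG\<close> is 0 there because sgn 0 = 0, so
    its identity holds without exception.\<close>
  have eqG: "Green (x - y) * F y = 1 / 2 * exp (- x) * p y + 1 / 2 * exp x * q y" if "y \<noteq> x" for y
    using that by (cases y x rule: linorder_cases) (simp_all add: Green_def p_def q_def exp_diff exp_minus field_simps)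
  have "conv Green F x = (\<integral>y. 1 / 2 * exp (- x) * p y + 1 / 2 * exp x * q y \<partial>lborel)"
    unfolding conv_def by (rule integral_discrete_difference[of "{x}"]) (use eqG in auto)
  also have "\<dots> = (\<integral>y. 1 / 2 * exp (- x) * p y \<partial>lborel) + (\<integral>y. 1 / 2 * exp x * q y \<partial>lborel)"
    by (rule Bochner_Integration.integral_add) (intro integrable_mult_right pi qi)+
  finally show "conv Green F x = 1 / 2 * exp (- x) * exp_primitive F x + 1 / 2 * exp x * exp_primitive (\<lambda>y. F (- y)) (- x)"
    by (simp only: integral_mult_right_zero P Q)
qed

text \<open>\<open>\<partial>\<^sub>x\<^sup>2 G * F = G * F - F\<close>, because \<open>G\<close> is the Green function of \<open>1 - \<partial>\<^sub>x\<^sup>2\<close>.\<close>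

lemma has_real_derivative_conv_dG:
  fixes F :: "real \<Rightarrow> real"
  assumes F: "continuous_on UNIV F" and B: "\<And>x. \<bar>F x\<bar> \<le> B"
  shows "(conv dG F has_real_derivative conv Green F x - F x) (at x)"
proof -
  have F': "continuous_on UNIV (\<lambda>y. F (- y))"
    by (intro continuous_on_compose2[OF F] continuous_intros) auto
  define P where "P = exp_primitive F"
  define Q where "Q = exp_primitive (\<lambda>y. F (- y))"
  have dP: "(P has_real_derivative exp x * F x) (at x)"
    unfolding P_def by (rule has_real_derivative_exp_primitive[OF F B])
  have "(Q has_real_derivative exp (- x) * F (- (- x))) (at (- x))"
    unfolding Q_def by (rule has_real_derivative_exp_primitive[OF F', of B]) (rule B)
  moreover have "((\<lambda>x. - x) has_real_derivative - 1) (at x)" by (auto intro!: derivative_eq_intros)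
  ultimately have dQ: "((\<lambda>x. Q (- x)) has_real_derivative - (exp (- x) * F x)) (at x)"
    using DERIV_chain2[of Q "exp (- x) * F x" "\<lambda>x. - x" x "- 1" UNIV] by simp
  have "((\<lambda>x. - (1 / 2 * exp (- x)) * P x + 1 / 2 * exp x * Q (- x)) has_real_derivative
      (1 / 2 * exp (- x) * P x + exp x * F x * - (1 / 2 * exp (- x))) + (1 / 2 * exp x * Q (- x) + - (exp (- x) * F x) * (1 / 2 * exp x))) (at x)"
    by (intro DERIV_add DERIV_mult dP dQ) (auto intro!: derivative_eq_intros)
  moreover have "(1 / 2 * exp (- x) * P x + exp x * F x * - (1 / 2 * exp (- x))) + (1 / 2 * exp x * Q (- x) + - (exp (- x) * F x) * (1 / 2 * exp x)) = conv Green F x - F x"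
    unfolding conv_dG_Green_eq(2)[OF F B] P_def Q_def by (simp add: exp_minus)
  moreover have "conv dG F = (\<lambda>x. - (1 / 2 * exp (- x)) * P x + 1 / 2 * exp x * Q (- x))"
    by (rule ext) (simp only: conv_dG_Green_eq(1)[OF F B] P_def Q_def)
  ultimately show ?thesis by (simp only:)
qed

text \<open>The weight passes through the kernel by w(x) exp (-|x - y|) \<le> k(x - y) w(y), and
  Young's inequality for k gives the constant K. Only |h| \<le> \<open>Green\<close> enters, so
  \<open>Green\<close> and \<open>dG\<close> are treated at once.\<close>

lemma Lp_norm_weighted_conv_le:
  fixes w k F h :: "real \<Rightarrow> real"
  assumes p: "1 \<le> p" and w[measurable]: "w \<in> borel_measurable borel" and w0: "\<And>x. 0 < w x"
    and k[measurable]: "k \<in> borel_measurable borel" and k0: "\<And>z. 0 \<le> k z" and K: "(\<integral>\<^sup>+z. ennreal (k z) \<partial>lborel) \<le> ennreal K" "K > 0"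
    and ker: "AE z in lborel. \<forall>y. w (z + y) * exp (- \<bar>z\<bar>) \<le> k z * w y"
    and h[measurable]: "h \<in> borel_measurable borel" and hG: "\<And>z. \<bar>h z\<bar> \<le> Green z"
    and F: "continuous_on UNIV F" and B: "\<And>x. \<bar>F x\<bar> \<le> B"
  shows "Lp_norm p (\<lambda>x. w x * conv h F x) \<le> ennreal K * Lp_norm p (\<lambda>x. w x * F x)"
proof -
  have Fm [measurable]: "F \<in> borel_measurable borel" using F by (rule borel_measurable_continuous_onI)
  have hi: "integrable lborel h"
    by (rule Bochner_Integration.integrable_bound[OF integrable_Green])
      (use hG in \<open>auto intro: order_trans[OF _ abs_ge_self]\<close>)
  have [measurable]: "conv h F \<in> borel_measurable borel"
    unfolding conv_def[abs_def] by measurable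
  have "Lp_norm p (\<lambda>x. w x * conv h F x) \<le> ennreal K * Lp_norm p (\<lambda>x. \<bar>w x * F x\<bar>)"
  proof (rule Lp_norm_convolution_le[where k = k])
    fix x
    \<comment> \<open>For fixed x the inequality is needed at z = x - y for almost every y;
      reflection and translation preserve null sets.\<close>
    obtain N where N: "\<And>z. z \<in> space lborel - N \<Longrightarrow> \<forall>y. w (z + y) * exp (- \<bar>z\<bar>) \<le> k z * w y" "N \<in> null_sets lborel"
      using AE_E3[OF ker] by blast
    have N': "N \<in> sets borel" using N(2) by auto
    have aeN: "AE z in lborel. z \<notin> N" using N(2) by (rule AE_not_in)
    have "AE y in lborel. x + (- 1) * y \<notin> N"
      by (rule AE_borel_affine[OF _ _ aeN]) (use N' in \<open>simp_all add: pred_sets2 pred_def\<close>)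
    then have aey: "AE y in lborel. w x * exp (- \<bar>x - y\<bar>) \<le> k (x - y) * w y"
    proof eventually_elim
      case (elim y)
      then show ?case using N(1)[of "x - y"] by (auto dest!: spec[of _ y])
    qed
    have "ennreal \<bar>w x * conv h F x\<bar> = ennreal (w x) * ennreal \<bar>conv h F x\<bar>"
      using w0[of x] by (simp add: abs_mult ennreal_mult)
    also have "\<dots> \<le> ennreal (w x) * (\<integral>\<^sup>+y. ennreal (exp (- \<bar>x - y\<bar>) * \<bar>F y\<bar>) \<partial>lborel)"
    proof (intro mult_left_mono)
      have i: "integrable lborel (\<lambda>y. h (x - y) * F y)"
      proof -
        from lborel_integrable_real_affine[OF integrable_conv[OF hi Fm B, of x], of "- 1" x]
        show ?thesis by simp
      qed
      have "ennreal \<bar>conv h F x\<bar> \<le> (\<integral>\<^sup>+y. ennreal (norm (h (x - y) * F y)) \<partial>lborel)"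
        using integral_norm_bound_ennreal[OF i] by (simp add: conv_def)
      also have "\<dots> \<le> (\<integral>\<^sup>+y. ennreal (exp (- \<bar>x - y\<bar>) * \<bar>F y\<bar>) \<partial>lborel)"
      proof (intro nn_integral_mono ennreal_leI)
        fix y
        have "\<bar>h (x - y)\<bar> \<le> exp (- \<bar>x - y\<bar>)" using hG[of "x - y"] by (simp add: Green_def)
        then show "norm (h (x - y) * F y) \<le> exp (- \<bar>x - y\<bar>) * \<bar>F y\<bar>"
          by (simp add: abs_mult mult_right_mono)
      qed
      finally show "ennreal \<bar>conv h F x\<bar> \<le> (\<integral>\<^sup>+y. ennreal (exp (- \<bar>x - y\<bar>) * \<bar>F y\<bar>) \<partial>lborel)" .
    qed simp
    also have "\<dots> = (\<integral>\<^sup>+y. ennreal (w x) * ennreal (exp (- \<bar>x - y\<bar>) * \<bar>F y\<bar>) \<partial>lborel)"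
      by (rule nn_integral_cmult[symmetric]) measurable
    also have "\<dots> \<le> (\<integral>\<^sup>+y. ennreal (k (x - y)) * ennreal \<bar>w y * F y\<bar> \<partial>lborel)"
    proof (rule nn_integral_mono_AE)
      show "AE y in lborel. ennreal (w x) * ennreal (exp (- \<bar>x - y\<bar>) * \<bar>F y\<bar>) \<le> ennreal (k (x - y)) * ennreal \<bar>w y * F y\<bar>"
        using aey
      proof eventually_elim
        case (elim y)
        have "(w x * exp (- \<bar>x - y\<bar>)) * \<bar>F y\<bar> \<le> (k (x - y) * w y) * \<bar>F y\<bar>"
          by (intro mult_right_mono elim) simp
        then have "ennreal (w x * (exp (- \<bar>x - y\<bar>) * \<bar>F y\<bar>)) \<le> ennreal (k (x - y) * \<bar>w y * F y\<bar>)"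
          using w0[of y] by (intro ennreal_leI) (simp add: abs_mult mult_ac)
        then show ?case using w0[of x] k0[of "x - y"] by (simp add: ennreal_mult')
      qed
    qed
    finally show "ennreal \<bar>w x * conv h F x\<bar> \<le> (\<integral>\<^sup>+y. ennreal (k (x - y)) * ennreal \<bar>w y * F y\<bar> \<partial>lborel)" .
  qed (use K k0 p in auto)
  also have "Lp_norm p (\<lambda>x. \<bar>w x * F x\<bar>) \<le> Lp_norm p (\<lambda>x. w x * F x)"
    by (rule Lp_norm_mono_AE) (use p in auto)
  finally show ?thesis by (simp add: mult_left_mono)
qed

section \<open>Weighted estimates for transport equations\<close>

lemma log_Lipschitz_continuous:
  fixes w :: "real \<Rightarrow> real"
  assumes w0: "\<And>x. 0 < w x" and lip: "\<And>x y. w x \<le> w y * exp (A * \<bar>x - y\<bar>)"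
  shows "continuous_on UNIV w"
proof -
  have ln_lip: "ln (w x) - ln (w y) \<le> \<bar>A\<bar> * \<bar>x - y\<bar>" for x y
  proof -
    have "ln (w x) \<le> ln (w y * exp (A * \<bar>x - y\<bar>))" using w0 lip by (subst ln_le_cancel_iff) auto
    also have "\<dots> = ln (w y) + A * \<bar>x - y\<bar>" using w0[of y] by (simp add: ln_mult)
    also have "A * \<bar>x - y\<bar> \<le> \<bar>A\<bar> * \<bar>x - y\<bar>" by (intro mult_right_mono) auto
    finally show ?thesis by simp
  qed
  have "\<bar>A\<bar>-lipschitz_on UNIV (\<lambda>x. ln (w x))"
  proof (rule lipschitz_onI)
    show "dist (ln (w x)) (ln (w y)) \<le> \<bar>A\<bar> * dist x y" for x y
      using ln_lip[of x y] ln_lip[of y x] by (simp add: dist_real_def abs_minus_commute abs_le_iff)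
  qed simp
  then have "continuous_on UNIV (\<lambda>x. ln (w x))" by (rule lipschitz_on_continuous_on)
  then have "continuous_on UNIV (\<lambda>x. exp (ln (w x)))" by (rule continuous_on_exp)
  moreover have "(\<lambda>x. exp (ln (w x))) = w" using w0 by (simp add: fun_eq_iff)
  ultimately show ?thesis by (simp only:)
qed

text \<open>Converts the Jacobian factor of one Euler step into an exponential, so that the factors
  of all steps multiply to an exponential in time.\<close>

lemma inverse_le_exp:
  fixes y :: real
  assumes "0 \<le> y" "y \<le> 1 / 2"
  shows "1 / (1 - y) \<le> exp (2 * y)"
proof -
  have "1 + 2 * y \<le> exp (2 * y)" by (rule exp_ge_add_one_self)
  moreover have "1 / (1 - y) \<le> 1 + 2 * y"
  proof -
    have "0 \<le> y * (1 - 2 * y)" using assms by (intro mult_nonneg_nonneg) auto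
    then have "1 \<le> (1 + 2 * y) * (1 - y)" by (simp add: algebra_simps)
    then show ?thesis using assms by (simp add: pos_divide_le_eq)
  qed
  ultimately show ?thesis by linarith
qed

text \<open>The map x - h U(x) has derivative at least 1 - h M, so composition with it costs 1 / (1
  - h M) \<le> exp (2 h M) in every L^p; moving the weight by at most h M costs exp (A h M).
  Together this is exp ((A + 2) M h), independent of p.\<close>

lemma Lp_norm_transport_step:
  fixes U Ux v v' S w :: "real \<Rightarrow> real"
  assumes p: "1 \<le> p" and w0: "\<And>x. 0 < w x" and lip: "\<And>x y. w x \<le> w y * exp (A * \<bar>x - y\<bar>)" and A: "A \<ge> 0"
    and dU: "\<And>x. (U has_real_derivative Ux x) (at x)" and Ux: "continuous_on UNIV Ux"
    and M: "\<And>x. \<bar>U x\<bar> \<le> M" "\<And>x. \<bar>Ux x\<bar> \<le> M"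
    and h: "0 < h" "h * M \<le> 1 / 2" and \<eta>: "\<eta> \<ge> 0"
    and cont: "continuous_on UNIV v" "continuous_on UNIV v'" "continuous_on UNIV S"
    and step: "\<And>x. \<bar>v' x\<bar> \<le> \<bar>v (x - h * U x)\<bar> + h * \<bar>S x\<bar> + h * \<eta>"
  shows "Lp_norm p (\<lambda>x. w x * v' x) \<le> ennreal (exp ((A + 2) * M * h)) * Lp_norm p (\<lambda>x. w x * v x)
    + ennreal h * Lp_norm p (\<lambda>x. w x * S x) + ennreal (h * \<eta>) * Lp_norm p w"
proof -
  have M0: "M \<ge> 0" using M(1)[of 0] by linarith
  have wc: "continuous_on UNIV w" by (rule log_Lipschitz_continuous[OF w0 lip])
  have Uc: "continuous_on UNIV U"
    using dU by (intro continuous_at_imp_continuous_on ballI) (auto intro: DERIV_isCont)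
  have [measurable]: "w \<in> borel_measurable borel" "U \<in> borel_measurable borel" "v \<in> borel_measurable borel"
      "v' \<in> borel_measurable borel" "S \<in> borel_measurable borel"
    using wc Uc cont by (auto intro: borel_measurable_continuous_onI)
  define E where "E = exp (A * (h * M))"
  define f1 where "f1 = (\<lambda>x. (\<lambda>y. w y * v y) (x - h * U x))"
  define f2 where "f2 = (\<lambda>x. w x * S x)"
  have fm [measurable]: "f1 \<in> borel_measurable borel" "f2 \<in> borel_measurable borel" unfolding f1_def f2_def by measurable
  have pw: "\<bar>w x * v' x\<bar> \<le> (E * \<bar>f1 x\<bar> + h * \<bar>f2 x\<bar>) + h * \<eta> * w x" for x
  proof -
    have "w x \<le> w (x - h * U x) * E"
    proof -
      have "w x \<le> w (x - h * U x) * exp (A * \<bar>x - (x - h * U x)\<bar>)" by (rule lip)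
      also have "\<dots> \<le> w (x - h * U x) * E"
        unfolding E_def using w0[of "x - h * U x"] A h(1) M(1)[of x]
        by (intro mult_left_mono) (auto simp: abs_mult intro!: mult_left_mono)
      finally show ?thesis .
    qed
    then have "w x * \<bar>v (x - h * U x)\<bar> \<le> (w (x - h * U x) * E) * \<bar>v (x - h * U x)\<bar>" by (intro mult_right_mono) auto
    also have "\<dots> = E * \<bar>f1 x\<bar>" using w0[of "x - h * U x"] by (simp add: f1_def abs_mult)
    finally have a: "w x * \<bar>v (x - h * U x)\<bar> \<le> E * \<bar>f1 x\<bar>" .
    have "\<bar>w x * v' x\<bar> = w x * \<bar>v' x\<bar>" using w0[of x] by (simp add: abs_mult)
    also have "\<dots> \<le> w x * (\<bar>v (x - h * U x)\<bar> + h * \<bar>S x\<bar> + h * \<eta>)"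
      using w0[of x] by (intro mult_left_mono step) auto
    also have "\<dots> = w x * \<bar>v (x - h * U x)\<bar> + h * \<bar>f2 x\<bar> + h * \<eta> * w x"
      using w0[of x] by (simp add: f2_def abs_mult algebra_simps)
    finally show ?thesis using a by linarith
  qed
  have "Lp_norm p (\<lambda>x. w x * v' x) \<le> Lp_norm p (\<lambda>x. (E * \<bar>f1 x\<bar> + h * \<bar>f2 x\<bar>) + h * \<eta> * w x)"
  proof (rule Lp_norm_mono_AE[OF _ _ p])
    show "AE x in lborel. norm (w x * v' x) \<le> norm (E * \<bar>f1 x\<bar> + h * \<bar>f2 x\<bar> + h * \<eta> * w x)"
      using pw by (intro AE_I2) (auto intro: order_trans[OF _ abs_ge_self])
  qed measurable
  also have "\<dots> \<le> Lp_norm p (\<lambda>x. E * \<bar>f1 x\<bar> + h * \<bar>f2 x\<bar>) + Lp_norm p (\<lambda>x. h * \<eta> * w x)"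
    by (rule Lp_norm_triangle[OF _ _ p]) measurable
  also have "\<dots> \<le> (Lp_norm p (\<lambda>x. E * \<bar>f1 x\<bar>) + Lp_norm p (\<lambda>x. h * \<bar>f2 x\<bar>)) + ennreal (h * \<eta>) * Lp_norm p w"
  proof (rule add_mono)
    show "Lp_norm p (\<lambda>x. E * \<bar>f1 x\<bar> + h * \<bar>f2 x\<bar>) \<le> Lp_norm p (\<lambda>x. E * \<bar>f1 x\<bar>) + Lp_norm p (\<lambda>x. h * \<bar>f2 x\<bar>)"
      by (rule Lp_norm_triangle[OF _ _ p]) measurable
    show "Lp_norm p (\<lambda>x. h * \<eta> * w x) \<le> ennreal (h * \<eta>) * Lp_norm p w"
      by (rule Lp_norm_cmult_le[OF _ p]) (use h \<eta> in auto)
  qed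
  also have "\<dots> \<le> (ennreal (exp ((A + 2) * M * h)) * Lp_norm p (\<lambda>x. w x * v x) + ennreal h * Lp_norm p (\<lambda>x. w x * S x)) + ennreal (h * \<eta>) * Lp_norm p w"
  proof (intro add_mono order_refl)
    have abs_le: "Lp_norm p (\<lambda>x. \<bar>f x\<bar>) \<le> Lp_norm p f" if "f \<in> borel_measurable borel" for f :: "real \<Rightarrow> real"
      by (rule Lp_norm_mono_AE[OF _ _ p]) (use that in auto)
    have "Lp_norm p (\<lambda>x. E * \<bar>f1 x\<bar>) \<le> ennreal E * Lp_norm p (\<lambda>x. \<bar>f1 x\<bar>)"
      by (rule Lp_norm_cmult_le[OF _ p]) (auto simp: E_def)
    also have "\<dots> \<le> ennreal E * Lp_norm p f1" by (intro mult_left_mono abs_le) auto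
    also have "\<dots> \<le> ennreal E * (ennreal (1 / (1 - h * M)) * Lp_norm p (\<lambda>x. w x * v x))"
    proof (intro mult_left_mono)
      show "Lp_norm p f1 \<le> ennreal (1 / (1 - h * M)) * Lp_norm p (\<lambda>x. w x * v x)"
        unfolding f1_def
      proof (rule Lp_norm_composition_le[OF _ _ _ _ _ _ p])
        show "continuous_on UNIV (\<lambda>x. w x * v x)" by (intro continuous_intros wc cont)
        show "((\<lambda>x. x - h * U x) has_real_derivative 1 - h * Ux x) (at x)" for x
          by (intro DERIV_diff DERIV_ident DERIV_cmult dU)
        show "continuous_on UNIV (\<lambda>x. 1 - h * Ux x)" by (intro continuous_intros Ux)
        show "0 < 1 - h * M" using h by linarith
        show "1 - h * M \<le> 1" using h M0 by simp
        show "1 - h * M \<le> 1 - h * Ux x" for x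
          using M(2)[of x] h(1) by (simp add: abs_le_iff)
      qed
    qed simp
    also have "\<dots> = ennreal (E * (1 / (1 - h * M))) * Lp_norm p (\<lambda>x. w x * v x)"
      using h by (subst ennreal_mult) (auto simp: E_def mult.assoc)
    also have "\<dots> \<le> ennreal (exp ((A + 2) * M * h)) * Lp_norm p (\<lambda>x. w x * v x)"
    proof (intro mult_right_mono ennreal_leI)
      have "E * (1 / (1 - h * M)) \<le> E * exp (2 * (h * M))"
        using h M0 by (intro mult_left_mono inverse_le_exp) (auto simp: E_def)
      also have "\<dots> = exp ((A + 2) * M * h)" unfolding E_def exp_add[symmetric] by (simp add: algebra_simps)
      finally show "E * (1 / (1 - h * M)) \<le> exp ((A + 2) * M * h)" .
    qed simp
    finally show "Lp_norm p (\<lambda>x. E * \<bar>f1 x\<bar>) \<le> ennreal (exp ((A + 2) * M * h)) * Lp_norm p (\<lambda>x. w x * v x)" .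
    have "Lp_norm p (\<lambda>x. h * \<bar>f2 x\<bar>) \<le> ennreal h * Lp_norm p (\<lambda>x. \<bar>f2 x\<bar>)"
      by (rule Lp_norm_cmult_le[OF _ p]) (use h in auto)
    also have "\<dots> \<le> ennreal h * Lp_norm p f2" by (intro mult_left_mono abs_le) auto
    finally show "Lp_norm p (\<lambda>x. h * \<bar>f2 x\<bar>) \<le> ennreal h * Lp_norm p (\<lambda>x. w x * S x)" by (simp add: f2_def)
  qed
  finally show ?thesis .
qed

text \<open>Since a \<ge> 1, each added b may be counted as if it had been present from the start
  and multiplied by the full power of a. Extended values are allowed, so no finiteness has to be
  checked.\<close>

lemma discrete_Gronwall:
  fixes z :: "nat \<Rightarrow> ennreal"
  assumes a: "1 \<le> a" and b: "0 \<le> b" and step: "\<And>k. k < n \<Longrightarrow> z (Suc k) \<le> ennreal a * z k + ennreal b"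
  shows "k \<le> n \<Longrightarrow> z k \<le> ennreal (a ^ k) * (z 0 + ennreal (real k * b))"
proof (induction k)
  case 0
  then show ?case by simp
next
  case (Suc k)
  have ak: "1 \<le> a ^ k" "1 \<le> a ^ Suc k" using a by (auto intro!: one_le_power simp del: power_Suc)
  have "z (Suc k) \<le> ennreal a * z k + ennreal b" using Suc.prems by (intro step) simp
  also have "\<dots> \<le> ennreal a * (ennreal (a ^ k) * (z 0 + ennreal (real k * b))) + ennreal (a ^ Suc k) * ennreal b"
  proof (intro add_mono mult_left_mono)
    show "z k \<le> ennreal (a ^ k) * (z 0 + ennreal (real k * b))" using Suc by simp
    have "1 * ennreal b \<le> ennreal (a ^ Suc k) * ennreal b"
      using ak(2) by (intro mult_right_mono) (auto simp del: power_Suc)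
    then show "ennreal b \<le> ennreal (a ^ Suc k) * ennreal b" by simp
  qed simp
  also have "ennreal a * (ennreal (a ^ k) * (z 0 + ennreal (real k * b))) = ennreal (a ^ Suc k) * (z 0 + ennreal (real k * b))"
    using a by (simp add: ennreal_mult mult.assoc)
  also have "ennreal (a ^ Suc k) * (z 0 + ennreal (real k * b)) + ennreal (a ^ Suc k) * ennreal b = ennreal (a ^ Suc k) * (z 0 + ennreal (real (Suc k) * b))"
  proof -
    have "ennreal (real (Suc k) * b) = ennreal (real k * b) + ennreal b"
      using b by (subst ennreal_plus[symmetric]) (auto simp: algebra_simps)
    then show ?thesis by (simp only: distrib_left add.assoc)
  qed
  finally show ?case .
qed

text \<open>The unknowns W i share the velocity U, and each source is controlled by the sum of all
  weighted norms, so the Gronwall argument is applied to this sum. It is run for approximations v i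
  at uniform distance \<eta>; such an error costs \<eta> times the norm of w, whence the assumption
  \<open>fin\<close>. At the end \<eta> tends to 0 for fixed t.\<close>

lemma weighted_transport_estimate:
  fixes U Ux :: "real \<Rightarrow> real \<Rightarrow> real" and W S :: "nat \<Rightarrow> real \<Rightarrow> real \<Rightarrow> real" and w :: "real \<Rightarrow> real"
  assumes I: "I = {0..T}"
    and p: "1 \<le> p" and w0: "\<And>x. 0 < w x" and lip: "\<And>x y. w x \<le> w y * exp (A * \<bar>x - y\<bar>)" and A: "A \<ge> 0"
    and fin: "Lp_norm p w < \<infinity>"
    and U: "BUC I U" and Ux: "BUC I Ux" and W: "\<And>i. i < N \<Longrightarrow> BUC I (W i)" and S: "\<And>i. i < N \<Longrightarrow> BUC I (S i)"
    and dU: "\<And>t x. t \<in> I \<Longrightarrow> (U t has_real_derivative Ux t x) (at x)"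
    and M: "\<And>t x. t \<in> I \<Longrightarrow> \<bar>U t x\<bar> \<le> M" "\<And>t x. t \<in> I \<Longrightarrow> \<bar>Ux t x\<bar> \<le> M" "M \<ge> 0"
    and eqn: "\<And>i e t x. i < N \<Longrightarrow> e > 0 \<Longrightarrow> t \<in> I \<Longrightarrow> ((\<lambda>\<tau>. conv (normal_density 0 e) (W i \<tau>) x) has_real_derivative
        conv (normal_density 0 e) (\<lambda>y. Ux t y * W i t y) x - conv (normal_deriv e) (\<lambda>y. U t y * W i t y) x
        + conv (normal_density 0 e) (S i t) x) (at t within I)"
    and c: "c \<ge> 0"
    and bound: "\<And>i t. i < N \<Longrightarrow> t \<in> I \<Longrightarrow> Lp_norm p (\<lambda>x. w x * S i t x) \<le> ennreal c * (\<Sum>j<N. Lp_norm p (\<lambda>x. w x * W j t x))"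
    and t: "t \<in> I"
  shows "(\<Sum>i<N. Lp_norm p (\<lambda>x. w x * W i t x)) \<le> ennreal (exp (((A + 2) * M + real N * c) * t)) * (\<Sum>i<N. Lp_norm p (\<lambda>x. w x * W i 0 x))"
proof (cases "t = 0")
  case True
  then show ?thesis by simp
next
  case False
  then have t0: "t > 0" using t I by auto
  define Y where "Y = (\<lambda>t. \<Sum>i<N. Lp_norm p (\<lambda>x. w x * W i t x))"
  define L where "L = enn2real (Lp_norm p w)"
  have L: "Lp_norm p w = ennreal L" "L \<ge> 0" using fin by (auto simp: L_def)
  define \<kappa> where "\<kappa> = (A + 2) * M + real N * c"
  have \<kappa>0: "\<kappa> \<ge> 0" using A M(3) c by (simp add: \<kappa>_def)
  have wc: "continuous_on UNIV w" by (rule log_Lipschitz_continuous[OF w0 lip])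
  then have wm [measurable]: "w \<in> borel_measurable borel" by (rule borel_measurable_continuous_onI)
  \<comment> \<open>Error per unit of time relative to \<eta>: each of the N components contributes
    \<eta> L from its Euler step and c N \<eta> L from replacing W by v in the source bound.\<close>
  define D where "D = real N * (c * real N + 1) * L"
  have D0: "D \<ge> 0" using L c by (simp add: D_def)
  have key: "Y t \<le> ennreal (exp (\<kappa> * t)) * (Y 0 + ennreal (real N * \<eta> * L) + ennreal (t * (\<eta> * D))) + ennreal (real N * \<eta> * L)"
    if \<eta>: "\<eta> > 0" for \<eta>
  proof -
    have "\<forall>i\<in>{..<N}. \<exists>vd. BUC I (fst vd) \<and> (\<forall>t\<in>I. \<forall>x. \<bar>fst vd t x - W i t x\<bar> \<le> \<eta>) \<and> snd vd > 0 \<and>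
      (\<forall>t\<in>I. \<forall>h. 0 < h \<longrightarrow> h < snd vd \<longrightarrow> t + h \<in> I \<longrightarrow> (\<forall>x. \<bar>fst vd (t + h) x\<bar> \<le> \<bar>fst vd t (x - h * U t x)\<bar> + h * \<bar>S i t x\<bar> + h * \<eta>))"
    proof
      fix i assume "i \<in> {..<N}"
      then have i: "i < N" by simp
      have cI: "convex I" unfolding I by simp
      have "\<exists>v d. BUC I v \<and> (\<forall>t\<in>I. \<forall>x. \<bar>v t x - W i t x\<bar> \<le> \<eta>) \<and> d > 0 \<and>
        (\<forall>t\<in>I. \<forall>h. 0 < h \<longrightarrow> h < d \<longrightarrow> t + h \<in> I \<longrightarrow> (\<forall>x. \<bar>v (t + h) x\<bar> \<le> \<bar>v t (x - h * U t x)\<bar> + h * \<bar>S i t x\<bar> + h * \<eta>))"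
        by (rule transport_approximation[OF cI U Ux W[OF i] S[OF i] dU M eqn[OF i] \<eta>])
      then obtain v d where "BUC I v \<and> (\<forall>t\<in>I. \<forall>x. \<bar>v t x - W i t x\<bar> \<le> \<eta>) \<and> d > 0 \<and>
        (\<forall>t\<in>I. \<forall>h. 0 < h \<longrightarrow> h < d \<longrightarrow> t + h \<in> I \<longrightarrow> (\<forall>x. \<bar>v (t + h) x\<bar> \<le> \<bar>v t (x - h * U t x)\<bar> + h * \<bar>S i t x\<bar> + h * \<eta>))"
        by (elim exE)
      then show "\<exists>vd. BUC I (fst vd) \<and> (\<forall>t\<in>I. \<forall>x. \<bar>fst vd t x - W i t x\<bar> \<le> \<eta>) \<and> snd vd > 0 \<and>
        (\<forall>t\<in>I. \<forall>h. 0 < h \<longrightarrow> h < snd vd \<longrightarrow> t + h \<in> I \<longrightarrow> (\<forall>x. \<bar>fst vd (t + h) x\<bar> \<le> \<bar>fst vd t (x - h * U t x)\<bar> + h * \<bar>S i t x\<bar> + h * \<eta>))"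
        by (intro exI[of _ "(v, d)"]) (unfold fst_conv snd_conv)
    qed
    from bchoice[OF this] obtain vd where vd: "\<forall>i\<in>{..<N}. BUC I (fst (vd i)) \<and> (\<forall>t\<in>I. \<forall>x. \<bar>fst (vd i) t x - W i t x\<bar> \<le> \<eta>) \<and> snd (vd i) > 0 \<and>
      (\<forall>t\<in>I. \<forall>h. 0 < h \<longrightarrow> h < snd (vd i) \<longrightarrow> t + h \<in> I \<longrightarrow> (\<forall>x. \<bar>fst (vd i) (t + h) x\<bar> \<le> \<bar>fst (vd i) t (x - h * U t x)\<bar> + h * \<bar>S i t x\<bar> + h * \<eta>))" ..
    define v d where "v = (\<lambda>i. fst (vd i))" and "d = (\<lambda>i. snd (vd i))"
    have vB: "BUC I (v i)" and vW: "\<And>t x. t \<in> I \<Longrightarrow> \<bar>v i t x - W i t x\<bar> \<le> \<eta>" and d0: "d i > 0"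
      and vstep: "\<And>t h x. t \<in> I \<Longrightarrow> 0 < h \<Longrightarrow> h < d i \<Longrightarrow> t + h \<in> I \<Longrightarrow> \<bar>v i (t + h) x\<bar> \<le> \<bar>v i t (x - h * U t x)\<bar> + h * \<bar>S i t x\<bar> + h * \<eta>"
      if "i < N" for i
      using bspec[OF vd, of i] that unfolding v_def d_def by simp_all
    define Z where "Z = (\<lambda>t. \<Sum>i<N. Lp_norm p (\<lambda>x. w x * v i t x))"
    \<comment> \<open>Passes between W and v in the weighted norm: a uniform error \<eta> weighs
      \<eta> L, which is finite because w itself lies in L^p.\<close>
    have near: "Lp_norm p (\<lambda>x. w x * f x) \<le> Lp_norm p (\<lambda>x. w x * g x) + ennreal (\<eta> * L)"
      if f: "continuous_on UNIV f" and g: "continuous_on UNIV g" and le: "\<And>x. \<bar>f x - g x\<bar> \<le> \<eta>" for f g :: "real \<Rightarrow> real"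
    proof -
      have [measurable]: "f \<in> borel_measurable borel" "g \<in> borel_measurable borel"
        using f g by (auto intro: borel_measurable_continuous_onI)
      have "Lp_norm p (\<lambda>x. w x * f x) \<le> Lp_norm p (\<lambda>x. w x * \<bar>g x\<bar> + \<eta> * w x)"
      proof (rule Lp_norm_mono_AE[OF _ _ p])
        have "norm (w x * f x) \<le> norm (w x * \<bar>g x\<bar> + \<eta> * w x)" for x
        proof -
          have "\<bar>f x\<bar> \<le> \<bar>g x\<bar> + \<eta>" using le[of x] by linarith
          then have "w x * \<bar>f x\<bar> \<le> w x * (\<bar>g x\<bar> + \<eta>)" using w0[of x] by (intro mult_left_mono) auto
          then have "\<bar>w x * f x\<bar> \<le> w x * \<bar>g x\<bar> + \<eta> * w x" using w0[of x] by (simp add: abs_mult distrib_left mult.commute)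
          then show ?thesis unfolding real_norm_def by (rule order_trans[OF _ abs_ge_self])
        qed
        then show "AE x in lborel. norm (w x * f x) \<le> norm (w x * \<bar>g x\<bar> + \<eta> * w x)" by (rule AE_I2)
      qed measurable
      also have "\<dots> \<le> Lp_norm p (\<lambda>x. w x * \<bar>g x\<bar>) + Lp_norm p (\<lambda>x. \<eta> * w x)"
        by (rule Lp_norm_triangle[OF _ _ p]) measurable
      also have "\<dots> \<le> Lp_norm p (\<lambda>x. w x * g x) + ennreal (\<eta> * L)"
      proof (rule add_mono)
        show "Lp_norm p (\<lambda>x. w x * \<bar>g x\<bar>) \<le> Lp_norm p (\<lambda>x. w x * g x)"
          by (rule Lp_norm_mono_AE[OF _ _ p]) (auto simp: abs_mult)
        have "Lp_norm p (\<lambda>x. \<eta> * w x) \<le> ennreal \<eta> * Lp_norm p w"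
          by (rule Lp_norm_cmult_le[OF wm p]) (use \<eta> in simp)
        then show "Lp_norm p (\<lambda>x. \<eta> * w x) \<le> ennreal (\<eta> * L)" using L \<eta> by (simp add: ennreal_mult)
      qed
      finally show ?thesis .
    qed
    have sumc: "(\<Sum>i<N. ennreal (\<eta> * L)) = ennreal (real N * \<eta> * L)"
      using \<eta> L by (simp add: ennreal_of_nat_eq_real_of_nat ennreal_mult mult.assoc)
    have YZ: "Y s \<le> Z s + ennreal (real N * \<eta> * L)" and ZY: "Z s \<le> Y s + ennreal (real N * \<eta> * L)" if s: "s \<in> I" for s
    proof -
      have "Y s \<le> (\<Sum>i<N. Lp_norm p (\<lambda>x. w x * v i s x) + ennreal (\<eta> * L))"
        unfolding Y_def
      proof (intro sum_mono near)
        fix i x assume "i \<in> {..<N}"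
        then show "continuous_on UNIV (W i s)" "continuous_on UNIV (v i s)" "\<bar>W i s x - v i s x\<bar> \<le> \<eta>"
          using BUC_continuous[OF W s] BUC_continuous[OF vB s] vW[of i s x] s by (auto simp: abs_minus_commute)
      qed
      then show "Y s \<le> Z s + ennreal (real N * \<eta> * L)" unfolding Z_def by (simp only: sum.distrib sumc)
      have "Z s \<le> (\<Sum>i<N. Lp_norm p (\<lambda>x. w x * W i s x) + ennreal (\<eta> * L))"
        unfolding Z_def
      proof (intro sum_mono near)
        fix i x assume "i \<in> {..<N}"
        then show "continuous_on UNIV (v i s)" "continuous_on UNIV (W i s)" "\<bar>v i s x - W i s x\<bar> \<le> \<eta>"
          using BUC_continuous[OF W s] BUC_continuous[OF vB s] vW[of i s x] s by auto
      qed
      then show "Z s \<le> Y s + ennreal (real N * \<eta> * L)" unfolding Y_def by (simp only: sum.distrib sumc)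
    qed
    have Zstep: "Z (s + h) \<le> ennreal (exp (\<kappa> * h)) * Z s + ennreal (h * (\<eta> * D))"
      if s: "s \<in> I" "s + h \<in> I" and h: "0 < h" "h * M \<le> 1 / 2" "\<And>i. i < N \<Longrightarrow> h < d i" for s h
    proof -
      \<comment> \<open>What the source and the step error add to each component, per unit of
        time.\<close>
      define R where "R = ennreal c * (Z s + ennreal (real N * \<eta> * L)) + ennreal (\<eta> * L)"
      have "Z (s + h) \<le> (\<Sum>i<N. ennreal (exp ((A + 2) * M * h)) * Lp_norm p (\<lambda>x. w x * v i s x) + ennreal h * R)"
        unfolding Z_def
      proof (rule sum_mono)
        fix i assume "i \<in> {..<N}"
        then have i: "i < N" by simp
        have "Lp_norm p (\<lambda>x. w x * v i (s + h) x) \<le> ennreal (exp ((A + 2) * M * h)) * Lp_norm p (\<lambda>x. w x * v i s x)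
            + ennreal h * Lp_norm p (\<lambda>x. w x * S i s x) + ennreal (h * \<eta>) * Lp_norm p w"
          by (rule Lp_norm_transport_step[OF p w0 lip A dU[OF s(1)] BUC_continuous[OF Ux s(1)] M(1)[OF s(1)] M(2)[OF s(1)] h(1,2) less_imp_le[OF \<eta>]
                BUC_continuous[OF vB[OF i] s(1)] BUC_continuous[OF vB[OF i] s(2)] BUC_continuous[OF S[OF i] s(1)] vstep[OF i s(1) h(1) h(3)[OF i] s(2)]])
        also have "ennreal (h * \<eta>) * Lp_norm p w = ennreal h * ennreal (\<eta> * L)"
          using h(1) \<eta> L by (simp add: ennreal_mult mult.assoc)
        also have "ennreal (exp ((A + 2) * M * h)) * Lp_norm p (\<lambda>x. w x * v i s x) + ennreal h * Lp_norm p (\<lambda>x. w x * S i s x) + ennreal h * ennreal (\<eta> * L)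
            \<le> ennreal (exp ((A + 2) * M * h)) * Lp_norm p (\<lambda>x. w x * v i s x) + ennreal h * (ennreal c * (Z s + ennreal (real N * \<eta> * L))) + ennreal h * ennreal (\<eta> * L)"
        proof (intro add_mono mult_left_mono order_refl)
          have "Lp_norm p (\<lambda>x. w x * S i s x) \<le> ennreal c * Y s" unfolding Y_def by (rule bound[OF i s(1)])
          also have "\<dots> \<le> ennreal c * (Z s + ennreal (real N * \<eta> * L))" by (intro mult_left_mono YZ s) simp
          finally show "Lp_norm p (\<lambda>x. w x * S i s x) \<le> ennreal c * (Z s + ennreal (real N * \<eta> * L))" .
        qed auto
        finally show "Lp_norm p (\<lambda>x. w x * v i (s + h) x) \<le> ennreal (exp ((A + 2) * M * h)) * Lp_norm p (\<lambda>x. w x * v i s x) + ennreal h * R"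
          unfolding R_def by (simp only: distrib_left add.assoc)
      qed
      also have "\<dots> = ennreal (exp ((A + 2) * M * h)) * Z s + ennreal (real N) * (ennreal h * R)"
        unfolding Z_def by (simp add: sum.distrib sum_distrib_left ennreal_of_nat_eq_real_of_nat)
      also have "ennreal (real N) * (ennreal h * R) = ennreal (real N * c * h) * Z s + ennreal (h * (\<eta> * D))"
      proof -
        have "ennreal (real N) * (ennreal h * R) = ennreal (real N * h) * (ennreal c * Z s + (ennreal c * ennreal (real N * \<eta> * L) + ennreal (\<eta> * L)))"
          unfolding R_def using h(1) by (simp only: ennreal_mult of_nat_0_le_iff less_imp_le distrib_left mult.assoc add.assoc)
        also have "ennreal c * ennreal (real N * \<eta> * L) + ennreal (\<eta> * L) = ennreal (c * (real N * \<eta> * L) + \<eta> * L)"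
          using c \<eta> L by (subst ennreal_mult[symmetric]; (subst ennreal_plus[symmetric])?; simp)
        also have "ennreal (real N * h) * (ennreal c * Z s + ennreal (c * (real N * \<eta> * L) + \<eta> * L))
           = (ennreal (real N * h) * ennreal c) * Z s + ennreal (real N * h) * ennreal (c * (real N * \<eta> * L) + \<eta> * L)"
          by (simp only: distrib_left mult.assoc)
        also have "ennreal (real N * h) * ennreal c = ennreal (real N * c * h)"
          using h(1) c by (subst ennreal_mult[symmetric]) (auto simp: mult_ac)
        also have "ennreal (real N * h) * ennreal (c * (real N * \<eta> * L) + \<eta> * L) = ennreal (h * (\<eta> * D))"
          using h(1) c \<eta> L by (subst ennreal_mult[symmetric]) (auto simp: D_def algebra_simps)
        finally show ?thesis .
      qed
      also have "ennreal (exp ((A + 2) * M * h)) * Z s + (ennreal (real N * c * h) * Z s + ennreal (h * (\<eta> * D)))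
          = ennreal (exp ((A + 2) * M * h) + real N * c * h) * Z s + ennreal (h * (\<eta> * D))"
        using h(1) c by (simp add: distrib_right add.assoc)
      also have "\<dots> \<le> ennreal (exp (\<kappa> * h)) * Z s + ennreal (h * (\<eta> * D))"
      proof (intro add_mono mult_right_mono ennreal_leI order_refl)
        \<comment> \<open>The transport factor and the source term merge by exp P + Q \<le> exp P (1
          + Q) \<le> exp (P + Q), as exp P \<ge> 1.\<close>
        define P Q where "P = (A + 2) * M * h" and "Q = real N * c * h"
        have PQ: "P \<ge> 0" "Q \<ge> 0" using A M(3) h(1) c by (auto simp: P_def Q_def)
        have "exp P * (1 + Q) \<le> exp P * exp Q" by (intro mult_left_mono exp_ge_add_one_self) simp
        moreover have "1 * Q \<le> exp P * Q" using PQ by (intro mult_right_mono) auto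
        ultimately have "exp P + Q \<le> exp (P + Q)" by (simp add: exp_add distrib_left)
        moreover have "P + Q = \<kappa> * h" by (simp add: P_def Q_def \<kappa>_def algebra_simps)
        ultimately show "exp ((A + 2) * M * h) + real N * c * h \<le> exp (\<kappa> * h)" by (simp add: P_def Q_def)
      qed (use \<eta> D0 in auto)
      finally show ?thesis .
    qed
    have "\<exists>\<delta>>0. \<forall>i<N. \<delta> \<le> d i"
    proof (intro exI[of _ "Min (insert 1 (d ` {..<N}))"] conjI allI impI)
      show "0 < Min (insert 1 (d ` {..<N}))" using d0 by (subst Min_gr_iff) auto
      show "Min (insert 1 (d ` {..<N})) \<le> d i" if "i < N" for i using that by (intro Min_le) auto
    qed
    then obtain \<delta> where \<delta>: "\<delta> > 0" "\<And>i. i < N \<Longrightarrow> \<delta> \<le> d i" by blast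
    \<comment> \<open>Equal steps h = t / n reach t exactly, and this n is large enough for both h <
      \<delta> and h M \<le> 1/2.\<close>
    obtain n :: nat where n: "t / \<delta> + 2 * t * M < real n" using reals_Archimedean2 by blast
    have n0: "real n > 0"
    proof -
      have "0 \<le> t / \<delta> + 2 * t * M" using t0 \<delta>(1) M(3) by simp
      then show ?thesis using n by linarith
    qed
    define h where "h = t / real n"
    have h0: "h > 0" using t0 n0 by (simp add: h_def)
    have hn: "real n * h = t" using n0 by (simp add: h_def)
    have h\<delta>: "h < \<delta>"
    proof -
      have "0 \<le> 2 * t * M" using t0 M(3) by simp
      then have "t / \<delta> < real n" using n by linarith
      then show ?thesis using \<delta>(1) n0 by (simp add: h_def pos_divide_less_eq mult.commute)
    qed
    have hM: "h * M \<le> 1 / 2"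
    proof -
      have "0 \<le> t / \<delta>" using t0 \<delta>(1) by simp
      then have "2 * t * M < real n" using n by linarith
      then show ?thesis using n0 by (simp add: h_def field_simps)
    qed
    have "Z (real k * h) \<le> ennreal (exp (\<kappa> * h) ^ k) * (Z (real 0 * h) + ennreal (real k * (h * (\<eta> * D))))" if "k \<le> n" for k
    proof (rule discrete_Gronwall[where z = "\<lambda>k. Z (real k * h)" and n = n, OF _ _ _ that])
      show "1 \<le> exp (\<kappa> * h)" using \<kappa>0 h0 by simp
      show "0 \<le> h * (\<eta> * D)" using h0 \<eta> D0 by simp
      fix k assume k: "k < n"
      have in_I: "real j * h \<in> I" if "j \<le> n" for j
      proof -
        have "real j * h \<le> real n * h" using that h0 by (intro mult_right_mono) auto
        then show ?thesis using hn h0 t unfolding I by simp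
      qed
      have "real (Suc k) * h = real k * h + h" by (simp add: algebra_simps)
      moreover have "Z (real k * h + h) \<le> ennreal (exp (\<kappa> * h)) * Z (real k * h) + ennreal (h * (\<eta> * D))"
      proof (rule Zstep[OF _ _ h0 hM])
        show "real k * h \<in> I" using k by (intro in_I) simp
        show "real k * h + h \<in> I" using in_I[of "Suc k"] k by (simp add: algebra_simps)
        show "h < d i" if "i < N" for i using h\<delta> \<delta>(2)[OF that] by linarith
      qed
      ultimately show "Z (real (Suc k) * h) \<le> ennreal (exp (\<kappa> * h)) * Z (real k * h) + ennreal (h * (\<eta> * D))" by (simp only:)
    qed
    from this[of n]
    have Zt: "Z t \<le> ennreal (exp (\<kappa> * h) ^ n) * (Z 0 + ennreal (real n * (h * (\<eta> * D))))" by (simp add: hn)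
    have "exp (\<kappa> * h) ^ n = exp (\<kappa> * t)" unfolding exp_of_nat_mult[symmetric] using hn by (simp add: mult.left_commute)
    moreover have "real n * (h * (\<eta> * D)) = t * (\<eta> * D)" by (simp only: mult.assoc[symmetric] hn)
    ultimately have "Z t \<le> ennreal (exp (\<kappa> * t)) * (Z 0 + ennreal (t * (\<eta> * D)))" using Zt by (simp only:)
    also have "\<dots> \<le> ennreal (exp (\<kappa> * t)) * (Y 0 + ennreal (real N * \<eta> * L) + ennreal (t * (\<eta> * D)))"
      using t t0 by (intro mult_left_mono add_mono ZY order_refl) (auto simp: I)
    finally have "Z t \<le> ennreal (exp (\<kappa> * t)) * (Y 0 + ennreal (real N * \<eta> * L) + ennreal (t * (\<eta> * D)))" .
    with YZ[OF t] show ?thesis by (meson add_right_mono order_trans)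
  qed
  \<comment> \<open>Collects the terms of \<open>key\<close> that are linear in \<eta>; with \<eta>
    = e / (C + 1) their total is at most e.\<close>
  define C where "C = exp (\<kappa> * t) * (real N * L + t * D) + real N * L"
  have C0: "C \<ge> 0" using L t0 D0 by (simp add: C_def)
  have "Y t \<le> ennreal (exp (\<kappa> * t)) * Y 0"
  proof (rule ennreal_le_epsilon)
    fix e :: real assume e: "e > 0"
    define \<eta> where "\<eta> = e / (C + 1)"
    have \<eta>: "\<eta> > 0" using e C0 by (simp add: \<eta>_def)
    have "ennreal (exp (\<kappa> * t)) * (Y 0 + ennreal (real N * \<eta> * L) + ennreal (t * (\<eta> * D))) + ennreal (real N * \<eta> * L)
      = ennreal (exp (\<kappa> * t)) * Y 0 + ennreal (exp (\<kappa> * t) * (real N * \<eta> * L + t * (\<eta> * D)) + real N * \<eta> * L)"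
    proof -
      have "ennreal (exp (\<kappa> * t)) * (Y 0 + ennreal (real N * \<eta> * L) + ennreal (t * (\<eta> * D))) = ennreal (exp (\<kappa> * t)) * Y 0 + ennreal (exp (\<kappa> * t)) * ennreal (real N * \<eta> * L + t * (\<eta> * D))"
        using L t0 D0 \<eta> by (simp only: distrib_left add.assoc) (simp add: ennreal_plus distrib_left)
      also have "ennreal (exp (\<kappa> * t)) * ennreal (real N * \<eta> * L + t * (\<eta> * D)) = ennreal (exp (\<kappa> * t) * (real N * \<eta> * L + t * (\<eta> * D)))"
        using L t0 D0 \<eta> by (intro ennreal_mult[symmetric]) auto
      finally show ?thesis
        using L t0 D0 \<eta> by (simp only: add.assoc) (subst ennreal_plus; simp)
    qed
    also have "exp (\<kappa> * t) * (real N * \<eta> * L + t * (\<eta> * D)) + real N * \<eta> * L = \<eta> * C"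
      by (simp add: C_def algebra_simps)
    finally have "Y t \<le> ennreal (exp (\<kappa> * t)) * Y 0 + ennreal (\<eta> * C)" using key[OF \<eta>] by simp
    also have "\<dots> \<le> ennreal (exp (\<kappa> * t)) * Y 0 + ennreal e"
    proof (intro add_left_mono ennreal_leI)
      have "\<eta> * C \<le> \<eta> * (C + 1)" using \<eta> by (intro mult_left_mono) auto
      then show "\<eta> * C \<le> e" using C0 by (simp add: \<eta>_def)
    qed
    finally show "Y t \<le> ennreal (exp (\<kappa> * t)) * Y 0 + ennreal e" .
  qed
  then show ?thesis by (simp add: Y_def \<kappa>_def)
qed

section \<open>Transport form of the system\<close>

lemma in_HsD:
  assumes "in_Hs s f"
  obtains g where "in_Lp 2 f" "has_fourier f g" "Lp_norm 2 (\<lambda>\<xi>. ((1 + \<xi>\<^sup>2) powr (s / 2)) *\<^sub>R g \<xi>) < \<infinity>"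
  using assms unfolding in_Hs_def in_Lp_def by blast

text \<open>\<open>fourier\<close> is a choice, meaningful only once some transform exists. For a
  difference, existence follows by linearity; this links \<open>Hs_norm\<close> of differences, in
  which continuity in time is expressed, to the embedding.\<close>

lemma has_fourier_fourier_diff:
  assumes "in_Hs s f" "in_Hs s g"
  shows "in_Lp 2 (\<lambda>x. f x - g x)" "has_fourier (\<lambda>x. f x - g x) (fourier (\<lambda>x. f x - g x))"
proof -
  obtain f' where f': "in_Lp 2 f" "has_fourier f f'" using assms(1) unfolding in_Hs_def by blast
  obtain g' where g': "in_Lp 2 g" "has_fourier g g'" using assms(2) unfolding in_Hs_def by blast
  show "in_Lp 2 (\<lambda>x. f x - g x)" by (rule in_Lp_2_diff[OF f'(1) g'(1)])
  show "has_fourier (\<lambda>x. f x - g x) (fourier (\<lambda>x. f x - g x))"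
    by (rule has_fourier_fourier[OF has_fourier_diff[OF f'(2) g'(2) f'(1) g'(1) in_Lp_2_schwartz_fourier]])
qed

lemma Hs_continuous_onD:
  assumes "Hs_continuous_on s J f" "t \<in> J" "e > 0"
  obtains d where "d > 0" "\<And>t'. t' \<in> J \<Longrightarrow> t' \<noteq> t \<Longrightarrow> \<bar>t' - t\<bar> < d \<Longrightarrow> Hs_norm s (\<lambda>x. f t' x - f t x) < ennreal e"
proof -
  have "((\<lambda>\<tau>. Hs_norm s (\<lambda>x. f \<tau> x - f t x)) \<longlongrightarrow> 0) (at t within J)"
    using assms(1,2) unfolding Hs_continuous_on_def by blast
  then have "\<forall>\<^sub>F \<tau> in at t within J. Hs_norm s (\<lambda>x. f \<tau> x - f t x) < ennreal e"
    by (rule order_tendstoD) (use assms(3) in simp)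
  then obtain d where "d > 0" "\<forall>\<tau>\<in>J. \<tau> \<noteq> t \<and> dist \<tau> t < d \<longrightarrow> Hs_norm s (\<lambda>x. f \<tau> x - f t x) < ennreal e"
    unfolding eventually_at by blast
  then show ?thesis by (intro that[of d]) (auto simp: dist_real_def)
qed

text \<open>The embedding is used twice: at each time it yields a bounded uniformly continuous
  representative, and for the difference of two times it bounds the supremum norm by the Sobolev
  norm, which gives continuity in time uniformly in x.\<close>

lemma Sobolev_representative:
  assumes s: "s > 1 / 2" and f: "Hs_continuous_on s J f" and I: "compact I" "I \<subseteq> J"
  shows "\<exists>F. BUC I F \<and> (\<forall>t\<in>I. AE x in lborel. f t x = F t x)"
proof -
  obtain C where C: "C > 0" and
    emb0: "\<forall>f g. in_Lp 2 f \<longrightarrow> has_fourier f g \<longrightarrow> Lp_norm 2 (\<lambda>\<xi>. ((1 + \<xi>\<^sup>2) powr (s / 2)) *\<^sub>R g \<xi>) < \<infinity> \<longrightarrow>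
      (\<exists>h. uniformly_continuous_on UNIV h \<and> (AE x in lborel. f x = h x) \<and>
            (\<forall>x. \<bar>h x\<bar> \<le> C * enn2real (Lp_norm 2 (\<lambda>\<xi>. ((1 + \<xi>\<^sup>2) powr (s / 2)) *\<^sub>R g \<xi>))))"
    by (rule Sobolev_embedding[OF s], rule that, assumption, blast)
  note emb = emb0[rule_format]
  have Hs: "in_Hs s (f t)" if "t \<in> I" for t using f that I(2) unfolding Hs_continuous_on_def by blast
  have "\<forall>t\<in>I. \<exists>h. uniformly_continuous_on UNIV h \<and> (AE x in lborel. f t x = h x) \<and> (\<exists>B. \<forall>x. \<bar>h x\<bar> \<le> B)"
  proof
    fix t assume "t \<in> I"
    from Hs[OF this] obtain g where "in_Lp 2 (f t)" "has_fourier (f t) g" "Lp_norm 2 (\<lambda>\<xi>. ((1 + \<xi>\<^sup>2) powr (s / 2)) *\<^sub>R g \<xi>) < \<infinity>"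
      by (rule in_HsD)
    from emb[OF this] show "\<exists>h. uniformly_continuous_on UNIV h \<and> (AE x in lborel. f t x = h x) \<and> (\<exists>B. \<forall>x. \<bar>h x\<bar> \<le> B)"
      by blast
  qed
  from bchoice[OF this] obtain F where F: "\<forall>t\<in>I. uniformly_continuous_on UNIV (F t) \<and> (AE x in lborel. f t x = F t x) \<and> (\<exists>B. \<forall>x. \<bar>F t x\<bar> \<le> B)" ..
  have FAE: "AE x in lborel. f t x = F t x" if "t \<in> I" for t using F that by blast
  have Fc: "continuous_on UNIV (F t)" if "t \<in> I" for t using F that uniformly_continuous_imp_continuous by blast
  have "BUC I F"
  proof (rule BUC_compact_I[OF I(1)])
    show "uniformly_continuous_on UNIV (F t)" if "t \<in> I" for t using F that by blast
    show "\<exists>B. \<forall>x. \<bar>F t x\<bar> \<le> B" if "t \<in> I" for t using F that by blast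
    fix t e :: real assume t: "t \<in> I" and e: "e > 0"
    have eC: "e / C > 0" using e C by simp
    have tJ: "t \<in> J" using t I(2) by blast
    obtain d where d: "d > 0" "\<And>t'. t' \<in> J \<Longrightarrow> t' \<noteq> t \<Longrightarrow> \<bar>t' - t\<bar> < d \<Longrightarrow> Hs_norm s (\<lambda>x. f t' x - f t x) < ennreal (e / C)"
      using Hs_continuous_onD[OF f tJ eC] by metis
    have "\<bar>F t' x - F t x\<bar> \<le> e" if t': "t' \<in> I" "\<bar>t' - t\<bar> < d" for t' x
    proof (cases "t' = t")
      case True
      then show ?thesis using e by simp
    next
      case False
      have lt: "Hs_norm s (\<lambda>x. f t' x - f t x) < ennreal (e / C)" by (rule d(2)) (use t' False I(2) in auto)
      then have fin: "Lp_norm 2 (\<lambda>\<xi>. ((1 + \<xi>\<^sup>2) powr (s / 2)) *\<^sub>R fourier (\<lambda>x. f t' x - f t x) \<xi>) < \<infinity>"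
        unfolding Hs_norm_def by (rule order_less_trans) simp
      from emb[OF has_fourier_fourier_diff[OF Hs[OF t'(1)] Hs[OF t]] fin]
      obtain h where h: "AE x in lborel. f t' x - f t x = h x"
        "\<forall>x. \<bar>h x\<bar> \<le> C * enn2real (Hs_norm s (\<lambda>x. f t' x - f t x))"
        unfolding Hs_norm_def by (elim exE conjE)
      have "enn2real (Hs_norm s (\<lambda>x. f t' x - f t x)) \<le> e / C"
        using enn2real_mono[OF less_imp_le[OF lt]] eC by simp
      then have "C * enn2real (Hs_norm s (\<lambda>x. f t' x - f t x)) \<le> C * (e / C)" using C by (intro mult_left_mono) auto
      then have Ce: "C * enn2real (Hs_norm s (\<lambda>x. f t' x - f t x)) \<le> e" using C by simp
      have he: "\<bar>h x\<bar> \<le> e" for x by (rule order_trans[OF spec[OF h(2)] Ce])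
      have "AE x in lborel. f t' x - f t x = F t' x - F t x"
        using FAE[OF t'(1)] FAE[OF t] by eventually_elim simp
      moreover have "AE x in lborel. \<bar>f t' x - f t x\<bar> \<le> e"
        using h(1) by eventually_elim (simp add: he)
      moreover have "continuous_on UNIV (\<lambda>x. F t' x - F t x)" by (intro continuous_intros Fc t' t)
      ultimately show ?thesis by (intro AE_eq_continuous_imp_le[of "\<lambda>x. F t' x - F t x" "\<lambda>x. f t' x - f t x"])
    qed
    then show "\<exists>d>0. \<forall>t'\<in>I. \<bar>t' - t\<bar> < d \<longrightarrow> (\<forall>x. \<bar>F t' x - F t x\<bar> \<le> e)" using d(1) by (intro exI[of _ d]) simp
  qed
  then show ?thesis using FAE by (intro exI[of _ F]) simp
qed

lemma Sobolev_representative_C1: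
  assumes s: "s > 3 / 2" and f: "Hs_continuous_on s J f" and I: "compact I" "I \<subseteq> J"
  shows "\<exists>F F'. BUC I F \<and> BUC I F' \<and> (\<forall>t\<in>I. (AE x in lborel. f t x = F t x) \<and> (AE x in lborel. weak_deriv (f t) x = F' t x) \<and>
    has_weak_deriv (f t) (weak_deriv (f t)) \<and> (\<forall>x. (F t has_real_derivative F' t x) (at x)))"
proof -
  obtain C where C: "C > 0" and
    emb0: "\<forall>f g. in_Lp 2 f \<longrightarrow> has_fourier f g \<longrightarrow> Lp_norm 2 (\<lambda>\<xi>. ((1 + \<xi>\<^sup>2) powr (s / 2)) *\<^sub>R g \<xi>) < \<infinity> \<longrightarrow>
      (\<exists>h h'. uniformly_continuous_on UNIV h \<and> uniformly_continuous_on UNIV h' \<and>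
            (AE x in lborel. f x = h x) \<and> has_weak_deriv f (weak_deriv f) \<and> (AE x in lborel. weak_deriv f x = h' x) \<and>
            (\<forall>x. (h has_real_derivative h' x) (at x)) \<and>
            (\<forall>x. \<bar>h x\<bar> \<le> C * enn2real (Lp_norm 2 (\<lambda>\<xi>. ((1 + \<xi>\<^sup>2) powr (s / 2)) *\<^sub>R g \<xi>))) \<and>
            (\<forall>x. \<bar>h' x\<bar> \<le> C * enn2real (Lp_norm 2 (\<lambda>\<xi>. ((1 + \<xi>\<^sup>2) powr (s / 2)) *\<^sub>R g \<xi>))))"
    by (rule Sobolev_embedding_C1[OF s], rule that, assumption, blast)
  note emb = emb0[rule_format]
  have Hs: "in_Hs s (f t)" if "t \<in> I" for t using f that I(2) unfolding Hs_continuous_on_def by blast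
  have "\<forall>t\<in>I. \<exists>hh. uniformly_continuous_on UNIV (fst hh) \<and> uniformly_continuous_on UNIV (snd hh) \<and>
     (AE x in lborel. f t x = fst hh x) \<and> has_weak_deriv (f t) (weak_deriv (f t)) \<and> (AE x in lborel. weak_deriv (f t) x = snd hh x) \<and>
     (\<forall>x. (fst hh has_real_derivative snd hh x) (at x)) \<and> (\<exists>B. \<forall>x. \<bar>fst hh x\<bar> \<le> B) \<and> (\<exists>B. \<forall>x. \<bar>snd hh x\<bar> \<le> B)"
  proof
    fix t assume "t \<in> I"
    from Hs[OF this] obtain g where "in_Lp 2 (f t)" "has_fourier (f t) g" "Lp_norm 2 (\<lambda>\<xi>. ((1 + \<xi>\<^sup>2) powr (s / 2)) *\<^sub>R g \<xi>) < \<infinity>"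
      by (rule in_HsD)
    from emb[OF this] obtain h h' where hh: "uniformly_continuous_on UNIV h" "uniformly_continuous_on UNIV h'"
            "AE x in lborel. f t x = h x" "has_weak_deriv (f t) (weak_deriv (f t))" "AE x in lborel. weak_deriv (f t) x = h' x"
            "\<forall>x. (h has_real_derivative h' x) (at x)"
            "\<forall>x. \<bar>h x\<bar> \<le> C * enn2real (Lp_norm 2 (\<lambda>\<xi>. ((1 + \<xi>\<^sup>2) powr (s / 2)) *\<^sub>R g \<xi>))"
            "\<forall>x. \<bar>h' x\<bar> \<le> C * enn2real (Lp_norm 2 (\<lambda>\<xi>. ((1 + \<xi>\<^sup>2) powr (s / 2)) *\<^sub>R g \<xi>))"
      by (elim exE conjE)
    have b: "\<exists>B. \<forall>x. \<bar>h x\<bar> \<le> B" "\<exists>B. \<forall>x. \<bar>h' x\<bar> \<le> B"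
      by (rule exI, rule hh(7), rule exI, rule hh(8))
    show "\<exists>hh. uniformly_continuous_on UNIV (fst hh) \<and> uniformly_continuous_on UNIV (snd hh) \<and>
     (AE x in lborel. f t x = fst hh x) \<and> has_weak_deriv (f t) (weak_deriv (f t)) \<and> (AE x in lborel. weak_deriv (f t) x = snd hh x) \<and>
     (\<forall>x. (fst hh has_real_derivative snd hh x) (at x)) \<and> (\<exists>B. \<forall>x. \<bar>fst hh x\<bar> \<le> B) \<and> (\<exists>B. \<forall>x. \<bar>snd hh x\<bar> \<le> B)"
      by (intro exI[of _ "(h, h')"], unfold fst_conv snd_conv) (intro conjI hh(1-6) b)
  qed
  from bchoice[OF this] obtain hh where hh: "\<forall>t\<in>I. uniformly_continuous_on UNIV (fst (hh t)) \<and> uniformly_continuous_on UNIV (snd (hh t)) \<and>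
     (AE x in lborel. f t x = fst (hh t) x) \<and> has_weak_deriv (f t) (weak_deriv (f t)) \<and> (AE x in lborel. weak_deriv (f t) x = snd (hh t) x) \<and>
     (\<forall>x. (fst (hh t) has_real_derivative snd (hh t) x) (at x)) \<and> (\<exists>B. \<forall>x. \<bar>fst (hh t) x\<bar> \<le> B) \<and> (\<exists>B. \<forall>x. \<bar>snd (hh t) x\<bar> \<le> B)" ..
  define F F' where "F = (\<lambda>t. fst (hh t))" and "F' = (\<lambda>t. snd (hh t))"
  have all: "uniformly_continuous_on UNIV (F t) \<and> uniformly_continuous_on UNIV (F' t) \<and>
     (AE x in lborel. f t x = F t x) \<and> has_weak_deriv (f t) (weak_deriv (f t)) \<and> (AE x in lborel. weak_deriv (f t) x = F' t x) \<and>
     (\<forall>x. (F t has_real_derivative F' t x) (at x)) \<and> (\<exists>B. \<forall>x. \<bar>F t x\<bar> \<le> B) \<and> (\<exists>B. \<forall>x. \<bar>F' t x\<bar> \<le> B)" if "t \<in> I" for t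
    using bspec[OF hh that] unfolding F_def F'_def .
  note uc = all[THEN conjunct1] and all1 = all[THEN conjunct2]
  note uc' = all1[THEN conjunct1] and all2 = all1[THEN conjunct2]
  note FAE = all2[THEN conjunct1] and all3 = all2[THEN conjunct2]
  note wd = all3[THEN conjunct1] and all4 = all3[THEN conjunct2]
  note FAE' = all4[THEN conjunct1] and all5 = all4[THEN conjunct2]
  note dF = all5[THEN conjunct1] and all6 = all5[THEN conjunct2]
  note bd = all6[THEN conjunct1] and bd' = all6[THEN conjunct2]
  have Fc: "continuous_on UNIV (F t)" "continuous_on UNIV (F' t)" if "t \<in> I" for t
    by (rule uniformly_continuous_imp_continuous[OF uc[OF that]], rule uniformly_continuous_imp_continuous[OF uc'[OF that]])
  have tc: "\<exists>d>0. \<forall>t'\<in>I. \<bar>t' - t\<bar> < d \<longrightarrow> (\<forall>x. \<bar>F t' x - F t x\<bar> \<le> e \<and> \<bar>F' t' x - F' t x\<bar> \<le> e)"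
    if t: "t \<in> I" and e: "e > 0" for t e
  proof -
    have eC: "e / C > 0" using e C by simp
    have tJ: "t \<in> J" using t I(2) by blast
    obtain d where d: "d > 0" "\<And>t'. t' \<in> J \<Longrightarrow> t' \<noteq> t \<Longrightarrow> \<bar>t' - t\<bar> < d \<Longrightarrow> Hs_norm s (\<lambda>x. f t' x - f t x) < ennreal (e / C)"
      using Hs_continuous_onD[OF f tJ eC] by metis
    have "\<bar>F t' x - F t x\<bar> \<le> e \<and> \<bar>F' t' x - F' t x\<bar> \<le> e" if t': "t' \<in> I" "\<bar>t' - t\<bar> < d" for t' x
    proof (cases "t' = t")
      case True
      then show ?thesis using e by simp
    next
      case False
      define q where "q = (\<lambda>x. f t' x - f t x)"
      have lt: "Hs_norm s q < ennreal (e / C)" unfolding q_def by (rule d(2)) (use t' False I(2) in auto)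
      then have fin: "Lp_norm 2 (\<lambda>\<xi>. ((1 + \<xi>\<^sup>2) powr (s / 2)) *\<^sub>R fourier q \<xi>) < \<infinity>"
        unfolding Hs_norm_def by (rule order_less_trans) simp
      from emb[OF has_fourier_fourier_diff[OF Hs[OF t'(1)] Hs[OF t], folded q_def] fin]
      obtain h h' where h: "AE x in lborel. q x = h x" "has_weak_deriv q (weak_deriv q)" "AE x in lborel. weak_deriv q x = h' x"
        "\<forall>x. \<bar>h x\<bar> \<le> C * enn2real (Lp_norm 2 (\<lambda>\<xi>. ((1 + \<xi>\<^sup>2) powr (s / 2)) *\<^sub>R fourier q \<xi>))"
        "\<forall>x. \<bar>h' x\<bar> \<le> C * enn2real (Lp_norm 2 (\<lambda>\<xi>. ((1 + \<xi>\<^sup>2) powr (s / 2)) *\<^sub>R fourier q \<xi>))"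
        by (elim exE conjE)
      have "enn2real (Hs_norm s q) \<le> e / C"
        using enn2real_mono[OF less_imp_le[OF lt]] eC by simp
      then have "C * enn2real (Hs_norm s q) \<le> C * (e / C)" using C by (intro mult_left_mono) auto
      then have Ce: "C * enn2real (Lp_norm 2 (\<lambda>\<xi>. ((1 + \<xi>\<^sup>2) powr (s / 2)) *\<^sub>R fourier q \<xi>)) \<le> e"
        using C by (simp add: Hs_norm_def)
      have he: "\<bar>h x\<bar> \<le> e" "\<bar>h' x\<bar> \<le> e" for x
        by (rule order_trans[OF spec[OF h(4)] Ce], rule order_trans[OF spec[OF h(5)] Ce])
      have "AE x in lborel. q x = F t' x - F t x"
        using FAE[OF t'(1)] FAE[OF t] by eventually_elim (simp add: q_def)
      moreover have "AE x in lborel. \<bar>q x\<bar> \<le> e"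
        using h(1) by eventually_elim (simp add: he)
      moreover have "continuous_on UNIV (\<lambda>x. F t' x - F t x)" by (intro continuous_intros Fc t' t)
      ultimately have 1: "\<bar>F t' x - F t x\<bar> \<le> e" by (intro AE_eq_continuous_imp_le[of "\<lambda>x. F t' x - F t x" q])
      have L2: "in_Lp 2 (f t')" "in_Lp 2 (f t)" using Hs[OF t'(1)] Hs[OF t] unfolding in_Hs_def by blast+
      \<comment> \<open>Uniqueness of weak derivatives identifies, almost everywhere, the chosen
        derivative of a difference with the difference of the chosen ones; the embedding bound for q
        thereby controls the derivatives at two times.\<close>
      have "has_weak_deriv q (\<lambda>x. weak_deriv (f t') x - weak_deriv (f t) x)"
        unfolding q_def by (rule has_weak_deriv_diff[OF wd[OF t'(1)] wd[OF t] L2])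
      from has_weak_deriv_unique[OF h(2) this]
      have "AE x in lborel. weak_deriv q x = F' t' x - F' t x"
        using FAE'[OF t'(1)] FAE'[OF t] by eventually_elim simp
      moreover have "AE x in lborel. \<bar>weak_deriv q x\<bar> \<le> e"
        using h(3) by eventually_elim (simp add: he)
      moreover have "continuous_on UNIV (\<lambda>x. F' t' x - F' t x)" by (intro continuous_intros Fc t' t)
      ultimately have 2: "\<bar>F' t' x - F' t x\<bar> \<le> e" by (intro AE_eq_continuous_imp_le[of "\<lambda>x. F' t' x - F' t x" "weak_deriv q"])
      show ?thesis using 1 2 by blast
    qed
    then show ?thesis using d(1) by (intro exI[of _ d]) simp
  qed
  have "BUC I F"
  proof (rule BUC_compact_I[OF I(1) uc bd])
    show "\<exists>d>0. \<forall>t'\<in>I. \<bar>t' - t\<bar> < d \<longrightarrow> (\<forall>x. \<bar>F t' x - F t x\<bar> \<le> e)" if "t \<in> I" "e > 0" for t e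
    proof -
      from tc[OF that] obtain d where "d > 0" and d: "\<forall>t'\<in>I. \<bar>t' - t\<bar> < d \<longrightarrow> (\<forall>x. \<bar>F t' x - F t x\<bar> \<le> e \<and> \<bar>F' t' x - F' t x\<bar> \<le> e)"
        by (elim exE conjE)
      then show ?thesis by (intro exI[of _ d]) simp
    qed
  qed
  moreover have "BUC I F'"
  proof (rule BUC_compact_I[OF I(1) uc' bd'])
    show "\<exists>d>0. \<forall>t'\<in>I. \<bar>t' - t\<bar> < d \<longrightarrow> (\<forall>x. \<bar>F' t' x - F' t x\<bar> \<le> e)" if "t \<in> I" "e > 0" for t e
    proof -
      from tc[OF that] obtain d where "d > 0" and d: "\<forall>t'\<in>I. \<bar>t' - t\<bar> < d \<longrightarrow> (\<forall>x. \<bar>F t' x - F t x\<bar> \<le> e \<and> \<bar>F' t' x - F' t x\<bar> \<le> e)"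
        by (elim exE conjE)
      then show ?thesis by (intro exI[of _ d]) simp
    qed
  qed
  ultimately show ?thesis
    by (intro exI[of _ F] exI[of _ F'] conjI ballI) (assumption | rule FAE FAE' wd dF)+
qed

section \<open>Testing the equations with Gaussians\<close>

lemma weak_deriv_cong_AE:
  assumes "f \<in> borel_measurable borel" "g \<in> borel_measurable borel" "AE x in lborel. f x = g x"
  shows "weak_deriv f = weak_deriv g"
proof -
  \<comment> \<open>Equality as predicates in h, so the choice in \<open>weak_deriv\<close> picks
    literally the same function for f and g.\<close>
  have "has_weak_deriv f h = has_weak_deriv g h" for h
    unfolding has_weak_deriv_def
    using pairing_cong_AE[OF assms(1,2) _ assms(3)] schwartz_measurable[OF schwartz_deriv(2)] by auto
  then show ?thesis unfolding weak_deriv_def by presburger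
qed

lemma normal_density_shift: "normal_density x e y = normal_density 0 e (x - y)"
  by (simp add: normal_density_def power2_commute)

lemma x_deriv_normal_density:
  assumes "e > 0"
  shows "x_deriv (\<lambda>y. complex_of_real (normal_density x e y)) y = complex_of_real (- normal_deriv e (x - y))"
proof (intro vector_derivative_at has_vector_derivative_of_real)
  have "((\<lambda>y. x - y) has_real_derivative - 1) (at y)" by (auto intro!: derivative_eq_intros)
  from DERIV_chain2[OF has_real_derivative_normal_density[OF assms] this]
  show "(normal_density x e has_real_derivative - normal_deriv e (x - y)) (at y)"
    unfolding normal_density_shift[of x e, abs_def] by simp
qed

lemma pairing_normal_density:
  "pairing f (\<lambda>y. complex_of_real (normal_density x e y)) = complex_of_real (conv (normal_density 0 e) f x)"
proof -
  have "pairing f (\<lambda>y. complex_of_real (normal_density x e y)) = (\<integral>y. complex_of_real (normal_density 0 e (x - y) * f y) \<partial>lborel)"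
    unfolding pairing_def normal_density_shift[of x] by (intro Bochner_Integration.integral_cong) (auto simp: mult.commute)
  then show ?thesis by (simp only: integral_complex_of_real conv_def)
qed

lemma pairing_normal_deriv:
  assumes "e > 0"
  shows "pairing f (x_deriv (\<lambda>y. complex_of_real (normal_density x e y))) = complex_of_real (- conv (normal_deriv e) f x)"
proof -
  have "pairing f (x_deriv (\<lambda>y. complex_of_real (normal_density x e y))) = (\<integral>y. complex_of_real (- (normal_deriv e (x - y) * f y)) \<partial>lborel)"
    unfolding pairing_def x_deriv_normal_density[OF assms] by (intro Bochner_Integration.integral_cong) (auto simp: mult.commute)
  also have "\<dots> = complex_of_real (\<integral>y. - (normal_deriv e (x - y) * f y) \<partial>lborel)" by (rule integral_complex_of_real)
  finally show ?thesis by (simp add: conv_def)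
qed

lemma conv_normal_deriv:
  fixes f f' :: "real \<Rightarrow> real"
  assumes e: "e > 0" and f: "\<And>x. (f has_real_derivative f' x) (at x)" and f': "continuous_on UNIV f'"
    and B: "\<And>x. \<bar>f x\<bar> \<le> B" "\<And>x. \<bar>f' x\<bar> \<le> B'"
  shows "conv (normal_deriv e) f x = conv (normal_density 0 e) f' x"
proof -
  have d: "((\<lambda>z. f (x - z)) has_real_derivative - f' (x - z)) (at z)" for z
  proof -
    have "((\<lambda>z. x - z) has_real_derivative - 1) (at z)" by (auto intro!: derivative_eq_intros)
    from DERIV_chain2[OF f this] show ?thesis by simp
  qed
  have c: "continuous_on UNIV (\<lambda>z. - f' (x - z))"
    by (intro continuous_intros continuous_on_compose2[OF f']) auto
  have "(\<integral>z. f (x - z) * normal_deriv e z \<partial>lborel) = - (\<integral>z. - f' (x - z) * normal_density 0 e z \<partial>lborel)"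
    by (rule integral_by_parts_gaussian[OF e d c B(1)]) (use B(2) in simp)
  then show ?thesis by (simp add: conv_eq mult.commute)
qed

lemma conv_add:
  fixes f g k :: "real \<Rightarrow> real"
  assumes k: "integrable lborel k" and f: "f \<in> borel_measurable borel" "\<And>x. \<bar>f x\<bar> \<le> B"
    and g: "g \<in> borel_measurable borel" "\<And>x. \<bar>g x\<bar> \<le> B'"
  shows "conv k (\<lambda>x. f x + g x) x = conv k f x + conv k g x"
  unfolding conv_eq distrib_left
  by (rule Bochner_Integration.integral_add) (rule integrable_conv[OF k f] integrable_conv[OF k g])+

lemma conv_cmult:
  fixes f k :: "real \<Rightarrow> real"
  shows "conv k (\<lambda>x. c * f x) x = c * conv k f x"
  unfolding conv_eq mult.left_commute[of _ c] by (rule integral_mult_right_zero)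

lemma BUC_conv_add:
  assumes k: "integrable lborel k" and f: "BUC I f" and g: "BUC I g" and t: "t \<in> I"
  shows "conv k (\<lambda>y. f t y + g t y) x = conv k (f t) x + conv k (g t) x"
proof -
  obtain B where "B > 0" and B: "\<And>t x. t \<in> I \<Longrightarrow> \<bar>f t x\<bar> \<le> B" using BUC_bounded[OF f] by metis
  obtain C where "C > 0" and C: "\<And>t x. t \<in> I \<Longrightarrow> \<bar>g t x\<bar> \<le> C" using BUC_bounded[OF g] by metis
  show ?thesis
    by (rule conv_add[OF k BUC_measurable[OF f t] B[OF t] BUC_measurable[OF g t] C[OF t]])
qed

lemma BUC_conv_deriv:
  assumes e: "e > 0" and f: "BUC I f" and f': "BUC I f'" and t: "t \<in> I"
    and d: "\<And>x. (f t has_real_derivative f' t x) (at x)"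
  shows "conv (normal_deriv e) (f t) x = conv (normal_density 0 e) (f' t) x"
proof -
  obtain B where "B > 0" and B: "\<And>t x. t \<in> I \<Longrightarrow> \<bar>f t x\<bar> \<le> B" using BUC_bounded[OF f] by metis
  obtain C where "C > 0" and C: "\<And>t x. t \<in> I \<Longrightarrow> \<bar>f' t x\<bar> \<le> C" using BUC_bounded[OF f'] by metis
  show ?thesis by (rule conv_normal_deriv[OF e d BUC_continuous[OF f' t] B[OF t] C[OF t]])
qed

text \<open>The equations hold for complex pairings and within the whole life span; real parts and
  restriction to I give the form needed for mollified functions.\<close>

lemma real_derivative_of_complex:
  assumes "(f has_vector_derivative V) (at t within J)" "I \<subseteq> J" "t \<in> I"
    and "\<And>\<tau>. \<tau> \<in> I \<Longrightarrow> f \<tau> = complex_of_real (g \<tau>)" and "V = complex_of_real v"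
  shows "(g has_real_derivative v) (at t within I)"
proof -
  have "(f has_vector_derivative V) (at t within I)" by (rule has_vector_derivative_within_subset[OF assms(1,2)])
  then have "((\<lambda>\<tau>. Re (f \<tau>)) has_vector_derivative Re V) (at t within I)"
    by (rule bounded_linear.has_vector_derivative[OF bounded_linear_Re])
  then have "(g has_vector_derivative Re V) (at t within I)"
    by (rule has_vector_derivative_transform[OF assms(3), rotated]) (simp add: assms(4))
  then show ?thesis by (simp add: assms(5) has_real_derivative_iff_has_vector_derivative)
qed

lemma conv_cong_AE:
  assumes [measurable]: "k \<in> borel_measurable borel" "f \<in> borel_measurable borel" "g \<in> borel_measurable borel"
    and ae: "AE y in lborel. f y = g y"
  shows "conv k f x = conv k g x"
  unfolding conv_def
proof (rule integral_cong_AE)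
  show "AE y in lborel. k (x - y) * f y = k (x - y) * g y" using ae by eventually_elim simp
qed measurable

text \<open>In terms of the continuous representatives \<open>U\<close>, \<open>Ux\<close>, \<open>R\<close> of \<open>u\<close>, \<open>u\<^sub>x\<close>, \<open>\<rho>\<close>, all three unknowns are
  transported by \<open>U\<close>, with source terms \<open>- \<partial>\<^sub>xG * F\<close>, \<open>- Ux\<^sup>2 - G * F + F\<close> and \<open>- (b - 1) Ux R\<close>.\<close>

lemma solution_transport_form:
  fixes \<alpha> b \<kappa> :: real
  assumes sol: "is_solution \<alpha> b \<kappa> s T u \<rho>" and s: "s > 3 / 2" and I: "compact I" "I \<subseteq> life_span T"
  shows "\<exists>U Ux R F. BUC I U \<and> BUC I Ux \<and> BUC I R \<and> BUC I F \<and>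
    (\<forall>t\<in>I. (AE x in lborel. u t x = U t x) \<and> (AE x in lborel. weak_deriv (u t) x = Ux t x) \<and> (AE x in lborel. \<rho> t x = R t x) \<and>
       u t \<in> borel_measurable borel \<and> weak_deriv (u t) \<in> borel_measurable borel \<and> \<rho> t \<in> borel_measurable borel \<and>
       (\<forall>x. (U t has_real_derivative Ux t x) (at x)) \<and>
       (\<forall>x. F t x = b / 2 * (U t x)\<^sup>2 + (3 - b) / 2 * (Ux t x)\<^sup>2 + \<kappa> / 2 * (R t x)\<^sup>2 - \<alpha> * U t x) \<and>
       (\<forall>e>0. \<forall>x.
          ((\<lambda>\<tau>. conv (normal_density 0 e) (U \<tau>) x) has_real_derivative
            conv (normal_density 0 e) (\<lambda>y. Ux t y * U t y) x - conv (normal_deriv e) (\<lambda>y. U t y * U t y) x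
            + conv (normal_density 0 e) (\<lambda>y. (- 1) * conv dG (F t) y) x) (at t within I) \<and>
          ((\<lambda>\<tau>. conv (normal_density 0 e) (Ux \<tau>) x) has_real_derivative
            conv (normal_density 0 e) (\<lambda>y. Ux t y * Ux t y) x - conv (normal_deriv e) (\<lambda>y. U t y * Ux t y) x
            + conv (normal_density 0 e) (\<lambda>y. (- 1) * (Ux t y * Ux t y) + (- 1) * (conv Green (F t) y - F t y)) x) (at t within I) \<and>
          ((\<lambda>\<tau>. conv (normal_density 0 e) (R \<tau>) x) has_real_derivative
            conv (normal_density 0 e) (\<lambda>y. Ux t y * R t y) x - conv (normal_deriv e) (\<lambda>y. U t y * R t y) x
            + conv (normal_density 0 e) (\<lambda>y. (- (b - 1)) * (Ux t y * R t y)) x) (at t within I)))"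
proof -
  note sol' = sol[unfolded is_solution_def]
  note cont = sol'[THEN conjunct1] sol'[THEN conjunct2, THEN conjunct1] and eqs = sol'[THEN conjunct2, THEN conjunct2]
  from Sobolev_representative_C1[OF s cont(1) I] obtain U Ux where UB: "BUC I U" and UxB: "BUC I Ux"
    and UU: "\<forall>t\<in>I. (AE x in lborel. u t x = U t x) \<and> (AE x in lborel. weak_deriv (u t) x = Ux t x) \<and>
      has_weak_deriv (u t) (weak_deriv (u t)) \<and> (\<forall>x. (U t has_real_derivative Ux t x) (at x))"
    by (elim exE conjE)
  have "s - 1 > 1 / 2" using s by simp
  from Sobolev_representative[OF this cont(2) I] obtain R where RB: "BUC I R" and RR: "\<forall>t\<in>I. AE x in lborel. \<rho> t x = R t x"
    by (elim exE conjE)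
  have uAE: "AE x in lborel. u t x = U t x" and wAE: "AE x in lborel. weak_deriv (u t) x = Ux t x"
    and wd: "has_weak_deriv (u t) (weak_deriv (u t))" and dU: "(U t has_real_derivative Ux t x) (at x)" if "t \<in> I" for t x
    using bspec[OF UU that] by blast+
  have rAE: "AE x in lborel. \<rho> t x = R t x" if "t \<in> I" for t using bspec[OF RR that] .
  have um: "u t \<in> borel_measurable borel" and rm: "\<rho> t \<in> borel_measurable borel" if "t \<in> I" for t
    using cont that I(2) unfolding Hs_continuous_on_def in_Hs_def in_Lp_2_iff by blast+
  have wm: "weak_deriv (u t) \<in> borel_measurable borel" if "t \<in> I" for t
    using wd[OF that] unfolding has_weak_deriv_def in_Lp_2_iff by blast
  note Um = BUC_measurable[OF UB] and Uxm = BUC_measurable[OF UxB] and Rm = BUC_measurable[OF RB]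
  define F where "F = (\<lambda>t x. b / 2 * (U t x * U t x) + (3 - b) / 2 * (Ux t x * Ux t x) + \<kappa> / 2 * (R t x * R t x) - \<alpha> * U t x)"
  have FB: "BUC I F" unfolding F_def by (intro BUC_diff BUC_add BUC_cmult BUC_mult UB UxB RB)
  have Fx: "F t x = b / 2 * (U t x)\<^sup>2 + (3 - b) / 2 * (Ux t x)\<^sup>2 + \<kappa> / 2 * (R t x)\<^sup>2 - \<alpha> * U t x" for t x
    by (simp add: F_def power2_eq_square)
  have cF: "conv dG (nonlocal_flux \<alpha> b \<kappa> (u t) (\<rho> t)) = conv dG (F t)" if t: "t \<in> I" for t
  proof (rule ext, rule conv_cong_AE)
    have [measurable]: "u t \<in> borel_measurable borel" "\<rho> t \<in> borel_measurable borel" "weak_deriv (u t) \<in> borel_measurable borel"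
      by (rule um[OF t], rule rm[OF t], rule wm[OF t])
    show "nonlocal_flux \<alpha> b \<kappa> (u t) (\<rho> t) \<in> borel_measurable borel"
      unfolding nonlocal_flux_def[abs_def] by measurable
    show "AE y in lborel. nonlocal_flux \<alpha> b \<kappa> (u t) (\<rho> t) y = F t y"
      using uAE[OF t] wAE[OF t] rAE[OF t] by eventually_elim (simp add: nonlocal_flux_def Fx)
  qed (rule dG_measurable BUC_measurable[OF FB t])+
  define P where "P = (\<lambda>t. conv dG (F t))"
  have PB: "BUC I P" unfolding P_def by (rule BUC_conv[OF FB integrable_dG])
  define Q where "Q = (\<lambda>t x. conv Green (F t) x - F t x)"
  have QB: "BUC I Q" unfolding Q_def by (intro BUC_diff BUC_conv FB integrable_Green)
  have dP: "(P t has_real_derivative Q t x) (at x)" if t: "t \<in> I" for t x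
  proof -
    obtain B where "B > 0" and B: "\<And>t x. t \<in> I \<Longrightarrow> \<bar>F t x\<bar> \<le> B" using BUC_bounded[OF FB] by metis
    show ?thesis unfolding P_def Q_def by (rule has_real_derivative_conv_dG[OF BUC_continuous[OF FB t] B[OF t]])
  qed
  have main: "((\<lambda>\<tau>. conv (normal_density 0 e) (U \<tau>) x) has_real_derivative
            conv (normal_density 0 e) (\<lambda>y. Ux t y * U t y) x - conv (normal_deriv e) (\<lambda>y. U t y * U t y) x
            + conv (normal_density 0 e) (\<lambda>y. (- 1) * P t y) x) (at t within I) \<and>
          ((\<lambda>\<tau>. conv (normal_density 0 e) (Ux \<tau>) x) has_real_derivative
            conv (normal_density 0 e) (\<lambda>y. Ux t y * Ux t y) x - conv (normal_deriv e) (\<lambda>y. U t y * Ux t y) x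
            + conv (normal_density 0 e) (\<lambda>y. (- 1) * (Ux t y * Ux t y) + (- 1) * Q t y) x) (at t within I) \<and>
          ((\<lambda>\<tau>. conv (normal_density 0 e) (R \<tau>) x) has_real_derivative
            conv (normal_density 0 e) (\<lambda>y. Ux t y * R t y) x - conv (normal_deriv e) (\<lambda>y. U t y * R t y) x
            + conv (normal_density 0 e) (\<lambda>y. (- (b - 1)) * (Ux t y * R t y)) x) (at t within I)"
    if t: "t \<in> I" and e: "e > 0" for t e x
  proof -
    define n where "n = normal_density 0 e"
    define n' where "n' = normal_deriv e"
    have ni: "integrable lborel n" unfolding n_def using e by simp
    have n'i: "integrable lborel n'" unfolding n'_def by (rule integrable_normal_deriv[OF e])
    \<comment> \<open>The Gaussian centred at x: pairing with it evaluates the mollification at x.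
      Pairing with its derivative gives minus the convolution with \<open>normal_deriv\<close>,
      since differentiation acts on y in x - y.\<close>
    define \<psi> where "\<psi> = (\<lambda>y. complex_of_real (normal_density x e y))"
    have s\<psi>: "schwartz \<psi>" unfolding \<psi>_def by (rule schwartz_normal_density[OF e])
    note s\<psi>' = schwartz_deriv(2)[OF s\<psi>]
    note \<psi>m = schwartz_measurable[OF s\<psi>] and \<psi>'m = schwartz_measurable[OF s\<psi>']
    have p\<psi>: "pairing f \<psi> = complex_of_real (conv n f x)" for f
      unfolding \<psi>_def n_def by (rule pairing_normal_density)
    have p\<psi>': "pairing f (x_deriv \<psi>) = complex_of_real (- conv n' f x)" for f
      unfolding \<psi>_def n'_def by (rule pairing_normal_deriv[OF e])
    have tT: "t \<in> life_span T" using t I(2) by blast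
    have E1: "((\<lambda>\<tau>. pairing (u \<tau>) \<phi>) has_vector_derivative
           - pairing (\<lambda>x. u t x * weak_deriv (u t) x) \<phi> - pairing (conv dG (nonlocal_flux \<alpha> b \<kappa> (u t) (\<rho> t))) \<phi>) (at t within life_span T)"
      if "schwartz \<phi>" for \<phi> using eqs tT that by blast
    have E2: "((\<lambda>\<tau>. pairing (\<rho> \<tau>) \<psi>) has_vector_derivative - pairing_u_rho_x (u t) (\<rho> t) \<psi>
           - complex_of_real (b - 1) * pairing (\<lambda>x. weak_deriv (u t) x * \<rho> t x) \<psi>) (at t within life_span T)"
      using eqs tT s\<psi> by blast
    have uux: "pairing (\<lambda>x. u t x * weak_deriv (u t) x) \<phi> = pairing (\<lambda>x. U t x * Ux t x) \<phi>" if "\<phi> \<in> borel_measurable borel" for \<phi>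
    proof (rule pairing_cong_AE[OF _ _ that])
      show "AE x in lborel. u t x * weak_deriv (u t) x = U t x * Ux t x"
        using uAE[OF t] wAE[OF t] by eventually_elim simp
    qed (use um[OF t] wm[OF t] Um[OF t] Uxm[OF t] in measurable)
    have uxr: "pairing (\<lambda>x. weak_deriv (u t) x * \<rho> t x) \<psi> = pairing (\<lambda>x. Ux t x * R t x) \<psi>"
    proof (rule pairing_cong_AE[OF _ _ \<psi>m])
      show "AE x in lborel. weak_deriv (u t) x * \<rho> t x = Ux t x * R t x"
        using wAE[OF t] rAE[OF t] by eventually_elim simp
    qed (use wm[OF t] rm[OF t] Uxm[OF t] Rm[OF t] in measurable)
    note UUx = BUC_mult[OF UB UxB] and UxU = BUC_mult[OF UxB UB] and UxUx = BUC_mult[OF UxB UxB]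
      and UxR = BUC_mult[OF UxB RB] and UR = BUC_mult[OF UB RB] and UUB = BUC_mult[OF UB UB]
    have 1: "((\<lambda>\<tau>. conv n (U \<tau>) x) has_real_derivative
      conv n (\<lambda>y. Ux t y * U t y) x - conv n' (\<lambda>y. U t y * U t y) x + conv n (\<lambda>y. (- 1) * P t y) x) (at t within I)"
    proof (rule real_derivative_of_complex[OF E1[OF s\<psi>] I(2) t])
      show "pairing (u \<tau>) \<psi> = complex_of_real (conv n (U \<tau>) x)" if "\<tau> \<in> I" for \<tau>
        using pairing_cong_AE[OF um[OF that] Um[OF that] \<psi>m uAE[OF that]] by (simp only: p\<psi>)
      \<comment> \<open>Conservative form: the derivative of U^2 is 2 U Ux, so -U Ux equals Ux U
        minus the derivative of U^2.\<close>
      have "((\<lambda>y. U t y * U t y) has_real_derivative Ux t y * U t y + Ux t y * U t y) (at y)" for y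
        by (rule DERIV_mult[OF dU[OF t] dU[OF t]])
      then have "conv n' (\<lambda>y. U t y * U t y) x = conv n (\<lambda>y. Ux t y * U t y + Ux t y * U t y) x"
        unfolding n_def n'_def by (rule BUC_conv_deriv[OF e UUB BUC_add[OF UxU UxU] t])
      also have "\<dots> = conv n (\<lambda>y. Ux t y * U t y) x + conv n (\<lambda>y. Ux t y * U t y) x"
        by (rule BUC_conv_add[OF ni UxU UxU t])
      finally have a: "conv n' (\<lambda>y. U t y * U t y) x = conv n (\<lambda>y. Ux t y * U t y) x + conv n (\<lambda>y. Ux t y * U t y) x" .
      have b': "conv n (\<lambda>y. U t y * Ux t y) x = conv n (\<lambda>y. Ux t y * U t y) x" by (simp only: mult.commute)
      have c: "conv n (\<lambda>y. (- 1) * P t y) x = - conv n (P t) x" unfolding conv_cmult by simp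
      show "- pairing (\<lambda>x. u t x * weak_deriv (u t) x) \<psi> - pairing (conv dG (nonlocal_flux \<alpha> b \<kappa> (u t) (\<rho> t))) \<psi>
        = complex_of_real (conv n (\<lambda>y. Ux t y * U t y) x - conv n' (\<lambda>y. U t y * U t y) x + conv n (\<lambda>y. (- 1) * P t y) x)"
        unfolding uux[OF \<psi>m] cF[OF t] p\<psi> a b' c unfolding P_def by simp
    qed
    \<comment> \<open>The equation for Ux is the one for u tested with the derivative of \<psi>; the
      sign comes from moving that derivative onto u.\<close>
    have "((\<lambda>\<tau>. - conv n (Ux \<tau>) x) has_real_derivative conv n' (\<lambda>y. U t y * Ux t y) x + conv n' (P t) x) (at t within I)"
    proof (rule real_derivative_of_complex[OF E1[OF s\<psi>'] I(2) t])
      show "pairing (u \<tau>) (x_deriv \<psi>) = complex_of_real (- conv n (Ux \<tau>) x)" if "\<tau> \<in> I" for \<tau>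
      proof -
        have "pairing (u \<tau>) (x_deriv \<psi>) = - pairing (weak_deriv (u \<tau>)) \<psi>"
          using wd[OF that] s\<psi> unfolding has_weak_deriv_def by blast
        also have "pairing (weak_deriv (u \<tau>)) \<psi> = pairing (Ux \<tau>) \<psi>"
          by (rule pairing_cong_AE[OF wm[OF that] Uxm[OF that] \<psi>m wAE[OF that]])
        finally show ?thesis by (simp only: p\<psi> of_real_minus)
      qed
      show "- pairing (\<lambda>x. u t x * weak_deriv (u t) x) (x_deriv \<psi>) - pairing (conv dG (nonlocal_flux \<alpha> b \<kappa> (u t) (\<rho> t))) (x_deriv \<psi>)
        = complex_of_real (conv n' (\<lambda>y. U t y * Ux t y) x + conv n' (P t) x)"
        unfolding uux[OF \<psi>'m] cF[OF t] p\<psi>' P_def by simp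
    qed
    from DERIV_minus[OF this]
    have "((\<lambda>\<tau>. conv n (Ux \<tau>) x) has_real_derivative - (conv n' (\<lambda>y. U t y * Ux t y) x + conv n' (P t) x)) (at t within I)"
      by simp
    \<comment> \<open>Adding and subtracting Ux^2 produces the transport form; the derivative left
      over falls on \<open>P\<close> and yields \<open>Q\<close>.\<close>
    moreover have "- (conv n' (\<lambda>y. U t y * Ux t y) x + conv n' (P t) x)
       = conv n (\<lambda>y. Ux t y * Ux t y) x - conv n' (\<lambda>y. U t y * Ux t y) x + conv n (\<lambda>y. (- 1) * (Ux t y * Ux t y) + (- 1) * Q t y) x"
    proof -
      have "conv n (\<lambda>y. (- 1) * (Ux t y * Ux t y) + (- 1) * Q t y) x = conv n (\<lambda>y. (- 1) * (Ux t y * Ux t y)) x + conv n (\<lambda>y. (- 1) * Q t y) x"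
        by (rule BUC_conv_add[OF ni BUC_cmult[OF UxUx] BUC_cmult[OF QB] t])
      moreover have "conv n' (P t) x = conv n (Q t) x"
        unfolding n_def n'_def by (rule BUC_conv_deriv[OF e PB QB t dP[OF t]])
      ultimately show ?thesis unfolding conv_cmult by simp
    qed
    ultimately have 2: "((\<lambda>\<tau>. conv n (Ux \<tau>) x) has_real_derivative
       conv n (\<lambda>y. Ux t y * Ux t y) x - conv n' (\<lambda>y. U t y * Ux t y) x + conv n (\<lambda>y. (- 1) * (Ux t y * Ux t y) + (- 1) * Q t y) x) (at t within I)"
      by (simp only:)
    have 3: "((\<lambda>\<tau>. conv n (R \<tau>) x) has_real_derivative
      conv n (\<lambda>y. Ux t y * R t y) x - conv n' (\<lambda>y. U t y * R t y) x + conv n (\<lambda>y. (- (b - 1)) * (Ux t y * R t y)) x) (at t within I)"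
    proof (rule real_derivative_of_complex[OF E2 I(2) t])
      show "pairing (\<rho> \<tau>) \<psi> = complex_of_real (conv n (R \<tau>) x)" if "\<tau> \<in> I" for \<tau>
        using pairing_cong_AE[OF rm[OF that] Rm[OF that] \<psi>m rAE[OF that]] by (simp only: p\<psi>)
      have i1: "integrable lborel (\<lambda>y. n (x - y) * (Ux t y * R t y))" and i2: "integrable lborel (\<lambda>y. n' (x - y) * (U t y * R t y))"
      proof -
        obtain B where "B > 0" and B: "\<And>t x. t \<in> I \<Longrightarrow> \<bar>Ux t x * R t x\<bar> \<le> B" using BUC_bounded[OF UxR] by metis
        from lborel_integrable_real_affine[OF integrable_conv[OF ni BUC_measurable[OF UxR t] B[OF t], of x], of "- 1" x]
        show "integrable lborel (\<lambda>y. n (x - y) * (Ux t y * R t y))" by simp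
        obtain C where "C > 0" and C: "\<And>t x. t \<in> I \<Longrightarrow> \<bar>U t x * R t x\<bar> \<le> C" using BUC_bounded[OF UR] by metis
        from lborel_integrable_real_affine[OF integrable_conv[OF n'i BUC_measurable[OF UR t] C[OF t], of x], of "- 1" x]
        show "integrable lborel (\<lambda>y. n' (x - y) * (U t y * R t y))" by simp
      qed
      \<comment> \<open>The weak form of u times the derivative of \<rho> already is the transport
        form, and no derivative is ever put on \<rho>. The minus sign in the kernel is that of the
        derivative of \<psi>.\<close>
      have "- pairing_u_rho_x (u t) (\<rho> t) \<psi> = (\<integral>y. complex_of_real (n (x - y) * (Ux t y * R t y) - n' (x - y) * (U t y * R t y)) \<partial>lborel)"
        unfolding pairing_u_rho_x_def minus_minus
      proof (rule integral_cong_AE)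
        have x_deriv: "x_deriv \<psi> y = complex_of_real (- n' (x - y))" for y unfolding \<psi>_def n'_def by (rule x_deriv_normal_density[OF e])
        have [measurable]: "u t \<in> borel_measurable borel" "\<rho> t \<in> borel_measurable borel" "weak_deriv (u t) \<in> borel_measurable borel"
          by (rule um[OF t], rule rm[OF t], rule wm[OF t])
        note [measurable] = \<psi>m \<psi>'m
        show "(\<lambda>x. complex_of_real (\<rho> t x) * (complex_of_real (weak_deriv (u t) x) * \<psi> x + complex_of_real (u t x) * x_deriv \<psi> x)) \<in> borel_measurable lborel"
          by measurable
        have "(\<lambda>y. n (x - y) * (Ux t y * R t y) - n' (x - y) * (U t y * R t y)) \<in> borel_measurable lborel"
          using Bochner_Integration.integrable_diff[OF i1 i2] by (rule borel_measurable_integrable)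
        then show "(\<lambda>y. complex_of_real (n (x - y) * (Ux t y * R t y) - n' (x - y) * (U t y * R t y))) \<in> borel_measurable lborel"
          by (rule measurable_compose[OF _ borel_measurable_of_real])
        show "AE y in lborel. complex_of_real (\<rho> t y) * (complex_of_real (weak_deriv (u t) y) * \<psi> y + complex_of_real (u t y) * x_deriv \<psi> y)
          = complex_of_real (n (x - y) * (Ux t y * R t y) - n' (x - y) * (U t y * R t y))"
          using uAE[OF t] wAE[OF t] rAE[OF t]
        proof eventually_elim
          case (elim y)
          have \<psi>y: "\<psi> y = complex_of_real (n (x - y))" unfolding \<psi>_def n_def normal_density_shift[of x e y] ..
          have "r * (q * N + p * (- N')) = N * (q * r) - N' * (p * r)" for r q p N N' :: real by (simp add: algebra_simps)
          then show ?case unfolding elim x_deriv \<psi>y of_real_mult[symmetric] of_real_add[symmetric] by (simp only:)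
        qed
      qed
      also have "\<dots> = complex_of_real (\<integral>y. n (x - y) * (Ux t y * R t y) - n' (x - y) * (U t y * R t y) \<partial>lborel)"
        by (rule integral_complex_of_real)
      also have "(\<integral>y. n (x - y) * (Ux t y * R t y) - n' (x - y) * (U t y * R t y) \<partial>lborel) = conv n (\<lambda>y. Ux t y * R t y) x - conv n' (\<lambda>y. U t y * R t y) x"
        unfolding conv_def by (rule Bochner_Integration.integral_diff[OF i1 i2])
      finally have a: "- pairing_u_rho_x (u t) (\<rho> t) \<psi> = complex_of_real (conv n (\<lambda>y. Ux t y * R t y) x - conv n' (\<lambda>y. U t y * R t y) x)" .
      show "- pairing_u_rho_x (u t) (\<rho> t) \<psi> - complex_of_real (b - 1) * pairing (\<lambda>x. weak_deriv (u t) x * \<rho> t x) \<psi>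
        = complex_of_real (conv n (\<lambda>y. Ux t y * R t y) x - conv n' (\<lambda>y. U t y * R t y) x + conv n (\<lambda>y. (- (b - 1)) * (Ux t y * R t y)) x)"
        unfolding a uxr p\<psi> conv_cmult by (simp add: algebra_simps)
    qed
    show ?thesis using 1 2 3 unfolding n_def n'_def by (intro conjI)
  qed
  show ?thesis
    by (intro exI[of _ U] exI[of _ Ux] exI[of _ R] exI[of _ F] conjI[OF UB] conjI[OF UxB] conjI[OF RB] conjI[OF FB] ballI conjI)
      (assumption | rule uAE wAE rAE um wm rm allI dU Fx impI main[unfolded P_def Q_def])+
qed

section \<open>Persistence of weighted norms\<close>

lemma Lp_norm_combination_le:
  fixes q f g h :: "real \<Rightarrow> real"
  assumes [measurable]: "q \<in> borel_measurable borel" "f \<in> borel_measurable borel" "g \<in> borel_measurable borel" "h \<in> borel_measurable borel"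
    and p: "1 \<le> p" and a: "a \<ge> 0" and le: "\<And>x. \<bar>q x\<bar> \<le> a * (\<bar>f x\<bar> + \<bar>g x\<bar> + \<bar>h x\<bar>)"
  shows "Lp_norm p q \<le> ennreal a * (Lp_norm p f + Lp_norm p g + Lp_norm p h)"
proof -
  have abs: "Lp_norm p (\<lambda>x. \<bar>r x\<bar>) \<le> Lp_norm p r" if [measurable]: "r \<in> borel_measurable borel" for r :: "real \<Rightarrow> real"
    by (rule Lp_norm_mono_AE[OF _ _ p]) auto
  have "Lp_norm p q \<le> Lp_norm p (\<lambda>x. a * (\<bar>f x\<bar> + \<bar>g x\<bar> + \<bar>h x\<bar>))"
  proof (rule Lp_norm_mono_AE[OF _ _ p])
    have "norm (q x) \<le> norm (a * (\<bar>f x\<bar> + \<bar>g x\<bar> + \<bar>h x\<bar>))" for x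
      using le[of x] by (metis abs_ge_self order_trans real_norm_def)
    then show "AE x in lborel. norm (q x) \<le> norm (a * (\<bar>f x\<bar> + \<bar>g x\<bar> + \<bar>h x\<bar>))" by simp
  qed measurable
  also have "\<dots> \<le> ennreal a * Lp_norm p (\<lambda>x. \<bar>f x\<bar> + \<bar>g x\<bar> + \<bar>h x\<bar>)"
    by (rule Lp_norm_cmult_le[OF _ p a]) measurable
  also have "Lp_norm p (\<lambda>x. \<bar>f x\<bar> + \<bar>g x\<bar> + \<bar>h x\<bar>) \<le> Lp_norm p (\<lambda>x. \<bar>f x\<bar> + \<bar>g x\<bar>) + Lp_norm p (\<lambda>x. \<bar>h x\<bar>)"
    by (rule Lp_norm_triangle[OF _ _ p]) measurable
  also have "Lp_norm p (\<lambda>x. \<bar>f x\<bar> + \<bar>g x\<bar>) \<le> Lp_norm p (\<lambda>x. \<bar>f x\<bar>) + Lp_norm p (\<lambda>x. \<bar>g x\<bar>)"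
    by (rule Lp_norm_triangle[OF _ _ p]) measurable
  also have "Lp_norm p (\<lambda>x. \<bar>f x\<bar>) \<le> Lp_norm p f" by (rule abs) measurable
  also have "Lp_norm p (\<lambda>x. \<bar>g x\<bar>) \<le> Lp_norm p g" by (rule abs) measurable
  also have "Lp_norm p (\<lambda>x. \<bar>h x\<bar>) \<le> Lp_norm p h" by (rule abs) measurable
  finally show ?thesis by (simp add: mult_left_mono add_mono)
qed

text \<open>Each square is at most M times one of the three moduli; the linear term \<alpha> U is
  the reason for 1 + M in place of M.\<close>

lemma flux_abs_le:
  fixes U V R M :: real
  assumes "\<bar>U\<bar> \<le> M" "\<bar>V\<bar> \<le> M" "\<bar>R\<bar> \<le> M"
  shows "\<bar>b / 2 * U\<^sup>2 + (3 - b) / 2 * V\<^sup>2 + \<kappa> / 2 * R\<^sup>2 - \<alpha> * U\<bar>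
    \<le> (\<bar>b / 2\<bar> + \<bar>(3 - b) / 2\<bar> + \<bar>\<kappa> / 2\<bar> + \<bar>\<alpha>\<bar>) * (1 + M) * (\<bar>U\<bar> + \<bar>V\<bar> + \<bar>R\<bar>)"
proof -
  define s where "s = (1 + M) * (\<bar>U\<bar> + \<bar>V\<bar> + \<bar>R\<bar>)"
  have M: "M \<ge> 0" using assms(1) by linarith
  have sq: "\<bar>x\<^sup>2\<bar> \<le> s" if "\<bar>x\<bar> \<le> M" "\<bar>x\<bar> \<le> \<bar>U\<bar> + \<bar>V\<bar> + \<bar>R\<bar>" for x
    unfolding power2_eq_square abs_mult s_def by (rule mult_mono) (use that M in auto)
  have "1 * (\<bar>U\<bar> + \<bar>V\<bar> + \<bar>R\<bar>) \<le> s" unfolding s_def by (rule mult_right_mono) (use M in auto)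
  then have U: "\<bar>U\<bar> \<le> s" by simp
  have *: "\<bar>c * y\<bar> \<le> \<bar>c\<bar> * s" if "\<bar>y\<bar> \<le> s" for c y unfolding abs_mult by (rule mult_left_mono[OF that]) simp
  have "\<bar>b / 2 * U\<^sup>2\<bar> \<le> \<bar>b / 2\<bar> * s" "\<bar>(3 - b) / 2 * V\<^sup>2\<bar> \<le> \<bar>(3 - b) / 2\<bar> * s" "\<bar>\<kappa> / 2 * R\<^sup>2\<bar> \<le> \<bar>\<kappa> / 2\<bar> * s" "\<bar>\<alpha> * U\<bar> \<le> \<bar>\<alpha>\<bar> * s"
    by (rule *[OF sq[OF assms(1)]] *[OF sq[OF assms(2)]] *[OF sq[OF assms(3)]] *[OF U]; simp)+
  then have "\<bar>b / 2 * U\<^sup>2 + (3 - b) / 2 * V\<^sup>2 + \<kappa> / 2 * R\<^sup>2 - \<alpha> * U\<bar> \<le> \<bar>b / 2\<bar> * s + \<bar>(3 - b) / 2\<bar> * s + \<bar>\<kappa> / 2\<bar> * s + \<bar>\<alpha>\<bar> * s"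
    by linarith
  then show ?thesis by (simp add: s_def distrib_right mult.assoc)
qed

text \<open>\<open>c1\<close> is the flux constant of \<open>flux_abs_le\<close>. In
  \<open>c2\<close>, the summand K \<open>c1\<close> comes from convolution with either kernel,
  \<open>c1\<close> from the local term F in the equation for Ux, 1 from Ux^2, and |b - 1| from the
  equation for \<rho>. The 3 in front of \<open>c2\<close> counts the unknowns.\<close>

lemma truncated_weight_estimate:
  fixes w k :: "real \<Rightarrow> real" and U Ux R F :: "real \<Rightarrow> real \<Rightarrow> real" and \<alpha> b \<kappa> K :: real
  defines "c1 \<equiv> \<bar>b / 2\<bar> + \<bar>(3 - b) / 2\<bar> + \<bar>\<kappa> / 2\<bar> + \<bar>\<alpha>\<bar>"
  defines "c2 \<equiv> 1 + (K + 1) * c1 + \<bar>b - 1\<bar>"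
  assumes p: "1 \<le> p" and w[measurable]: "w \<in> borel_measurable borel" and w0: "\<And>x. 0 < w x"
    and lip: "\<And>x y. w x \<le> w y * exp (A * \<bar>x - y\<bar>)" and A: "A \<ge> 0" and fin: "Lp_norm p w < \<infinity>"
    and k: "k \<in> borel_measurable borel" "\<And>z. 0 \<le> k z" "(\<integral>\<^sup>+z. ennreal (k z) \<partial>lborel) \<le> ennreal K" "K > 0"
    and ker: "AE z in lborel. \<forall>y. w (z + y) * exp (- \<bar>z\<bar>) \<le> k z * w y"
    and I: "I = {0..T}"
    and U: "BUC I U" and Ux: "BUC I Ux" and R: "BUC I R" and F: "BUC I F"
    and dU: "\<And>t x. t \<in> I \<Longrightarrow> (U t has_real_derivative Ux t x) (at x)"
    and Fx: "\<And>t x. t \<in> I \<Longrightarrow> F t x = b / 2 * (U t x)\<^sup>2 + (3 - b) / 2 * (Ux t x)\<^sup>2 + \<kappa> / 2 * (R t x)\<^sup>2 - \<alpha> * U t x"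
    and M: "\<And>t x. t \<in> I \<Longrightarrow> \<bar>U t x\<bar> \<le> M" "\<And>t x. t \<in> I \<Longrightarrow> \<bar>Ux t x\<bar> \<le> M" "\<And>t x. t \<in> I \<Longrightarrow> \<bar>R t x\<bar> \<le> M" "M \<ge> 0"
    and eqU: "\<And>e t x. e > 0 \<Longrightarrow> t \<in> I \<Longrightarrow> ((\<lambda>\<tau>. conv (normal_density 0 e) (U \<tau>) x) has_real_derivative
            conv (normal_density 0 e) (\<lambda>y. Ux t y * U t y) x - conv (normal_deriv e) (\<lambda>y. U t y * U t y) x
            + conv (normal_density 0 e) (\<lambda>y. (- 1) * conv dG (F t) y) x) (at t within I)"
    and eqUx: "\<And>e t x. e > 0 \<Longrightarrow> t \<in> I \<Longrightarrow> ((\<lambda>\<tau>. conv (normal_density 0 e) (Ux \<tau>) x) has_real_derivative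
            conv (normal_density 0 e) (\<lambda>y. Ux t y * Ux t y) x - conv (normal_deriv e) (\<lambda>y. U t y * Ux t y) x
            + conv (normal_density 0 e) (\<lambda>y. (- 1) * (Ux t y * Ux t y) + (- 1) * (conv Green (F t) y - F t y)) x) (at t within I)"
    and eqR: "\<And>e t x. e > 0 \<Longrightarrow> t \<in> I \<Longrightarrow> ((\<lambda>\<tau>. conv (normal_density 0 e) (R \<tau>) x) has_real_derivative
            conv (normal_density 0 e) (\<lambda>y. Ux t y * R t y) x - conv (normal_deriv e) (\<lambda>y. U t y * R t y) x
            + conv (normal_density 0 e) (\<lambda>y. (- (b - 1)) * (Ux t y * R t y)) x) (at t within I)"
    and t: "t \<in> I"
  shows "Lp_norm p (\<lambda>x. w x * U t x) + Lp_norm p (\<lambda>x. w x * Ux t x) + Lp_norm p (\<lambda>x. w x * R t x)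
    \<le> ennreal (exp ((A + 2 + 3 * c2) * (1 + M) * t)) *
       (Lp_norm p (\<lambda>x. w x * U 0 x) + Lp_norm p (\<lambda>x. w x * Ux 0 x) + Lp_norm p (\<lambda>x. w x * R 0 x))"
proof -
  define Y where "Y = (\<lambda>t. Lp_norm p (\<lambda>x. w x * U t x) + Lp_norm p (\<lambda>x. w x * Ux t x) + Lp_norm p (\<lambda>x. w x * R t x))"
  have c1: "c1 \<ge> 0" by (simp add: c1_def)
  have c2: "c2 \<ge> 0" using c1 k(4) by (simp add: c2_def)
  define c where "c = c2 * (1 + M)"
  have c0: "c \<ge> 0" using c2 M(4) by (simp add: c_def)
  have Y: "Lp_norm p (\<lambda>x. w x * f x) \<le> ennreal a * Y t"
    if t: "t \<in> I" and [measurable]: "f \<in> borel_measurable borel" and a: "a \<ge> 0" and le: "\<And>x. \<bar>f x\<bar> \<le> a * (\<bar>U t x\<bar> + \<bar>Ux t x\<bar> + \<bar>R t x\<bar>)" for f t a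
    unfolding Y_def
  proof (rule Lp_norm_combination_le[OF _ _ _ _ p a])
    note [measurable] = BUC_measurable[OF U t] BUC_measurable[OF Ux t] BUC_measurable[OF R t]
    show "(\<lambda>x. w x * f x) \<in> borel_measurable borel" "(\<lambda>x. w x * U t x) \<in> borel_measurable borel"
      "(\<lambda>x. w x * Ux t x) \<in> borel_measurable borel" "(\<lambda>x. w x * R t x) \<in> borel_measurable borel" by measurable
    fix x
    have "w x * \<bar>f x\<bar> \<le> w x * (a * (\<bar>U t x\<bar> + \<bar>Ux t x\<bar> + \<bar>R t x\<bar>))" by (rule mult_left_mono[OF le]) (rule less_imp_le[OF w0])
    then show "\<bar>w x * f x\<bar> \<le> a * (\<bar>w x * U t x\<bar> + \<bar>w x * Ux t x\<bar> + \<bar>w x * R t x\<bar>)"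
      using w0[of x] by (simp add: abs_mult algebra_simps)
  qed
  have Fle: "\<bar>F t x\<bar> \<le> c1 * (1 + M) * (\<bar>U t x\<bar> + \<bar>Ux t x\<bar> + \<bar>R t x\<bar>)" if t: "t \<in> I" for t x
    unfolding Fx[OF t] c1_def by (rule flux_abs_le[OF M(1)[OF t] M(2)[OF t] M(3)[OF t]])
  have c1M: "c1 * (1 + M) \<ge> 0" using c1 M(4) by simp
  have cF: "Lp_norm p (\<lambda>x. w x * ((- 1) * conv h (F t) x)) \<le> ennreal (K * (c1 * (1 + M))) * Y t"
    if t: "t \<in> I" and [measurable]: "h \<in> borel_measurable borel" and hG: "\<And>z. \<bar>h z\<bar> \<le> Green z" for t h
  proof -
    obtain B where "B > 0" and B: "\<And>t x. t \<in> I \<Longrightarrow> \<bar>F t x\<bar> \<le> B" using BUC_bounded[OF F] by metis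
    have hi: "integrable lborel h"
      by (rule Bochner_Integration.integrable_bound[OF integrable_Green])
        (use hG in \<open>auto intro: order_trans[OF _ abs_ge_self]\<close>)
    note [measurable] = BUC_measurable[OF BUC_conv[OF F hi] t]
    have "Lp_norm p (\<lambda>x. w x * ((- 1) * conv h (F t) x)) \<le> Lp_norm p (\<lambda>x. w x * conv h (F t) x)"
      by (rule Lp_norm_mono_AE[OF _ _ p]) auto
    also have "\<dots> \<le> ennreal K * Lp_norm p (\<lambda>x. w x * F t x)"
      by (rule Lp_norm_weighted_conv_le[OF p w w0 k ker that(2) hG BUC_continuous[OF F t] B[OF t]])
    also have "\<dots> \<le> ennreal K * (ennreal (c1 * (1 + M)) * Y t)"
      by (rule mult_left_mono[OF Y[OF t BUC_measurable[OF F t] c1M Fle[OF t]]]) simp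
    also have "\<dots> = ennreal (K * (c1 * (1 + M))) * Y t" by (simp only: ennreal_mult[OF less_imp_le[OF k(4)] c1M] mult.assoc)
    finally show ?thesis .
  qed
  have up: "X \<le> ennreal c * Y t" if "X \<le> ennreal a * Y t" "a \<le> c" for X a t
    by (rule order_trans[OF that(1) mult_right_mono[OF ennreal_leI[OF that(2)]]]) simp
  have nn: "M * c1 \<ge> 0" "K * c1 \<ge> 0" "M * (K * c1) \<ge> 0" "\<bar>b - 1\<bar> * M \<ge> 0" using c1 M(4) k(4) by simp_all
  \<comment> \<open>Expanded into nonnegative summands: the constant of each of the three sources is
    a partial sum.\<close>
  have ceq: "c = 1 + K * c1 + c1 + \<bar>b - 1\<bar> + M + M * (K * c1) + M * c1 + \<bar>b - 1\<bar> * M"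
    by (simp add: c_def c2_def algebra_simps)
  define W where "W = (\<lambda>i::nat. if i = 0 then U else if i = 1 then Ux else R)"
  define S where "S = (\<lambda>i::nat. if i = 0 then (\<lambda>t y. (- 1) * conv dG (F t) y)
     else if i = 1 then (\<lambda>t y. (- 1) * (Ux t y * Ux t y) + (- 1) * (conv Green (F t) y - F t y))
     else (\<lambda>t y. (- (b - 1)) * (Ux t y * R t y)))"
  have Y3: "(\<Sum>i<3. Lp_norm p (\<lambda>x. w x * W i t x)) = Y t" for t
    by (simp add: Y_def W_def numeral_3_eq_3 lessThan_Suc add_ac)
  have i3: "i = 0 \<or> i = 1 \<or> i = 2" if "i < 3" for i :: nat using that by auto
  have "(\<Sum>i<3. Lp_norm p (\<lambda>x. w x * W i t x)) \<le> ennreal (exp (((A + 2) * M + real 3 * c) * t)) * (\<Sum>i<3. Lp_norm p (\<lambda>x. w x * W i 0 x))"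
  proof (rule weighted_transport_estimate[OF I p w0 lip A fin U Ux _ _ dU M(1) M(2) M(4) _ c0 _ t])
    fix i :: nat assume i: "i < 3"
    show "BUC I (W i)" unfolding W_def using U Ux R by simp
    have 0: "BUC I (\<lambda>t y. (- 1) * conv dG (F t) y)" by (intro BUC_cmult BUC_conv F integrable_dG)
    have 1: "BUC I (\<lambda>t y. (- 1) * (Ux t y * Ux t y) + (- 1) * (conv Green (F t) y - F t y))"
      by (intro BUC_add BUC_cmult BUC_mult BUC_diff BUC_conv F integrable_Green Ux)
    have 2: "BUC I (\<lambda>t y. (- (b - 1)) * (Ux t y * R t y))" by (intro BUC_cmult BUC_mult Ux R)
    show "BUC I (S i)" unfolding S_def using 0 1 2 by presburger
    show "((\<lambda>\<tau>. conv (normal_density 0 e) (W i \<tau>) x) has_real_derivative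
        conv (normal_density 0 e) (\<lambda>y. Ux t y * W i t y) x - conv (normal_deriv e) (\<lambda>y. U t y * W i t y) x
        + conv (normal_density 0 e) (S i t) x) (at t within I)" if "e > 0" "t \<in> I" for e t x
      unfolding W_def S_def using eqU[OF that] eqUx[OF that] eqR[OF that] by presburger
    show "Lp_norm p (\<lambda>x. w x * S i t x) \<le> ennreal c * (\<Sum>j<3. Lp_norm p (\<lambda>x. w x * W j t x))" if t: "t \<in> I" for t
    proof -
      note [measurable] = BUC_measurable[OF Ux t] BUC_measurable[OF R t] BUC_measurable[OF F t] BUC_measurable[OF BUC_conv[OF F integrable_Green] t]
      have s0: "Lp_norm p (\<lambda>x. w x * ((- 1) * conv dG (F t) x)) \<le> ennreal c * Y t"
        by (rule up[OF cF[OF t dG_measurable abs_dG_le]]) (use nn c1 M(4) in \<open>simp add: ceq algebra_simps\<close>)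
      have s2: "Lp_norm p (\<lambda>x. w x * ((- (b - 1)) * (Ux t x * R t x))) \<le> ennreal c * Y t"
      proof (rule up[OF Y[OF t]])
        show "\<bar>(- (b - 1)) * (Ux t x * R t x)\<bar> \<le> (\<bar>b - 1\<bar> * M) * (\<bar>U t x\<bar> + \<bar>Ux t x\<bar> + \<bar>R t x\<bar>)" for x
        proof -
          have "\<bar>Ux t x\<bar> * \<bar>R t x\<bar> \<le> M * (\<bar>U t x\<bar> + \<bar>Ux t x\<bar> + \<bar>R t x\<bar>)" by (rule mult_mono[OF M(2)[OF t]]) (use M(4) in auto)
          then have "\<bar>b - 1\<bar> * (\<bar>Ux t x\<bar> * \<bar>R t x\<bar>) \<le> \<bar>b - 1\<bar> * (M * (\<bar>U t x\<bar> + \<bar>Ux t x\<bar> + \<bar>R t x\<bar>))" by (rule mult_left_mono) simp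
          then show ?thesis by (simp only: abs_mult abs_minus_cancel mult.assoc)
        qed
        show "\<bar>b - 1\<bar> * M \<ge> 0" using nn by simp
        show "\<bar>b - 1\<bar> * M \<le> c" using nn c1 M(4) by (simp add: ceq)
      qed measurable
      have s1: "Lp_norm p (\<lambda>x. w x * ((- 1) * (Ux t x * Ux t x) + (- 1) * (conv Green (F t) x - F t x))) \<le> ennreal c * Y t"
      proof -
        have "Lp_norm p (\<lambda>x. w x * ((- 1) * (Ux t x * Ux t x) + (- 1) * (conv Green (F t) x - F t x)))
          = Lp_norm p (\<lambda>x. w x * (F t x - Ux t x * Ux t x) + w x * ((- 1) * conv Green (F t) x))"
          by (rule arg_cong[where f = "Lp_norm p"]) (simp add: fun_eq_iff algebra_simps)
        also have "\<dots> \<le> Lp_norm p (\<lambda>x. w x * (F t x - Ux t x * Ux t x)) + Lp_norm p (\<lambda>x. w x * ((- 1) * conv Green (F t) x))"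
          by (rule Lp_norm_triangle[OF _ _ p]) measurable
        also have "\<dots> \<le> ennreal (c1 * (1 + M) + M) * Y t + ennreal (K * (c1 * (1 + M))) * Y t"
        proof (rule add_mono[OF Y[OF t] cF[OF t]])
          show "\<bar>F t x - Ux t x * Ux t x\<bar> \<le> (c1 * (1 + M) + M) * (\<bar>U t x\<bar> + \<bar>Ux t x\<bar> + \<bar>R t x\<bar>)" for x
          proof -
            have "\<bar>Ux t x * Ux t x\<bar> \<le> M * (\<bar>U t x\<bar> + \<bar>Ux t x\<bar> + \<bar>R t x\<bar>)"
              unfolding abs_mult by (rule mult_mono[OF M(2)[OF t]]) (use M(4) in auto)
            with Fle[OF t, of x] show ?thesis unfolding distrib_right[of "c1 * (1 + M)" M] by linarith
          qed
          show "\<bar>Green z\<bar> \<le> Green z" for z by (simp add: Green_def)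
        qed (use c1M M(4) in \<open>simp_all\<close>)
        also have "\<dots> = ennreal (c1 * (1 + M) + M + K * (c1 * (1 + M))) * Y t"
          using c1M M(4) k(4) by (subst (2) ennreal_plus) (simp_all add: distrib_right)
        finally show ?thesis by (rule up) (use nn c1 M(4) in \<open>simp add: ceq algebra_simps\<close>)
      qed
      show ?thesis unfolding Y3 S_def using i3[OF i] s0 s1 s2 by fastforce
    qed
  qed
  then have "Y t \<le> ennreal (exp (((A + 2) * M + real 3 * c) * t)) * Y 0" unfolding Y3 .
  also have "\<dots> \<le> ennreal (exp ((A + 2 + 3 * c2) * (1 + M) * t)) * Y 0"
  proof (rule mult_right_mono, rule ennreal_leI)
    have "((A + 2) * M + real 3 * c) * t \<le> (A + 2 + 3 * c2) * (1 + M) * t"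
      by (rule mult_right_mono) (use A t I in \<open>auto simp: c_def algebra_simps\<close>)
    then show "exp (((A + 2) * M + real 3 * c) * t) \<le> exp ((A + 2 + 3 * c2) * (1 + M) * t)" by simp
  qed simp
  finally show ?thesis unfolding Y_def .
qed


lemma Lp_norm_infinity_leD:
  fixes f h :: "real \<Rightarrow> real"
  assumes "f \<in> borel_measurable borel" "AE x in lborel. f x = h x" "continuous_on UNIV h"
    and "Lp_norm \<infinity> f \<le> ennreal M" "M \<ge> 0"
  shows "\<bar>h x\<bar> \<le> M"
proof (rule AE_eq_continuous_imp_le[OF assms(3,2)])
  show "AE x in lborel. \<bar>f x\<bar> \<le> M" using assms(4) unfolding Lp_norm_infinity_le_iff[OF assms(1,5)] by simp
qed

lemma sup_norm_bound_finite:
  assumes U: "BUC I U" and Ux: "BUC I Ux" and R: "BUC I R"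
    and m: "\<And>t. t \<in> I \<Longrightarrow> u t \<in> borel_measurable borel" "\<And>t. t \<in> I \<Longrightarrow> weak_deriv (u t) \<in> borel_measurable borel"
      "\<And>t. t \<in> I \<Longrightarrow> \<rho> t \<in> borel_measurable borel"
    and ae: "\<And>t. t \<in> I \<Longrightarrow> AE x in lborel. u t x = U t x" "\<And>t. t \<in> I \<Longrightarrow> AE x in lborel. weak_deriv (u t) x = Ux t x"
      "\<And>t. t \<in> I \<Longrightarrow> AE x in lborel. \<rho> t x = R t x"
  shows "sup_norm_bound I u \<rho> < \<infinity>"
proof -
  have bd: "\<exists>B\<ge>0. \<forall>t\<in>I. Lp_norm \<infinity> (f t) \<le> ennreal B"
    if V: "BUC I V" and m: "\<And>t. t \<in> I \<Longrightarrow> f t \<in> borel_measurable borel" and ae: "\<And>t. t \<in> I \<Longrightarrow> AE x in lborel. f t x = V t x" for V f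
  proof -
    obtain B where B: "B > 0" "\<And>t x. t \<in> I \<Longrightarrow> \<bar>V t x\<bar> \<le> B" using BUC_bounded[OF V] by metis
    have "Lp_norm \<infinity> (f t) \<le> ennreal B" if "t \<in> I" for t
      unfolding Lp_norm_infinity_le_iff[OF m[OF that] less_imp_le[OF B(1)]]
      using ae[OF that] by eventually_elim (simp add: B(2)[OF that])
    then show ?thesis using B(1) by (intro exI[of _ B]) simp
  qed
  obtain B1 where B1: "B1 \<ge> 0" "\<forall>t\<in>I. Lp_norm \<infinity> (u t) \<le> ennreal B1" using bd[OF U m(1) ae(1)] by auto
  obtain B2 where B2: "B2 \<ge> 0" "\<forall>t\<in>I. Lp_norm \<infinity> (weak_deriv (u t)) \<le> ennreal B2" using bd[OF Ux m(2) ae(2)] by auto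
  obtain B3 where B3: "B3 \<ge> 0" "\<forall>t\<in>I. Lp_norm \<infinity> (\<rho> t) \<le> ennreal B3" using bd[OF R m(3) ae(3)] by auto
  have "sup_norm_bound I u \<rho> \<le> ennreal B1 + ennreal B2 + ennreal B3"
    unfolding sup_norm_bound_def by (rule SUP_least) (use B1(2) B2(2) B3(2) in \<open>blast intro: add_mono\<close>)
  then show ?thesis by (rule le_less_trans) (simp add: less_top)
qed

text \<open>Monotonicity in n is recorded alongside the limit because it allows the suprema of the
  three norms to be added.\<close>

lemma Lp_norm_weighted_SUP:
  fixes f \<phi> :: "real \<Rightarrow> real" and w :: "nat \<Rightarrow> real \<Rightarrow> real"
  assumes p: "1 \<le> p" and [measurable]: "f \<in> borel_measurable borel" "\<phi> \<in> borel_measurable borel" "\<And>n. w n \<in> borel_measurable borel"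
    and w: "\<And>n x. 0 < w n x" "\<And>n x. w n x \<le> w (Suc n) x" "\<And>x. \<forall>\<^sub>F n in sequentially. w n x = \<phi> x"
  shows "Lp_norm p (\<lambda>x. f x * \<phi> x) \<le> (SUP n. Lp_norm p (\<lambda>x. w n x * f x))"
    and "incseq (\<lambda>n. Lp_norm p (\<lambda>x. w n x * f x))"
proof -
  show "Lp_norm p (\<lambda>x. f x * \<phi> x) \<le> (SUP n. Lp_norm p (\<lambda>x. w n x * f x))"
  proof (rule Lp_norm_le_liminf[where fn = "\<lambda>n x. w n x * f x", OF _ _ _ p])
    show "\<forall>\<^sub>F n in sequentially. w n x * f x = f x * \<phi> x" for x
      using w(3)[of x] by eventually_elim simp
  qed (measurable, rule SUP_upper, simp)
  show "incseq (\<lambda>n. Lp_norm p (\<lambda>x. w n x * f x))"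
  proof (rule incseq_SucI, rule Lp_norm_mono_AE[OF _ _ p])
    show "AE x in lborel. norm (w n x * f x) \<le> norm (w (Suc n) x * f x)" for n
      using w(1,2) by (auto simp: abs_mult less_imp_le intro!: mult_right_mono AE_I2)
  qed measurable
qed

lemma life_span_interval:
  assumes "t \<in> life_span T"
  shows "{0..t} \<subseteq> life_span T"
proof
  fix r assume r: "r \<in> {0..t}"
  then have "ereal r \<le> ereal t" by simp
  also have "ereal t < T" using assms by (simp add: life_span_def)
  finally show "r \<in> life_span T" using r by (simp add: life_span_def)
qed

text \<open>C is chosen before p, s, T and the solution. Compactness of [0, T'] bounds the
  representatives there, hence M is finite; every truncated weight obeys the estimate with the same
  constants, so the supremum over n gives it for \<phi>.\<close>

lemma weighted_persistence:
  fixes \<alpha> b \<kappa> :: real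
  assumes adm: "admissible_weight \<phi>"
  shows "\<exists>C>0. \<forall>p s T u \<rho>. 1 \<le> p \<longrightarrow> s > 3 / 2 \<longrightarrow> is_solution \<alpha> b \<kappa> s T u \<rho> \<longrightarrow>
    (\<forall>T'\<in>life_span T. sup_norm_bound {0..T'} u \<rho> < \<infinity> \<and>
       (\<forall>t\<in>{0..T'}. weighted_norm p \<phi> (u t) (\<rho> t) \<le>
          weighted_norm p \<phi> (u 0) (\<rho> 0) * ennreal (exp (C * (1 + enn2real (sup_norm_bound {0..T'} u \<rho>)) * t))))"
proof -
  obtain A K k w where A: "A > 0" and K: "K > 0" and km: "k \<in> borel_measurable borel" and k0: "\<And>z. 0 \<le> k z"
    and kK: "(\<integral>\<^sup>+z. ennreal (k z) \<partial>lborel) \<le> ennreal K" and \<phi>m: "\<phi> \<in> borel_measurable borel" and \<phi>0: "\<And>x. 0 < \<phi> x"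
    and wm: "\<And>n::nat. w n \<in> borel_measurable borel" and w0: "\<And>n x. 0 < w n x" and w\<phi>: "\<And>n x. w n x \<le> \<phi> x"
    and wSuc: "\<And>n x. w n x \<le> w (Suc n) x" and lip: "\<And>n x y. w n x \<le> w n y * exp (A * \<bar>x - y\<bar>)"
    and fin: "\<And>n p. 1 \<le> p \<Longrightarrow> Lp_norm p (w n) < \<infinity>"
    and ker: "\<And>n. AE z in lborel. \<forall>y. w n (z + y) * exp (- \<bar>z\<bar>) \<le> k z * w n y"
    and ev: "\<And>x. \<forall>\<^sub>F n in sequentially. w n x = \<phi> x"
    by (rule admissible_truncation[OF adm]) blast
  define c2 where "c2 = 1 + (K + 1) * (\<bar>b / 2\<bar> + \<bar>(3 - b) / 2\<bar> + \<bar>\<kappa> / 2\<bar> + \<bar>\<alpha>\<bar>) + \<bar>b - 1\<bar>"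
  have "c2 \<ge> 0" using K by (simp add: c2_def)
  define C where "C = A + 2 + 3 * c2"
  have C: "C > 0" using A \<open>c2 \<ge> 0\<close> by (simp add: C_def)
  have main: "sup_norm_bound {0..T'} u \<rho> < \<infinity> \<and>
       (\<forall>t\<in>{0..T'}. weighted_norm p \<phi> (u t) (\<rho> t) \<le>
          weighted_norm p \<phi> (u 0) (\<rho> 0) * ennreal (exp (C * (1 + enn2real (sup_norm_bound {0..T'} u \<rho>)) * t)))"
    if p: "1 \<le> p" and s: "s > 3 / 2" and sol: "is_solution \<alpha> b \<kappa> s T u \<rho>" and T': "T' \<in> life_span T" for p s T u \<rho> T'
  proof -
    define I where "I = {0..T'}"
    have T'0: "0 \<le> T'" using T' by (simp add: life_span_def)
    have cI: "compact I" by (simp add: I_def)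
    have I0: "0 \<in> I" using T'0 by (simp add: I_def)
    have "I \<subseteq> life_span T" unfolding I_def by (rule life_span_interval[OF T'])
    from solution_transport_form[OF sol s cI this]
    obtain U Ux R F where UB: "BUC I U" and UxB: "BUC I Ux" and RB: "BUC I R" and FB: "BUC I F"
      and rest: "\<forall>t\<in>I. (AE x in lborel. u t x = U t x) \<and> (AE x in lborel. weak_deriv (u t) x = Ux t x) \<and> (AE x in lborel. \<rho> t x = R t x) \<and>
       u t \<in> borel_measurable borel \<and> weak_deriv (u t) \<in> borel_measurable borel \<and> \<rho> t \<in> borel_measurable borel \<and>
       (\<forall>x. (U t has_real_derivative Ux t x) (at x)) \<and>
       (\<forall>x. F t x = b / 2 * (U t x)\<^sup>2 + (3 - b) / 2 * (Ux t x)\<^sup>2 + \<kappa> / 2 * (R t x)\<^sup>2 - \<alpha> * U t x) \<and>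
       (\<forall>e>0. \<forall>x.
          ((\<lambda>\<tau>. conv (normal_density 0 e) (U \<tau>) x) has_real_derivative
            conv (normal_density 0 e) (\<lambda>y. Ux t y * U t y) x - conv (normal_deriv e) (\<lambda>y. U t y * U t y) x
            + conv (normal_density 0 e) (\<lambda>y. (- 1) * conv dG (F t) y) x) (at t within I) \<and>
          ((\<lambda>\<tau>. conv (normal_density 0 e) (Ux \<tau>) x) has_real_derivative
            conv (normal_density 0 e) (\<lambda>y. Ux t y * Ux t y) x - conv (normal_deriv e) (\<lambda>y. U t y * Ux t y) x
            + conv (normal_density 0 e) (\<lambda>y. (- 1) * (Ux t y * Ux t y) + (- 1) * (conv Green (F t) y - F t y)) x) (at t within I) \<and>
          ((\<lambda>\<tau>. conv (normal_density 0 e) (R \<tau>) x) has_real_derivative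
            conv (normal_density 0 e) (\<lambda>y. Ux t y * R t y) x - conv (normal_deriv e) (\<lambda>y. U t y * R t y) x
            + conv (normal_density 0 e) (\<lambda>y. (- (b - 1)) * (Ux t y * R t y)) x) (at t within I))"
      by (elim exE conjE)
    have ae: "AE x in lborel. u t x = U t x" "AE x in lborel. weak_deriv (u t) x = Ux t x" "AE x in lborel. \<rho> t x = R t x"
      and m: "u t \<in> borel_measurable borel" "weak_deriv (u t) \<in> borel_measurable borel" "\<rho> t \<in> borel_measurable borel"
      if "t \<in> I" for t using bspec[OF rest that] by blast+
    have dU: "(U t has_real_derivative Ux t x) (at x)"
      and Fx: "F t x = b / 2 * (U t x)\<^sup>2 + (3 - b) / 2 * (Ux t x)\<^sup>2 + \<kappa> / 2 * (R t x)\<^sup>2 - \<alpha> * U t x"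
      if "t \<in> I" for t x using bspec[OF rest that] by blast+
    have sfin: "sup_norm_bound I u \<rho> < \<infinity>" by (rule sup_norm_bound_finite[OF UB UxB RB m ae])
    define M where "M = enn2real (sup_norm_bound I u \<rho>)"
    have M0: "M \<ge> 0" by (simp add: M_def)
    have sM: "sup_norm_bound I u \<rho> = ennreal M" using sfin by (simp add: M_def less_top)
    have L: "Lp_norm \<infinity> (u t) + Lp_norm \<infinity> (weak_deriv (u t)) + Lp_norm \<infinity> (\<rho> t) \<le> ennreal M" if "t \<in> I" for t
      unfolding sM[symmetric] sup_norm_bound_def by (rule SUP_upper[OF that])
    have Lu: "Lp_norm \<infinity> (u t) \<le> ennreal M" and Lw: "Lp_norm \<infinity> (weak_deriv (u t)) \<le> ennreal M"
      and Lr: "Lp_norm \<infinity> (\<rho> t) \<le> ennreal M" if "t \<in> I" for t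
      by (rule order_trans[OF _ L[OF that]], simp add: add_increasing add_increasing2)+
    have MU: "\<bar>U t x\<bar> \<le> M" and MUx: "\<bar>Ux t x\<bar> \<le> M" and MR: "\<bar>R t x\<bar> \<le> M" if t: "t \<in> I" for t x
      by (rule Lp_norm_infinity_leD[OF m(1)[OF t] ae(1)[OF t] BUC_continuous[OF UB t] Lu[OF t] M0],
          rule Lp_norm_infinity_leD[OF m(2)[OF t] ae(2)[OF t] BUC_continuous[OF UxB t] Lw[OF t] M0],
          rule Lp_norm_infinity_leD[OF m(3)[OF t] ae(3)[OF t] BUC_continuous[OF RB t] Lr[OF t] M0])
    have "weighted_norm p \<phi> (u t) (\<rho> t) \<le> weighted_norm p \<phi> (u 0) (\<rho> 0) * ennreal (exp (C * (1 + M) * t))" if t: "t \<in> I" for t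
    proof -
      define E where "E = ennreal (exp (C * (1 + M) * t))"
      have cong: "Lp_norm p (\<lambda>x. w n x * f x) = Lp_norm p (\<lambda>x. w n x * h x)"
        if "f \<in> borel_measurable borel" "h \<in> borel_measurable borel" "AE x in lborel. f x = h x" for f h :: "real \<Rightarrow> real" and n
      proof (rule Lp_norm_cong_AE[OF _ _ p])
        show "AE x in lborel. w n x * f x = w n x * h x" using that(3) by eventually_elim simp
      qed (use that wm in measurable)
      have cong3: "Lp_norm p (\<lambda>x. w n x * u t x) = Lp_norm p (\<lambda>x. w n x * U t x)"
        "Lp_norm p (\<lambda>x. w n x * weak_deriv (u t) x) = Lp_norm p (\<lambda>x. w n x * Ux t x)"
        "Lp_norm p (\<lambda>x. w n x * \<rho> t x) = Lp_norm p (\<lambda>x. w n x * R t x)" if t: "t \<in> I" for n t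
        by (rule cong[OF m(1)[OF t] BUC_measurable[OF UB t] ae(1)[OF t]], rule cong[OF m(2)[OF t] BUC_measurable[OF UxB t] ae(2)[OF t]],
          rule cong[OF m(3)[OF t] BUC_measurable[OF RB t] ae(3)[OF t]])
      define Z where "Z = (\<lambda>n t. Lp_norm p (\<lambda>x. w n x * u t x) + Lp_norm p (\<lambda>x. w n x * weak_deriv (u t) x) + Lp_norm p (\<lambda>x. w n x * \<rho> t x))"
      have step: "Z n t \<le> E * Z n 0" for n
        unfolding Z_def cong3[OF t] cong3[OF I0] E_def C_def c2_def
      proof (rule truncated_weight_estimate[OF p wm w0 lip less_imp_le[OF A] fin[OF p] km k0 kK K ker I_def UB UxB RB FB dU Fx MU MUx MR M0 _ _ _ t])
        fix e :: real and t x assume "e > 0" "t \<in> I"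
        note r = bspec[OF rest this(2), THEN conjunct2, THEN conjunct2, THEN conjunct2, THEN conjunct2, THEN conjunct2, THEN conjunct2,
            THEN conjunct2, THEN conjunct2, rule_format, OF this(1), of x]
        from r show "((\<lambda>\<tau>. conv (normal_density 0 e) (U \<tau>) x) has_real_derivative
            conv (normal_density 0 e) (\<lambda>y. Ux t y * U t y) x - conv (normal_deriv e) (\<lambda>y. U t y * U t y) x
            + conv (normal_density 0 e) (\<lambda>y. (- 1) * conv dG (F t) y) x) (at t within I)"
          by (elim conjE)
        from r show "((\<lambda>\<tau>. conv (normal_density 0 e) (Ux \<tau>) x) has_real_derivative
            conv (normal_density 0 e) (\<lambda>y. Ux t y * Ux t y) x - conv (normal_deriv e) (\<lambda>y. U t y * Ux t y) x
            + conv (normal_density 0 e) (\<lambda>y. (- 1) * (Ux t y * Ux t y) + (- 1) * (conv Green (F t) y - F t y)) x) (at t within I)"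
          by (elim conjE)
        from r show "((\<lambda>\<tau>. conv (normal_density 0 e) (R \<tau>) x) has_real_derivative
            conv (normal_density 0 e) (\<lambda>y. Ux t y * R t y) x - conv (normal_deriv e) (\<lambda>y. U t y * R t y) x
            + conv (normal_density 0 e) (\<lambda>y. (- (b - 1)) * (Ux t y * R t y)) x) (at t within I)"
          by (elim conjE)
      qed
      have le\<phi>: "Lp_norm p (\<lambda>x. w n x * f x) \<le> Lp_norm p (\<lambda>x. f x * \<phi> x)" if "f \<in> borel_measurable borel" for f :: "real \<Rightarrow> real" and n
      proof (rule Lp_norm_mono_AE[OF _ _ p])
        have "norm (w n x * f x) \<le> norm (f x * \<phi> x)" for x
        proof -
          have "w n x * \<bar>f x\<bar> \<le> \<phi> x * \<bar>f x\<bar>" by (rule mult_right_mono[OF w\<phi>]) simp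
          then show ?thesis using w0[of n x] \<phi>0[of x] by (simp add: abs_mult mult.commute)
        qed
        then show "AE x in lborel. norm (w n x * f x) \<le> norm (f x * \<phi> x)" by simp
      qed (use that wm \<phi>m in measurable)
      have Z0: "Z n 0 \<le> weighted_norm p \<phi> (u 0) (\<rho> 0)" for n
        unfolding Z_def weighted_norm_def by (intro add_mono le\<phi> m I0)
      note sup = Lp_norm_weighted_SUP[OF p _ \<phi>m wm w0 wSuc ev]
      have i: "incseq (\<lambda>n. Lp_norm p (\<lambda>x. w n x * u t x) + Lp_norm p (\<lambda>x. w n x * weak_deriv (u t) x))"
        using sup(2)[OF m(1)[OF t]] sup(2)[OF m(2)[OF t]] by (auto simp: incseq_def intro: add_mono)
      have i': "incseq (\<lambda>n. Lp_norm p (\<lambda>x. w n x * \<rho> t x))" by (rule sup(2)[OF m(3)[OF t]])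
      have "weighted_norm p \<phi> (u t) (\<rho> t) \<le> (SUP n. Lp_norm p (\<lambda>x. w n x * u t x)) + (SUP n. Lp_norm p (\<lambda>x. w n x * weak_deriv (u t) x))
          + (SUP n. Lp_norm p (\<lambda>x. w n x * \<rho> t x))"
        unfolding weighted_norm_def by (intro add_mono sup(1) m t)
      also have "\<dots> = (SUP n. Z n t)"
        unfolding Z_def by (simp only: ennreal_SUP_add[OF i i'] ennreal_SUP_add[OF sup(2)[OF m(1)[OF t]] sup(2)[OF m(2)[OF t]]])
      also have "\<dots> \<le> E * weighted_norm p \<phi> (u 0) (\<rho> 0)"
        by (rule SUP_least, rule order_trans[OF step mult_left_mono[OF Z0]]) simp
      finally show ?thesis by (simp add: E_def mult.commute)
    qed
    then show ?thesis using sfin unfolding I_def M_def by blast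
  qed
  show ?thesis by (rule exI[of _ C], rule conjI[OF C]) (intro allI impI ballI, rule main)
qed

text \<open>T may be a blow-up time, so finiteness of the supremum is asserted on the compact
  intervals [0, T'] and M is taken over them. Whenever the supremum over the whole life span is
  finite, monotonicity of the bound in M gives the estimate with that value.\<close>

theorem theorem4p1:
  fixes \<alpha> b \<kappa> :: real and \<phi> :: "real \<Rightarrow> real"
  assumes "admissible_weight \<phi>"
  shows "\<exists>C::real. C > 0 \<and>
    (\<forall>(p::ennreal) (s::real) (u0 :: real \<Rightarrow> real) (\<rho>0 :: real \<Rightarrow> real) (T::ereal)
       (u :: real \<Rightarrow> real \<Rightarrow> real) (\<rho> :: real \<Rightarrow> real \<Rightarrow> real).
       1 \<le> p \<and> s > 3 / 2 \<and> in_Hs s u0 \<and> in_Hs (s - 1) \<rho>0 \<and>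
       in_Lp p (\<lambda>x. u0 x * \<phi> x) \<and> in_Lp p (\<lambda>x. weak_deriv u0 x * \<phi> x) \<and>
       in_Lp p (\<lambda>x. \<rho>0 x * \<phi> x) \<and>
       is_maximal_solution \<alpha> b \<kappa> s T u \<rho> \<and> has_initial_data u \<rho> u0 \<rho>0
       \<longrightarrow>
       (\<forall>T'\<in>life_span T.
          sup_norm_bound {0..T'} u \<rho> < \<infinity> \<and>
          (\<forall>t\<in>{0..T'}.
             weighted_norm p \<phi> (u t) (\<rho> t) \<le>
             weighted_norm p \<phi> u0 \<rho>0 *
               ennreal (exp (C * (1 + enn2real (sup_norm_bound {0..T'} u \<rho>)) * t)))) \<and>
       (sup_norm_bound (life_span T) u \<rho> < \<infinity> \<longrightarrow>
          (\<forall>t\<in>life_span T.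
             weighted_norm p \<phi> (u t) (\<rho> t) \<le>
             weighted_norm p \<phi> u0 \<rho>0 *
               ennreal (exp (C * (1 + enn2real (sup_norm_bound (life_span T) u \<rho>)) * t)))))"
proof -
  from weighted_persistence[OF assms, of \<alpha> b \<kappa>] obtain C where C: "C > 0"
    and main: "\<forall>p s T u \<rho>. 1 \<le> p \<longrightarrow> s > 3 / 2 \<longrightarrow> is_solution \<alpha> b \<kappa> s T u \<rho> \<longrightarrow>
    (\<forall>T'\<in>life_span T. sup_norm_bound {0..T'} u \<rho> < \<infinity> \<and>
       (\<forall>t\<in>{0..T'}. weighted_norm p \<phi> (u t) (\<rho> t) \<le>
          weighted_norm p \<phi> (u 0) (\<rho> 0) * ennreal (exp (C * (1 + enn2real (sup_norm_bound {0..T'} u \<rho>)) * t))))"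
    by (elim exE conjE)
  have "continuous_on UNIV \<phi>" using assms by (simp add: admissible_weight_def locally_absolutely_continuous_imp_continuous)
  then have \<phi>m[measurable]: "\<phi> \<in> borel_measurable borel" by (rule borel_measurable_continuous_onI)
  show ?thesis
  proof (rule exI[of _ C], rule conjI[OF C], intro allI impI)
    fix p :: ennreal and s :: real and u0 \<rho>0 :: "real \<Rightarrow> real" and T :: ereal and u \<rho> :: "real \<Rightarrow> real \<Rightarrow> real"
    assume H: "1 \<le> p \<and> s > 3 / 2 \<and> in_Hs s u0 \<and> in_Hs (s - 1) \<rho>0 \<and>
       in_Lp p (\<lambda>x. u0 x * \<phi> x) \<and> in_Lp p (\<lambda>x. weak_deriv u0 x * \<phi> x) \<and>
       in_Lp p (\<lambda>x. \<rho>0 x * \<phi> x) \<and>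
       is_maximal_solution \<alpha> b \<kappa> s T u \<rho> \<and> has_initial_data u \<rho> u0 \<rho>0"
    then have p: "1 \<le> p" and s: "s > 3 / 2" and hs: "in_Hs s u0" "in_Hs (s - 1) \<rho>0"
      and max: "is_maximal_solution \<alpha> b \<kappa> s T u \<rho>" and init: "has_initial_data u \<rho> u0 \<rho>0" by blast+
    have sol: "is_solution \<alpha> b \<kappa> s T u \<rho>" and "0 < T" using max unfolding is_maximal_solution_def by blast+
    note est = main[rule_format, OF p s sol]
    have "0 \<in> life_span T" using \<open>0 < T\<close> by (simp add: life_span_def zero_ereal_def)
    then have hs': "in_Hs s (u 0)" "in_Hs (s - 1) (\<rho> 0)" using sol unfolding is_solution_def Hs_continuous_on_def by blast+
    have [measurable]: "u0 \<in> borel_measurable borel" "\<rho>0 \<in> borel_measurable borel" "u 0 \<in> borel_measurable borel" "\<rho> 0 \<in> borel_measurable borel"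
      using hs hs' unfolding in_Hs_def in_Lp_def by simp_all
    have ae: "AE x in lborel. u 0 x = u0 x" "AE x in lborel. \<rho> 0 x = \<rho>0 x" using init unfolding has_initial_data_def by auto
    \<comment> \<open>Data and solution agree only almost everywhere at time 0, yet
      \<open>weak_deriv\<close> returns literally the same function for both.\<close>
    have wd: "weak_deriv (u 0) = weak_deriv u0" by (rule weak_deriv_cong_AE[OF _ _ ae(1)]) measurable
    have "Lp_norm p (\<lambda>x. u 0 x * \<phi> x) = Lp_norm p (\<lambda>x. u0 x * \<phi> x)"
    proof (rule Lp_norm_cong_AE[OF _ _ p])
      show "AE x in lborel. u 0 x * \<phi> x = u0 x * \<phi> x" using ae(1) by eventually_elim simp
    qed measurable
    moreover have "Lp_norm p (\<lambda>x. \<rho> 0 x * \<phi> x) = Lp_norm p (\<lambda>x. \<rho>0 x * \<phi> x)"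
    proof (rule Lp_norm_cong_AE[OF _ _ p])
      show "AE x in lborel. \<rho> 0 x * \<phi> x = \<rho>0 x * \<phi> x" using ae(2) by eventually_elim simp
    qed measurable
    ultimately have w0: "weighted_norm p \<phi> (u 0) (\<rho> 0) = weighted_norm p \<phi> u0 \<rho>0"
      unfolding weighted_norm_def wd by simp
    note est = est[unfolded w0]
    show "(\<forall>T'\<in>life_span T.
          sup_norm_bound {0..T'} u \<rho> < \<infinity> \<and>
          (\<forall>t\<in>{0..T'}.
             weighted_norm p \<phi> (u t) (\<rho> t) \<le>
             weighted_norm p \<phi> u0 \<rho>0 *
               ennreal (exp (C * (1 + enn2real (sup_norm_bound {0..T'} u \<rho>)) * t)))) \<and>
       (sup_norm_bound (life_span T) u \<rho> < \<infinity> \<longrightarrow>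
          (\<forall>t\<in>life_span T.
             weighted_norm p \<phi> (u t) (\<rho> t) \<le>
             weighted_norm p \<phi> u0 \<rho>0 *
               ennreal (exp (C * (1 + enn2real (sup_norm_bound (life_span T) u \<rho>)) * t))))"
    proof (intro conjI ballI impI)
      fix T' assume "T' \<in> life_span T"
      from est[OF this] show "sup_norm_bound {0..T'} u \<rho> < \<infinity>" by (rule conjunct1)
      show "weighted_norm p \<phi> (u t) (\<rho> t) \<le> weighted_norm p \<phi> u0 \<rho>0 * ennreal (exp (C * (1 + enn2real (sup_norm_bound {0..T'} u \<rho>)) * t))"
        if "t \<in> {0..T'}" for t using est[OF \<open>T' \<in> life_span T\<close>] that by blast
    next
      fix t assume fin: "sup_norm_bound (life_span T) u \<rho> < \<infinity>" and t: "t \<in> life_span T"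
      have t0: "0 \<le> t" using t by (simp add: life_span_def)
      have "{0..t} \<subseteq> life_span T" by (rule life_span_interval[OF t])
      \<comment> \<open>The local estimate is used with T' = t, whose supremum is at most the one
        over the life span.\<close>
      then have "sup_norm_bound {0..t} u \<rho> \<le> sup_norm_bound (life_span T) u \<rho>"
        unfolding sup_norm_bound_def by (rule SUP_subset_mono) simp
      then have "enn2real (sup_norm_bound {0..t} u \<rho>) \<le> enn2real (sup_norm_bound (life_span T) u \<rho>)"
        by (rule enn2real_mono) (use fin in simp)
      then have "C * (1 + enn2real (sup_norm_bound {0..t} u \<rho>)) * t \<le> C * (1 + enn2real (sup_norm_bound (life_span T) u \<rho>)) * t"
        using C t0 by (intro mult_right_mono mult_left_mono) auto
      then have "ennreal (exp (C * (1 + enn2real (sup_norm_bound {0..t} u \<rho>)) * t)) \<le> ennreal (exp (C * (1 + enn2real (sup_norm_bound (life_span T) u \<rho>)) * t))"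
        by (intro ennreal_leI) simp
      from mult_left_mono[OF this]
      show "weighted_norm p \<phi> (u t) (\<rho> t) \<le> weighted_norm p \<phi> u0 \<rho>0 * ennreal (exp (C * (1 + enn2real (sup_norm_bound (life_span T) u \<rho>)) * t))"
        by (rule order_trans[rotated]) (use est[OF t] t0 in simp_all)
    qed
  qed
qed

end
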